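(* Let $G$ be a $\mathsf{PD}_n^+$ group with property (T), where $n>2$. Let $0\to F_n\to F_{n-1}\to\cdots\to F_0\to\mathbb{Z}\to 0$ be a $\mathbb{Z}G$-resolution of type $\mathsf{FP}_n$ (so each $F_i$ is finitely generated projective) extending a based free partial resolution $F_{n-1}\to\cdots\to F_0\to\mathbb{Z}$ of type $\mathsf{FL}_{n-1}$. Then there is a constant $C$, depending on the partial resolution and bases, such that for any finite index normal subgroup $H\unlhd G$ and every exact $(n-2)$-cycle $z\in C_{n-2}(F_*|_H;\mathbb{Z})$ there is an $(n-1)$-chain $A\in C_{n-1}(F_*|_H;\mathbb{Z})$ such that $$\partial A=z\quad\text{and}\quad\|A\|\le C\|z\|.$$
   Context: A countable discrete group $G$ has property (T) if $H^1(G;\pi)=0$ for all unitary representations $\pi$ of $G$. $G$ is a $\mathsf{PD}_n^+$ group (orientable Poincaré duality group of dimension $n$) if the trivial module $\mathbb{Z}$ has a finite length resolution by finitely generated projective $\mathbb{Z}G$-modules, $H^i(G;\mathbb{Z}G)=0$ for $i\ne n$, and $H^n(G;\mathbb{Z}G)\cong\mathbb{Z}$ with trivial $G$-action. A based partial resolution of type $\mathsf{FL}_{n-1}$ is an exact sequence $F_{n-1}\to\cdots\to F_0\to\mathbb{Z}\to0$ of left $\mathbb{Z}G$-modules ($\mathbb{Z}$ trivial) with each $F_i$ free of finite rank with a fixed $\mathbb{Z}G$-basis. For $H\unlhd G$ of finite index, $C_i(F_*|_H;\mathbb{Z})=F_i\otimes_{\mathbb{Z}H}\mathbb{Z}$,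 where $F_i$ is regarded as a $\mathbb{Z}H$-module by restriction (and as a right module via $g\mapsto g^{-1}$) and $\mathbb{Z}$ is the trivial module; $\partial$ is induced by the maps of the resolution. An exact $(n-2)$-cycle is an element of $\partial C_{n-1}(F_*|_H;\mathbb{Z})$. For $i\le n-1$, if $\{e_j\}$ is the fixed $\mathbb{Z}G$-basis of $F_i$ and $\{t_r\}$ are representatives for $H\backslash G$, then the elements $t_re_j\otimes1$ form a $\mathbb{Z}$-basis of $C_i(F_*|_H;\mathbb{Z})$, and $\|\cdot\|$ is the $\ell^1$-norm of this basis; it is independent of the choice of representatives. *)

theory Defs
  imports Complex_Main "HOL-Algebra.Module" "HOL-Algebra.Free_Abelian_Groups"
begin

section \<open>Modules over a not necessarily commutative ring\<close>

text \<open>The library locale \<open>module\<close> requires a commutative ring; only its record type is reused.\<close>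

locale left_module = R?: ring R + M?: abelian_group M
  for R :: "('r, 'c) ring_scheme" (structure) and M :: "('r, 'm, 'd) module_scheme" (structure) +
  assumes lsmult_closed: "\<lbrakk>a \<in> carrier R; x \<in> carrier M\<rbrakk> \<Longrightarrow> a \<odot>\<^bsub>M\<^esub> x \<in> carrier M"
    and lsmult_l_distr: "\<lbrakk>a \<in> carrier R; b \<in> carrier R; x \<in> carrier M\<rbrakk>
      \<Longrightarrow> (a \<oplus>\<^bsub>R\<^esub> b) \<odot>\<^bsub>M\<^esub> x = a \<odot>\<^bsub>M\<^esub> x \<oplus>\<^bsub>M\<^esub> b \<odot>\<^bsub>M\<^esub> x"
    and lsmult_r_distr: "\<lbrakk>a \<in> carrier R; x \<in> carrier M; y \<in> carrier M\<rbrakk>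
      \<Longrightarrow> a \<odot>\<^bsub>M\<^esub> (x \<oplus>\<^bsub>M\<^esub> y) = a \<odot>\<^bsub>M\<^esub> x \<oplus>\<^bsub>M\<^esub> a \<odot>\<^bsub>M\<^esub> y"
    and lsmult_assoc: "\<lbrakk>a \<in> carrier R; b \<in> carrier R; x \<in> carrier M\<rbrakk>
      \<Longrightarrow> (a \<otimes>\<^bsub>R\<^esub> b) \<odot>\<^bsub>M\<^esub> x = a \<odot>\<^bsub>M\<^esub> (b \<odot>\<^bsub>M\<^esub> x)"
    and lsmult_one: "x \<in> carrier M \<Longrightarrow> \<one>\<^bsub>R\<^esub> \<odot>\<^bsub>M\<^esub> x = x"

definition lmod_hom ::
  "('r, 'c) ring_scheme \<Rightarrow> ('r, 'm, 'd) module_scheme \<Rightarrow> ('r, 'n, 'e) module_scheme \<Rightarrow> ('m \<Rightarrow> 'n) set"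
  where "lmod_hom R M N = {f \<in> carrier M \<rightarrow> carrier N.
    (\<forall>x\<in>carrier M. \<forall>y\<in>carrier M. f (x \<oplus>\<^bsub>M\<^esub> y) = f x \<oplus>\<^bsub>N\<^esub> f y) \<and>
    (\<forall>a\<in>carrier R. \<forall>x\<in>carrier M. f (a \<odot>\<^bsub>M\<^esub> x) = a \<odot>\<^bsub>N\<^esub> f x)}"

definition finite_basis ::
  "('r, 'c) ring_scheme \<Rightarrow> ('r, 'm, 'd) module_scheme \<Rightarrow> 'm set \<Rightarrow> bool"
  where "finite_basis R M E \<longleftrightarrow> finite E \<and> E \<subseteq> carrier M \<and>
    (\<forall>x\<in>carrier M. \<exists>!c. c \<in> E \<rightarrow>\<^sub>E carrier R \<and> x = (\<Oplus>\<^bsub>M\<^esub>e\<in>E. c e \<odot>\<^bsub>M\<^esub> e))"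

definition fin_generated ::
  "('r, 'c) ring_scheme \<Rightarrow> ('r, 'm, 'd) module_scheme \<Rightarrow> bool"
  where "fin_generated R M \<longleftrightarrow> (\<exists>K. finite K \<and> K \<subseteq> carrier M \<and>
    (\<forall>x\<in>carrier M. \<exists>c \<in> K \<rightarrow> carrier R. x = (\<Oplus>\<^bsub>M\<^esub>e\<in>K. c e \<odot>\<^bsub>M\<^esub> e)))"

text \<open>The free module on the index set \<open>S\<close>. The multiplicative fields inherited from the ring
  record are not used.\<close>

definition free_module :: "('r, 'c) ring_scheme \<Rightarrow> 's set \<Rightarrow> ('r, 's \<Rightarrow> 'r) module"
  where "free_module R S = \<lparr>
    carrier = {f. finite {s. f s \<noteq> \<zero>\<^bsub>R\<^esub>} \<and> {s. f s \<noteq> \<zero>\<^bsub>R\<^esub>} \<subseteq> S \<and> (\<forall>s\<in>S. f s \<in> carrier R)},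
    monoid.mult = undefined, one = undefined,
    ring.zero = (\<lambda>_. \<zero>\<^bsub>R\<^esub>),
    ring.add = (\<lambda>f h s. if s \<in> S then f s \<oplus>\<^bsub>R\<^esub> h s else \<zero>\<^bsub>R\<^esub>),
    smult = (\<lambda>a f s. if s \<in> S then a \<otimes>\<^bsub>R\<^esub> f s else \<zero>\<^bsub>R\<^esub>)\<rparr>"

text \<open>Projective means direct summand of a free module. Restricting the index sets \<open>S\<close> to
  subsets of the type of \<open>P\<close> loses nothing: a projective \<open>P\<close> is a summand of the free module on
  \<open>carrier P\<close>.\<close>

definition projective_module ::
  "('r, 'c) ring_scheme \<Rightarrow> ('r, 'm, 'd) module_scheme \<Rightarrow> bool"
  where "projective_module R P \<longleftrightarrow> left_module R P \<and>
    (\<exists>(S::'m set) i p. i \<in> lmod_hom R P (free_module R S) \<and> p \<in> lmod_hom R (free_module R S) P \<and>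
       (\<forall>x\<in>carrier P. p (i x) = x))"


section \<open>Integral group rings\<close>

definition group_ring :: "('g, 'b) monoid_scheme \<Rightarrow> ('g \<Rightarrow> int) ring"
  where "group_ring G = \<lparr>
    carrier = {f. finite {g. f g \<noteq> 0} \<and> {g. f g \<noteq> 0} \<subseteq> carrier G},
    monoid.mult = (\<lambda>f h x. if x \<in> carrier G
      then (\<Sum>g | f g \<noteq> 0. f g * h (inv\<^bsub>G\<^esub> g \<otimes>\<^bsub>G\<^esub> x)) else 0),
    one = (\<lambda>x. if x = \<one>\<^bsub>G\<^esub> then 1 else 0),
    ring.zero = (\<lambda>_. 0), ring.add = (\<lambda>f h x. f x + h x)\<rparr>"

definition group_elem :: "'g \<Rightarrow> 'g \<Rightarrow> int"
  where "group_elem g = (\<lambda>x. if x = g then 1 else 0)"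

definition ring_inversion :: "('g, 'b) monoid_scheme \<Rightarrow> ('g \<Rightarrow> int) \<Rightarrow> 'g \<Rightarrow> int"
  where "ring_inversion G r = (\<lambda>g. if g \<in> carrier G then r (inv\<^bsub>G\<^esub> g) else 0)"

text \<open>The trivial module \<open>\<int>\<close>: a group ring element acts through its augmentation.\<close>

definition trivial_module :: "('g \<Rightarrow> int, int) module"
  where "trivial_module = \<lparr>carrier = UNIV, monoid.mult = undefined, one = undefined,
    ring.zero = 0, ring.add = (+), smult = (\<lambda>r k. (\<Sum>g | r g \<noteq> 0. r g) * k)\<rparr>"


section \<open>Group cohomology\<close>

text \<open>\<open>H\<^sup>i(G; M)\<close> is computed by the standard (inhomogeneous) cochain complex. The coefficients are
  the additive group of \<open>M\<close> with an action \<open>act\<close> of \<open>G\<close>; this covers \<open>\<int>G\<close>-modules as well as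
  unitary representations. Cochains are extensional functions on lists of length \<open>i\<close>.\<close>

definition tuples :: "('g, 'b) monoid_scheme \<Rightarrow> nat \<Rightarrow> 'g list set"
  where "tuples G i = {gs. length gs = i \<and> set gs \<subseteq> carrier G}"

definition cochains :: "('g, 'b) monoid_scheme \<Rightarrow> ('m, 'c) ring_scheme \<Rightarrow> nat \<Rightarrow> ('g list \<Rightarrow> 'm) set"
  where "cochains G M i = tuples G i \<rightarrow>\<^sub>E carrier M"

definition merge_at :: "('g, 'b) monoid_scheme \<Rightarrow> nat \<Rightarrow> 'g list \<Rightarrow> 'g list"
  where "merge_at G j gs = take j gs @ (gs ! j \<otimes>\<^bsub>G\<^esub> gs ! Suc j) # drop (j + 2) gs"

definition cobd ::
  "('g, 'b) monoid_scheme \<Rightarrow> ('m, 'c) ring_scheme \<Rightarrow> ('g \<Rightarrow> 'm \<Rightarrow> 'm) \<Rightarrow> nat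
    \<Rightarrow> ('g list \<Rightarrow> 'm) \<Rightarrow> 'g list \<Rightarrow> 'm"
  where "cobd G M act i f = (\<lambda>gs\<in>tuples G (Suc i).
    act (hd gs) (f (tl gs))
    \<oplus>\<^bsub>M\<^esub> (\<Oplus>\<^bsub>M\<^esub>j\<in>{..<i}. [((-1::int) ^ Suc j)] \<cdot>\<^bsub>M\<^esub> f (merge_at G j gs))
    \<oplus>\<^bsub>M\<^esub> [((-1::int) ^ Suc i)] \<cdot>\<^bsub>M\<^esub> f (butlast gs))"

definition zero_cochain :: "('g, 'b) monoid_scheme \<Rightarrow> ('m, 'c) ring_scheme \<Rightarrow> nat \<Rightarrow> 'g list \<Rightarrow> 'm"
  where "zero_cochain G M i = (\<lambda>gs\<in>tuples G i. \<zero>\<^bsub>M\<^esub>)"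

definition cocycle_group ::
  "('g, 'b) monoid_scheme \<Rightarrow> ('m, 'c) ring_scheme \<Rightarrow> ('g \<Rightarrow> 'm \<Rightarrow> 'm) \<Rightarrow> nat \<Rightarrow> ('g list \<Rightarrow> 'm) monoid"
  where "cocycle_group G M act i = \<lparr>
    carrier = {f \<in> cochains G M i. cobd G M act i f = zero_cochain G M (Suc i)},
    monoid.mult = (\<lambda>f h. \<lambda>gs\<in>tuples G i. f gs \<oplus>\<^bsub>M\<^esub> h gs),
    one = zero_cochain G M i\<rparr>"

definition coboundaries ::
  "('g, 'b) monoid_scheme \<Rightarrow> ('m, 'c) ring_scheme \<Rightarrow> ('g \<Rightarrow> 'm \<Rightarrow> 'm) \<Rightarrow> nat \<Rightarrow> ('g list \<Rightarrow> 'm) set"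
  where "coboundaries G M act i =
    (if i = 0 then {zero_cochain G M 0} else cobd G M act (i - 1) ` cochains G M (i - 1))"

definition cohomology_group ::
  "('g, 'b) monoid_scheme \<Rightarrow> ('m, 'c) ring_scheme \<Rightarrow> ('g \<Rightarrow> 'm \<Rightarrow> 'm) \<Rightarrow> nat
    \<Rightarrow> ('g list \<Rightarrow> 'm) set monoid"
  where "cohomology_group G M act i = cocycle_group G M act i Mod coboundaries G M act i"


section \<open>Property (T)\<close>

definition complex_ring :: "complex ring"
  where "complex_ring = \<lparr>carrier = UNIV, monoid.mult = (*), one = 1, ring.zero = 0, ring.add = (+)\<rparr>"

locale complex_hilbert_space = module complex_ring V
  for V :: "(complex, 'v) module" (structure) +
  fixes ip :: "'v \<Rightarrow> 'v \<Rightarrow> complex"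
  assumes ip_add: "\<lbrakk>x \<in> carrier V; y \<in> carrier V; z \<in> carrier V\<rbrakk>
      \<Longrightarrow> ip (x \<oplus>\<^bsub>V\<^esub> y) z = ip x z + ip y z"
    and ip_smult: "\<lbrakk>x \<in> carrier V; z \<in> carrier V\<rbrakk> \<Longrightarrow> ip (c \<odot>\<^bsub>V\<^esub> x) z = c * ip x z"
    and ip_commute: "\<lbrakk>x \<in> carrier V; y \<in> carrier V\<rbrakk> \<Longrightarrow> ip y x = cnj (ip x y)"
    and ip_ge_zero: "x \<in> carrier V \<Longrightarrow> 0 \<le> Re (ip x x)"
    and ip_definite: "\<lbrakk>x \<in> carrier V; ip x x = 0\<rbrakk> \<Longrightarrow> x = \<zero>\<^bsub>V\<^esub>"
    and complete: "\<lbrakk>\<And>k::nat. s k \<in> carrier V;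
        \<And>\<epsilon>. \<epsilon> > 0 \<Longrightarrow> \<exists>N. \<forall>k\<ge>N. \<forall>l\<ge>N. sqrt (Re (ip (s k \<ominus>\<^bsub>V\<^esub> s l) (s k \<ominus>\<^bsub>V\<^esub> s l))) < \<epsilon>\<rbrakk>
      \<Longrightarrow> \<exists>x\<in>carrier V. (\<lambda>k. sqrt (Re (ip (s k \<ominus>\<^bsub>V\<^esub> x) (s k \<ominus>\<^bsub>V\<^esub> x)))) \<longlonglongrightarrow> 0"

definition unitary_rep ::
  "('g, 'b) monoid_scheme \<Rightarrow> (complex, 'v) module \<Rightarrow> ('v \<Rightarrow> 'v \<Rightarrow> complex) \<Rightarrow> ('g \<Rightarrow> 'v \<Rightarrow> 'v) \<Rightarrow> bool"
  where "unitary_rep G V ip \<pi> \<longleftrightarrow> complex_hilbert_space V ip \<and>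
    (\<forall>g\<in>carrier G. \<pi> g \<in> lmod_hom complex_ring V V \<and> bij_betw (\<pi> g) (carrier V) (carrier V) \<and>
      (\<forall>x\<in>carrier V. \<forall>y\<in>carrier V. ip (\<pi> g x) (\<pi> g y) = ip x y)) \<and>
    (\<forall>g\<in>carrier G. \<forall>h\<in>carrier G. \<forall>x\<in>carrier V. \<pi> (g \<otimes>\<^bsub>G\<^esub> h) x = \<pi> g (\<pi> h x))"

text \<open>A quantifier over all Hilbert spaces needs a universe. The Hilbert spaces below have an
  arbitrary subset of the type \<open>nat \<Rightarrow> complex\<close> as underlying set and arbitrary operations, so every
  Hilbert space of cardinality at most the continuum, in particular every separable one, occurs up to
  isomorphism. For countable \<open>G\<close> this is no restriction: a 1-cocycle takes values in a separable
  closed invariant subspace, and if it is the coboundary of a vector then also of the projection of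
  that vector to the subspace.\<close>

definition property_T :: "('g, 'b) monoid_scheme \<Rightarrow> bool"
  where "property_T G \<longleftrightarrow> group G \<and> countable (carrier G) \<and>
    (\<forall>(V :: (complex, nat \<Rightarrow> complex) module) ip \<pi>.
       unitary_rep G V ip \<pi> \<longrightarrow> trivial_group (cohomology_group G V \<pi> 1))"


section \<open>Resolutions and Poincare duality groups\<close>

text \<open>Exactness of \<open>F\<^sub>m \<rightarrow> \<dots> \<rightarrow> F\<^sub>0 \<rightarrow> \<int> \<rightarrow> 0\<close>, where \<open>d i\<close> maps \<open>F i\<close> to \<open>F (i - 1)\<close>. Only
  \<open>F i\<close> for \<open>i \<le> m\<close> and \<open>d i\<close> for \<open>1 \<le> i \<le> m\<close> matter.\<close>

definition partial_resolution ::
  "('g, 'b) monoid_scheme \<Rightarrow> nat \<Rightarrow> (nat \<Rightarrow> ('g \<Rightarrow> int, 'm) module) \<Rightarrow> (nat \<Rightarrow> 'm \<Rightarrow> 'm)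
    \<Rightarrow> ('m \<Rightarrow> int) \<Rightarrow> bool"
  where "partial_resolution G m F d aug \<longleftrightarrow>
    (\<forall>i\<le>m. left_module (group_ring G) (F i)) \<and>
    (\<forall>i. 1 \<le> i \<and> i \<le> m \<longrightarrow> d i \<in> lmod_hom (group_ring G) (F i) (F (i - 1))) \<and>
    aug \<in> lmod_hom (group_ring G) (F 0) trivial_module \<and>
    aug ` carrier (F 0) = UNIV \<and>
    (1 \<le> m \<longrightarrow> d 1 ` carrier (F 1) = {x \<in> carrier (F 0). aug x = 0}) \<and>
    (\<forall>i. 1 \<le> i \<and> i < m \<longrightarrow>
       d (Suc i) ` carrier (F (Suc i)) = {x \<in> carrier (F i). d i x = \<zero>\<^bsub>F (i - 1)\<^esub>})"

definition FP_resolution ::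
  "('g, 'b) monoid_scheme \<Rightarrow> nat \<Rightarrow> (nat \<Rightarrow> ('g \<Rightarrow> int, 'm) module) \<Rightarrow> (nat \<Rightarrow> 'm \<Rightarrow> 'm)
    \<Rightarrow> ('m \<Rightarrow> int) \<Rightarrow> bool"
  where "FP_resolution G m F d aug \<longleftrightarrow> partial_resolution G m F d aug \<and>
    (\<forall>i\<le>m. fin_generated (group_ring G) (F i) \<and> projective_module (group_ring G) (F i)) \<and>
    (if m = 0 then inj_on aug (carrier (F 0)) else inj_on (d m) (carrier (F m)))"

definition based_FL_resolution ::
  "('g, 'b) monoid_scheme \<Rightarrow> nat \<Rightarrow> (nat \<Rightarrow> ('g \<Rightarrow> int, 'm) module) \<Rightarrow> (nat \<Rightarrow> 'm \<Rightarrow> 'm)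
    \<Rightarrow> ('m \<Rightarrow> int) \<Rightarrow> (nat \<Rightarrow> 'm set) \<Rightarrow> bool"
  where "based_FL_resolution G m F d aug E \<longleftrightarrow> partial_resolution G m F d aug \<and>
    (\<forall>i\<le>m. finite_basis (group_ring G) (F i) (E i))"

text \<open>\<open>H\<^sup>i(G; \<int>G)\<close>, with \<open>G\<close> acting on the coefficients by left multiplication. Right multiplication
  commutes with that action and induces the \<open>G\<close>-action on cohomology; below, a class is a coset of
  cocycles and is moved as a set.\<close>

definition ZG_cohomology :: "('g, 'b) monoid_scheme \<Rightarrow> nat \<Rightarrow> ('g list \<Rightarrow> 'g \<Rightarrow> int) set monoid"
  where "ZG_cohomology G i =
    cohomology_group G (group_ring G) (\<lambda>g x. group_elem g \<otimes>\<^bsub>group_ring G\<^esub> x) i"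

definition ZG_right_translate ::
  "('g, 'b) monoid_scheme \<Rightarrow> nat \<Rightarrow> 'g \<Rightarrow> ('g list \<Rightarrow> 'g \<Rightarrow> int) set \<Rightarrow> ('g list \<Rightarrow> 'g \<Rightarrow> int) set"
  where "ZG_right_translate G i g K =
    (\<lambda>f. \<lambda>gs\<in>tuples G i. f gs \<otimes>\<^bsub>group_ring G\<^esub> group_elem g) ` K"

text \<open>Finitely generated \<open>\<int>G\<close>-modules are quotients of some \<open>(\<int>G)\<^sup>k\<close>, so they all occur, up to
  isomorphism, on subsets of the type \<open>nat \<Rightarrow> 'g \<Rightarrow> int\<close>.\<close>

definition PD_plus_group :: "nat \<Rightarrow> ('g, 'b) monoid_scheme \<Rightarrow> bool"
  where "PD_plus_group n G \<longleftrightarrow> group G \<and>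
    (\<exists>m (P :: nat \<Rightarrow> ('g \<Rightarrow> int, nat \<Rightarrow> 'g \<Rightarrow> int) module) d aug. FP_resolution G m P d aug) \<and>
    (\<forall>i. i \<noteq> n \<longrightarrow> trivial_group (ZG_cohomology G i)) \<and>
    ZG_cohomology G n \<cong> integer_group \<and>
    (\<forall>g\<in>carrier G. \<forall>K\<in>carrier (ZG_cohomology G n). ZG_right_translate G n g K = K)"


section \<open>Tensor products\<close>

text \<open>The tensor product over \<open>R\<close> of an abelian group \<open>M\<close> with right \<open>R\<close>-action \<open>ra\<close> and a left
  \<open>R\<close>-module \<open>N\<close>: the free abelian group on pairs modulo the usual relations. It is an abelian group
  in multiplicative notation, whose elements are cosets.\<close>

definition tensor_gens :: "('m, 'c) ring_scheme \<Rightarrow> ('r, 'n, 'e) module_scheme \<Rightarrow> ('m \<times> 'n \<Rightarrow>\<^sub>0 int) monoid"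
  where "tensor_gens M N = free_Abelian_group (carrier M \<times> carrier N)"

definition tensor_relations ::
  "('r, 'a) ring_scheme \<Rightarrow> ('m, 'c) ring_scheme \<Rightarrow> ('m \<Rightarrow> 'r \<Rightarrow> 'm) \<Rightarrow> ('r, 'n, 'e) module_scheme
    \<Rightarrow> ('m \<times> 'n \<Rightarrow>\<^sub>0 int) set"
  where "tensor_relations R M ra N = generate (tensor_gens M N)
    ({frag_of (x \<oplus>\<^bsub>M\<^esub> x', y) - frag_of (x, y) - frag_of (x', y) | x x' y.
        x \<in> carrier M \<and> x' \<in> carrier M \<and> y \<in> carrier N} \<union>
     {frag_of (x, y \<oplus>\<^bsub>N\<^esub> y') - frag_of (x, y) - frag_of (x, y') | x y y'.
        x \<in> carrier M \<and> y \<in> carrier N \<and> y' \<in> carrier N} \<union>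
     {frag_of (ra x r, y) - frag_of (x, r \<odot>\<^bsub>N\<^esub> y) | x r y.
        x \<in> carrier M \<and> r \<in> carrier R \<and> y \<in> carrier N})"

definition tensor_product ::
  "('r, 'a) ring_scheme \<Rightarrow> ('m, 'c) ring_scheme \<Rightarrow> ('m \<Rightarrow> 'r \<Rightarrow> 'm) \<Rightarrow> ('r, 'n, 'e) module_scheme
    \<Rightarrow> ('m \<times> 'n \<Rightarrow>\<^sub>0 int) set monoid"
  where "tensor_product R M ra N = tensor_gens M N Mod tensor_relations R M ra N"

definition pure_tensor ::
  "('r, 'a) ring_scheme \<Rightarrow> ('m, 'c) ring_scheme \<Rightarrow> ('m \<Rightarrow> 'r \<Rightarrow> 'm) \<Rightarrow> ('r, 'n, 'e) module_scheme
    \<Rightarrow> 'm \<Rightarrow> 'n \<Rightarrow> ('m \<times> 'n \<Rightarrow>\<^sub>0 int) set"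
  where "pure_tensor R M ra N x y = tensor_relations R M ra N #>\<^bsub>tensor_gens M N\<^esub> frag_of (x, y)"

text \<open>The map induced by \<open>\<phi>\<close> on the first factor, with target the tensor product of \<open>M\<close> and \<open>N\<close>:
  the image of a coset under the map of free abelian groups, enlarged to a full coset of the
  relations of the target.\<close>

definition tensor_map ::
  "('r, 'a) ring_scheme \<Rightarrow> ('m, 'c) ring_scheme \<Rightarrow> ('m \<Rightarrow> 'r \<Rightarrow> 'm) \<Rightarrow> ('r, 'n, 'e) module_scheme
    \<Rightarrow> ('l \<Rightarrow> 'm) \<Rightarrow> ('l \<times> 'n \<Rightarrow>\<^sub>0 int) set \<Rightarrow> ('m \<times> 'n \<Rightarrow>\<^sub>0 int) set"
  where "tensor_map R M ra N \<phi> K = tensor_relations R M ra N <#>\<^bsub>tensor_gens M N\<^esub>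
    frag_extend (\<lambda>(x, y). frag_of (\<phi> x, y)) ` K"


section \<open>Chains of a finite index subgroup\<close>

abbreviation subgroup_ring :: "('g, 'b) monoid_scheme \<Rightarrow> 'g set \<Rightarrow> ('g \<Rightarrow> int) ring"
  where "subgroup_ring G H \<equiv> group_ring (G\<lparr>carrier := H\<rparr>)"

text \<open>A left module as a right module via inversion in \<open>G\<close>.\<close>

definition right_action ::
  "('g, 'b) monoid_scheme \<Rightarrow> ('g \<Rightarrow> int, 'm) module \<Rightarrow> 'm \<Rightarrow> ('g \<Rightarrow> int) \<Rightarrow> 'm"
  where "right_action G M x r = ring_inversion G r \<odot>\<^bsub>M\<^esub> x"

definition chain_group ::
  "('g, 'b) monoid_scheme \<Rightarrow> 'g set \<Rightarrow> ('g \<Rightarrow> int, 'm) module \<Rightarrow> ('m \<times> int \<Rightarrow>\<^sub>0 int) set monoid"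
  where "chain_group G H M =
    tensor_product (subgroup_ring G H) M (right_action G M) trivial_module"

definition chain_map ::
  "('g, 'b) monoid_scheme \<Rightarrow> 'g set \<Rightarrow> ('g \<Rightarrow> int, 'm) module \<Rightarrow> ('m \<Rightarrow> 'm)
    \<Rightarrow> ('m \<times> int \<Rightarrow>\<^sub>0 int) set \<Rightarrow> ('m \<times> int \<Rightarrow>\<^sub>0 int) set"
  where "chain_map G H M \<phi> =
    tensor_map (subgroup_ring G H) M (right_action G M) trivial_module \<phi>"

definition coset_representatives :: "('g, 'b) monoid_scheme \<Rightarrow> 'g set \<Rightarrow> 'g set \<Rightarrow> bool"
  where "coset_representatives G H T \<longleftrightarrow>
    T \<subseteq> carrier G \<and> (\<forall>K\<in>rcosets\<^bsub>G\<^esub> H. \<exists>!t. t \<in> T \<and> t \<in> K)"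

text \<open>Meaningful when \<open>b\<close>, indexed by the finite set \<open>I\<close>, is a \<open>\<int>\<close>-basis of the (multiplicatively
  written) abelian group \<open>A\<close>.\<close>

definition l1_norm :: "('a, 'b) monoid_scheme \<Rightarrow> 'i set \<Rightarrow> ('i \<Rightarrow> 'a) \<Rightarrow> 'a \<Rightarrow> int"
  where "l1_norm A I b x =
    (\<Sum>i\<in>I. \<bar>(THE c. c \<in> I \<rightarrow>\<^sub>E (UNIV :: int set) \<and> x = (\<Otimes>\<^bsub>A\<^esub>i\<in>I. b i [^]\<^bsub>A\<^esub> c i)) i\<bar>)"

definition chain_norm ::
  "('g, 'b) monoid_scheme \<Rightarrow> 'g set \<Rightarrow> 'g set \<Rightarrow> ('g \<Rightarrow> int, 'm) module \<Rightarrow> 'm set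
    \<Rightarrow> ('m \<times> int \<Rightarrow>\<^sub>0 int) set \<Rightarrow> int"
  where "chain_norm G H T M E = l1_norm (chain_group G H M) (T \<times> E)
    (\<lambda>(t, e). pure_tensor (subgroup_ring G H) M (right_action G M) trivial_module
       (group_elem t \<odot>\<^bsub>M\<^esub> e) 1)"

end

theory Submission
  imports Defs "HOL-Library.Function_Algebras" "HOL-Analysis.Analysis" "HOL-Complex_Analysis.Great_Picard"
begin

text \<open>Since \<open>H\<^sup>n(G; \<int>G)\<close> is \<open>\<int>\<close> with trivial action and \<open>H\<^sup>n\<^sup>-\<^sup>1(G; \<int>G)\<close> vanishes, dualizing the
  resolution yields homomorphisms \<open>\<beta> s\<close> from \<open>F (n - 1)\<close> to \<open>\<int>G\<close>, for \<open>s \<in> G\<close>, which satisfy the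
  cocycle identity up to homomorphisms that factor through the boundary map, and which determine the
  coordinates of a chain up to its boundary and up to terms that are boundaries of \<open>n\<close>-chains.
  For an exact cycle \<open>z = \<partial>u\<close> the functions \<open>b s = \<beta> s u\<close> on \<open>G/H\<close> are thus an almost cocycle whose defect
  is bounded by the norm of \<open>z\<close>. Property (T) provides an integral \<open>f\<close> for which all
  \<open>b s - (s f - f)\<close> are bounded by the norm of \<open>z\<close>, with a constant independent of \<open>H\<close>. Replacing
  \<open>b s\<close> by this difference in the formula for the coordinates of \<open>u\<close> gives the required \<open>A\<close>.

  For the almost cocycles, take counterexamples of minimal norm and normalize them to norm 1. In the limit,
  the \<open>l1\<close>-distances of \<open>b g\<close> and \<open>b h\<close> become the squared distances of an affine isometric action on a Hilbert
  space, which has a fixed point by property (T). It is approximated by a function on \<open>Q \<times> \<int>\<close> that is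
  almost invariant under the action twisted by \<open>b\<close>. By the coarea formula one of its superlevel sets is the subgraph of an integer
  function, subtracting whose coboundary decreases the norm.\<close>

section \<open>Hilbert spaces of positive semidefinite kernels\<close>

text \<open>The difficulty is uniformity in \<open>H\<close>: property (T) concerns one
  representation, while the quotients vary. Along a sequence of counterexamples only the normalized
  distances between the \<open>b g\<close> survive in the limit; they define a positive semidefinite
  kernel on pairs of group elements. Since \<open>property_T\<close> speaks about spaces inside
  \<open>nat \<Rightarrow> complex\<close>, the Hilbert space is realized as a reproducing kernel
  space of functions on an enumeration of these pairs. Its fixed point is used through finite
  combinations of kernel vectors, which make sense for every member of the sequence and have
  convergent norms. Closeness in square norm does not bound an \<open>l1\<close>-norm by itself.
  Thresholds are therefore taken from the middle third of the unit interval: a value near such a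
  threshold is far from 0 and 1, so a small jump there is paid for by the distance to an indicator
  function. Subtracting a coboundary from \<open>b\<close> changes the coordinates only by
  combinations of the cycles \<open>y j\<close>, since each \<open>\<xi> e\<close> is a combination
  of their coordinates and has augmentation 0. This is why the new chain keeps its boundary.\<close>

text \<open>A list of pairs \<open>(a, i)\<close> stands for the finite combination of the \<open>i\<close> with coefficients \<open>a\<close>.\<close>

definition lin :: "('i \<Rightarrow> real) \<Rightarrow> (real \<times> 'i) list \<Rightarrow> real"
  where "lin f c = (\<Sum>(a, i)\<leftarrow>c. a * f i)"

definition quad :: "('i \<Rightarrow> 'i \<Rightarrow> real) \<Rightarrow> (real \<times> 'i) list \<Rightarrow> real"
  where "quad K c = lin (\<lambda>i. lin (K i) c) c"

definition scale :: "real \<Rightarrow> (real \<times> 'i) list \<Rightarrow> (real \<times> 'i) list"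
  where "scale t c = map (\<lambda>(a, i). (t * a, i)) c"

definition push :: "('i \<Rightarrow> 'j) \<Rightarrow> (real \<times> 'i) list \<Rightarrow> (real \<times> 'j) list"
  where "push \<sigma> c = map (\<lambda>(a, i). (a, \<sigma> i)) c"

lemma lin_simps [simp]:
  "lin f [] = 0" "lin f ((a, i) # c) = a * f i + lin f c"
  "lin f (c @ c') = lin f c + lin f c'"
  by (auto simp: lin_def)

lemma lin_scale [simp]: "lin f (scale t c) = t * lin f c"
  by (induction c) (auto simp: scale_def algebra_simps)

lemma lin_push [simp]: "lin f (push \<sigma> c) = lin (f \<circ> \<sigma>) c"
  by (induction c) (auto simp: push_def)

lemma lin_add [simp]: "lin (f + g) c = lin f c + lin g c"
  by (induction c) (auto simp: algebra_simps)

lemma lin_add' [simp]: "lin (\<lambda>i. f i + g i) c = lin f c + lin g c"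
  by (induction c) (auto simp: algebra_simps)

lemma lin_diff [simp]: "lin (f - g) c = lin f c - lin g c"
  by (induction c) (auto simp: algebra_simps)

lemma lin_uminus [simp]: "lin (- f) c = - lin f c"
  by (induction c) (auto simp: algebra_simps)

lemma lin_zero [simp]: "lin 0 c = 0" "lin (\<lambda>_. 0) c = 0"
  by (induction c) (auto simp: algebra_simps)

lemma lin_cmult [simp]: "lin (\<lambda>i. t * f i) c = t * lin f c"
  by (induction c) (auto simp: algebra_simps)

lemma lin_swap: "lin (\<lambda>i. lin (K i) c) d = lin (\<lambda>j. lin (\<lambda>i. K i j) d) c"
  by (induction d) auto

lemma tendsto_lin: "(\<And>i. (\<lambda>k. f k i) \<longlonglongrightarrow> g i) \<Longrightarrow> (\<lambda>k. lin (f k) c) \<longlonglongrightarrow> lin g c"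
  by (induction c) (auto intro!: tendsto_intros)

lemma quad_scale [simp]: "quad K (scale t c) = t\<^sup>2 * quad K c"
  by (simp add: quad_def power2_eq_square mult.assoc)

lemma quad_push: "quad K (push \<sigma> c) = quad (\<lambda>i j. K (\<sigma> i) (\<sigma> j)) c"
  by (simp add: quad_def comp_def)

text \<open>The kernel may be degenerate, so different combinations can have distance 0. No quotient
  is formed: the Hilbert space will consist of functions on the indices, and these cannot separate
  such combinations.\<close>

locale psd_kernel =
  fixes K :: "'i \<Rightarrow> 'i \<Rightarrow> real"
  assumes sym: "K i j = K j i"
    and psd: "0 \<le> quad K c"
begin

lemma quad_append [simp]: "quad K (c @ d) = quad K c + 2 * lin (\<lambda>i. lin (K i) c) d + quad K d"
proof -
  have "lin (\<lambda>i. lin (K i) d) c = lin (\<lambda>i. lin (K i) c) d"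
    by (subst lin_swap) (simp add: sym)
  then show ?thesis by (simp add: quad_def)
qed

text \<open>The dual of the seminorm \<open>sqrt (quad K c)\<close>; its square is the Legendre transform \<open>N\<close> of \<open>quad K\<close>,
  for which the parallelogram law is a change of variables.\<close>

definition bdd :: "('i \<Rightarrow> real) set"
  where "bdd = {f. bdd_above (range (\<lambda>c. 2 * lin f c - quad K c))}"

definition N :: "('i \<Rightarrow> real) \<Rightarrow> real"
  where "N f = (SUP c. 2 * lin f c - quad K c)"

text \<open>The kernel sections of the reproducing kernel Hilbert space \<open>bdd\<close>: the
  inner product with \<open>emb c\<close> is evaluation at \<open>c\<close>.\<close>

definition emb :: "(real \<times> 'i) list \<Rightarrow> 'i \<Rightarrow> real"
  where "emb c = (\<lambda>i. lin (K i) c)"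

lemma N_upper: "f \<in> bdd \<Longrightarrow> 2 * lin f c - quad K c \<le> N f"
  unfolding N_def bdd_def by (rule cSUP_upper) auto

lemma N_leI: "(\<And>c. 2 * lin f c - quad K c \<le> B) \<Longrightarrow> N f \<le> B"
  unfolding N_def by (rule cSUP_least) auto

lemma bddI: "(\<And>c. 2 * lin f c - quad K c \<le> B) \<Longrightarrow> f \<in> bdd"
  unfolding bdd_def bdd_above_def by auto

lemma N_nonneg: "f \<in> bdd \<Longrightarrow> 0 \<le> N f"
  using N_upper[of f "[]"] by (simp add: quad_def)

lemma N_approx: assumes "f \<in> bdd" "e > 0" obtains c where "N f - e < 2 * lin f c - quad K c"
proof -
  have "\<exists>c. N f - e < 2 * lin f c - quad K c"
  proof (rule ccontr)
    assume "\<not> ?thesis"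
    then have "N f \<le> N f - e" by (intro N_leI) (auto simp: not_less)
    then show False using assms by simp
  qed
  then show ?thesis using that by blast
qed

text \<open>Halving the test combination halves the linear and quarters the quadratic part, so the
  left side is twice a value below \<open>N f\<close> plus twice a value below
  \<open>N g\<close>.\<close>

lemma bdd_half:
  assumes "f \<in> bdd" "g \<in> bdd" shows "2 * lin (f + g) c - quad K c \<le> 2 * N f + 2 * N g"
proof -
  have 1: "2 * lin f (scale (1/2) c) - quad K (scale (1/2) c) \<le> N f"
    and 2: "2 * lin g (scale (1/2) c) - quad K (scale (1/2) c) \<le> N g"
    using assms N_upper by blast+
  then show ?thesis by (simp add: power2_eq_square)
qed

lemma bdd_add: "f \<in> bdd \<Longrightarrow> g \<in> bdd \<Longrightarrow> f + g \<in> bdd"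
  using bdd_half by (intro bddI)

lemma bdd_uminus: assumes "f \<in> bdd" shows "- f \<in> bdd" "N (- f) = N f"
proof -
  have le: "2 * lin (- g) c - quad K c \<le> N g" if "g \<in> bdd" for g c
    using N_upper[OF that, of "scale (-1) c"] by simp
  show 1: "- f \<in> bdd" using le[OF assms] by (rule bddI)
  have "N (- f) \<le> N f" "N (- (- f)) \<le> N (- f)" using le[OF assms] le[OF 1] by (blast intro: N_leI)+
  then show "N (- f) = N f" by simp
qed

lemma bdd_diff: "f \<in> bdd \<Longrightarrow> g \<in> bdd \<Longrightarrow> f - g \<in> bdd"
  using bdd_add[of f "- g"] bdd_uminus by simp

lemma bdd_zero: "0 \<in> bdd"
  by (rule bddI[of _ 0]) (simp add: psd)

lemma N_zero: "N 0 = 0"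
  using N_nonneg[OF bdd_zero] N_leI[of 0 0] by (simp add: psd)

text \<open>Rescaling the test combination by \<open>1/t\<close> gives one inequality; the other is
  the same inequality for the factor \<open>1/t\<close>.\<close>

lemma bdd_cmult: assumes "f \<in> bdd" shows "(\<lambda>i. t * f i) \<in> bdd" "N (\<lambda>i. t * f i) = t\<^sup>2 * N f"
proof -
  have le: "2 * lin (\<lambda>i. t * g i) c - quad K c \<le> t\<^sup>2 * N g" if "g \<in> bdd" "t \<noteq> 0" for g t c
  proof -
    have "2 * lin g (scale (1/t) c) - quad K (scale (1/t) c) \<le> N g" using that N_upper by blast
    then have "t\<^sup>2 * (2 * lin g (scale (1/t) c) - quad K (scale (1/t) c)) \<le> t\<^sup>2 * N g"
      by (intro mult_left_mono) auto
    moreover have "t\<^sup>2 * (2 * lin g (scale (1/t) c) - quad K (scale (1/t) c)) = 2 * (t * lin g c) - quad K c"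
      using that by (simp add: power2_eq_square right_diff_distrib)
    ultimately show ?thesis by simp
  qed
  have *: "(\<lambda>i. t * g i) \<in> bdd" "N (\<lambda>i. t * g i) \<le> t\<^sup>2 * N g" if "g \<in> bdd" "t \<noteq> 0" for g t
    using bddI[OF le[OF that]] N_leI[OF le[OF that]] by auto
  show "(\<lambda>i. t * f i) \<in> bdd" using *[OF assms] bdd_zero
    by (cases "t = 0") (auto simp: zero_fun_def)
  show "N (\<lambda>i. t * f i) = t\<^sup>2 * N f"
  proof (cases "t = 0")
    case True then show ?thesis using N_zero by (simp add: zero_fun_def)
  next
    case False
    have "N (\<lambda>i. (1/t) * (t * f i)) \<le> (1/t)\<^sup>2 * N (\<lambda>i. t * f i)"
      using False *[OF assms] by (intro *(2)) auto
    then have "t\<^sup>2 * N f \<le> N (\<lambda>i. t * f i)" using False by (simp add: field_simps)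
    then show ?thesis using *[OF assms False] by simp
  qed
qed

text \<open>Both sides are suprema over two test combinations \<open>c\<close> and \<open>d\<close>.
  One inequality evaluates \<open>f\<close> and \<open>g\<close> at half the sum and half the
  difference of \<open>c\<close> and \<open>d\<close>, the other evaluates \<open>f + g\<close> and
  \<open>f - g\<close> at the sum and the difference.\<close>

lemma N_parallelogram:
  assumes "f \<in> bdd" "g \<in> bdd" shows "N (f + g) + N (f - g) = 2 * N f + 2 * N g"
proof (rule antisym)
  note b = bdd_add[OF assms] bdd_diff[OF assms]
  have "2 * lin (f + g) c - quad K c + (2 * lin (f - g) d - quad K d) \<le> 2 * N f + 2 * N g" for c d
  proof -
    have "2 * lin f (scale (1/2) (c @ d)) - quad K (scale (1/2) (c @ d)) \<le> N f"
      "2 * lin g (scale (1/2) (c @ scale (-1) d)) - quad K (scale (1/2) (c @ scale (-1) d)) \<le> N g"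
      using assms N_upper by blast+
    then show ?thesis by (simp add: power2_eq_square field_simps)
  qed
  then have "2 * lin (f + g) c - quad K c \<le> 2 * N f + 2 * N g - (2 * lin (f - g) d - quad K d)" for c d
    by (simp add: algebra_simps)
  then have "N (f + g) \<le> 2 * N f + 2 * N g - (2 * lin (f - g) d - quad K d)" for d
    by (blast intro: N_leI)
  then have "2 * lin (f - g) d - quad K d \<le> 2 * N f + 2 * N g - N (f + g)" for d
    by (simp add: algebra_simps)
  then have "N (f - g) \<le> 2 * N f + 2 * N g - N (f + g)" by (blast intro: N_leI)
  then show "N (f + g) + N (f - g) \<le> 2 * N f + 2 * N g" by simp
  have "2 * (2 * lin f c - quad K c) + 2 * (2 * lin g d - quad K d) \<le> N (f + g) + N (f - g)" for c d
  proof -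
    have "2 * lin (f + g) (c @ d) - quad K (c @ d) \<le> N (f + g)"
      "2 * lin (f - g) (c @ scale (-1) d) - quad K (c @ scale (-1) d) \<le> N (f - g)"
      using b N_upper by blast+
    then show ?thesis by simp
  qed
  then have "2 * lin f c - quad K c \<le> (N (f + g) + N (f - g)) / 2 - (2 * lin g d - quad K d)" for c d
    by (simp add: field_simps)
  then have "N f \<le> (N (f + g) + N (f - g)) / 2 - (2 * lin g d - quad K d)" for d
    by (blast intro: N_leI)
  then have "2 * lin g d - quad K d \<le> (N (f + g) + N (f - g)) / 2 - N f" for d
    by (simp add: field_simps)
  then have "N g \<le> (N (f + g) + N (f - g)) / 2 - N f" by (blast intro: N_leI)
  then show "2 * N f + 2 * N g \<le> N (f + g) + N (f - g)" by (simp add: field_simps)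
qed

definition B :: "('i \<Rightarrow> real) \<Rightarrow> ('i \<Rightarrow> real) \<Rightarrow> real"
  where "B f g = (N (f + g) - N f - N g) / 2"

lemma B_commute: "B f g = B g f"
  by (simp add: B_def add.commute)

text \<open>The argument of Jordan and von Neumann: a linear combination of four parallelogram
  identities.\<close>

lemma B_add:
  assumes "x \<in> bdd" "y \<in> bdd" "z \<in> bdd" shows "B (x + y) z = B x z + B y z"
proof -
  note cl = assms bdd_add bdd_diff
  have "N ((x + y) + z) + N ((x + y) - z) = 2 * N (x + y) + 2 * N z"
    "N (x + (y - z)) + N (x - (y - z)) = 2 * N x + 2 * N (y - z)"
    "N ((x + z) + y) + N ((x + z) - y) = 2 * N (x + z) + 2 * N y"
    "N (y + z) + N (y - z) = 2 * N y + 2 * N z"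
    by (intro N_parallelogram cl)+
  moreover have "(x + z) + y = (x + y) + z" "x + (y - z) = (x + y) - z" "x - (y - z) = (x + z) - y"
    by (auto simp: algebra_simps)
  ultimately show ?thesis unfolding B_def by (simp add: field_simps)
qed

lemma B_bound: assumes "f \<in> bdd" "g \<in> bdd" shows "\<bar>2 * B f g\<bar> \<le> N f + N g"
proof -
  have b: "- f \<in> bdd" "N (- f) = N f" using bdd_uminus assms by auto
  have 1: "2 * B h g \<le> N h + N g" if "h \<in> bdd" for h
    using N_parallelogram[OF that assms(2)] N_nonneg[OF bdd_diff[OF that assms(2)]] by (simp add: B_def)
  have "B (f + - f) g = B f g + B (- f) g" using assms b by (intro B_add)
  moreover have "B (f + - f) g = 0" by (simp add: B_def N_zero)
  ultimately have "B (- f) g = - B f g" by linarith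
  with 1[OF assms(1)] 1[OF b(1)] b show ?thesis by simp
qed

text \<open>Subtracting the linear function with the same value at 1 leaves an additive function
  that vanishes on integers. Its values are then those at fractional parts, so it is bounded; a
  bounded additive function is 0 because its values at multiples grow linearly.\<close>

lemma additive_bounded_linear:
  fixes \<phi> :: "real \<Rightarrow> real"
  assumes add: "\<And>s t. \<phi> (s + t) = \<phi> s + \<phi> t" and bd: "\<And>t. \<bar>t\<bar> \<le> 1 \<Longrightarrow> \<bar>\<phi> t\<bar> \<le> C"
  shows "\<phi> t = t * \<phi> 1"
proof -
  define \<psi> where "\<psi> t = \<phi> t - t * \<phi> 1" for t
  have a: "\<psi> (s + t) = \<psi> s + \<psi> t" for s t by (simp add: \<psi>_def add algebra_simps)
  have z: "\<psi> 0 = 0" using a[of 0 0] by simp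
  have n: "\<psi> (real n * t) = real n * \<psi> t" for n t
    by (induction n) (auto simp: z a algebra_simps)
  have neg: "\<psi> (- t) = - \<psi> t" for t using a[of t "-t"] z by simp
  have i: "\<psi> (of_int k) = 0" for k
  proof (cases k)
    case (nonneg m) then show ?thesis using n[of m 1] by (simp add: \<psi>_def)
  next
    case (neg m) then show ?thesis using n[of "Suc m" 1] \<open>\<And>t. \<psi> (- t) = - \<psi> t\<close>[of "of_nat (Suc m)"] by (simp add: \<psi>_def)
  qed
  have bd1: "\<bar>\<psi> t\<bar> \<le> C + \<bar>\<phi> 1\<bar>" for t
  proof -
    have "\<psi> t = \<psi> (frac t)" using a[of "of_int \<lfloor>t\<rfloor>" "frac t"] i by (simp add: frac_def)
    moreover have "0 \<le> frac t" "frac t < 1" by (auto simp: frac_lt_1)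
    moreover have "\<bar>\<psi> (frac t)\<bar> \<le> \<bar>\<phi> (frac t)\<bar> + frac t * \<bar>\<phi> 1\<bar>"
      unfolding \<psi>_def using \<open>0 \<le> frac t\<close> abs_triangle_ineq4[of "\<phi> (frac t)" "frac t * \<phi> 1"]
      by (simp add: abs_mult)
    moreover have "frac t * \<bar>\<phi> 1\<bar> \<le> \<bar>\<phi> 1\<bar>"
      using \<open>frac t < 1\<close> by (simp add: mult_left_le_one_le \<open>0 \<le> frac t\<close>)
    ultimately show ?thesis using bd[of "frac t"] by simp
  qed
  have "\<psi> t = 0"
  proof (rule ccontr)
    assume "\<psi> t \<noteq> 0"
    then obtain n where "real n * \<bar>\<psi> t\<bar> > C + \<bar>\<phi> 1\<bar>"
      using reals_Archimedean3[of "\<bar>\<psi> t\<bar>"] by auto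
    moreover have "real n * \<bar>\<psi> t\<bar> = \<bar>\<psi> (real n * t)\<bar>" by (simp add: n abs_mult)
    ultimately show False using bd1[of "real n * t"] by simp
  qed
  then show ?thesis by (simp add: \<psi>_def)
qed

text \<open>Additivity alone reaches only rational factors. The bound \<open>B_bound\<close> gives
  the boundedness on the unit interval that extends this to real ones.\<close>

lemma B_cmult: assumes "f \<in> bdd" "g \<in> bdd" shows "B (\<lambda>i. t * f i) g = t * B f g"
proof -
  have "B (\<lambda>i. t * f i) g = t * B (\<lambda>i. 1 * f i) g"
  proof (rule additive_bounded_linear[where C = "N f + N g"])
    fix s t :: real
    have "(\<lambda>i. (s + t) * f i) = (\<lambda>i. s * f i) + (\<lambda>i. t * f i)" by (auto simp: algebra_simps)
    then show "B (\<lambda>i. (s + t) * f i) g = B (\<lambda>i. s * f i) g + B (\<lambda>i. t * f i) g"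
      using assms bdd_cmult by (simp add: B_add)
  next
    fix t :: real assume "\<bar>t\<bar> \<le> 1"
    then have "t\<^sup>2 \<le> 1" by (simp add: abs_square_le_1)
    then have "t\<^sup>2 * N f \<le> N f" using N_nonneg[OF assms(1)] by (simp add: mult_left_le_one_le)
    then show "\<bar>B (\<lambda>i. t * f i) g\<bar> \<le> N f + N g"
      using B_bound[of "\<lambda>i. t * f i" g] assms bdd_cmult[OF assms(1), of t] N_nonneg[OF assms(1)] N_nonneg[OF assms(2)] by simp
  qed
  then show ?thesis by simp
qed

lemma B_self: assumes "f \<in> bdd" shows "B f f = N f"
  using N_parallelogram[OF assms assms] by (simp add: B_def N_zero)

lemma N_point: assumes "f \<in> bdd" shows "2 * t * f i - t\<^sup>2 * K i i \<le> N f"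
  using N_upper[OF assms, of "[(t, i)]"] by (simp add: quad_def power2_eq_square)

lemma N_definite: assumes "f \<in> bdd" "N f = 0" shows "f = 0"
proof
  fix i
  show "f i = 0 i"
  proof (cases "K i i = 0")
    case True
    then have "2 * (f i) * f i \<le> 0" using N_point[OF assms(1), of "f i" i] assms by simp
    moreover have "f i * f i \<ge> 0" by simp
    ultimately have "f i * f i = 0" by linarith
    then show ?thesis by simp
  next
    case False
    then show ?thesis using N_point[OF assms(1), of "f i / K i i" i] assms
        psd[of "[(1,i)]"]
      by (simp add: quad_def power2_eq_square field_simps) (smt (verit) mult_eq_0_iff not_sum_squares_lt_zero zero_le_mult_iff)
  qed
qed

text \<open>Cauchy-Schwarz for \<open>f\<close> and the kernel section at \<open>i\<close>, obtained
  by optimizing \<open>N_point\<close> over \<open>t\<close>. If \<open>K i i = 0\<close> that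
  inequality is linear in \<open>t\<close> and forces \<open>f i = 0\<close>.\<close>

lemma point_bound: assumes "f \<in> bdd" shows "(f i)\<^sup>2 \<le> N f * K i i"
proof (cases "K i i = 0")
  case True
  have "f i = 0"
  proof (rule ccontr)
    assume "f i \<noteq> 0"
    then have "2 * ((N f + 1) / f i) * f i \<le> N f"
      using N_point[OF assms, of "(N f + 1) / f i" i] True by simp
    then show False using \<open>f i \<noteq> 0\<close> N_nonneg[OF assms] by simp
  qed
  then show ?thesis using True by simp
next
  case False
  then have p: "K i i > 0" using psd[of "[(1,i)]"] by (simp add: quad_def)
  have "2 * (f i / K i i) * f i - (f i / K i i)\<^sup>2 * K i i \<le> N f" by (rule N_point[OF assms])
  moreover have "2 * (f i / K i i) * f i - (f i / K i i)\<^sup>2 * K i i = (f i)\<^sup>2 / K i i"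
    using p by (simp add: power2_eq_square field_simps)
  ultimately show ?thesis using p by (simp add: pos_divide_le_eq)
qed

text \<open>Evaluations are continuous by \<open>point_bound\<close>, so there is a pointwise limit.
  Each inequality that defines \<open>N\<close> involves finitely many points and survives in this
  limit, with a bound that does not depend on the test combination.\<close>

lemma bdd_complete:
  assumes s: "\<And>k::nat. s k \<in> bdd" and C: "\<And>e. e > 0 \<Longrightarrow> \<exists>M. \<forall>k\<ge>M. \<forall>l\<ge>M. N (s k - s l) < e"
  obtains f where "f \<in> bdd" "(\<lambda>k. N (s k - f)) \<longlonglongrightarrow> 0"
proof -
  have "Cauchy (\<lambda>k. s k i)" for i
  proof (rule metric_CauchyI)
    fix e :: real assume e: "e > 0"
    have Kp: "K i i \<ge> 0" using psd[of "[(1,i)]"] by (simp add: quad_def)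
    from C[of "e\<^sup>2 / (K i i + 1)"] e Kp obtain M where M: "\<forall>k\<ge>M. \<forall>l\<ge>M. N (s k - s l) < e\<^sup>2 / (K i i + 1)"
      by auto
    have "dist (s k i) (s l i) < e" if "k \<ge> M" "l \<ge> M" for k l
    proof -
      have b: "s k - s l \<in> bdd" using bdd_diff s by blast
      have "((s k - s l) i)\<^sup>2 \<le> N (s k - s l) * K i i" by (rule point_bound[OF b])
      also have "\<dots> \<le> N (s k - s l) * (K i i + 1)" using N_nonneg[OF b] by (simp add: algebra_simps)
      also have "\<dots> < e\<^sup>2" using M that Kp by (simp add: pos_less_divide_eq)
      finally have "\<bar>(s k - s l) i\<bar>\<^sup>2 < e\<^sup>2" by simp
      then have "\<bar>(s k - s l) i\<bar> < e" using e power2_less_imp_less less_imp_le by blast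
      then show ?thesis by (simp add: dist_real_def)
    qed
    then show "\<exists>M. \<forall>m\<ge>M. \<forall>n\<ge>M. dist (s m i) (s n i) < e" by blast
  qed
  then have "\<exists>l. (\<lambda>k. s k i) \<longlonglongrightarrow> l" for i using Cauchy_convergent convergent_def by blast
  then obtain f where f: "\<And>i. (\<lambda>k. s k i) \<longlonglongrightarrow> f i" by metis
  have key: "\<exists>M. \<forall>k\<ge>M. \<forall>c. 2 * lin (s k - f) c - quad K c \<le> e" if "e > 0" for e
  proof -
    from C[OF that] obtain M where M: "\<And>k l. k\<ge>M \<Longrightarrow> l\<ge>M \<Longrightarrow> N (s k - s l) < e" by blast
    have "2 * lin (s k - f) c - quad K c \<le> e" if k: "k \<ge> M" for k c
    proof (rule tendsto_upperbound)
      show "(\<lambda>l. 2 * lin (s k - s l) c - quad K c) \<longlonglongrightarrow> 2 * lin (s k - f) c - quad K c"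
        by (intro tendsto_intros tendsto_lin) (auto intro!: tendsto_intros f)
      show "\<forall>\<^sub>F l in sequentially. 2 * lin (s k - s l) c - quad K c \<le> e"
        using eventually_ge_at_top[of M]
      proof eventually_elim
        case (elim l)
        have "2 * lin (s k - s l) c - quad K c \<le> N (s k - s l)"
          by (intro N_upper bdd_diff s)
        then show ?case using M[OF k elim] by simp
      qed
    qed simp
    then show ?thesis by blast
  qed
  from key[of 1] obtain M where "\<And>c. 2 * lin (s M - f) c - quad K c \<le> 1" by auto
  then have "s M - f \<in> bdd" by (rule bddI)
  then have "s M - (s M - f) \<in> bdd" using s bdd_diff by blast
  then have fb: "f \<in> bdd" by simp
  have "(\<lambda>k. N (s k - f)) \<longlonglongrightarrow> 0"
  proof (rule LIMSEQ_I)
    fix e :: real assume "e > 0"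
    with key[of "e/2"] obtain M where M: "\<And>k c. k \<ge> M \<Longrightarrow> 2 * lin (s k - f) c - quad K c \<le> e/2" by auto
    then have "\<And>k. k \<ge> M \<Longrightarrow> N (s k - f) \<le> e/2" by (blast intro: N_leI)
    moreover have "0 \<le> N (s k - f)" for k by (intro N_nonneg bdd_diff s fb)
    ultimately show "\<exists>M. \<forall>n\<ge>M. norm (N (s n - f) - 0) < e" using \<open>e > 0\<close>
      by (intro exI[of _ M]) (smt (verit) field_sum_of_halves real_norm_def)
  qed
  with fb show ?thesis using that by blast
qed

text \<open>Translating the test combination by \<open>c\<close> completes the square. In particular
  the inner product of \<open>f\<close> with \<open>emb c\<close> is \<open>lin f c\<close>.\<close>

lemma N_diff_emb: assumes "f \<in> bdd" shows "f - emb c \<in> bdd" "N (f - emb c) = N f - 2 * lin f c + quad K c"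
proof -
  have eq: "2 * lin (f - emb c) d - quad K d = (2 * lin f (d @ c) - quad K (d @ c)) - 2 * lin f c + quad K c" for d
  proof -
    have "lin (emb c) d = lin (\<lambda>i. lin (K i) d) c"
      unfolding emb_def by (subst lin_swap) (simp add: sym)
    then show ?thesis by simp
  qed
  have le: "2 * lin (f - emb c) d - quad K d \<le> N f - 2 * lin f c + quad K c" for d
    using eq[of d] N_upper[OF assms, of "d @ c"] by linarith
  show b: "f - emb c \<in> bdd" using le by (rule bddI)
  have "N (f - emb c) \<le> N f - 2 * lin f c + quad K c" using le by (rule N_leI)
  moreover have "N f \<le> N (f - emb c) + 2 * lin f c - quad K c"
  proof (rule N_leI)
    fix d
    have "2 * lin (f - emb c) (d @ scale (-1) c) - quad K (d @ scale (-1) c) \<le> N (f - emb c)" using N_upper[OF b] .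
    moreover have "lin (emb c) d = lin (\<lambda>i. lin (K i) d) c"
      unfolding emb_def by (subst lin_swap) (simp add: sym)
    moreover have "lin (emb c) c = quad K c" by (simp add: emb_def quad_def)
    ultimately show "2 * lin f d - quad K d \<le> N (f - emb c) + 2 * lin f c - quad K c" by simp
  qed
  ultimately show "N (f - emb c) = N f - 2 * lin f c + quad K c" by simp
qed

lemma bdd_emb: "emb c \<in> bdd" "N (emb c) = quad K c"
proof -
  have "- emb c \<in> bdd" "N (- emb c) = quad K c" using N_diff_emb[OF bdd_zero, of c] N_zero by auto
  then show "emb c \<in> bdd" "N (emb c) = quad K c" using bdd_uminus[of "- emb c"] by auto
qed

text \<open>A near maximizer \<open>c\<close> in the Legendre transform is the approximation sought:
  the amount by which it misses the supremum equals the squared distance of \<open>f\<close> and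
  \<open>emb c\<close>.\<close>

lemma emb_dense: assumes "f \<in> bdd" "e > 0" obtains c where "N (f - emb c) < e"
proof -
  obtain c where "N f - e < 2 * lin f c - quad K c" using N_approx assms by blast
  then have "N (f - emb c) < e" using N_diff_emb[OF assms(1), of c] by simp
  then show ?thesis using that by blast
qed

text \<open>Pushing test combinations forward along a symmetry of the kernel leaves their quadratic
  form unchanged. This makes group actions on the indices isometric on \<open>bdd\<close>.\<close>

lemma bdd_comp:
  assumes "f \<in> bdd" "\<And>i j. K (\<sigma> i) (\<sigma> j) = K i j" shows "f \<circ> \<sigma> \<in> bdd" "N (f \<circ> \<sigma>) \<le> N f"
proof -
  have "2 * lin (f \<circ> \<sigma>) c - quad K c \<le> N f" for c
    using N_upper[OF assms(1), of "push \<sigma> c"] assms(2) by (simp add: quad_push)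
  then show "f \<circ> \<sigma> \<in> bdd" "N (f \<circ> \<sigma>) \<le> N f" by (auto intro: bddI N_leI)
qed

end

section \<open>Vanishing first cohomology in terms of cocycles\<close>

lemma trivial_FactGroup_mem:
  assumes "trivial_group (A Mod B)" "c \<in> carrier A" "\<one>\<^bsub>A\<^esub> \<in> B" "\<one>\<^bsub>A\<^esub> \<otimes>\<^bsub>A\<^esub> c = c"
  shows "c \<in> B"
proof -
  have "B #>\<^bsub>A\<^esub> c \<in> carrier (A Mod B)" using assms by (auto simp: FactGroup_def RCOSETS_def)
  then have "B #>\<^bsub>A\<^esub> c = B" using assms(1) by (simp add: trivial_group_def FactGroup_def)
  moreover have "c \<in> B #>\<^bsub>A\<^esub> c" using assms by (force simp: r_coset_def)
  ultimately show ?thesis by simp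
qed

lemma tuples_Suc_0: "gs \<in> tuples G (Suc 0) \<longleftrightarrow> (\<exists>g\<in>carrier G. gs = [g])"
  by (auto simp: tuples_def length_Suc_conv)

lemma tuples_2: "gs \<in> tuples G (Suc (Suc 0)) \<longleftrightarrow> (\<exists>g\<in>carrier G. \<exists>h\<in>carrier G. gs = [g, h])"
  by (auto simp: tuples_def length_Suc_conv)

text \<open>A cocycle becomes a function on lists of length 1. Membership in the coboundaries
  follows from the coset description of the factor group alone, and \<open>v\<close> is the value of
  the resulting 0-cochain at the empty list.\<close>

lemma property_T_cocycle:
  fixes G :: "('g, 'b) monoid_scheme" and V :: "(complex, nat \<Rightarrow> complex) module"
  assumes T: "property_T G" and rep: "unitary_rep G V ip \<pi>"
    and cl: "\<And>g. g \<in> carrier G \<Longrightarrow> c g \<in> carrier V"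
    and coc: "\<And>g h. g \<in> carrier G \<Longrightarrow> h \<in> carrier G \<Longrightarrow> c (g \<otimes>\<^bsub>G\<^esub> h) = c g \<oplus>\<^bsub>V\<^esub> \<pi> g (c h)"
  shows "\<exists>v\<in>carrier V. \<forall>g\<in>carrier G. c g = \<pi> g v \<ominus>\<^bsub>V\<^esub> v"
proof -
  interpret G: group G using T by (simp add: property_T_def)
  interpret complex_hilbert_space V ip using rep by (simp add: unitary_rep_def)
  have pi_hom: "\<pi> g \<in> lmod_hom complex_ring V V" if "g \<in> carrier G" for g
    using rep that by (auto simp: unitary_rep_def)
  then have pi_cl: "\<pi> g x \<in> carrier V" if "g \<in> carrier G" "x \<in> carrier V" for g x
    using that by (fastforce simp: lmod_hom_def)
  have pi_zero: "\<pi> g \<zero>\<^bsub>V\<^esub> = \<zero>\<^bsub>V\<^esub>" if "g \<in> carrier G" for g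
  proof -
    have "\<pi> g (\<zero>\<^bsub>V\<^esub> \<oplus>\<^bsub>V\<^esub> \<zero>\<^bsub>V\<^esub>) = \<pi> g \<zero>\<^bsub>V\<^esub> \<oplus>\<^bsub>V\<^esub> \<pi> g \<zero>\<^bsub>V\<^esub>"
      using pi_hom[OF that] unfolding lmod_hom_def by blast
    then show ?thesis using pi_cl[OF that] by (metis M.add.r_cancel_one' M.zero_closed M.l_zero)
  qed
  have neg: "[(- 1::int)] \<cdot>\<^bsub>V\<^esub> x = \<ominus>\<^bsub>V\<^esub> x" if "x \<in> carrier V" for x
    using M.add.int_pow_neg[of x 1] M.add.int_pow_1 that by (simp add: add_pow_def a_inv_def)
  have pos: "[(1::int)] \<cdot>\<^bsub>V\<^esub> x = x" if "x \<in> carrier V" for x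
    using M.add.int_pow_1 that by (simp add: add_pow_def)
  have fin: "(\<Oplus>\<^bsub>V\<^esub>j\<in>{..<Suc 0}. F j) = F 0" if "F 0 \<in> carrier V" for F :: "nat \<Rightarrow> nat \<Rightarrow> complex"
    using that by (simp add: lessThan_Suc)
  define f where "f = (\<lambda>gs\<in>tuples G 1. c (hd gs))"
  have "cobd G V \<pi> 1 f = zero_cochain G V 2"
  proof -
    have "cobd G V \<pi> 1 f [g, h] = \<zero>\<^bsub>V\<^esub>" if gh: "g \<in> carrier G" "h \<in> carrier G" for g h
    proof -
      have "cobd G V \<pi> 1 f [g, h] = \<pi> g (c h) \<oplus>\<^bsub>V\<^esub> \<ominus>\<^bsub>V\<^esub> c (g \<otimes>\<^bsub>G\<^esub> h) \<oplus>\<^bsub>V\<^esub> c g"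
        using gh cl pi_cl by (simp add: cobd_def tuples_2 tuples_Suc_0 f_def merge_at_def neg pos fin)
      also have "\<dots> = \<zero>\<^bsub>V\<^esub>"
        using gh cl pi_cl by (simp add: coc M.minus_add M.a_ac M.r_neg M.r_neg1 M.r_neg2 M.l_neg)
      finally show ?thesis .
    qed
    then show ?thesis
      by (auto simp: zero_cochain_def cobd_def tuples_2 numeral_2_eq_2 restrict_def fun_eq_iff)
  qed
  then have f: "f \<in> carrier (cocycle_group G V \<pi> 1)"
    using cl by (auto simp: cocycle_group_def cochains_def f_def tuples_Suc_0 numeral_2_eq_2)
  have d0: "cobd G V \<pi> 0 h [g] = \<pi> g (h []) \<oplus>\<^bsub>V\<^esub> \<ominus>\<^bsub>V\<^esub> h []" if "h \<in> cochains G V 0" "g \<in> carrier G" for h g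
  proof -
    have "h [] \<in> carrier V" using that by (auto simp: cochains_def tuples_def)
    then show ?thesis using that pi_cl by (simp add: cobd_def tuples_Suc_0 neg)
  qed
  have "zero_cochain G V 1 = cobd G V \<pi> 0 (zero_cochain G V 0)"
  proof -
    have "zero_cochain G V 0 \<in> cochains G V 0" "zero_cochain G V 0 [] = \<zero>\<^bsub>V\<^esub>"
      by (auto simp: zero_cochain_def cochains_def tuples_def)
    then have "cobd G V \<pi> 0 (zero_cochain G V 0) [g] = \<zero>\<^bsub>V\<^esub>" if "g \<in> carrier G" for g
      using d0 that pi_zero by (simp add: M.r_neg)
    then show ?thesis
      by (auto simp: zero_cochain_def cobd_def tuples_Suc_0 restrict_def fun_eq_iff)
  qed
  then have z: "zero_cochain G V 1 \<in> coboundaries G V \<pi> 1"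
    by (auto simp: coboundaries_def zero_cochain_def cochains_def)
  have "f \<in> coboundaries G V \<pi> 1"
  proof (rule trivial_FactGroup_mem)
    show "trivial_group (cocycle_group G V \<pi> 1 Mod coboundaries G V \<pi> 1)"
      using T rep by (auto simp: property_T_def cohomology_group_def)
    show "f \<in> carrier (cocycle_group G V \<pi> 1)" by (rule f)
    show "\<one>\<^bsub>cocycle_group G V \<pi> 1\<^esub> \<in> coboundaries G V \<pi> 1" using z by (simp add: cocycle_group_def)
    show "\<one>\<^bsub>cocycle_group G V \<pi> 1\<^esub> \<otimes>\<^bsub>cocycle_group G V \<pi> 1\<^esub> f = f"
      using cl by (auto simp: cocycle_group_def zero_cochain_def f_def tuples_Suc_0 restrict_def fun_eq_iff)
  qed
  then obtain h where h: "h \<in> cochains G V 0" "f = cobd G V \<pi> 0 h" by (auto simp: coboundaries_def)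
  have "h [] \<in> carrier V" using h by (auto simp: cochains_def tuples_def)
  moreover have "c g = \<pi> g (h []) \<ominus>\<^bsub>V\<^esub> h []" if "g \<in> carrier G" for g
  proof -
    have "c g = f [g]" using that by (simp add: f_def tuples_Suc_0)
    then show ?thesis using d0[OF h(1) that] h(2) by (simp add: a_minus_def)
  qed
  ultimately show ?thesis by blast
qed

section \<open>The complex Hilbert space of a kernel\<close>

context psd_kernel
begin

text \<open>The complexification of \<open>bdd\<close>, since unitary representations are complex.
  For indices in \<open>nat\<close> it lies in the type over which \<open>property_T\<close>
  quantifies.\<close>

definition cspace :: "(complex, 'i \<Rightarrow> complex) module"
  where "cspace = \<lparr>carrier = {F. (\<lambda>i. Re (F i)) \<in> bdd \<and> (\<lambda>i. Im (F i)) \<in> bdd},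
    monoid.mult = undefined, one = undefined, ring.zero = (\<lambda>_. 0),
    ring.add = (\<lambda>F F' i. F i + F' i), module.smult = (\<lambda>c F i. c * F i)\<rparr>"

text \<open>The sesquilinear extension of the real inner product \<open>B\<close>, linear in the
  first argument.\<close>

definition cip :: "('i \<Rightarrow> complex) \<Rightarrow> ('i \<Rightarrow> complex) \<Rightarrow> complex"
  where "cip F F' = Complex (B (\<lambda>i. Re (F i)) (\<lambda>i. Re (F' i)) + B (\<lambda>i. Im (F i)) (\<lambda>i. Im (F' i)))
    (B (\<lambda>i. Im (F i)) (\<lambda>i. Re (F' i)) - B (\<lambda>i. Re (F i)) (\<lambda>i. Im (F' i)))"

lemma bdd_add': "f \<in> bdd \<Longrightarrow> g \<in> bdd \<Longrightarrow> (\<lambda>i. f i + g i) \<in> bdd"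
  using bdd_add by (simp add: plus_fun_def)

lemma bdd_diff': "f \<in> bdd \<Longrightarrow> g \<in> bdd \<Longrightarrow> (\<lambda>i. f i - g i) \<in> bdd"
  using bdd_diff by (simp add: fun_diff_def)

lemma B_add': "x \<in> bdd \<Longrightarrow> y \<in> bdd \<Longrightarrow> z \<in> bdd \<Longrightarrow> B (\<lambda>i. x i + y i) z = B x z + B y z"
  using B_add by (simp add: plus_fun_def)

lemma B_diff': assumes "x \<in> bdd" "y \<in> bdd" "z \<in> bdd" shows "B (\<lambda>i. x i - y i) z = B x z - B y z"
proof -
  have "B (\<lambda>i. (x i - y i) + y i) z = B (\<lambda>i. x i - y i) z + B y z"
    using assms bdd_diff' by (intro B_add') auto
  then show ?thesis by simp
qed

lemma cspace_minus:
  assumes "abelian_group cspace" "F \<in> carrier cspace" "F' \<in> carrier cspace"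
  shows "F \<ominus>\<^bsub>cspace\<^esub> F' = (\<lambda>i. F i - F' i)"
proof -
  interpret abelian_group cspace by fact
  have "(\<lambda>i. - F' i) \<in> carrier cspace"
    using assms(3) bdd_diff'[of "0"] bdd_zero by (auto simp: cspace_def)
  then have "\<ominus>\<^bsub>cspace\<^esub> F' = (\<lambda>i. - F' i)"
    using assms(3) by (intro minus_equality) (auto simp: cspace_def)
  then show ?thesis by (simp add: a_minus_def cspace_def)
qed

lemma abelian_group_cspace: "abelian_group cspace"
proof (rule abelian_groupI)
  fix x assume "x \<in> carrier cspace"
  then have "(\<lambda>i. - x i) \<in> carrier cspace"
    using bdd_diff'[of "0"] bdd_zero by (auto simp: cspace_def)
  then show "\<exists>y\<in>carrier cspace. y \<oplus>\<^bsub>cspace\<^esub> x = \<zero>\<^bsub>cspace\<^esub>"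
    by (rule bexI[rotated]) (simp add: cspace_def)
qed (use bdd_zero in \<open>auto simp: cspace_def bdd_add' zero_fun_def algebra_simps\<close>)

lemma cring_complex_ring: "cring complex_ring"
proof (rule cringI)
  show "abelian_group complex_ring"
  proof (rule abelian_groupI)
    fix x show "\<exists>y\<in>carrier complex_ring. y \<oplus>\<^bsub>complex_ring\<^esub> x = \<zero>\<^bsub>complex_ring\<^esub>"
      by (rule bexI[of _ "- x"]) (auto simp: complex_ring_def)
  qed (auto simp: complex_ring_def)
  show "comm_monoid complex_ring" by (rule comm_monoidI) (auto simp: complex_ring_def)
qed (auto simp: complex_ring_def algebra_simps)

lemma cip_self: assumes "F \<in> carrier cspace" shows "cip F F = of_real (N (\<lambda>i. Re (F i)) + N (\<lambda>i. Im (F i)))"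
  using assms by (simp add: cip_def cspace_def B_self B_commute complex_eq_iff)

lemma complex_hilbert_space_cspace: "complex_hilbert_space cspace cip"
proof -
  have mod: "module complex_ring cspace"
  proof (rule moduleI[OF cring_complex_ring abelian_group_cspace])
    fix a x assume "x \<in> carrier cspace"
    then show "a \<odot>\<^bsub>cspace\<^esub> x \<in> carrier cspace"
      by (auto simp: cspace_def intro!: bdd_add' bdd_diff' bdd_cmult)
  qed (auto simp: cspace_def complex_ring_def algebra_simps)
  interpret module complex_ring cspace by (rule mod)
  note mm = cspace_minus[OF abelian_group_cspace]
  show ?thesis
  proof (intro complex_hilbert_space.intro complex_hilbert_space_axioms.intro mod)
    fix x y z assume "x \<in> carrier cspace" "y \<in> carrier cspace" "z \<in> carrier cspace"
    then show "cip (x \<oplus>\<^bsub>cspace\<^esub> y) z = cip x z + cip y z"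
      by (simp add: cip_def cspace_def complex_eq_iff B_add')
  next
    fix x z c assume xz: "x \<in> carrier cspace" "z \<in> carrier cspace"
    then show "cip (c \<odot>\<^bsub>cspace\<^esub> x) z = c * cip x z"
      by (simp add: cip_def cspace_def complex_eq_iff B_add' B_diff' bdd_cmult B_cmult algebra_simps)
  next
    fix x y show "cip y x = cnj (cip x y)" by (simp add: cip_def complex_eq_iff B_commute)
  next
    fix x assume "x \<in> carrier cspace"
    then show "0 \<le> Re (cip x x)" by (simp add: cip_self N_nonneg) (simp add: cspace_def N_nonneg)
  next
    fix x assume x: "x \<in> carrier cspace" "cip x x = 0"
    then have n: "N (\<lambda>i. Re (x i)) + N (\<lambda>i. Im (x i)) = 0" using cip_self
      by (metis of_real_eq_0_iff)
    have b: "(\<lambda>i. Re (x i)) \<in> bdd" "(\<lambda>i. Im (x i)) \<in> bdd" using x by (auto simp: cspace_def)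
    with n have "N (\<lambda>i. Re (x i)) = 0" "N (\<lambda>i. Im (x i)) = 0"
      using N_nonneg[OF b(1)] N_nonneg[OF b(2)] by linarith+
    with b have "(\<lambda>i. Re (x i)) = 0" "(\<lambda>i. Im (x i)) = 0" using N_definite by blast+
    then show "x = \<zero>\<^bsub>cspace\<^esub>" by (auto simp: cspace_def fun_eq_iff complex_eq_iff)
  next
    fix s :: "nat \<Rightarrow> 'i \<Rightarrow> complex"
    assume s: "\<And>k. s k \<in> carrier cspace"
      and C: "\<And>\<epsilon>. \<epsilon> > 0 \<Longrightarrow> \<exists>N. \<forall>k\<ge>N. \<forall>l\<ge>N. sqrt (Re (cip (s k \<ominus>\<^bsub>cspace\<^esub> s l) (s k \<ominus>\<^bsub>cspace\<^esub> s l))) < \<epsilon>"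
    define r where "r k = (\<lambda>i. Re (s k i))" for k
    define t where "t k = (\<lambda>i. Im (s k i))" for k
    have rt: "r k \<in> bdd" "t k \<in> bdd" for k using s by (auto simp: r_def t_def cspace_def)
    have nrm: "Re (cip (s k \<ominus>\<^bsub>cspace\<^esub> x) (s k \<ominus>\<^bsub>cspace\<^esub> x)) = N (r k - (\<lambda>i. Re (x i))) + N (t k - (\<lambda>i. Im (x i)))"
      if "x \<in> carrier cspace" for k x
    proof -
      have "s k \<ominus>\<^bsub>cspace\<^esub> x \<in> carrier cspace" using s that by simp
      then show ?thesis using mm[OF s that] by (simp add: cip_self r_def t_def fun_diff_def)
    qed
    have C2: "\<exists>M. \<forall>k\<ge>M. \<forall>l\<ge>M. N (r k - r l) + N (t k - t l) < e" if "e > 0" for e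
    proof -
      have "sqrt e > 0" using that by simp
      from C[OF this] obtain M where M: "\<forall>k\<ge>M. \<forall>l\<ge>M. sqrt (N (r k - r l) + N (t k - t l)) < sqrt e"
        using nrm[OF s] by (auto simp: r_def t_def)
      then show ?thesis by auto
    qed
    have nn: "0 \<le> N (r k - r l)" "0 \<le> N (t k - t l)" for k l by (intro N_nonneg bdd_diff rt)+
    have "\<exists>M. \<forall>k\<ge>M. \<forall>l\<ge>M. N (r k - r l) < e" if "e > 0" for e
      using C2[OF that] nn by (meson add_increasing2 le_add_same_cancel1 order_le_less_trans)
    from bdd_complete[OF rt(1) this] obtain f where f: "f \<in> bdd" "(\<lambda>k. N (r k - f)) \<longlonglongrightarrow> 0" by blast
    have "\<exists>M. \<forall>k\<ge>M. \<forall>l\<ge>M. N (t k - t l) < e" if "e > 0" for e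
      using C2[OF that] nn by (meson add_increasing le_add_same_cancel2 order_le_less_trans)
    from bdd_complete[OF rt(2) this] obtain g where g: "g \<in> bdd" "(\<lambda>k. N (t k - g)) \<longlonglongrightarrow> 0" by blast
    define x where "x = (\<lambda>i. Complex (f i) (g i))"
    have x: "x \<in> carrier cspace" using f g by (simp add: x_def cspace_def)
    have "(\<lambda>k. sqrt (N (r k - f) + N (t k - g))) \<longlonglongrightarrow> sqrt (0 + 0)"
      by (intro tendsto_intros f g)
    then have "(\<lambda>k. sqrt (Re (cip (s k \<ominus>\<^bsub>cspace\<^esub> x) (s k \<ominus>\<^bsub>cspace\<^esub> x)))) \<longlonglongrightarrow> 0"
      using nrm[OF x] by (simp add: x_def)
    with x show "\<exists>x\<in>carrier cspace. (\<lambda>k. sqrt (Re (cip (s k \<ominus>\<^bsub>cspace\<^esub> x) (s k \<ominus>\<^bsub>cspace\<^esub> x)))) \<longlonglongrightarrow> 0"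
      by blast
  qed
qed

end

section \<open>Approximate fixed points from invariant kernels\<close>

definition shift :: "('g, 'b) monoid_scheme \<Rightarrow> 'g \<Rightarrow> 'g \<times> 'g \<Rightarrow> 'g \<times> 'g"
  where "shift G g = (\<lambda>(x, y). (x \<otimes>\<^bsub>G\<^esub> g, y \<otimes>\<^bsub>G\<^esub> g))"

lemma set_push: "snd ` set (push \<sigma> c) = \<sigma> ` snd ` set c"
  by (force simp: push_def)

lemma push_simps [simp]:
  "push \<sigma> [] = []" "push \<sigma> ((a, i) # c) = (a, \<sigma> i) # push \<sigma> c"
  "push \<sigma> (c @ d) = push \<sigma> c @ push \<sigma> d"
  by (auto simp: push_def)

lemma push_scale: "push \<sigma> (scale t c) = scale t (push \<sigma> c)"
  by (induction c) (auto simp: push_def scale_def)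

text \<open>If the values differed, multiples of the difference of the two points would cost nothing
  in the quadratic form and exceed any bound. This makes elements of \<open>bdd\<close> well defined
  on pairs although an enumeration may list a pair repeatedly.\<close>

lemma (in psd_kernel) bdd_zero_dist:
  assumes "f \<in> bdd" "quad K [(1, i), (-1, j)] = 0" shows "f i = f j"
proof (rule ccontr)
  assume ne: "f i \<noteq> f j"
  define t where "t = (N f + 1) / (f i - f j)"
  have "2 * (t * (f i - f j)) \<le> N f"
    using N_upper[OF assms(1), of "scale t [(1, i), (-1, j)]"] by (simp add: assms(2))
  then show False using ne N_nonneg[OF assms(1)] by (simp add: t_def)
qed

text \<open>Read a pair \<open>(x, y)\<close> as the vector \<open>v y - v x\<close> of a Hilbert
  space on which \<open>g\<close> acts affinely by sending \<open>v x\<close> to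
  \<open>v (x g)\<close>. The last combination is then the displacement under \<open>g\<close> of
  the point reached from the base point \<open>v 1\<close> by \<open>c\<close>, so \<open>c\<close>
  describes an approximate fixed point. The bound \<open>M\<close> comes before
  \<open>\<epsilon>\<close>, since later constants have to be chosen between the two.\<close>

lemma property_T_kernel:
  fixes G :: "('g, 'b) monoid_scheme" and K :: "'g \<times> 'g \<Rightarrow> 'g \<times> 'g \<Rightarrow> real"
  assumes T: "property_T G"
    and sym: "\<And>p q. K p q = K q p"
    and psd: "\<And>c. snd ` set c \<subseteq> carrier G \<times> carrier G \<Longrightarrow> 0 \<le> quad K c"
    and inv: "\<And>g p q. g \<in> carrier G \<Longrightarrow> p \<in> carrier G \<times> carrier G \<Longrightarrow> q \<in> carrier G \<times> carrier G
      \<Longrightarrow> K (shift G g p) (shift G g q) = K p q"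
    and add: "\<And>x y z p. \<lbrakk>x \<in> carrier G; y \<in> carrier G; z \<in> carrier G; p \<in> carrier G \<times> carrier G\<rbrakk>
      \<Longrightarrow> K (x, z) p = K (x, y) p + K (y, z) p"
  shows "\<exists>M. \<forall>\<epsilon>>0. \<exists>c. snd ` set c \<subseteq> carrier G \<times> carrier G \<and> quad K c \<le> M \<and>
    (\<forall>g\<in>carrier G. quad K ((1, (\<one>\<^bsub>G\<^esub>, g)) # push (shift G g) c @ scale (-1) c) \<le> \<epsilon>)"
proof -
  interpret G: group G using T by (simp add: property_T_def)
  let ?P = "carrier G \<times> carrier G"
  have "countable (carrier G)" using T by (simp add: property_T_def)
  then have "countable ?P" by (intro countable_SIGMA)
  moreover have "?P \<noteq> {}" using G.one_closed by blast
  ultimately have cP: "countable ?P" "?P \<noteq> {}" by auto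
  \<comment> \<open>Indexing pairs by natural numbers places the function space in the universe of
    \<open>property_T\<close>.\<close>
  define e where "e = from_nat_into ?P"
  have e: "e i \<in> ?P" for i unfolding e_def by (rule from_nat_into[OF cP(2)])
  define idx where "idx p = (SOME i. e i = p)" for p
  have idx: "e (idx p) = p" if "p \<in> ?P" for p
  proof -
    have "\<exists>i. e i = p" using from_nat_into_surj[OF cP(1) that] by (auto simp: e_def)
    then show ?thesis unfolding idx_def by (rule someI_ex)
  qed
  define L where "L i j = K (e i) (e j)" for i j
  have quadL: "quad L c = quad K (push e c)" for c
    by (simp add: quad_push L_def[abs_def])
  interpret L: psd_kernel L
  proof
    show "L i j = L j i" for i j by (simp add: L_def sym)
    show "0 \<le> quad L c" for c unfolding quadL by (rule psd) (use e in \<open>unfold set_push, blast\<close>)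
  qed
  have eqI: "f i = f j" if "f \<in> L.bdd" "e i = e j" for f i j
    by (rule L.bdd_zero_dist[OF that(1)]) (simp add: quad_def L_def that(2))
  define s where "s g i = idx (shift G g (e i))" for g i
  have sh: "shift G g p \<in> ?P" if "g \<in> carrier G" "p \<in> ?P" for g p
    using that by (auto simp: shift_def)
  have es: "e (s g i) = shift G g (e i)" if "g \<in> carrier G" for g i
    unfolding s_def by (intro idx sh that e)
  have Ls: "L (s g i) (s g j) = L i j" if "g \<in> carrier G" for g i j
    by (simp add: L_def es that inv e)
  have ss: "f (s h (s g i)) = f (s (g \<otimes>\<^bsub>G\<^esub> h) i)" if "g \<in> carrier G" "h \<in> carrier G" "f \<in> L.bdd" for g h i f
    using e[of i] that by (intro eqI) (auto simp: es shift_def G.m_assoc split: prod.split)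
  have s1: "f (s \<one>\<^bsub>G\<^esub> i) = f i" if "f \<in> L.bdd" for i f
    using e[of i] that by (intro eqI) (auto simp: es shift_def split: prod.split)
  have bs: "(\<lambda>i. f (s g i)) \<in> L.bdd" "L.N (\<lambda>i. f (s g i)) = L.N f" if g: "g \<in> carrier G" "f \<in> L.bdd" for g f
  proof -
    have c: "f' \<circ> s h \<in> L.bdd" "L.N (f' \<circ> s h) \<le> L.N f'" if "h \<in> carrier G" "f' \<in> L.bdd" for h f'
      using L.bdd_comp[OF that(2), of "s h"] Ls[OF that(1)] by auto
    have "(f \<circ> s g) \<circ> s (inv\<^bsub>G\<^esub> g) = f"
      using g by (auto simp: fun_eq_iff ss s1)
    then have "L.N (f \<circ> s g) = L.N f" using c[OF g] c(2)[OF G.inv_closed[OF g(1)] c(1)[OF g]] by simp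
    then show "(\<lambda>i. f (s g i)) \<in> L.bdd" "L.N (\<lambda>i. f (s g i)) = L.N f" using c[OF g] by (auto simp: comp_def)
  qed
  have Bs: "L.B (\<lambda>i. f (s g i)) (\<lambda>i. f' (s g i)) = L.B f f'" if "g \<in> carrier G" "f \<in> L.bdd" "f' \<in> L.bdd" for g f f'
  proof -
    have "(\<lambda>i. f (s g i)) + (\<lambda>i. f' (s g i)) = (\<lambda>i. (f + f') (s g i))" by auto
    then show ?thesis
      using bs(2)[OF that(1) L.bdd_add[OF that(2,3)]] that by (simp only: L.B_def bs(2))
  qed
  \<comment> \<open>Precomposition with right translation is a left action on functions. It moves
    the kernel section of a pair to that of the pair translated by the inverse of
    \<open>g\<close>.\<close>
  define \<pi> where "\<pi> g F = (\<lambda>i. F (s g i) :: complex)" for g F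
  have pi_cl: "\<pi> g F \<in> carrier L.cspace" if "g \<in> carrier G" "F \<in> carrier L.cspace" for g F
    using that by (auto simp: \<pi>_def L.cspace_def bs(1)[of g "\<lambda>i. Re (F i)"] bs(1)[of g "\<lambda>i. Im (F i)"])
  have pi_comp: "\<pi> g (\<pi> h F) = \<pi> (g \<otimes>\<^bsub>G\<^esub> h) F" if "g \<in> carrier G" "h \<in> carrier G" "F \<in> carrier L.cspace" for g h F
    using that ss[of g h "\<lambda>i. Re (F i)"] ss[of g h "\<lambda>i. Im (F i)"]
    by (auto simp: \<pi>_def L.cspace_def fun_eq_iff complex_eq_iff)
  have pi_one: "\<pi> \<one>\<^bsub>G\<^esub> F = F" if "F \<in> carrier L.cspace" for F
    using that s1[of "\<lambda>i. Re (F i)"] s1[of "\<lambda>i. Im (F i)"]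
    by (auto simp: \<pi>_def L.cspace_def fun_eq_iff complex_eq_iff)
  have rep: "unitary_rep G L.cspace L.cip \<pi>"
    unfolding unitary_rep_def
  proof (intro conjI ballI L.complex_hilbert_space_cspace)
    fix g assume g: "g \<in> carrier G"
    show "\<pi> g \<in> lmod_hom complex_ring L.cspace L.cspace"
      using pi_cl[OF g] by (auto simp: lmod_hom_def) (auto simp: \<pi>_def L.cspace_def)
    have "\<pi> (inv\<^bsub>G\<^esub> g) (\<pi> g F) = F" "\<pi> g (\<pi> (inv\<^bsub>G\<^esub> g) F) = F" if "F \<in> carrier L.cspace" for F
      using that g by (simp_all add: pi_comp pi_one)
    then show "bij_betw (\<pi> g) (carrier L.cspace) (carrier L.cspace)"
      using pi_cl g by (intro bij_betwI[where g = "\<pi> (inv\<^bsub>G\<^esub> g)"]) auto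
  next
    fix g x y assume "g \<in> carrier G" "x \<in> carrier L.cspace" "y \<in> carrier L.cspace"
    then show "L.cip (\<pi> g x) (\<pi> g y) = L.cip x y"
      using Bs[of g "\<lambda>i. Re (x i)" "\<lambda>i. Re (y i)"] Bs[of g "\<lambda>i. Im (x i)" "\<lambda>i. Im (y i)"]
        Bs[of g "\<lambda>i. Re (x i)" "\<lambda>i. Im (y i)"] Bs[of g "\<lambda>i. Im (x i)" "\<lambda>i. Re (y i)"]
      by (auto simp: L.cip_def \<pi>_def L.cspace_def)
  next
    fix g h x assume "g \<in> carrier G" "h \<in> carrier G" "x \<in> carrier L.cspace"
    then show "\<pi> (g \<otimes>\<^bsub>G\<^esub> h) x = \<pi> g (\<pi> h x)" by (simp add: pi_comp)
  qed
  \<comment> \<open>The displacement of the base point under \<open>g\<close>. The inverse appears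
    because \<open>\<pi> g\<close> translates kernel sections by the inverse of
    \<open>g\<close>.\<close>
  define b where "b g = L.emb [(1, idx (\<one>\<^bsub>G\<^esub>, inv\<^bsub>G\<^esub> g))]" for g
  have b_eq: "b g i = K (e i) (\<one>\<^bsub>G\<^esub>, inv\<^bsub>G\<^esub> g)" if "g \<in> carrier G" for g i
    using that by (simp add: b_def L.emb_def L_def idx)
  have b_bdd: "b g \<in> L.bdd" for g unfolding b_def by (rule L.bdd_emb)
  have b_coc: "b (g \<otimes>\<^bsub>G\<^esub> h) i = b g i + b h (s g i)" if gh: "g \<in> carrier G" "h \<in> carrier G" for g h i
  proof -
    have "b h (s g i) = K (shift G g (e i)) (\<one>\<^bsub>G\<^esub>, inv\<^bsub>G\<^esub> h)" using gh by (simp add: b_eq es)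
    also have "\<dots> = K (shift G g (e i)) (shift G g (inv\<^bsub>G\<^esub> g, inv\<^bsub>G\<^esub> (g \<otimes>\<^bsub>G\<^esub> h)))"
      using gh by (simp add: shift_def G.inv_mult_group G.m_assoc)
    also have "\<dots> = K (e i) (inv\<^bsub>G\<^esub> g, inv\<^bsub>G\<^esub> (g \<otimes>\<^bsub>G\<^esub> h))"
      using gh e by (intro inv) auto
    finally show ?thesis
      using gh e[of i] add[of "\<one>\<^bsub>G\<^esub>" "inv\<^bsub>G\<^esub> g" "inv\<^bsub>G\<^esub> (g \<otimes>\<^bsub>G\<^esub> h)" "e i"] by (simp add: b_eq sym)
  qed
  have "\<exists>v\<in>carrier L.cspace. \<forall>g\<in>carrier G. (\<lambda>i. of_real (b g i)) = \<pi> g v \<ominus>\<^bsub>L.cspace\<^esub> v"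
  proof (rule property_T_cocycle[OF T rep])
    fix g assume "g \<in> carrier G"
    then show "(\<lambda>i. of_real (b g i)) \<in> carrier L.cspace"
      using b_bdd[of g] L.bdd_zero by (simp add: L.cspace_def zero_fun_def)
  next
    fix g h assume "g \<in> carrier G" "h \<in> carrier G"
    then show "(\<lambda>i. of_real (b (g \<otimes>\<^bsub>G\<^esub> h) i)) = (\<lambda>i. of_real (b g i)) \<oplus>\<^bsub>L.cspace\<^esub> \<pi> g (\<lambda>i. of_real (b h i))"
      by (simp add: L.cspace_def \<pi>_def b_coc)
  qed
  then obtain w where w: "w \<in> carrier L.cspace"
    and wb: "\<And>g. g \<in> carrier G \<Longrightarrow> (\<lambda>i. of_real (b g i)) = \<pi> g w \<ominus>\<^bsub>L.cspace\<^esub> w" by blast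
  \<comment> \<open>The cocycle is real and the action commutes with real parts, so the real part of
    a solution is again a solution.\<close>
  define v where "v = (\<lambda>i. Re (w i))"
  have v: "v \<in> L.bdd" using w by (simp add: v_def L.cspace_def)
  have vb: "b g i = v (s g i) - v i" if "g \<in> carrier G" for g i
    using wb[OF that] L.cspace_minus[OF L.abelian_group_cspace pi_cl[OF that w] w]
    by (auto simp: v_def \<pi>_def fun_eq_iff complex_eq_iff)
  have "\<exists>c. snd ` set c \<subseteq> ?P \<and> quad K c \<le> 2 * L.N v + 2 \<and>
    (\<forall>g\<in>carrier G. quad K ((1, (\<one>\<^bsub>G\<^esub>, g)) # push (shift G g) c @ scale (-1) c) \<le> \<epsilon>)"
    if eps: "\<epsilon> > 0" for \<epsilon>
  proof -
    \<comment> \<open>From \<open>b g = \<pi> g v - v\<close> the fixed point of the affine action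
      is \<open>- v\<close>. The minimum with 1 keeps the norm of \<open>c\<close> bounded
      independently of \<open>\<epsilon>\<close>; the quarter compensates the factor 4 lost for a
      difference of two vectors of equal norm.\<close>
    obtain c where c: "L.N (- v - L.emb c) < min (\<epsilon> / 4) 1"
      using L.emb_dense[OF L.bdd_uminus(1)[OF v], of "min (\<epsilon> / 4) 1"] eps by auto
    define r where "r = - v - L.emb c"
    have r: "r \<in> L.bdd" unfolding r_def by (intro L.bdd_diff L.bdd_uminus v L.bdd_emb)
    have ve: "L.emb c i = - v i - r i" for i by (simp add: r_def)
    have "L.N (- v - r) \<le> 2 * L.N (- v) + 2 * L.N r"
      using L.N_parallelogram[OF L.bdd_uminus(1)[OF v] r] L.N_nonneg[OF L.bdd_add[OF L.bdd_uminus(1)[OF v] r]] by simp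
    moreover have "- v - r = L.emb c" by (auto simp: r_def)
    ultimately have 1: "quad K (push e c) \<le> 2 * L.N v + 2"
      using c L.bdd_emb(2)[of c] L.bdd_uminus(2)[OF v] by (simp add: quadL r_def)
    have 2: "quad K ((1, (\<one>\<^bsub>G\<^esub>, g)) # push (shift G g) (push e c) @ scale (-1) (push e c)) \<le> \<epsilon>"
      if g: "g \<in> carrier G" for g
    proof -
      \<comment> \<open>In the space of functions the displacement is that of the operator for the
        inverse of \<open>g\<close>. The contributions of \<open>v\<close> cancel and only the error
        \<open>r\<close> minus its translate remains.\<close>
      define d where "d = (1, idx (\<one>\<^bsub>G\<^esub>, g)) # push (s g) c @ scale (-1) c"
      have pe: "push e (push (s g) c) = push (shift G g) (push e c)"
        using es[OF g] by (simp add: push_def case_prod_unfold comp_def)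
      have "push e d = (1, (\<one>\<^bsub>G\<^esub>, g)) # push (shift G g) (push e c) @ scale (-1) (push e c)"
        using g by (simp add: d_def push_scale pe idx)
      moreover have "L.emb d i = r i - r (s (inv\<^bsub>G\<^esub> g) i)" for i
      proof -
        have gi: "inv\<^bsub>G\<^esub> g \<in> carrier G" using g by simp
        have "L i (s g j) = L (s (inv\<^bsub>G\<^esub> g) i) j" for j
        proof -
          have "shift G g (shift G (inv\<^bsub>G\<^esub> g) (e i)) = e i"
            using e[of i] g by (auto simp: shift_def G.m_assoc split: prod.split)
          then have "L i (s g j) = K (shift G g (shift G (inv\<^bsub>G\<^esub> g) (e i))) (shift G g (e j))"
            using g by (simp add: L_def es)
          also have "\<dots> = L (s (inv\<^bsub>G\<^esub> g) i) j"
            using g gi by (simp add: L_def es inv sh e)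
          finally show ?thesis .
        qed
        then have "L i \<circ> s g = L (s (inv\<^bsub>G\<^esub> g) i)" by auto
        then have "L.emb d i = b (inv\<^bsub>G\<^esub> g) i + L.emb c (s (inv\<^bsub>G\<^esub> g) i) - L.emb c i"
          using g by (simp add: L.emb_def d_def b_def)
        then show ?thesis using vb[OF gi] by (simp add: ve)
      qed
      then have "L.emb d = r - (\<lambda>i. r (s (inv\<^bsub>G\<^esub> g) i))" by auto
      moreover have "L.N (r - (\<lambda>i. r (s (inv\<^bsub>G\<^esub> g) i))) \<le> 2 * L.N r + 2 * L.N r"
        using L.N_parallelogram[OF r bs(1)[of "inv\<^bsub>G\<^esub> g" r]] g r
          L.N_nonneg[OF L.bdd_add[OF r bs(1)[of "inv\<^bsub>G\<^esub> g" r]]] by (simp add: bs(2))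
      moreover have "L.N r \<le> \<epsilon> / 4" using c by (simp add: r_def)
      ultimately show ?thesis using L.bdd_emb(2)[of d] by (simp add: quadL)
    qed
    have "snd ` set (push e c) \<subseteq> ?P" using e unfolding set_push by blast
    with 1 2 show ?thesis by blast
  qed
  then show ?thesis by blast
qed

section \<open>Almost cocycles on finite \<open>G\<close>-sets\<close>

definition l1 :: "'q set \<Rightarrow> ('q \<Rightarrow> int) \<Rightarrow> real"
  where "l1 Q f = real_of_int (\<Sum>q\<in>Q. \<bar>f q\<bar>)"

section \<open>Thresholds and rounding to integer functions\<close>

abbreviation thr :: "real \<Rightarrow> real \<Rightarrow> real"
  where "thr t a \<equiv> of_bool (t < a)"

text \<open>A threshold separates \<open>a\<close> from \<open>b\<close> when it lies between them,
  so the integral is the length of the part of that interval in the middle third. This is the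
  one-point case of the coarea formula.\<close>

lemma integral_thr_diff:
  fixes a b :: real
  shows "((\<lambda>t. \<bar>thr t a - thr t b\<bar>) has_integral
    max 0 (min (max a b) (2/3) - max (min a b) (1/3))) {1/3..2/3}"
proof -
  have *: "((\<lambda>t. \<bar>thr t a - thr t b\<bar>) has_integral max 0 (min b (2/3) - max a (1/3))) {1/3..2/3}"
    if "a \<le> b" for a b :: real
  proof (cases "max a (1/3) \<le> min b (2/3)")
    case True
    let ?c = "max a (1/3)" and ?d = "min b (2/3)"
    have "((\<lambda>t. 1::real) has_integral (?d - ?c)) {?c..?d}"
      using has_integral_const_real[of "1::real" ?c ?d] True by simp
    then have "((\<lambda>t. if t \<in> {?c..?d} then 1 else 0 :: real) has_integral (?d - ?c)) {1/3..2/3}"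
      using has_integral_restrict_closed_subinterval[of "\<lambda>_. 1::real" "?d - ?c" ?c ?d "1/3" "2/3"] True
      by simp
    then have "((\<lambda>t. \<bar>thr t a - thr t b\<bar>) has_integral (?d - ?c)) {1/3..2/3}"
    proof (rule has_integral_spike_finite[of "{?d}", rotated 2])
      fix t assume "t \<in> {1/3..2/3} - {?d}"
      then show "\<bar>thr t a - thr t b\<bar> = (if t \<in> {?c..?d} then 1 else 0)"
        using that True by (auto simp: of_bool_def min_def max_def split: if_splits)
    qed simp
    then show ?thesis using True by (simp add: max_def)
  next
    case False
    have "((\<lambda>t. 0::real) has_integral 0) {1/3..2/3}" by simp
    then have "((\<lambda>t. \<bar>thr t a - thr t b\<bar>) has_integral 0) {1/3..2/3}"
    proof (rule has_integral_cong[THEN iffD1, rotated])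
      fix t :: real assume "t \<in> {1/3..2/3}"
      then show "0 = \<bar>thr t a - thr t b\<bar>"
        using that False by (auto simp: of_bool_def min_def max_def split: if_splits)
    qed
    moreover have "max 0 (min b (2/3) - max a (1/3)) = 0"
      by (intro max_absorb1) (use False in linarith)
    ultimately show ?thesis by simp
  qed
  show ?thesis
  proof (cases "a \<le> b")
    case True then show ?thesis using *[OF True] by (simp add: min_def max_def)
  next
    case False
    have "(\<lambda>t. \<bar>thr t a - thr t b\<bar>) = (\<lambda>t. \<bar>thr t b - thr t a\<bar>)" by (auto simp: abs_minus_commute)
    then show ?thesis using *[of b a] False by (simp add: min_def max_def)
  qed
qed

text \<open>A jump of at least 1/6 is at most six times its square. For a smaller jump that meets
  the middle third, \<open>b\<close> has distance at least 1/6 from \<open>x\<close>, which is 0 or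
  1; the jump is then at most six times its product with this distance, and the inequality of
  arithmetic and geometric means with weight \<open>\<eta>\<close> separates the two
  factors.\<close>

lemma thr_overlap_bound:
  fixes a b x \<eta> :: real
  assumes "x = 0 \<or> x = 1" "\<eta> > 0"
  shows "max 0 (min (max a b) (2/3) - max (min a b) (1/3))
    \<le> 6 * (a - b)\<^sup>2 + 3 * ((a - b)\<^sup>2 / \<eta> + \<eta> * (b - x)\<^sup>2)"
proof -
  define l where "l = max 0 (min (max a b) (2/3) - max (min a b) (1/3))"
  have l: "l \<le> \<bar>a - b\<bar>" "l \<ge> 0" by (auto simp: l_def)
  have nn: "(a - b)\<^sup>2 / \<eta> + \<eta> * (b - x)\<^sup>2 \<ge> 0" using assms by simp
  define r where "r = (a - b)\<^sup>2 / \<eta> + \<eta> * (b - x)\<^sup>2"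
  have amgm: "2 * (\<bar>a - b\<bar> * \<bar>b - x\<bar>) \<le> r"
  proof -
    have "0 \<le> (\<bar>a - b\<bar> - \<eta> * \<bar>b - x\<bar>)\<^sup>2 / \<eta>" using assms by simp
    also have "\<dots> = (a - b)\<^sup>2 / \<eta> + \<eta> * (b - x)\<^sup>2 - 2 * \<bar>a - b\<bar> * \<bar>b - x\<bar>"
      using assms(2) by (simp add: power2_diff power_mult_distrib field_simps power2_eq_square)
    finally show ?thesis by (simp add: r_def)
  qed
  consider "l = 0" | "\<bar>a - b\<bar> \<ge> 1/6" | "l > 0" "\<bar>a - b\<bar> < 1/6" using l by linarith
  then have "l \<le> 6 * (a - b)\<^sup>2 + 3 * ((a - b)\<^sup>2 / \<eta> + \<eta> * (b - x)\<^sup>2)"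
  proof cases
    case 1 then show ?thesis using nn by simp
  next
    case 2
    have "\<bar>a - b\<bar> * 1 \<le> \<bar>a - b\<bar> * (6 * \<bar>a - b\<bar>)" using 2 by (intro mult_left_mono) auto
    also have "\<dots> = 6 * (a - b)\<^sup>2" by (simp add: power2_eq_square)
    finally show ?thesis using l nn by simp
  next
    case 3
    then have "b \<ge> 1/6" "b \<le> 5/6" by (auto simp: l_def max_def min_def abs_if split: if_splits)
    then have "\<bar>b - x\<bar> \<ge> 1/6" using assms by auto
    then have "\<bar>a - b\<bar> * 1 \<le> \<bar>a - b\<bar> * (6 * \<bar>b - x\<bar>)" by (intro mult_left_mono) auto
    then have "l \<le> 6 * (\<bar>a - b\<bar> * \<bar>b - x\<bar>)" using l by (simp add: algebra_simps)
    then have "l \<le> 3 * r" using amgm by linarith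
    then show ?thesis using zero_le_power2[of "a - b"] unfolding r_def by linarith
  qed
  then show ?thesis by (simp add: l_def)
qed

text \<open>Shifting by \<open>\<beta>\<close> moves the superlevel set by \<open>\<beta>\<close>,
  and the doubled window still contains everything that varies. The shifted window has
  \<open>L + \<beta>\<close> positions below \<open>- L\<close>, all of which count.\<close>

lemma sum_thr_shift:
  fixes W :: "int \<Rightarrow> real" and L \<beta> :: int
  assumes lo: "\<And>j. j < - L \<Longrightarrow> W j = 1" and hi: "\<And>j. j \<ge> L \<Longrightarrow> W j = 0"
    and \<beta>: "\<bar>\<beta>\<bar> \<le> L" and t: "0 \<le> t" "t < 1"
  shows "(\<Sum>j\<in>{-2*L..<2*L}. of_bool (t < W (j - \<beta>)) :: int) = (\<Sum>j\<in>{-L..<L}. of_bool (t < W j)) + L + \<beta>"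
proof -
  have L: "L \<ge> 0" using \<beta> by simp
  define w :: "int \<Rightarrow> int" where "w j = of_bool (t < W j)" for j
  have "(\<Sum>j\<in>{-2*L..<2*L}. of_bool (t < W (j - \<beta>)) :: int) = sum w {-2*L-\<beta>..<2*L-\<beta>}"
    unfolding w_def[abs_def] by (rule sum.reindex_bij_witness[of _ "\<lambda>j. j + \<beta>" "\<lambda>j. j - \<beta>"]) auto
  also have "{-2*L-\<beta>..<2*L-\<beta>} = {-2*L-\<beta>..<-L} \<union> {-L..<L} \<union> {L..<2*L-\<beta>}" using \<beta> L by auto
  also have "sum w \<dots> = sum w ({-2*L-\<beta>..<-L} \<union> {-L..<L}) + sum w {L..<2*L-\<beta>}"
    by (rule sum.union_disjoint) auto
  also have "sum w ({-2*L-\<beta>..<-L} \<union> {-L..<L}) = sum w {-2*L-\<beta>..<-L} + sum w {-L..<L}"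
    by (rule sum.union_disjoint) auto
  also have "sum w {-2*L-\<beta>..<-L} = (\<Sum>j\<in>{-2*L-\<beta>..<-L}. 1)"
    using t by (intro sum.cong) (auto simp: lo w_def)
  also have "sum w {L..<2*L-\<beta>} = 0"
    using t by (intro sum.neutral) (auto simp: hi w_def)
  finally show ?thesis using \<beta> by (simp add: w_def[abs_def])
qed

text \<open>Summing \<open>thr_overlap_bound\<close> bounds the average \<open>l1\<close>-variation
  of the superlevel sets, so some threshold does better than \<open>m\<close>. A column of that set
  may fail to be an interval; its size is enough, because sizes differ by at most the size of the
  symmetric difference. \<open>X\<close> measures how far \<open>V\<close> is from being invariant
  under the twisted action, \<open>Y\<close> how far it is from an indicator function.\<close>

lemma rounding:
  fixes V :: "'q \<Rightarrow> int \<Rightarrow> real" and \<beta> :: "'s \<Rightarrow> 'q \<Rightarrow> int" and L :: int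
  assumes fin: "finite Q" "finite S"
    and lo: "\<And>q j. q \<in> Q \<Longrightarrow> j < - L \<Longrightarrow> V q j = 1" and hi: "\<And>q j. q \<in> Q \<Longrightarrow> j \<ge> L \<Longrightarrow> V q j = 0"
    and \<sigma>: "\<And>s q. s \<in> S \<Longrightarrow> q \<in> Q \<Longrightarrow> \<sigma> s q \<in> Q"
    and \<beta>: "\<And>s q. s \<in> S \<Longrightarrow> q \<in> Q \<Longrightarrow> \<bar>\<beta> s q\<bar> \<le> L" and L: "L \<ge> 0"
    and \<omega>: "\<And>q j. \<omega> q j = 0 \<or> \<omega> q j = (1::real)" and \<eta>: "\<eta> > 0"
    and X: "\<And>s. s \<in> S \<Longrightarrow> (\<Sum>q\<in>Q. \<Sum>j\<in>{-2*L..<2*L}. (V (\<sigma> s q) (j - \<beta> s q) - V q j)\<^sup>2) \<le> X"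
    and Y: "(\<Sum>q\<in>Q. \<Sum>j\<in>{-2*L..<2*L}. (V q j - \<omega> q j)\<^sup>2) \<le> Y"
    and m: "card S * (6 * X + 3 * (X / \<eta> + \<eta> * Y)) < m / 3"
  obtains f :: "'q \<Rightarrow> int" where "(\<Sum>s\<in>S. l1 Q (\<lambda>q. \<beta> s q + f (\<sigma> s q) - f q)) < m"
proof -
  define J where "J = {-2*L..<2*L}"
  define \<Phi> where "\<Phi> t = (\<Sum>s\<in>S. \<Sum>q\<in>Q. \<Sum>j\<in>J. \<bar>thr t (V (\<sigma> s q) (j - \<beta> s q)) - thr t (V q j)\<bar>)" for t
  define I where "I s q j = (let a = V (\<sigma> s q) (j - \<beta> s q); b = V q j in max 0 (min (max a b) (2/3) - max (min a b) (1/3)))" for s q j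
  have int: "(\<Phi> has_integral (\<Sum>s\<in>S. \<Sum>q\<in>Q. \<Sum>j\<in>J. I s q j)) {1/3..2/3}"
    unfolding \<Phi>_def I_def Let_def using fin by (intro has_integral_sum integral_thr_diff) (auto simp: J_def)
  have "(\<Sum>q\<in>Q. \<Sum>j\<in>J. I s q j) \<le> 6 * X + 3 * (X / \<eta> + \<eta> * Y)" if s: "s \<in> S" for s
  proof -
    have "(\<Sum>q\<in>Q. \<Sum>j\<in>J. I s q j) \<le> (\<Sum>q\<in>Q. \<Sum>j\<in>J. 6 * (V (\<sigma> s q) (j - \<beta> s q) - V q j)\<^sup>2
      + 3 * ((V (\<sigma> s q) (j - \<beta> s q) - V q j)\<^sup>2 / \<eta> + \<eta> * (V q j - \<omega> q j)\<^sup>2))"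
      unfolding I_def Let_def by (intro sum_mono thr_overlap_bound \<omega> \<eta>)
    also have "\<dots> = 6 * (\<Sum>q\<in>Q. \<Sum>j\<in>J. (V (\<sigma> s q) (j - \<beta> s q) - V q j)\<^sup>2)
      + 3 * ((\<Sum>q\<in>Q. \<Sum>j\<in>J. (V (\<sigma> s q) (j - \<beta> s q) - V q j)\<^sup>2) / \<eta> + \<eta> * (\<Sum>q\<in>Q. \<Sum>j\<in>J. (V q j - \<omega> q j)\<^sup>2))"
      by (simp add: sum.distrib sum_distrib_left sum_divide_distrib)
    also have "\<dots> \<le> 6 * X + 3 * (X / \<eta> + \<eta> * Y)"
      using X[OF s] Y \<eta> unfolding J_def by (intro add_mono mult_left_mono divide_right_mono) auto
    finally show ?thesis .
  qed
  then have "(\<Sum>s\<in>S. \<Sum>q\<in>Q. \<Sum>j\<in>J. I s q j) \<le> card S * (6 * X + 3 * (X / \<eta> + \<eta> * Y))"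
    by (rule sum_bounded_above)
  then have lt: "(\<Sum>s\<in>S. \<Sum>q\<in>Q. \<Sum>j\<in>J. I s q j) < m / 3" using m by linarith
  \<comment> \<open>The thresholds form an interval of length 1/3, whence the bound
    \<open>m / 3\<close>.\<close>
  have "\<exists>t\<in>{1/3..2/3}. \<Phi> t < m"
  proof (rule ccontr)
    assume "\<not> ?thesis"
    then have "\<And>t. t \<in> {1/3..2/3} \<Longrightarrow> m \<le> \<Phi> t" by force
    moreover have "((\<lambda>t. m) has_integral m / 3) {1/3..2/3::real}"
      using has_integral_const_real[of m "1/3" "2/3"] by simp
    ultimately have "m / 3 \<le> (\<Sum>s\<in>S. \<Sum>q\<in>Q. \<Sum>j\<in>J. I s q j)"
      using int has_integral_le by blast
    then show False using lt by simp
  qed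
  then obtain t where t: "1/3 \<le> t" "t \<le> 2/3" "\<Phi> t < m" by auto
  \<comment> \<open>The size of column \<open>q\<close> of the superlevel set, up to a constant
    \<open>L\<close> that cancels in differences.\<close>
  define f where "f q = (\<Sum>j\<in>{-L..<L}. of_bool (t < V q j) :: int)" for q
  have "l1 Q (\<lambda>q. \<beta> s q + f (\<sigma> s q) - f q) \<le> (\<Sum>q\<in>Q. \<Sum>j\<in>J. \<bar>thr t (V (\<sigma> s q) (j - \<beta> s q)) - thr t (V q j)\<bar>)"
    if s: "s \<in> S" for s
    unfolding l1_def of_int_sum
  proof (rule sum_mono)
    fix q assume q: "q \<in> Q"
    have "(\<Sum>j\<in>J. of_bool (t < V (\<sigma> s q) (j - \<beta> s q)) :: int) = f (\<sigma> s q) + L + \<beta> s q"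
      unfolding J_def f_def using t s q by (intro sum_thr_shift lo hi \<sigma> \<beta>) auto
    moreover have "(\<Sum>j\<in>J. of_bool (t < V q (j - 0)) :: int) = f q + L + 0"
      unfolding J_def f_def using t q L by (intro sum_thr_shift lo hi) auto
    ultimately have "\<beta> s q + f (\<sigma> s q) - f q = (\<Sum>j\<in>J. of_bool (t < V (\<sigma> s q) (j - \<beta> s q)) - of_bool (t < V q j))"
      by (simp add: sum_subtractf)
    then have "\<bar>\<beta> s q + f (\<sigma> s q) - f q\<bar> \<le> (\<Sum>j\<in>J. \<bar>of_bool (t < V (\<sigma> s q) (j - \<beta> s q)) - of_bool (t < V q j) :: int\<bar>)"
      by (simp add: sum_abs)
    then have "real_of_int \<bar>\<beta> s q + f (\<sigma> s q) - f q\<bar> \<le> real_of_int (\<Sum>j\<in>J. \<bar>of_bool (t < V (\<sigma> s q) (j - \<beta> s q)) - of_bool (t < V q j) :: int\<bar>)"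
      by linarith
    then show "real_of_int \<bar>\<beta> s q + f (\<sigma> s q) - f q\<bar> \<le> (\<Sum>j\<in>J. \<bar>thr t (V (\<sigma> s q) (j - \<beta> s q)) - thr t (V q j)\<bar>)"
      by simp
  qed
  then have "(\<Sum>s\<in>S. l1 Q (\<lambda>q. \<beta> s q + f (\<sigma> s q) - f q)) \<le> \<Phi> t"
    unfolding \<Phi>_def by (rule sum_mono)
  then show ?thesis using t that by (meson order_le_less_trans)
qed

text \<open>If \<open>D x y\<close> is the squared distance of \<open>v x\<close> and \<open>v y\<close> in a Hilbert space, this is the inner product
  of the differences \<open>v y - v x\<close> and \<open>v y' - v x'\<close>.\<close>

definition dker :: "('p \<Rightarrow> 'p \<Rightarrow> real) \<Rightarrow> 'p \<times> 'p \<Rightarrow> 'p \<times> 'p \<Rightarrow> real"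
  where "dker D = (\<lambda>(x, y) (x', y'). (D y x' + D x y' - D y y' - D x x') / 2)"

text \<open>Integer functions on \<open>Q\<close> are embedded into the square summable functions on \<open>Q \<times> \<int>\<close> as
  indicator functions of subgraphs, so that squared distances become \<open>l1\<close>-distances.\<close>

definition vec :: "('p \<Rightarrow> 'q \<Rightarrow> int) \<Rightarrow> (real \<times> 'p \<times> 'p) list \<Rightarrow> 'q \<Rightarrow> int \<Rightarrow> real"
  where "vec u c q j = lin (\<lambda>(x, y). of_bool (j < u y q) - of_bool (j < u x q)) c"

section \<open>Kernels of \<open>l1\<close>-distances\<close>

lemma lin_cong: "(\<And>i. i \<in> snd ` set c \<Longrightarrow> f i = g i) \<Longrightarrow> lin f c = lin g c"
proof (induction c)
  case (Cons p c)
  obtain a i where [simp]: "p = (a, i)" by (cases p)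
  have "lin f c = lin g c" by (rule Cons.IH) (rule Cons.prems, simp)
  moreover have "f i = g i" by (rule Cons.prems) simp
  ultimately show ?case by simp
qed simp

lemma quad_cong:
  assumes "\<And>i j. i \<in> snd ` set c \<Longrightarrow> j \<in> snd ` set c \<Longrightarrow> K i j = K' i j" shows "quad K c = quad K' c"
  unfolding quad_def
proof (rule lin_cong)
  fix i assume "i \<in> snd ` set c"
  then show "lin (K i) c = lin (K' i) c" by (rule lin_cong[OF assms])
qed

lemma lin_sum: "lin (\<lambda>i. \<Sum>x\<in>A. f x i) c = (\<Sum>x\<in>A. lin (f x) c)"
proof (induction c)
  case (Cons p c)
  obtain a i where [simp]: "p = (a, i)" by (cases p)
  show ?case by (simp only: lin_simps \<open>p = (a, i)\<close> Cons sum.distrib sum_distrib_left)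
qed simp

lemma quad_gram: "quad (\<lambda>i j. \<Sum>x\<in>A. \<phi> x i * \<phi> x j) c = (\<Sum>x\<in>A. (lin (\<phi> x) c)\<^sup>2)"
proof -
  have 1: "lin (\<lambda>i. \<phi> x i * lin (\<phi> x) c) c = lin (\<lambda>i. lin (\<phi> x) c * \<phi> x i) c" for x
    by (rule arg_cong[of _ _ "\<lambda>f. lin f c"]) (rule ext, rule mult.commute)
  show ?thesis unfolding quad_def lin_sum lin_cmult 1 power2_eq_square ..
qed

text \<open>The two subgraph indicators differ exactly at the integers between \<open>x\<close> and
  \<open>y\<close>, all of which lie in the window.\<close>

lemma sum_thr_sq:
  fixes x y L :: int
  assumes "\<bar>x\<bar> \<le> L" "\<bar>y\<bar> \<le> L"
  shows "(\<Sum>j\<in>{-L..<L}. (of_bool (j < y) - of_bool (j < x) :: real)\<^sup>2) = \<bar>y - x\<bar>"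
proof -
  have 1: "(of_bool (j < y) - of_bool (j < x) :: real)\<^sup>2 = of_bool (j \<in> {min x y..<max x y})" for j
    by (cases "j < y"; cases "j < x") (simp_all add: min_def max_def)
  have "(\<Sum>j\<in>{-L..<L}. of_bool (j \<in> {min x y..<max x y}) :: real) = real (card ({-L..<L} \<inter> {min x y..<max x y}))"
    by (simp only: sum_of_bool_eq finite_atLeastLessThan_int Collect_mem_eq)
  also have "{-L..<L} \<inter> {min x y..<max x y} = {min x y..<max x y}"
    by (intro Int_absorb1) (simp add: atLeastLessThan_subset_iff, use assms in linarith)
  also have "real (card {min x y..<max x y}) = \<bar>y - x\<bar>" by (cases "x \<le> y") (simp_all add: min_def max_def)
  finally show ?thesis by (simp only: 1)
qed

text \<open>Polarization: the product of two differences of subgraph indicators is half a signed sum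
  of four squared distances, and each of these is an absolute difference of integers by
  \<open>sum_thr_sq\<close>. The left side is thus a square norm and in particular
  nonnegative.\<close>

lemma quad_dker_l1:
  fixes u :: "'p \<Rightarrow> 'q \<Rightarrow> int" and L :: int
  assumes L: "\<And>x y q. (x, y) \<in> snd ` set c \<Longrightarrow> q \<in> Q \<Longrightarrow> \<bar>u x q\<bar> \<le> L \<and> \<bar>u y q\<bar> \<le> L"
  shows "quad (dker (\<lambda>x y. l1 Q (u x - u y))) c = (\<Sum>q\<in>Q. \<Sum>j\<in>{-L..<L}. (vec u c q j)\<^sup>2)"
proof -
  define \<phi> where "\<phi> = (\<lambda>(q, j) (x, y). of_bool (j < u y q) - of_bool (j < u x q) :: real)"
  have "quad (dker (\<lambda>x y. l1 Q (u x - u y))) c = quad (\<lambda>p p'. \<Sum>q\<in>Q. \<Sum>j\<in>{-L..<L}. \<phi> (q, j) p * \<phi> (q, j) p') c"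
  proof (rule quad_cong)
    fix p p' assume p: "p \<in> snd ` set c" "p' \<in> snd ` set c"
    obtain x y x' y' where [simp]: "p = (x, y)" "p' = (x', y')" by (metis surj_pair)
    have "(\<Sum>j\<in>{-L..<L}. \<phi> (q, j) p * \<phi> (q, j) p') = (\<bar>u y q - u x' q\<bar> + \<bar>u x q - u y' q\<bar> - \<bar>u y q - u y' q\<bar> - \<bar>u x q - u x' q\<bar>) / 2"
      if q: "q \<in> Q" for q
    proof -
      let ?h = "\<lambda>x y. \<Sum>j\<in>{-L..<L}. (of_bool (j < u y q) - of_bool (j < u x q) :: real)\<^sup>2"
      let ?g = "\<lambda>j x y. (of_bool (j < u y q) - of_bool (j < u x q) :: real)\<^sup>2"
      have "\<phi> (q, j) p * \<phi> (q, j) p' = (?g j x' y + ?g j y' x - ?g j y' y - ?g j x' x) / 2" for j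
        by (simp add: \<phi>_def power2_eq_square field_simps)
      then have "(\<Sum>j\<in>{-L..<L}. \<phi> (q, j) p * \<phi> (q, j) p') = (?h x' y + ?h y' x - ?h y' y - ?h x' x) / 2"
        by (simp only: sum.distrib sum_subtractf flip: sum_divide_distrib)
      moreover have "?h x' y = \<bar>u y q - u x' q\<bar>" "?h y' x = \<bar>u x q - u y' q\<bar>"
        "?h y' y = \<bar>u y q - u y' q\<bar>" "?h x' x = \<bar>u x q - u x' q\<bar>"
        using L p q by (intro sum_thr_sq; force)+
      ultimately show ?thesis by simp
    qed
    then have "(\<Sum>q\<in>Q. \<Sum>j\<in>{-L..<L}. \<phi> (q, j) p * \<phi> (q, j) p') =
      (\<Sum>q\<in>Q. (\<bar>u y q - u x' q\<bar> + \<bar>u x q - u y' q\<bar> - \<bar>u y q - u y' q\<bar> - \<bar>u x q - u x' q\<bar>) / 2)"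
      by (intro sum.cong) auto
    also have "\<dots> = dker (\<lambda>x y. l1 Q (u x - u y)) p p'"
      by (simp add: dker_def l1_def sum.distrib sum_subtractf flip: sum_divide_distrib)
    finally show "dker (\<lambda>x y. l1 Q (u x - u y)) p p' = (\<Sum>q\<in>Q. \<Sum>j\<in>{-L..<L}. \<phi> (q, j) p * \<phi> (q, j) p')" by simp
  qed
  also have "\<dots> = (\<Sum>q\<in>Q. \<Sum>j\<in>{-L..<L}. (lin (\<phi> (q, j)) c)\<^sup>2)"
    by (simp add: sum.cartesian_product quad_gram[of "\<lambda>z. \<phi> z"] case_prod_unfold)
  finally show ?thesis by (simp add: vec_def \<phi>_def)
qed

section \<open>Cocycles up to small errors on finite \<open>G\<close>-sets\<close>

definition finite_gset :: "('g, 'b) monoid_scheme \<Rightarrow> 'q set \<Rightarrow> ('q \<Rightarrow> 'g \<Rightarrow> 'q) \<Rightarrow> bool"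
  where "finite_gset G Q act \<longleftrightarrow> finite Q \<and> (\<forall>q\<in>Q. \<forall>g\<in>carrier G. act q g \<in> Q) \<and>
    (\<forall>q\<in>Q. act q \<one>\<^bsub>G\<^esub> = q) \<and>
    (\<forall>q\<in>Q. \<forall>g\<in>carrier G. \<forall>h\<in>carrier G. act (act q g) h = act q (g \<otimes>\<^bsub>G\<^esub> h))"

text \<open>Functions on \<open>Q\<close> carry the right action
  \<open>(f . t) q = f (act q (inv t))\<close>. The defect measures the failure of the identity
  \<open>b (s t) = b s . t + b t\<close> for this action.\<close>

definition defect :: "('g, 'b) monoid_scheme \<Rightarrow> ('q \<Rightarrow> 'g \<Rightarrow> 'q) \<Rightarrow> ('g \<Rightarrow> 'q \<Rightarrow> int) \<Rightarrow> 'g \<Rightarrow> 'g \<Rightarrow> 'q \<Rightarrow> int"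
  where "defect G act b s t q = b (s \<otimes>\<^bsub>G\<^esub> t) q - b s (act q (inv\<^bsub>G\<^esub> t)) - b t q"

lemma l1_nonneg: "0 \<le> l1 Q f"
  by (simp add: l1_def sum_nonneg)

lemma l1_cong: "(\<And>q. q \<in> Q \<Longrightarrow> f q = g q) \<Longrightarrow> l1 Q f = l1 Q g"
  by (simp add: l1_def)

lemma l1_add: "l1 Q (\<lambda>q. f q + g q) \<le> l1 Q f + l1 Q g"
proof -
  have "(\<Sum>q\<in>Q. \<bar>f q + g q\<bar>) \<le> (\<Sum>q\<in>Q. \<bar>f q\<bar> + \<bar>g q\<bar>)" by (intro sum_mono) simp
  then show ?thesis unfolding l1_def sum.distrib by linarith
qed

lemma l1_uminus: "l1 Q (\<lambda>q. - f q) = l1 Q f"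
  by (simp add: l1_def)

lemma l1_diff: "l1 Q (\<lambda>q. f q - g q) \<le> l1 Q f + l1 Q g"
  using l1_add[of Q f "\<lambda>q. - g q"] by (simp add: l1_uminus)

lemma l1_dist: "\<bar>l1 Q f - l1 Q g\<bar> \<le> l1 Q (\<lambda>q. f q - g q)"
proof -
  have "l1 Q f \<le> l1 Q (\<lambda>q. f q - g q) + l1 Q g" using l1_add[of Q "\<lambda>q. f q - g q" g] by simp
  moreover have "l1 Q g \<le> l1 Q f + l1 Q (\<lambda>q. f q - g q)" using l1_diff[of Q f "\<lambda>q. f q - g q"] by simp
  ultimately show ?thesis by linarith
qed

lemma l1_act:
  fixes G (structure)
  assumes "group G" "finite_gset G Q act" "g \<in> carrier G" shows "l1 Q (\<lambda>q. f (act q g)) = l1 Q f"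
proof -
  interpret group G by fact
  have "(\<Sum>q\<in>Q. \<bar>f (act q g)\<bar>) = (\<Sum>q\<in>Q. \<bar>f q\<bar>)"
    by (rule sum.reindex_bij_witness[of _ "\<lambda>q. act q (inv g)" "\<lambda>q. act q g"])
      (use assms in \<open>auto simp: finite_gset_def\<close>)
  then show ?thesis by (simp add: l1_def)
qed

lemma tendsto_lin_on: "(\<And>i. i \<in> snd ` set c \<Longrightarrow> (\<lambda>k. f k i) \<longlonglongrightarrow> g i) \<Longrightarrow> (\<lambda>k. lin (f k) c) \<longlonglongrightarrow> lin g c"
proof (induction c)
  case (Cons p c)
  obtain a i where [simp]: "p = (a, i)" by (cases p)
  have "(\<lambda>k. lin (f k) c) \<longlonglongrightarrow> lin g c" by (rule Cons.IH) (rule Cons.prems, simp)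
  moreover have "(\<lambda>k. f k i) \<longlonglongrightarrow> g i" by (rule Cons.prems) simp
  ultimately show ?case by (auto intro!: tendsto_intros)
qed simp

lemma tendsto_quad_on:
  assumes "\<And>i j. i \<in> snd ` set c \<Longrightarrow> j \<in> snd ` set c \<Longrightarrow> (\<lambda>k. f k i j) \<longlonglongrightarrow> g i j"
  shows "(\<lambda>k. quad (f k) c) \<longlonglongrightarrow> quad g c"
  unfolding quad_def by (rule tendsto_lin_on, rule tendsto_lin_on, rule assms)

lemma tendsto_quad_dker:
  assumes c: "snd ` set c \<subseteq> A \<times> A" and D: "\<And>x y. x \<in> A \<Longrightarrow> y \<in> A \<Longrightarrow> (\<lambda>k. D k x y) \<longlonglongrightarrow> E x y"
  shows "(\<lambda>k. quad (dker (D k)) c) \<longlonglongrightarrow> quad (dker E) c"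
proof (rule tendsto_quad_on)
  fix i j assume "i \<in> snd ` set c" "j \<in> snd ` set c"
  then have "fst i \<in> A" "snd i \<in> A" "fst j \<in> A" "snd j \<in> A" using c by auto
  then show "(\<lambda>k. dker (D k) i j) \<longlonglongrightarrow> dker E i j"
    unfolding dker_def by (auto simp: case_prod_unfold intro!: tendsto_intros D)
qed

lemma quad_divide: "quad (\<lambda>i j. K i j / m) c = quad K c / m"
proof -
  have "lin (\<lambda>i. f i / m) c = lin f c / m" for f
    using lin_cmult[of "1/m" f c] by simp
  then show ?thesis by (simp add: quad_def)
qed

lemma dker_divide: "dker (\<lambda>x y. D x y / m) = (\<lambda>i j. dker D i j / m)"
  by (simp add: dker_def fun_eq_iff diff_divide_distrib add_divide_distrib mult.commute)

lemma ex_bound: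
  fixes u :: "'p \<Rightarrow> 'q \<Rightarrow> int"
  assumes "finite P" "finite Q" shows "\<exists>L\<ge>0. \<forall>p\<in>P. \<forall>q\<in>Q. \<bar>u p q\<bar> \<le> L"
proof -
  have "\<bar>u p q\<bar> \<le> (\<Sum>p\<in>P. \<Sum>q\<in>Q. \<bar>u p q\<bar>)" if "p \<in> P" "q \<in> Q" for p q
  proof -
    have "\<bar>u p q\<bar> \<le> (\<Sum>q\<in>Q. \<bar>u p q\<bar>)" using assms that by (intro member_le_sum) auto
    also have "\<dots> \<le> (\<Sum>p\<in>P. \<Sum>q\<in>Q. \<bar>u p q\<bar>)"
      using assms that by (intro member_le_sum[of p P "\<lambda>p. \<Sum>q\<in>Q. \<bar>u p q\<bar>"]) (auto intro: sum_nonneg)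
    finally show ?thesis .
  qed
  then show ?thesis by (intro exI[of _ "\<Sum>p\<in>P. \<Sum>q\<in>Q. \<bar>u p q\<bar>"]) (auto intro!: sum_nonneg)
qed

text \<open>The numbers \<open>m k\<close> are the norms of cocycles that no coboundary can shorten,
  and relative to them the defects tend to 0. In the limit there is an honest affine isometric
  action; transporting its approximate fixed point back to some \<open>k\<close> and rounding it
  produces a coboundary that does shorten \<open>b k\<close>.\<close>

lemma almost_cocycle_contradiction:
  fixes G :: "('g, 'b) monoid_scheme" (structure) and b :: "nat \<Rightarrow> 'g \<Rightarrow> 'q \<Rightarrow> int"
  assumes T: "property_T G" and S: "finite S" "S \<subseteq> carrier G" "generate G S = carrier G"
    and gs: "\<And>k. finite_gset G (Q k) (act k)" and m: "\<And>k. m k > 0"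
    and le: "\<And>k. (\<Sum>s\<in>S. l1 (Q k) (b k s)) \<le> m k"
    and min: "\<And>k f. m k \<le> (\<Sum>s\<in>S. l1 (Q k) (\<lambda>q. b k s q + f (act k q (inv\<^bsub>G\<^esub> s)) - f q))"
    and dfc: "\<And>x y. x \<in> carrier G \<Longrightarrow> y \<in> carrier G \<Longrightarrow> (\<lambda>k. l1 (Q k) (defect G (act k) (b k) x y) / m k) \<longlonglongrightarrow> 0"
  shows False
proof -
  interpret group G using T by (simp add: property_T_def)
  have cG: "countable (carrier G)" using T by (simp add: property_T_def)
  note perm = l1_act[OF is_group gs]
  have dfb: "\<exists>C. \<forall>k. l1 (Q k) (defect G (act k) (b k) x y) \<le> C * m k" if "x \<in> carrier G" "y \<in> carrier G" for x y
  proof -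
    have "Bseq (\<lambda>k. l1 (Q k) (defect G (act k) (b k) x y) / m k)"
      using dfc[OF that] convergent_imp_Bseq convergent_def by blast
    then obtain C where "\<And>k. \<bar>l1 (Q k) (defect G (act k) (b k) x y) / m k\<bar> \<le> C"
      unfolding Bseq_def by auto
    then have le: "l1 (Q k) (defect G (act k) (b k) x y) / m k \<le> C" for k using abs_le_D1 by blast
    have "l1 (Q k) (defect G (act k) (b k) x y) \<le> C * m k" for k
      using m[of k] le[of k] by (simp add: pos_divide_le_eq)
    then show ?thesis by blast
  qed
  have b1: "\<exists>C. \<forall>k. l1 (Q k) (b k \<one>) \<le> C * m k"
  proof -
    have "l1 (Q k) (b k \<one>) = l1 (Q k) (defect G (act k) (b k) \<one> \<one>)" for k
    proof -
      have "l1 (Q k) (defect G (act k) (b k) \<one> \<one>) = l1 (Q k) (\<lambda>q. - b k \<one> q)"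
        using gs[of k] by (intro l1_cong) (simp add: defect_def finite_gset_def)
      then show ?thesis by (simp add: l1_uminus)
    qed
    then show ?thesis using dfb[of \<one> \<one>] by simp
  qed
  have bS: "\<forall>k. l1 (Q k) (b k s) \<le> 1 * m k" if "s \<in> S" for s
  proof
    fix k
    have "l1 (Q k) (b k s) \<le> (\<Sum>s\<in>S. l1 (Q k) (b k s))"
      using S that by (intro member_le_sum) (auto simp: l1_nonneg)
    then show "l1 (Q k) (b k s) \<le> 1 * m k" using le[of k] by simp
  qed
  \<comment> \<open>Induction over words in the generators. The bound grows with the word, but it is
    independent of \<open>k\<close>.\<close>
  have bdd: "\<exists>C. \<forall>k. l1 (Q k) (b k x) \<le> C * m k" if "x \<in> carrier G" for x
  proof -
    have "x \<in> generate G S" using that S by simp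
    then show ?thesis
    proof (induction rule: generate.induct)
      case one then show ?case by (rule b1)
    next
      case (incl s) then show ?case using bS by blast
    next
      case (inv s)
      then have s: "s \<in> carrier G" using S by auto
      obtain C1 where C1: "\<And>k. l1 (Q k) (b k \<one>) \<le> C1 * m k" using b1 by blast
      obtain C2 where C2: "\<And>k. l1 (Q k) (defect G (act k) (b k) (inv\<^bsub>G\<^esub> s) s) \<le> C2 * m k"
        using dfb[OF inv_closed[OF s] s] by blast
      have "l1 (Q k) (b k (inv\<^bsub>G\<^esub> s)) \<le> (C1 + C2 + 1) * m k" for k
      proof -
        have "l1 (Q k) (b k (inv\<^bsub>G\<^esub> s)) = l1 (Q k) (\<lambda>q. b k (inv\<^bsub>G\<^esub> s) (act k q (inv\<^bsub>G\<^esub> s)))"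
          using perm s by simp
        also have "\<dots> = l1 (Q k) (\<lambda>q. (b k \<one> q - defect G (act k) (b k) (inv\<^bsub>G\<^esub> s) s q) - b k s q)"
          using s by (intro l1_cong) (simp add: defect_def)
        also have "\<dots> \<le> l1 (Q k) (b k \<one>) + l1 (Q k) (defect G (act k) (b k) (inv\<^bsub>G\<^esub> s) s) + l1 (Q k) (b k s)"
          using l1_diff[of "Q k" "\<lambda>q. b k \<one> q - defect G (act k) (b k) (inv\<^bsub>G\<^esub> s) s q" "b k s"]
            l1_diff[of "Q k" "b k \<one>" "defect G (act k) (b k) (inv\<^bsub>G\<^esub> s) s"] by linarith
        also have "\<dots> \<le> (C1 + C2 + 1) * m k"
          using C1[of k] C2[of k] bS[OF inv(1)] by (simp add: algebra_simps add_mono)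
        finally show ?thesis .
      qed
      then show ?case by blast
    next
      case (eng x y)
      then have x: "x \<in> carrier G" "y \<in> carrier G" using S by auto
      obtain C1 where C1: "\<And>k. l1 (Q k) (b k x) \<le> C1 * m k" using eng by blast
      obtain C3 where C3: "\<And>k. l1 (Q k) (b k y) \<le> C3 * m k" using eng by blast
      obtain C2 where C2: "\<And>k. l1 (Q k) (defect G (act k) (b k) x y) \<le> C2 * m k"
        using dfb[OF x] by blast
      have "l1 (Q k) (b k (x \<otimes> y)) \<le> (C1 + C2 + C3) * m k" for k
      proof -
        have "l1 (Q k) (b k (x \<otimes> y)) = l1 (Q k) (\<lambda>q. (b k x (act k q (inv\<^bsub>G\<^esub> y)) + defect G (act k) (b k) x y q) + b k y q)"
          by (intro l1_cong) (simp add: defect_def)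
        also have "\<dots> \<le> l1 (Q k) (\<lambda>q. b k x (act k q (inv\<^bsub>G\<^esub> y))) + l1 (Q k) (defect G (act k) (b k) x y) + l1 (Q k) (b k y)"
          using l1_add[of "Q k" "\<lambda>q. b k x (act k q (inv\<^bsub>G\<^esub> y)) + defect G (act k) (b k) x y q" "b k y"]
            l1_add[of "Q k" "\<lambda>q. b k x (act k q (inv\<^bsub>G\<^esub> y))" "defect G (act k) (b k) x y"] by linarith
        also have "l1 (Q k) (\<lambda>q. b k x (act k q (inv\<^bsub>G\<^esub> y))) = l1 (Q k) (b k x)" using perm x by simp
        finally show ?thesis using C1[of k] C2[of k] C3[of k] by (simp add: algebra_simps)
      qed
      then show ?case by blast
    qed
  qed
  define D where "D k x y = l1 (Q k) (\<lambda>q. b k x q - b k y q) / m k" for k x y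
  have "\<exists>C. \<forall>x\<in>carrier G. \<forall>k. l1 (Q k) (b k x) \<le> C x * m k" using bdd by metis
  then obtain C where C: "\<And>x k. x \<in> carrier G \<Longrightarrow> l1 (Q k) (b k x) \<le> C x * m k" by blast
  have C0: "C x \<ge> 0" if "x \<in> carrier G" for x
    using C[OF that, of 0] l1_nonneg[of "Q 0" "b 0 x"] m[of 0] by (smt (verit) mult_neg_pos)
  have Dle: "\<bar>D k x y\<bar> \<le> C x + C y" if "x \<in> carrier G" "y \<in> carrier G" for k x y
  proof -
    have "l1 (Q k) (\<lambda>q. b k x q - b k y q) \<le> (C x + C y) * m k"
      using l1_diff[of "Q k" "b k x" "b k y"] C[OF that(1), of k] C[OF that(2), of k] by (simp add: algebra_simps)
    then show ?thesis using m[of k] by (simp add: D_def pos_divide_le_eq abs_of_nonneg[OF l1_nonneg])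
  qed
  \<comment> \<open>Dividing by bounds that depend on the pair makes all functions bounded by 1, so
    one subsequence converges at all of the countably many pairs.\<close>
  define F where "F k = (\<lambda>(x, y). D k x y / (1 + C x + C y))" for k
  have F1: "norm (F k p) \<le> 1" if "p \<in> carrier G \<times> carrier G" for k p
  proof -
    obtain x y where p: "p = (x, y)" by (cases p)
    then have "x \<in> carrier G" "y \<in> carrier G" using that by auto
    then have "\<bar>D k x y\<bar> \<le> 1 + C x + C y" "0 < 1 + C x + C y"
      using Dle[of x y k] C0[of x] C0[of y] by linarith+
    then show ?thesis by (simp add: p F_def abs_divide)
  qed
  have "countable (carrier G \<times> carrier G)" using cG by (intro countable_SIGMA)
  then obtain r where r: "strict_mono (r :: nat \<Rightarrow> nat)"
    and rF: "\<And>p. p \<in> carrier G \<times> carrier G \<Longrightarrow> \<exists>l. (\<lambda>k. F (r k) p) \<longlonglongrightarrow> l"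
    using function_convergent_subsequence[of "carrier G \<times> carrier G" F 1, OF _ F1] that by auto
  define E where "E x y = lim (\<lambda>k. D (r k) x y)" for x y
  have DE: "(\<lambda>k. D (r k) x y) \<longlonglongrightarrow> E x y" if xy: "x \<in> carrier G" "y \<in> carrier G" for x y
  proof -
    obtain l where "(\<lambda>k. F (r k) (x, y)) \<longlonglongrightarrow> l" using rF[of "(x, y)"] xy by blast
    then have "(\<lambda>k. F (r k) (x, y) * (1 + C x + C y)) \<longlonglongrightarrow> l * (1 + C x + C y)"
      by (intro tendsto_intros)
    moreover have "F k (x, y) * (1 + C x + C y) = D k x y" for k
      using C0[OF xy(1)] C0[OF xy(2)] by (simp add: F_def)
    ultimately have "(\<lambda>k. D (r k) x y) \<longlonglongrightarrow> l * (1 + C x + C y)" by simp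
    then show ?thesis unfolding E_def using limI by fastforce
  qed
  have Esym: "E x y = E y x" for x y
  proof -
    have "D k x y = D k y x" for k
      using l1_uminus[of "Q k" "\<lambda>q. b k x q - b k y q"] by (simp add: D_def)
    then show ?thesis by (simp add: E_def)
  qed
  text \<open>\<open>(False, x)\<close> stands for the point \<open>b k x\<close> and \<open>(True, x)\<close> for its image under the affine map of \<open>s\<close>.\<close>
  define u where "u k s = (\<lambda>(i, x) q. if i then b k x (act k q (inv\<^bsub>G\<^esub> s)) + b k s q else b k x q)" for k s
  define prj where "prj s = (\<lambda>(i, x). if i then x \<otimes> s else x)" for s
  define D' where "D' k s p p' = l1 (Q k) (\<lambda>q. u k s p q - u k s p' q) / m k" for k s p p'
  have dfr: "(\<lambda>k. l1 (Q (r k)) (defect G (act (r k)) (b (r k)) x y) / m (r k)) \<longlonglongrightarrow> 0"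
    if "x \<in> carrier G" "y \<in> carrier G" for x y
    using LIMSEQ_subseq_LIMSEQ[OF dfc[OF that] r] by (simp add: comp_def)
  \<comment> \<open>The affine image of \<open>b k x\<close> differs from
    \<open>b k (x \<otimes> s)\<close> by a defect, which is negligible after division by
    \<open>m k\<close>. Hence distances of points converge to those of their projections under
    \<open>prj s\<close>.\<close>
  have D'E: "(\<lambda>k. D' (r k) s p p') \<longlonglongrightarrow> E (prj s p) (prj s p')"
    if s: "s \<in> carrier G" and p: "p \<in> UNIV \<times> carrier G" "p' \<in> UNIV \<times> carrier G" for s p p'
  proof -
    have prjc: "prj s p \<in> carrier G" "prj s p' \<in> carrier G" using s p by (auto simp: prj_def)
    define e where "e k z = l1 (Q k) (defect G (act k) (b k) (snd z) s) / m k" for k and z :: "bool \<times> 'g"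
    have e0: "(\<lambda>k. e (r k) p + e (r k) p') \<longlonglongrightarrow> 0 + 0"
      unfolding e_def using p s by (intro tendsto_add dfr) auto
    have dist: "l1 (Q k) (\<lambda>q. u k s z q - b k (prj s z) q) / m k \<le> e k z" for k z
    proof (cases "fst z")
      case True
      then have "l1 (Q k) (\<lambda>q. u k s z q - b k (prj s z) q) = l1 (Q k) (\<lambda>q. - defect G (act k) (b k) (snd z) s q)"
        by (intro l1_cong) (simp add: u_def prj_def defect_def case_prod_unfold)
      then show ?thesis by (simp add: e_def l1_uminus)
    next
      case False
      then have "l1 (Q k) (\<lambda>q. u k s z q - b k (prj s z) q) = 0"
        by (simp add: u_def prj_def case_prod_unfold l1_def)
      then show ?thesis using m[of k] by (simp add: e_def divide_nonneg_pos[OF l1_nonneg])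
    qed
    have "\<bar>D' k s p p' - D k (prj s p) (prj s p')\<bar> \<le> e k p + e k p'" for k
    proof -
      have "\<bar>l1 (Q k) (\<lambda>q. u k s p q - u k s p' q) - l1 (Q k) (\<lambda>q. b k (prj s p) q - b k (prj s p') q)\<bar>
        \<le> l1 (Q k) (\<lambda>q. (u k s p q - u k s p' q) - (b k (prj s p) q - b k (prj s p') q))"
        by (rule l1_dist)
      also have "\<dots> = l1 (Q k) (\<lambda>q. (u k s p q - b k (prj s p) q) - (u k s p' q - b k (prj s p') q))"
        by (intro l1_cong) simp
      also have "\<dots> \<le> l1 (Q k) (\<lambda>q. u k s p q - b k (prj s p) q) + l1 (Q k) (\<lambda>q. u k s p' q - b k (prj s p') q)"
        by (rule l1_diff)
      finally have "\<bar>l1 (Q k) (\<lambda>q. u k s p q - u k s p' q) - l1 (Q k) (\<lambda>q. b k (prj s p) q - b k (prj s p') q)\<bar> / m k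
        \<le> (l1 (Q k) (\<lambda>q. u k s p q - b k (prj s p) q) + l1 (Q k) (\<lambda>q. u k s p' q - b k (prj s p') q)) / m k"
        using m[of k] by (intro divide_right_mono) auto
      moreover have "\<bar>l1 (Q k) (\<lambda>q. u k s p q - u k s p' q) - l1 (Q k) (\<lambda>q. b k (prj s p) q - b k (prj s p') q)\<bar> / m k
        = \<bar>D' k s p p' - D k (prj s p) (prj s p')\<bar>"
        using m[of k] by (simp add: D'_def D_def flip: diff_divide_distrib)
      ultimately show ?thesis using dist[of k p] dist[of k p'] by (simp add: add_divide_distrib)
    qed
    then have "\<forall>\<^sub>F k in sequentially. norm (D' (r k) s p p' - D (r k) (prj s p) (prj s p')) \<le> e (r k) p + e (r k) p'"
      by simp
    from Lim_null_comparison[OF this] have "(\<lambda>k. D' (r k) s p p' - D (r k) (prj s p) (prj s p')) \<longlonglongrightarrow> 0"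
      using e0 by simp
    from tendsto_add[OF this DE[OF prjc]] show ?thesis by simp
  qed
  \<comment> \<open>For every \<open>k\<close> the affine map of \<open>g\<close> permutes
    \<open>Q k\<close> and adds a fixed function, so it preserves distances exactly.\<close>
  have Einv: "E (x \<otimes> g) (y \<otimes> g) = E x y" if "x \<in> carrier G" "y \<in> carrier G" "g \<in> carrier G" for x y g
  proof -
    have "D' k g (True, x) (True, y) = D k x y" for k
      using perm[of "inv\<^bsub>G\<^esub> g" k "\<lambda>q. b k x q - b k y q"] that by (simp add: D'_def D_def u_def)
    then have "(\<lambda>k. D (r k) x y) \<longlonglongrightarrow> E (x \<otimes> g) (y \<otimes> g)"
      using D'E[of g "(True, x)" "(True, y)"] that by (simp add: prj_def)
    then show ?thesis using DE that LIMSEQ_unique by blast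
  qed
  define K where "K = dker E"
  \<comment> \<open>For each \<open>k\<close> the quadratic form is a positive multiple of a square
    norm by \<open>quad_dker_l1\<close>; nonnegativity passes to the limit.\<close>
  have psd: "0 \<le> quad K c" if c: "snd ` set c \<subseteq> carrier G \<times> carrier G" for c
  proof (rule tendsto_lowerbound)
    show "(\<lambda>k. quad (dker (D (r k))) c) \<longlonglongrightarrow> quad K c"
      unfolding K_def using c DE by (rule tendsto_quad_dker)
    have "0 \<le> quad (dker (D k)) c" for k
    proof -
      have "finite (Q k)" using gs by (simp add: finite_gset_def)
      then obtain L where L: "\<forall>x\<in>fst ` snd ` set c \<union> snd ` snd ` set c. \<forall>q\<in>Q k. \<bar>b k x q\<bar> \<le> L"
        using ex_bound[of "fst ` snd ` set c \<union> snd ` snd ` set c" "Q k" "b k"] by auto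
      have "quad (dker (\<lambda>x y. l1 (Q k) (b k x - b k y))) c = (\<Sum>q\<in>Q k. \<Sum>j\<in>{-L..<L}. (vec (b k) c q j)\<^sup>2)"
        by (rule quad_dker_l1) (use L in \<open>force simp: image_iff\<close>)
      then have "0 \<le> quad (dker (\<lambda>x y. l1 (Q k) (b k x - b k y))) c" by (simp add: sum_nonneg)
      moreover have "D k = (\<lambda>x y. l1 (Q k) (b k x - b k y) / m k)" by (intro ext) (simp add: D_def fun_diff_def)
      ultimately show ?thesis using m[of k] by (simp add: dker_divide quad_divide)
    qed
    then show "\<forall>\<^sub>F k in sequentially. 0 \<le> quad (dker (D (r k))) c" by simp
  qed simp
  have "\<exists>M. \<forall>\<epsilon>>0. \<exists>c. snd ` set c \<subseteq> carrier G \<times> carrier G \<and> quad K c \<le> M \<and>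
    (\<forall>g\<in>carrier G. quad K ((1, (\<one>, g)) # push (shift G g) c @ scale (-1) c) \<le> \<epsilon>)"
  proof (rule property_T_kernel[OF T])
    show "K p q = K q p" for p q by (auto simp: K_def dker_def case_prod_unfold Esym)
    show "0 \<le> quad K c" if "snd ` set c \<subseteq> carrier G \<times> carrier G" for c using that by (rule psd)
    show "K (shift G g p) (shift G g q) = K p q" if "g \<in> carrier G" "p \<in> carrier G \<times> carrier G" "q \<in> carrier G \<times> carrier G" for g p q
      using that by (auto simp: K_def dker_def shift_def Einv)
    show "K (x, z) p = K (x, y) p + K (y, z) p" for x y z p
      by (auto simp: K_def dker_def case_prod_unfold field_simps)
  qed
  then obtain M0 where M0: "\<And>\<epsilon>. \<epsilon> > 0 \<Longrightarrow> \<exists>c. snd ` set c \<subseteq> carrier G \<times> carrier G \<and> quad K c \<le> M0 \<and>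
    (\<forall>g\<in>carrier G. quad K ((1, (\<one>, g)) # push (shift G g) c @ scale (-1) c) \<le> \<epsilon>)" by blast
  \<comment> \<open>Raising the bound by 1 makes it strict, so that it holds eventually along the
    sequence. The next constants are chosen so that with \<open>X = 2 * \<epsilon> * m k\<close> and
    \<open>Y = M * m k\<close> both parts of the hypothesis of \<open>rounding\<close>,
    \<open>6 * X + 3 * X / \<eta>\<close> and \<open>3 * \<eta> * Y\<close>, equal
    \<open>m k / (12 * (n + 1))\<close>.\<close>
  define M where "M = \<bar>M0\<bar> + 1"
  define n where "n = real (card S)"
  define \<eta> where "\<eta> = 1 / (3 * (12 * (n + 1)) * M)"
  define \<epsilon> where "\<epsilon> = 1 / (2 * (12 * (n + 1)) * (6 + 3 / \<eta>))"
  have pos: "M > 0" "n \<ge> 0" "\<eta> > 0" by (auto simp: M_def n_def \<eta>_def)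
  then have "6 + 3 / \<eta> > 0" by (simp add: add_pos_pos)
  then have \<epsilon>: "\<epsilon> > 0" using pos by (simp add: \<epsilon>_def)
  obtain c where c: "snd ` set c \<subseteq> carrier G \<times> carrier G" "quad K c \<le> M0"
    and cg: "\<And>g. g \<in> carrier G \<Longrightarrow> quad K ((1, (\<one>, g)) # push (shift G g) c @ scale (-1) c) \<le> \<epsilon>"
    using M0[OF \<epsilon>] by blast
  \<comment> \<open>The displacement of the approximate fixed point, written with exact affine
    images instead of the points \<open>b k (x \<otimes> s)\<close>. Only the exact images
    correspond to a translation of \<open>V\<close>, while in the limit both agree.\<close>
  define d where "d = (1, ((False, \<one>), (True, \<one>))) # push (\<lambda>(x, y). ((True, x), (True, y))) c
    @ scale (-1) (push (\<lambda>(x, y). ((False, x), (False, y))) c)"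
  have set_scale: "snd ` set (scale t c') = snd ` set c'" for t and c' :: "(real \<times> 'z) list"
    by (force simp: scale_def)
  have dc: "snd ` set d \<subseteq> (UNIV \<times> carrier G) \<times> (UNIV \<times> carrier G)"
    using c(1) by (auto simp: d_def set_scale set_push image_Un)
  have dlim: "(\<lambda>k. quad (dker (D' (r k) s)) d) \<longlonglongrightarrow> quad K ((1, (\<one>, s)) # push (shift G s) c @ scale (-1) c)"
    if s: "s \<in> carrier G" for s
  proof -
    have "(\<lambda>k. quad (dker (D' (r k) s)) d) \<longlonglongrightarrow> quad (dker (\<lambda>p p'. E (prj s p) (prj s p'))) d"
      using dc D'E[OF s] by (rule tendsto_quad_dker)
    also have "dker (\<lambda>p p'. E (prj s p) (prj s p')) = (\<lambda>i j. K (map_prod (prj s) (prj s) i) (map_prod (prj s) (prj s) j))"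
      by (auto simp: K_def dker_def fun_eq_iff)
    also have "quad \<dots> d = quad K (push (map_prod (prj s) (prj s)) d)" by (simp add: quad_push)
    also have "push (map_prod (prj s) (prj s)) d = (1, (\<one>, s)) # push (shift G s) c @ scale (-1) c"
      using s by (simp add: d_def push_scale prj_def) (simp add: push_def comp_def case_prod_unfold shift_def)
    finally show ?thesis .
  qed
  \<comment> \<open>\<open>S\<close> is finite and \<open>c\<close> is fixed, so finitely many
    inequalities pass from the limit to a common member of the sequence.\<close>
  have "\<forall>\<^sub>F k in sequentially. \<forall>s\<in>S. quad (dker (D' (r k) s)) d < 2 * \<epsilon>"
  proof (rule eventually_ball_finite[OF S(1)], rule ballI)
    fix s assume "s \<in> S"
    then have s: "s \<in> carrier G" using S by auto
    show "\<forall>\<^sub>F k in sequentially. quad (dker (D' (r k) s)) d < 2 * \<epsilon>"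
      using order_tendstoD(2)[OF dlim[OF s], of "2 * \<epsilon>"] cg[OF s] \<epsilon> by simp
  qed
  moreover have "\<forall>\<^sub>F k in sequentially. quad (dker (D (r k))) c < M"
  proof -
    have "(\<lambda>k. quad (dker (D (r k))) c) \<longlonglongrightarrow> quad K c" unfolding K_def using c(1) DE by (rule tendsto_quad_dker)
    from order_tendstoD(2)[OF this, of M] show ?thesis using c(2) by (simp add: M_def)
  qed
  ultimately have "\<forall>\<^sub>F k in sequentially. (\<forall>s\<in>S. quad (dker (D' (r k) s)) d < 2 * \<epsilon>) \<and> quad (dker (D (r k))) c < M"
    by (rule eventually_conj)
  then obtain k' where k': "\<forall>s\<in>S. quad (dker (D' (r k') s)) d < 2 * \<epsilon>" "quad (dker (D (r k'))) c < M"
    using eventually_happens'[OF sequentially_bot] by blast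
  define k where "k = r k'"
  define P where "P = {\<one>} \<union> S \<union> fst ` snd ` set c \<union> snd ` snd ` set c"
  have "finite (Q k)" "finite P" using gs S by (auto simp: finite_gset_def P_def)
  then obtain L where L0: "L \<ge> 0" and LP: "\<forall>x\<in>P. \<forall>q\<in>Q k. \<bar>b k x q\<bar> \<le> L"
    using ex_bound[of P "Q k" "b k"] by blast
  have L: "\<bar>b k x q\<bar> \<le> L" if "x \<in> P" "q \<in> Q k" for x q using LP that by blast
  have cP: "x \<in> P" "y \<in> P" if "(x, y) \<in> snd ` set c" for x y using that by (force simp: P_def)+
  have actQ: "act k q (inv\<^bsub>G\<^esub> s) \<in> Q k" if "q \<in> Q k" "s \<in> S" for q s
    using gs[of k] that S by (auto simp: finite_gset_def)
  \<comment> \<open>The approximate fixed point at stage \<open>k\<close>: the subgraph indicator of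
    \<open>b k \<one>\<close> moved by the combination \<open>c\<close>.\<close>
  define V where "V q j = of_bool (j < b k \<one> q) + vec (b k) c q j" for q j
  have vec0: "vec (b k) c q j = 0" if "q \<in> Q k" "j < -L \<or> j \<ge> L" for q j
  proof -
    have "vec (b k) c q j = lin (\<lambda>_. 0) c" unfolding vec_def
    proof (rule lin_cong)
      fix i assume i: "i \<in> snd ` set c"
      obtain x y where [simp]: "i = (x, y)" by (cases i)
      have "\<bar>b k x q\<bar> \<le> L" "\<bar>b k y q\<bar> \<le> L" using L cP i that by auto
      then show "(case i of (x, y) \<Rightarrow> of_bool (j < b k y q) - of_bool (j < b k x q)) = (0::real)"
        using that by auto
    qed
    then show ?thesis by simp
  qed
  \<comment> \<open>Adding \<open>b k s q\<close> to an integer function translates its subgraph in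
    column \<open>q\<close>. The affine map of \<open>s\<close> thus becomes a twisted translation
    of functions on \<open>Q \<times> \<int>\<close>, and the difference is exactly the vector of
    \<open>d\<close>.\<close>
  have Vd: "V (act k q (inv\<^bsub>G\<^esub> s)) (j - b k s q) - V q j = vec (u k s) d q j" for s q j
  proof -
    have "(j - b k s q < x) = (j < x + b k s q)" for x by linarith
    then show ?thesis
      by (simp add: V_def vec_def d_def u_def comp_def case_prod_unfold)
  qed
  obtain f where f: "(\<Sum>s\<in>S. l1 (Q k) (\<lambda>q. b k s q + f (act k q (inv\<^bsub>G\<^esub> s)) - f q)) < m k"
  proof (rule rounding[where Q = "Q k" and S = S and V = V and L = L and \<sigma> = "\<lambda>s q. act k q (inv\<^bsub>G\<^esub> s)"
        and \<beta> = "b k" and \<omega> = "\<lambda>q j. of_bool (j < b k \<one> q)" and \<eta> = \<eta> and X = "2 * \<epsilon> * m k" and Y = "M * m k" and m = "m k"])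
    show "finite (Q k)" using gs by (simp add: finite_gset_def)
    show "V q j = 1" if "q \<in> Q k" "j < -L" for q j
    proof -
      have "\<bar>b k \<one> q\<bar> \<le> L" using that L by (simp add: P_def)
      then show ?thesis using that vec0 by (simp add: V_def)
    qed
    show "V q j = 0" if "q \<in> Q k" "j \<ge> L" for q j
    proof -
      have "\<bar>b k \<one> q\<bar> \<le> L" using that L by (simp add: P_def)
      then show ?thesis using that vec0 by (simp add: V_def)
    qed
    show "\<bar>b k s q\<bar> \<le> L" if "s \<in> S" "q \<in> Q k" for s q using that L by (simp add: P_def)
    show "(\<Sum>q\<in>Q k. \<Sum>j\<in>{- 2 * L..<2 * L}. (V (act k q (inv\<^bsub>G\<^esub> s)) (j - b k s q) - V q j)\<^sup>2) \<le> 2 * \<epsilon> * m k"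
      if s: "s \<in> S" for s
    proof -
      \<comment> \<open>An affine image is a sum of two values bounded by \<open>L\<close>, which
        accounts for the window of doubled size.\<close>
      have "\<bar>u k s p q\<bar> \<le> 2 * L" if p: "snd p \<in> P" and q: "q \<in> Q k" for p q
      proof -
        have "\<bar>b k s q\<bar> \<le> L" "\<bar>b k (snd p) q\<bar> \<le> L" "\<bar>b k (snd p) (act k q (inv\<^bsub>G\<^esub> s))\<bar> \<le> L"
          using p q s L actQ by (auto simp: P_def)
        then show ?thesis by (auto simp: u_def case_prod_unfold)
      qed
      moreover have "snd x \<in> P \<and> snd y \<in> P" if "(x, y) \<in> snd ` set d" for x y
      proof -
        have "x \<in> P" "y \<in> P" if "(a, (x, y)) \<in> set c" for a x y
          using cP[of x y] that by force+
        moreover have "\<one> \<in> P" by (simp add: P_def)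
        ultimately show ?thesis
          using that unfolding d_def by (auto simp: set_scale set_push image_Un)
      qed
      ultimately have "quad (dker (\<lambda>x y. l1 (Q k) (u k s x - u k s y))) d = (\<Sum>q\<in>Q k. \<Sum>j\<in>{-(2*L)..<2*L}. (vec (u k s) d q j)\<^sup>2)"
        by (intro quad_dker_l1) blast
      moreover have "quad (dker (\<lambda>x y. l1 (Q k) (u k s x - u k s y))) d = m k * quad (dker (D' k s)) d"
      proof -
        have "D' k s = (\<lambda>x y. l1 (Q k) (u k s x - u k s y) / m k)" by (intro ext) (simp add: D'_def fun_diff_def)
        then show ?thesis using m[of k] by (simp add: dker_divide quad_divide)
      qed
      moreover have "m k * quad (dker (D' k s)) d \<le> m k * (2 * \<epsilon>)"
        using k'(1) s m[of k] unfolding k_def by (intro mult_left_mono) (auto intro: less_imp_le)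
      ultimately show ?thesis by (simp add: Vd mult.commute)
    qed
    show "(\<Sum>q\<in>Q k. \<Sum>j\<in>{- 2 * L..<2 * L}. (V q j - of_bool (j < b k \<one> q))\<^sup>2) \<le> M * m k"
    proof -
      have "\<bar>b k x q\<bar> \<le> 2 * L" if "x \<in> P" "q \<in> Q k" for x q using L[OF that] L0 by linarith
      then have "quad (dker (\<lambda>x y. l1 (Q k) (b k x - b k y))) c = (\<Sum>q\<in>Q k. \<Sum>j\<in>{-(2*L)..<2*L}. (vec (b k) c q j)\<^sup>2)"
        using cP by (intro quad_dker_l1) blast
      moreover have "quad (dker (\<lambda>x y. l1 (Q k) (b k x - b k y))) c = m k * quad (dker (D k)) c"
      proof -
        have "D k = (\<lambda>x y. l1 (Q k) (b k x - b k y) / m k)" by (intro ext) (simp add: D_def fun_diff_def)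
        then show ?thesis using m[of k] by (simp add: dker_divide quad_divide)
      qed
      moreover have "m k * quad (dker (D k)) c \<le> m k * M"
        using k'(2) m[of k] unfolding k_def by (intro mult_left_mono) auto
      ultimately show ?thesis by (simp add: V_def mult.commute)
    qed
    have "n * (6 * (2 * \<epsilon>) + 3 * (2 * \<epsilon> / \<eta> + \<eta> * M)) = n / (n + 1) * (1/6)"
    proof -
      have "2 * \<epsilon> * (6 + 3 / \<eta>) = 1 / (12 * (n + 1))"
      proof -
        have "2 * (1 / (2 * w * z)) * z = 1 / w" if "z > 0" for w z :: real
          using that by simp
        from this[OF \<open>6 + 3 / \<eta> > 0\<close>] show ?thesis unfolding \<epsilon>_def .
      qed
      moreover have "3 * (\<eta> * M) = 1 / (12 * (n + 1))"
      proof -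
        have "3 * (1 / (3 * w * M) * M) = 1 / w" for w :: real using pos by simp
        from this show ?thesis unfolding \<eta>_def .
      qed
      moreover have "6 * (2 * \<epsilon>) + 3 * (2 * \<epsilon> / \<eta> + \<eta> * M) = 2 * \<epsilon> * (6 + 3 / \<eta>) + 3 * (\<eta> * M)"
        by (simp add: algebra_simps)
      ultimately have "6 * (2 * \<epsilon>) + 3 * (2 * \<epsilon> / \<eta> + \<eta> * M) = 2 * (1 / (12 * (n + 1)))" by linarith
      moreover have "n * (2 * (1 / (12 * w))) = n / w * (1/6)" for w by simp
      ultimately show ?thesis by (simp only:)
    qed
    also have "\<dots> < 1 / 3" using pos by (simp add: divide_less_eq)
    finally have "m k * (n * (6 * (2 * \<epsilon>) + 3 * (2 * \<epsilon> / \<eta> + \<eta> * M))) < m k * (1 / 3)"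
      using m[of k] by (rule mult_strict_left_mono)
    then show "real (card S) * (6 * (2 * \<epsilon> * m k) + 3 * (2 * \<epsilon> * m k / \<eta> + \<eta> * (M * m k))) < m k / 3"
      by (simp add: n_def algebra_simps)
  qed (use S L0 pos actQ in auto)
  then show False using min[of k f] by simp
qed

text \<open>The constants do not depend on the finite set, which later makes the filling constant
  independent of the subgroup. If no pair \<open>C\<close>, \<open>R\<close> works, the choice of
  larger and larger constants and finite sets of pairs yields the sequence excluded by
  \<open>almost_cocycle_contradiction\<close>.\<close>

theorem property_T_almost_cocycle:
  fixes G :: "('g, 'b) monoid_scheme"
  assumes T: "property_T G" and S: "finite S" "S \<subseteq> carrier G" "generate G S = carrier G"
  shows "\<exists>C R. finite R \<and> R \<subseteq> carrier G \<times> carrier G \<and> 0 \<le> C \<and>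
    (\<forall>(Q :: 'q set) act b. finite_gset G Q act \<longrightarrow>
      (\<exists>f. \<forall>s\<in>S. l1 Q (\<lambda>q. b s q - (f (act q (inv\<^bsub>G\<^esub> s)) - f q)) \<le> C * (\<Sum>(x, y)\<in>R. l1 Q (defect G act b x y))))"
proof (rule ccontr)
  assume neg: "\<not> ?thesis"
  interpret group G using T by (simp add: property_T_def)
  have cG: "countable (carrier G)" using T by (simp add: property_T_def)
  define A where "A k = from_nat_into (carrier G) ` {..k::nat}" for k
  have A: "finite (A k)" "A k \<subseteq> carrier G" for k
    using from_nat_into[of "carrier G"] by (auto simp: A_def)
  have "\<exists>(Q :: 'q set) act b m. finite_gset G Q act \<and> m > 0 \<and> (\<Sum>s\<in>S. l1 Q (b s)) \<le> m \<and>
     (\<forall>f. m \<le> (\<Sum>s\<in>S. l1 Q (\<lambda>q. b s q + f (act q (inv\<^bsub>G\<^esub> s)) - f q))) \<and>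
     (\<forall>x\<in>A k. \<forall>y\<in>A k. real (Suc k) * l1 Q (defect G act b x y) \<le> m)" for k
  proof -
    have "finite (A k \<times> A k)" "A k \<times> A k \<subseteq> carrier G \<times> carrier G" using A by auto
    with neg have "\<not> (\<forall>(Q :: 'q set) act b. finite_gset G Q act \<longrightarrow>
      (\<exists>f. \<forall>s\<in>S. l1 Q (\<lambda>q. b s q - (f (act q (inv\<^bsub>G\<^esub> s)) - f q)) \<le> real (Suc k) * (\<Sum>(x, y)\<in>A k \<times> A k. l1 Q (defect G act b x y))))"
      using of_nat_0_le_iff by blast
    then obtain Q :: "'q set" and act b0 where Q: "finite_gset G Q act"
      and b0: "\<And>f. \<exists>s\<in>S. real (Suc k) * (\<Sum>(x, y)\<in>A k \<times> A k. l1 Q (defect G act b0 x y)) < l1 Q (\<lambda>q. b0 s q - (f (act q (inv\<^bsub>G\<^esub> s)) - f q))"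
      by (meson not_le)
    define b where "b f s q = b0 s q + f (act q (inv\<^bsub>G\<^esub> s)) - f q" for f s q
    define h where "h f = (\<Sum>s\<in>S. \<Sum>q\<in>Q. \<bar>b f s q\<bar>)" for f
    have h: "(\<Sum>s\<in>S. l1 Q (b f s)) = real_of_int (h f)" for f by (simp add: l1_def h_def)
    have h0: "h f \<ge> 0" for f by (simp add: h_def sum_nonneg)
    \<comment> \<open>Integrality enters here: the norms are natural numbers, so a minimum over all
      modifications by coboundaries is attained.\<close>
    obtain f0 where f0: "\<And>f. nat (h f0) \<le> nat (h f)"
      using ex_has_least_nat[of "\<lambda>_. True" undefined "\<lambda>f. nat (h f)"] by auto
    have f0': "h f0 \<le> h f" for f using f0[of f] h0[of f] by simp
    have add: "b f0 s q + f (act q (inv\<^bsub>G\<^esub> s)) - f q = b (\<lambda>q. f0 q + f q) s q" for f s q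
      by (simp add: b_def)
    \<comment> \<open>A coboundary satisfies the cocycle identity exactly, so it does not change
      defects.\<close>
    have dd: "l1 Q (defect G act (b f0) x y) = l1 Q (defect G act b0 x y)" if "x \<in> carrier G" "y \<in> carrier G" for x y
      using Q that by (intro l1_cong) (simp add: defect_def b_def finite_gset_def inv_mult_group)
    \<comment> \<open>Since the estimate fails for every coboundary, it fails for the minimal
      representative. This makes its norm positive and large compared with the defects.\<close>
    obtain s where s: "s \<in> S" "real (Suc k) * (\<Sum>(x, y)\<in>A k \<times> A k. l1 Q (defect G act b0 x y)) < l1 Q (b f0 s)"
    proof -
      have "(\<lambda>q. b0 s q - (- f0 (act q (inv\<^bsub>G\<^esub> s)) - - f0 q)) = b f0 s" for s
        by (auto simp: b_def)
      then show ?thesis using b0[of "\<lambda>q. - f0 q"] that by auto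
    qed
    have s_le: "l1 Q (b f0 s) \<le> real_of_int (h f0)"
      unfolding h[symmetric] using S s by (intro member_le_sum) (auto simp: l1_nonneg)
    have nn: "0 \<le> (\<Sum>(x, y)\<in>A k \<times> A k. l1 Q (defect G act b0 x y))" by (intro sum_nonneg) (auto simp: l1_nonneg)
    have "0 \<le> real (Suc k) * (\<Sum>(x, y)\<in>A k \<times> A k. l1 Q (defect G act b0 x y))" using nn by (intro mult_nonneg_nonneg) auto
    then have pos: "real_of_int (h f0) > 0" using s s_le by linarith
    have "real (Suc k) * l1 Q (defect G act (b f0) x y) \<le> real_of_int (h f0)" if xy: "x \<in> A k" "y \<in> A k" for x y
    proof -
      have "l1 Q (defect G act b0 x y) \<le> (\<Sum>(x, y)\<in>A k \<times> A k. l1 Q (defect G act b0 x y))"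
        using A xy member_le_sum[of "(x, y)" "A k \<times> A k" "\<lambda>(x, y). l1 Q (defect G act b0 x y)"] by (auto simp: l1_nonneg)
      then have le1: "real (Suc k) * l1 Q (defect G act b0 x y) \<le> real (Suc k) * (\<Sum>(x, y)\<in>A k \<times> A k. l1 Q (defect G act b0 x y))"
        by (intro mult_left_mono) auto
      have "x \<in> carrier G" "y \<in> carrier G" using A xy by auto
      then show ?thesis
        using order_trans[OF le1 less_imp_le[OF less_le_trans[OF s(2) s_le]]] by (simp only: dd)
    qed
    moreover have "real_of_int (h f0) \<le> (\<Sum>s\<in>S. l1 Q (\<lambda>q. b f0 s q + f (act q (inv\<^bsub>G\<^esub> s)) - f q))" for f
      using f0'[of "\<lambda>q. f0 q + f q"] unfolding add by (simp add: h)
    ultimately show ?thesis using Q pos h[of f0]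
      by (intro exI[of _ Q] exI[of _ act] exI[of _ "b f0"] exI[of _ "real_of_int (h f0)"]) auto
  qed
  then have "\<forall>k. \<exists>(Q :: 'q set) act b m. finite_gset G Q act \<and> m > 0 \<and> (\<Sum>s\<in>S. l1 Q (b s)) \<le> m \<and>
     (\<forall>f. m \<le> (\<Sum>s\<in>S. l1 Q (\<lambda>q. b s q + f (act q (inv\<^bsub>G\<^esub> s)) - f q))) \<and>
     (\<forall>x\<in>A k. \<forall>y\<in>A k. real (Suc k) * l1 Q (defect G act b x y) \<le> m)" by blast
  then obtain Q :: "nat \<Rightarrow> 'q set" and act b m where
    Q: "\<And>k. finite_gset G (Q k) (act k)" and m: "\<And>k. m k > 0" and le: "\<And>k. (\<Sum>s\<in>S. l1 (Q k) (b k s)) \<le> m k"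
    and min: "\<And>k f. m k \<le> (\<Sum>s\<in>S. l1 (Q k) (\<lambda>q. b k s q + f (act k q (inv\<^bsub>G\<^esub> s)) - f q))"
    and df: "\<And>k x y. x \<in> A k \<Longrightarrow> y \<in> A k \<Longrightarrow> real (Suc k) * l1 (Q k) (defect G (act k) (b k) x y) \<le> m k"
    unfolding choice_iff by blast
  have "(\<lambda>k. l1 (Q k) (defect G (act k) (b k) x y) / m k) \<longlonglongrightarrow> 0" if xy: "x \<in> carrier G" "y \<in> carrier G" for x y
  proof (rule Lim_null_comparison)
    obtain i j where ij: "x = from_nat_into (carrier G) i" "y = from_nat_into (carrier G) j"
      using from_nat_into_surj[OF cG] xy by metis
    show "\<forall>\<^sub>F k in sequentially. norm (l1 (Q k) (defect G (act k) (b k) x y) / m k) \<le> inverse (real (Suc k))"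
      using eventually_ge_at_top[of "max i j"]
    proof eventually_elim
      case (elim k)
      then have "x \<in> A k" "y \<in> A k" using ij by (auto simp: A_def)
      from df[OF this] show ?case using m[of k] by (simp add: field_simps abs_of_nonneg[OF l1_nonneg])
    qed
    show "(\<lambda>k. inverse (real (Suc k))) \<longlonglongrightarrow> 0" by (rule LIMSEQ_inverse_real_of_nat)
  qed
  then show False
    by (rule almost_cocycle_contradiction[where Q = Q and act = act and m = m and b = b, OF T S Q m le min])
qed

section \<open>Additive maps and linear extension to formal combinations\<close>

definition addhom :: "('m, 'c) ring_scheme \<Rightarrow> ('n, 'd) ring_scheme \<Rightarrow> ('m \<Rightarrow> 'n) \<Rightarrow> bool"
  where "addhom M N f \<longleftrightarrow> f \<in> carrier M \<rightarrow> carrier N \<and>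
    (\<forall>x\<in>carrier M. \<forall>y\<in>carrier M. f (x \<oplus>\<^bsub>M\<^esub> y) = f x \<oplus>\<^bsub>N\<^esub> f y)"

definition fext :: "('m, 'c) ring_scheme \<Rightarrow> ('x \<Rightarrow> 'm) \<Rightarrow> ('x \<Rightarrow>\<^sub>0 int) \<Rightarrow> 'm"
  where "fext M f u = (\<Oplus>\<^bsub>M\<^esub>x\<in>Poly_Mapping.keys u. [Poly_Mapping.lookup u x] \<cdot>\<^bsub>M\<^esub> f x)"

context abelian_group
begin

lemma ipow_closed [simp]: "x \<in> carrier G \<Longrightarrow> [(k::int)] \<cdot> x \<in> carrier G"
  using add.int_pow_closed[of x k] by (simp add: add_pow_def)

lemma ipow_0 [simp]: "[(0::int)] \<cdot> x = \<zero>"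
  by (simp add: add_pow_def)

lemma ipow_1 [simp]: "x \<in> carrier G \<Longrightarrow> [(1::int)] \<cdot> x = x"
  using add.int_pow_1[of x] by (simp add: add_pow_def)

lemma ipow_add: "x \<in> carrier G \<Longrightarrow> [(k + l::int)] \<cdot> x = [k] \<cdot> x \<oplus> [l] \<cdot> x"
  using add.int_pow_mult[of x k l] by (simp add: add_pow_def)

lemma ipow_uminus: "x \<in> carrier G \<Longrightarrow> [(- k::int)] \<cdot> x = \<ominus> ([k] \<cdot> x)"
  using add.int_pow_neg[of x k] by (simp add: add_pow_def a_inv_def)

lemma ipow_distrib: "x \<in> carrier G \<Longrightarrow> y \<in> carrier G \<Longrightarrow> [(k::int)] \<cdot> (x \<oplus> y) = [k] \<cdot> x \<oplus> [k] \<cdot> y"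
  using add.int_pow_mult_distrib[of x y k] by (simp add: add_pow_def a_comm)

lemma ipow_zero [simp]: "[(k::int)] \<cdot> \<zero> = \<zero>"
  using add.int_pow_one[of k] by (simp add: add_pow_def)

lemma fext_superset:
  assumes "finite A" "Poly_Mapping.keys u \<subseteq> A" "f \<in> A \<rightarrow> carrier G"
  shows "fext G f u = (\<Oplus>x\<in>A. [Poly_Mapping.lookup u x] \<cdot> f x)"
  unfolding fext_def
  by (rule add.finprod_mono_neutral_cong_left) (use assms in \<open>auto simp: in_keys_iff\<close>)

lemma fext_closed [simp]: "f \<in> Poly_Mapping.keys u \<rightarrow> carrier G \<Longrightarrow> fext G f u \<in> carrier G"
  unfolding fext_def by (rule finsum_closed) auto

lemma fext_zero [simp]: "fext G f 0 = \<zero>"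
  by (simp add: fext_def)

lemma fext_frag_of [simp]: "f x \<in> carrier G \<Longrightarrow> fext G f (frag_of x) = f x"
  by (simp add: fext_def)

lemma fext_add:
  assumes "Poly_Mapping.keys u \<subseteq> S" "Poly_Mapping.keys v \<subseteq> S" "f \<in> S \<rightarrow> carrier G"
  shows "fext G f (u + v) = fext G f u \<oplus> fext G f v"
proof -
  let ?A = "Poly_Mapping.keys u \<union> Poly_Mapping.keys v"
  have f: "f \<in> ?A \<rightarrow> carrier G" using assms by auto
  have fcl: "f x \<in> carrier G" if "x \<in> ?A" for x using f that by auto
  have "fext G f (u + v) = (\<Oplus>x\<in>?A. [Poly_Mapping.lookup (u + v) x] \<cdot> f x)"
    by (rule fext_superset[OF _ keys_add f]) simp
  also have "\<dots> = (\<Oplus>x\<in>?A. [Poly_Mapping.lookup u x] \<cdot> f x \<oplus> [Poly_Mapping.lookup v x] \<cdot> f x)"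
    by (rule finsum_cong') (auto simp: lookup_add ipow_add fcl)
  also have "\<dots> = (\<Oplus>x\<in>?A. [Poly_Mapping.lookup u x] \<cdot> f x) \<oplus> (\<Oplus>x\<in>?A. [Poly_Mapping.lookup v x] \<cdot> f x)"
    using f by (intro finsum_addf) auto
  also have "\<dots> = fext G f u \<oplus> fext G f v"
    using f fext_superset[of ?A u f] fext_superset[of ?A v f] by simp
  finally show ?thesis .
qed

lemma fext_diff:
  assumes "Poly_Mapping.keys u \<subseteq> S" "Poly_Mapping.keys v \<subseteq> S" "f \<in> S \<rightarrow> carrier G"
  shows "fext G f (u - v) = fext G f u \<ominus> fext G f v"
proof -
  have k: "Poly_Mapping.keys (u - v) \<subseteq> S" using keys_diff[of u v] assms by blast
  have "fext G f ((u - v) + v) = fext G f (u - v) \<oplus> fext G f v" by (rule fext_add[OF k assms(2,3)])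
  moreover have "fext G f u \<in> carrier G" "fext G f v \<in> carrier G" "fext G f (u - v) \<in> carrier G"
    using assms k by (auto intro!: fext_closed)
  ultimately show ?thesis by (simp add: a_minus_def a_assoc r_neg)
qed

lemma fext_cong:
  assumes "\<And>x. x \<in> Poly_Mapping.keys u \<Longrightarrow> f x = g x" "g \<in> Poly_Mapping.keys u \<rightarrow> carrier G"
  shows "fext G f u = fext G g u"
  unfolding fext_def using assms by (intro finsum_cong') auto

lemma fext_frag_extend:
  assumes u: "Poly_Mapping.keys u \<subseteq> S" and b: "\<And>x. x \<in> S \<Longrightarrow> Poly_Mapping.keys (b x) \<subseteq> T"
    and f: "f \<in> T \<rightarrow> carrier G"
  shows "fext G f (frag_extend b u) = fext G (\<lambda>x. fext G f (b x)) u"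
proof -
  have cl: "(\<lambda>x. fext G f (b x)) \<in> S \<rightarrow> carrier G" using b f by (auto intro!: fext_closed)
  have "fext G f (frag_extend b u) = fext G (\<lambda>x. fext G f (b x)) u \<and> Poly_Mapping.keys (frag_extend b u) \<subseteq> T"
    using u
  proof (rule free_Abelian_group_induct)
    fix x y assume xy: "Poly_Mapping.keys x \<subseteq> S" "Poly_Mapping.keys y \<subseteq> S"
      "fext G f (frag_extend b x) = fext G (\<lambda>x. fext G f (b x)) x \<and> Poly_Mapping.keys (frag_extend b x) \<subseteq> T"
      "fext G f (frag_extend b y) = fext G (\<lambda>x. fext G f (b x)) y \<and> Poly_Mapping.keys (frag_extend b y) \<subseteq> T"
    have "Poly_Mapping.keys (frag_extend b x - frag_extend b y) \<subseteq> T"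
      using xy keys_diff by (meson Un_least order_trans)
    then show "fext G f (frag_extend b (x - y)) = fext G (\<lambda>x. fext G f (b x)) (x - y) \<and> Poly_Mapping.keys (frag_extend b (x - y)) \<subseteq> T"
      using xy by (simp add: frag_extend_diff fext_diff[OF _ _ f, of "frag_extend b x" "frag_extend b y"] fext_diff[OF xy(1,2) cl])
  next
    fix a assume "a \<in> S" then show "fext G f (frag_extend b (frag_of a)) = fext G (\<lambda>x. fext G f (b x)) (frag_of a) \<and> Poly_Mapping.keys (frag_extend b (frag_of a)) \<subseteq> T"
      using b cl by (auto simp: Pi_iff)
  qed simp
  then show ?thesis by blast
qed

end

lemma addhom_closed: "addhom M N f \<Longrightarrow> x \<in> carrier M \<Longrightarrow> f x \<in> carrier N"
  by (auto simp: addhom_def)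

lemma addhom_add: "addhom M N f \<Longrightarrow> x \<in> carrier M \<Longrightarrow> y \<in> carrier M \<Longrightarrow> f (x \<oplus>\<^bsub>M\<^esub> y) = f x \<oplus>\<^bsub>N\<^esub> f y"
  by (auto simp: addhom_def)

lemma addhom_zero:
  assumes "abelian_group M" "abelian_group N" "addhom M N f" shows "f \<zero>\<^bsub>M\<^esub> = \<zero>\<^bsub>N\<^esub>"
proof -
  interpret M: abelian_group M by fact
  interpret N: abelian_group N by fact
  have "f \<zero>\<^bsub>M\<^esub> \<oplus>\<^bsub>N\<^esub> f \<zero>\<^bsub>M\<^esub> = f \<zero>\<^bsub>M\<^esub>" using addhom_add[OF assms(3), of "\<zero>\<^bsub>M\<^esub>" "\<zero>\<^bsub>M\<^esub>"] by simp
  then show ?thesis using addhom_closed[OF assms(3) M.zero_closed] by (metis N.add.r_cancel_one')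
qed

lemma addhom_minus:
  assumes "abelian_group M" "abelian_group N" "addhom M N f" "x \<in> carrier M" "y \<in> carrier M"
  shows "f (x \<ominus>\<^bsub>M\<^esub> y) = f x \<ominus>\<^bsub>N\<^esub> f y"
proof -
  interpret M: abelian_group M by fact
  interpret N: abelian_group N by fact
  note cl = addhom_closed[OF assms(3)]
  have "f (x \<ominus>\<^bsub>M\<^esub> y) \<oplus>\<^bsub>N\<^esub> f y = f ((x \<ominus>\<^bsub>M\<^esub> y) \<oplus>\<^bsub>M\<^esub> y)"
    using assms by (subst addhom_add[OF assms(3)]) auto
  also have "(x \<ominus>\<^bsub>M\<^esub> y) \<oplus>\<^bsub>M\<^esub> y = x" using assms by (simp add: a_minus_def M.a_assoc M.l_neg)
  finally have "(f (x \<ominus>\<^bsub>M\<^esub> y) \<oplus>\<^bsub>N\<^esub> f y) \<ominus>\<^bsub>N\<^esub> f y = f x \<ominus>\<^bsub>N\<^esub> f y" by simp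
  then show ?thesis using cl assms by (simp add: a_minus_def N.a_assoc N.r_neg)
qed

lemma addhom_fext:
  assumes M: "abelian_group M" and N: "abelian_group N" and h: "addhom M N h"
    and u: "Poly_Mapping.keys u \<subseteq> S" and f: "f \<in> S \<rightarrow> carrier M"
  shows "h (fext M f u) = fext N (\<lambda>x. h (f x)) u"
proof -
  interpret M: abelian_group M by fact
  interpret N: abelian_group N by fact
  have hf: "(\<lambda>x. h (f x)) \<in> S \<rightarrow> carrier N" using f addhom_closed[OF h] by auto
  show ?thesis using u
  proof (rule free_Abelian_group_induct)
    show "h (fext M f 0) = fext N (\<lambda>x. h (f x)) 0" by (simp add: addhom_zero[OF M N h])
  next
    fix a assume "a \<in> S" then show "h (fext M f (frag_of a)) = fext N (\<lambda>x. h (f x)) (frag_of a)"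
      using f hf by (auto simp: Pi_iff)
  next
    fix x y assume xy: "Poly_Mapping.keys x \<subseteq> S" "Poly_Mapping.keys y \<subseteq> S"
      "h (fext M f x) = fext N (\<lambda>x. h (f x)) x" "h (fext M f y) = fext N (\<lambda>x. h (f x)) y"
    have "fext M f x \<in> carrier M" "fext M f y \<in> carrier M" using xy f by (auto intro!: M.fext_closed)
    then show "h (fext M f (x - y)) = fext N (\<lambda>x. h (f x)) (x - y)"
      using xy by (simp add: M.fext_diff[OF _ _ f] N.fext_diff[OF _ _ hf] addhom_minus[OF M N h])
  qed
qed

lemma addhom_finsum:
  assumes M: "abelian_group M" and N: "abelian_group N" and h: "addhom M N h"
    and fin: "finite A" and f: "f \<in> A \<rightarrow> carrier M"
  shows "h (\<Oplus>\<^bsub>M\<^esub>i\<in>A. f i) = (\<Oplus>\<^bsub>N\<^esub>i\<in>A. h (f i))"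
proof -
  interpret M: abelian_group M by fact
  interpret N: abelian_group N by fact
  show ?thesis using fin f
  proof (induction A)
    case empty then show ?case by (simp add: addhom_zero[OF M N h])
  next
    case (insert i A)
    then have "(\<Oplus>\<^bsub>M\<^esub>i\<in>A. f i) \<in> carrier M" by (intro M.finsum_closed) auto
    with insert show ?case
      using addhom_closed[OF h] by (simp add: addhom_add[OF h] Pi_iff)
  qed
qed

lemma addhom_ipow:
  assumes M: "abelian_group M" and N: "abelian_group N" and h: "addhom M N h" and x: "x \<in> carrier M"
  shows "h ([(k::int)] \<cdot>\<^bsub>M\<^esub> x) = [k] \<cdot>\<^bsub>N\<^esub> h x"
proof -
  interpret M: abelian_group M by fact
  interpret N: abelian_group N by fact
  note cl = addhom_closed[OF h]
  have n: "h ([int n] \<cdot>\<^bsub>M\<^esub> x) = [int n] \<cdot>\<^bsub>N\<^esub> h x" for n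
  proof (induction n)
    case 0 then show ?case using addhom_zero[OF M N h] by simp
  next
    case (Suc n)
    then show ?case using x cl by (simp add: M.ipow_add N.ipow_add addhom_add[OF h])
  qed
  show ?thesis
  proof (cases k)
    case (nonneg n) then show ?thesis using n by simp
  next
    case (neg n)
    have "h (\<zero>\<^bsub>M\<^esub> \<ominus>\<^bsub>M\<^esub> [int (Suc n)] \<cdot>\<^bsub>M\<^esub> x) = \<zero>\<^bsub>N\<^esub> \<ominus>\<^bsub>N\<^esub> [int (Suc n)] \<cdot>\<^bsub>N\<^esub> h x"
      using x n[of "Suc n"] by (subst addhom_minus[OF M N h]) (simp_all add: addhom_zero[OF M N h] del: of_nat_Suc)
    then show ?thesis using neg x cl
      by (simp add: M.ipow_uminus N.ipow_uminus a_minus_def del: of_nat_Suc)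
  qed
qed

section \<open>The bar complex\<close>

text \<open>Homogeneous simplices \<open>[x\<^sub>0, \<dots>, x\<^sub>i]\<close>; the empty list spans degree \<open>-1\<close>, so the complex is augmented.\<close>

definition join :: "'g \<Rightarrow> ('g list \<Rightarrow>\<^sub>0 int) \<Rightarrow> ('g list \<Rightarrow>\<^sub>0 int)"
  where "join x = frag_extend (\<lambda>l. frag_of (x # l))"

fun bd :: "'g list \<Rightarrow> ('g list \<Rightarrow>\<^sub>0 int)"
  where "bd [] = 0" | "bd (x # l) = frag_of l - join x (bd l)"

definition del :: "nat \<Rightarrow> 'a list \<Rightarrow> 'a list"
  where "del j l = take j l @ drop (Suc j) l"

definition gact :: "('g, 'b) monoid_scheme \<Rightarrow> 'g \<Rightarrow> ('g list \<Rightarrow>\<^sub>0 int) \<Rightarrow> ('g list \<Rightarrow>\<^sub>0 int)"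
  where "gact G g = frag_extend (\<lambda>l. frag_of (map ((\<otimes>\<^bsub>G\<^esub>) g) l))"

lemma join_simps [simp]: "join x 0 = 0" "join x (frag_of l) = frag_of (x # l)" "join x (u - v) = join x u - join x v"
  "join x (u + v) = join x u + join x v"
  by (simp_all add: join_def frag_extend_diff frag_extend_add)

lemma gact_simps [simp]: "gact G g 0 = 0" "gact G g (frag_of l) = frag_of (map ((\<otimes>\<^bsub>G\<^esub>) g) l)"
  "gact G g (u - v) = gact G g u - gact G g v" "gact G g (u + v) = gact G g u + gact G g v"
  by (simp_all add: gact_def frag_extend_diff frag_extend_add)

text \<open>The cone with a fixed vertex contracts the augmented complex. All lifts through the bar
  complex below come from this identity.\<close>

lemma bd_join: "frag_extend bd (join x u) = u - join x (frag_extend bd u)"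
proof -
  have "Poly_Mapping.keys u \<subseteq> UNIV" by simp
  then show ?thesis
    by (induction u rule: frag_induction) (simp_all add: frag_extend_diff)
qed

lemma bd_bd: "frag_extend bd (bd l) = 0"
  by (induction l) (simp_all add: frag_extend_diff bd_join)

lemma keys_join: "Poly_Mapping.keys u \<subseteq> tuples G i \<Longrightarrow> x \<in> carrier G \<Longrightarrow> Poly_Mapping.keys (join x u) \<subseteq> tuples G (Suc i)"
proof
  fix l assume u: "Poly_Mapping.keys u \<subseteq> tuples G i" "x \<in> carrier G" and "l \<in> Poly_Mapping.keys (join x u)"
  then obtain m where "m \<in> Poly_Mapping.keys u" "l = x # m"
    unfolding join_def using keys_frag_extend[of "\<lambda>l. frag_of (x # l)" u] by auto
  then show "l \<in> tuples G (Suc i)" using u by (auto simp: tuples_def)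
qed

lemma keys_bd: "l \<in> tuples G (Suc i) \<Longrightarrow> Poly_Mapping.keys (bd l) \<subseteq> tuples G i"
proof (induction l arbitrary: i)
  case (Cons x l)
  then have l: "l \<in> tuples G i" "x \<in> carrier G" by (auto simp: tuples_def)
  have "Poly_Mapping.keys (join x (bd l)) \<subseteq> tuples G i"
  proof (cases i)
    case 0 then show ?thesis using l by (simp add: tuples_def)
  next
    case (Suc j) then show ?thesis using keys_join[OF Cons.IH[of j] l(2)] l by simp
  qed
  then show ?case using l keys_diff[of "frag_of l" "join x (bd l)"] by auto
qed (simp add: tuples_def)

lemma keys_gact: "group G \<Longrightarrow> Poly_Mapping.keys u \<subseteq> tuples G i \<Longrightarrow> g \<in> carrier G \<Longrightarrow> Poly_Mapping.keys (gact G g u) \<subseteq> tuples G i"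
proof
  fix l assume G: "group G" and u: "Poly_Mapping.keys u \<subseteq> tuples G i" "g \<in> carrier G" and "l \<in> Poly_Mapping.keys (gact G g u)"
  then obtain m where "m \<in> Poly_Mapping.keys u" "l = map ((\<otimes>\<^bsub>G\<^esub>) g) m"
    unfolding gact_def using keys_frag_extend[of "\<lambda>l. frag_of (map ((\<otimes>\<^bsub>G\<^esub>) g) l)" u] by auto
  then show "l \<in> tuples G i" using u group.is_monoid[OF G] by (auto simp: tuples_def intro!: monoid.m_closed)
qed

lemma gact_join: "gact G g (join x u) = join (g \<otimes>\<^bsub>G\<^esub> x) (gact G g u)"
proof -
  have "Poly_Mapping.keys u \<subseteq> UNIV" by simp
  then show ?thesis by (induction u rule: frag_induction) simp_all
qed

lemma bd_gact: "frag_extend bd (gact G g u) = gact G g (frag_extend bd u)"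
proof -
  have *: "bd (map ((\<otimes>\<^bsub>G\<^esub>) g) l) = gact G g (bd l)" for l
    by (induction l) (simp_all add: gact_join)
  have "Poly_Mapping.keys u \<subseteq> UNIV" by simp
  then show ?thesis by (induction u rule: frag_induction) (simp_all add: * frag_extend_diff)
qed

text \<open>The recursive form suits the contraction; the alternating sum over vertices is the form
  comparable with \<open>cobd\<close>.\<close>

lemma bd_sum: "bd l = (\<Sum>j<length l. frag_cmul ((-1) ^ j) (frag_of (del j l)))"
proof (induction l)
  case (Cons x l)
  have "join x (frag_cmul c u) = frag_cmul c (join x u)" for c u by (simp add: join_def frag_extend_cmul)
  then have "join x (bd l) = (\<Sum>j<length l. frag_cmul ((-1) ^ j) (frag_of (x # del j l)))"
    unfolding Cons by (simp add: join_def frag_extend_sum comp_def frag_extend_cmul)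
  then have "bd (x # l) = frag_of l + (\<Sum>j<length l. frag_cmul ((-1) ^ Suc j) (frag_of (del (Suc j) (x # l))))"
    by (simp add: del_def sum_negf[symmetric] diff_conv_add_uminus del: add_uminus_conv_diff)
  also have "\<dots> = (\<Sum>j<length (x # l). frag_cmul ((-1) ^ j) (frag_of (del j (x # l))))"
    by (simp add: sum.lessThan_Suc_shift del_def del: sum.lessThan_Suc)
  finally show ?case .
qed simp

section \<open>Homogeneous and inhomogeneous simplices\<close>

fun quots :: "('g, 'b) monoid_scheme \<Rightarrow> 'g \<Rightarrow> 'g list \<Rightarrow> 'g list"
  where "quots G x [] = []" | "quots G x (y # l) = (inv\<^bsub>G\<^esub> x \<otimes>\<^bsub>G\<^esub> y) # quots G y l"

fun pprods :: "('g, 'b) monoid_scheme \<Rightarrow> 'g \<Rightarrow> 'g list \<Rightarrow> 'g list"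
  where "pprods G x [] = []" | "pprods G x (g # l) = (x \<otimes>\<^bsub>G\<^esub> g) # pprods G (x \<otimes>\<^bsub>G\<^esub> g) l"

lemma length_quots [simp]: "length (quots G x l) = length l"
  by (induction l arbitrary: x) auto

lemma length_pprods [simp]: "length (pprods G x l) = length l"
  by (induction l arbitrary: x) auto

context group
begin

lemma set_quots: "x \<in> carrier G \<Longrightarrow> set l \<subseteq> carrier G \<Longrightarrow> set (quots G x l) \<subseteq> carrier G"
  by (induction l arbitrary: x) auto

lemma set_pprods: "x \<in> carrier G \<Longrightarrow> set l \<subseteq> carrier G \<Longrightarrow> set (pprods G x l) \<subseteq> carrier G"
  by (induction l arbitrary: x) auto

lemma quots_pprods: "x \<in> carrier G \<Longrightarrow> set l \<subseteq> carrier G \<Longrightarrow> quots G x (pprods G x l) = l"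
  by (induction l arbitrary: x) (auto simp: m_assoc[symmetric])

lemma quots_map: "g \<in> carrier G \<Longrightarrow> x \<in> carrier G \<Longrightarrow> set l \<subseteq> carrier G \<Longrightarrow> quots G (g \<otimes> x) (map ((\<otimes>) g) l) = quots G x l"
proof (induction l arbitrary: x)
  case (Cons y l)
  have "inv (g \<otimes> x) \<otimes> (g \<otimes> y) = inv x \<otimes> y"
    using Cons.prems by (simp add: inv_mult_group m_assoc) (simp add: m_assoc[symmetric])
  then show ?case using Cons by simp
qed simp

text \<open>Removing a vertex multiplies the two quotients that meet there. The last vertex is
  excluded, since its removal drops a quotient instead; see \<open>quots_butlast\<close>.\<close>

lemma quots_del:
  assumes "x \<in> carrier G" "set l \<subseteq> carrier G" "Suc j < length l"
  shows "quots G x (del j l) = merge_at G j (quots G x l)"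
  using assms
proof (induction l arbitrary: x j)
  case (Cons y l)
  show ?case
  proof (cases j)
    case 0
    obtain z l' where l: "l = z # l'" using Cons.prems 0 by (cases l) auto
    have "inv x \<otimes> z = (inv x \<otimes> y) \<otimes> (inv y \<otimes> z)"
      using Cons.prems l by (simp add: m_assoc) (simp add: m_assoc[symmetric])
    then show ?thesis using l 0 by (simp add: del_def merge_at_def)
  next
    case (Suc i)
    then have "quots G y (del i l) = merge_at G i (quots G y l)" using Cons by auto
    then show ?thesis using Suc by (simp add: del_def merge_at_def)
  qed
qed simp

lemma quots_butlast: "quots G x (butlast l) = butlast (quots G x l)"
  by (induction l arbitrary: x) (auto, case_tac l, auto)

end

locale gmod = G: group G + M: abelian_group M
  for G :: "('g, 'b) monoid_scheme" and M :: "('m, 'c) ring_scheme" +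
  fixes act :: "'g \<Rightarrow> 'm \<Rightarrow> 'm"
  assumes act_closed: "g \<in> carrier G \<Longrightarrow> x \<in> carrier M \<Longrightarrow> act g x \<in> carrier M"
    and act_add: "g \<in> carrier G \<Longrightarrow> x \<in> carrier M \<Longrightarrow> y \<in> carrier M \<Longrightarrow> act g (x \<oplus>\<^bsub>M\<^esub> y) = act g x \<oplus>\<^bsub>M\<^esub> act g y"
    and act_mult: "g \<in> carrier G \<Longrightarrow> h \<in> carrier G \<Longrightarrow> x \<in> carrier M \<Longrightarrow> act (g \<otimes>\<^bsub>G\<^esub> h) x = act g (act h x)"
    and act_one: "x \<in> carrier M \<Longrightarrow> act \<one>\<^bsub>G\<^esub> x = x"
begin

lemma addhom_act: "g \<in> carrier G \<Longrightarrow> addhom M M (act g)"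
  by (auto simp: addhom_def act_closed act_add)

text \<open>The equivariant function on homogeneous simplices that corresponds to an inhomogeneous
  cochain.\<close>

definition homog :: "('g list \<Rightarrow> 'm) \<Rightarrow> 'g list \<Rightarrow> 'm"
  where "homog \<theta> l = act (hd l) (\<theta> (quots G (hd l) (tl l)))"

lemma quots_tuples: "x # l \<in> tuples G (Suc i) \<Longrightarrow> quots G x l \<in> tuples G i"
  using G.set_quots[of x l] by (auto simp: tuples_def)

lemma homog_closed: "\<theta> \<in> tuples G i \<rightarrow> carrier M \<Longrightarrow> l \<in> tuples G (Suc i) \<Longrightarrow> homog \<theta> l \<in> carrier M"
proof -
  assume a: "\<theta> \<in> tuples G i \<rightarrow> carrier M" "l \<in> tuples G (Suc i)"
  then obtain x l' where l: "l = x # l'" by (cases l) (auto simp: tuples_def)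
  then have "\<theta> (quots G x l') \<in> carrier M" using a quots_tuples by blast
  then show ?thesis using a l by (auto simp: homog_def tuples_def intro!: act_closed)
qed

lemma homog_gact:
  assumes "\<theta> \<in> tuples G i \<rightarrow> carrier M" "l \<in> tuples G (Suc i)" "g \<in> carrier G"
  shows "homog \<theta> (map ((\<otimes>\<^bsub>G\<^esub>) g) l) = act g (homog \<theta> l)"
proof -
  obtain x l' where l: "l = x # l'" using assms by (cases l) (auto simp: tuples_def)
  then have "\<theta> (quots G x l') \<in> carrier M" using assms quots_tuples by blast
  then show ?thesis using assms l by (simp add: homog_def tuples_def G.quots_map act_mult)
qed

text \<open>The simplex of partial products starting at \<open>\<one>\<close> has the given tuple as
  its quotients. It serves to read identities of homogeneous functions back as identities of
  cochains.\<close>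

lemma homog_surj:
  assumes "gs \<in> tuples G i"
  obtains l where "l \<in> tuples G (Suc i)" "\<And>\<theta>. \<theta> gs \<in> carrier M \<Longrightarrow> homog \<theta> l = \<theta> gs"
proof
  let ?l = "\<one>\<^bsub>G\<^esub> # pprods G \<one>\<^bsub>G\<^esub> gs"
  show "?l \<in> tuples G (Suc i)" using assms G.set_pprods[of "\<one>\<^bsub>G\<^esub>" gs] by (auto simp: tuples_def)
  show "homog \<theta> ?l = \<theta> gs" if "\<theta> gs \<in> carrier M" for \<theta>
    using that assms by (simp add: homog_def G.quots_pprods tuples_def act_one)
qed

lemma merge_tuples: "gs \<in> tuples G (Suc i) \<Longrightarrow> j < i \<Longrightarrow> merge_at G j gs \<in> tuples G i"
proof -
  assume a: "gs \<in> tuples G (Suc i)" "j < i"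
  have "gs ! j \<in> carrier G" "gs ! Suc j \<in> carrier G" using a nth_mem[of j gs] nth_mem[of "Suc j" gs] by (auto simp: tuples_def)
  moreover have "set (take j gs) \<subseteq> carrier G" "set (drop (j + 2) gs) \<subseteq> carrier G"
    using a set_take_subset[of j gs] set_drop_subset[of "j + 2" gs] by (auto simp: tuples_def)
  ultimately show ?thesis using a by (auto simp: merge_at_def tuples_def)
qed

lemma tl_tuples: "gs \<in> tuples G (Suc i) \<Longrightarrow> tl gs \<in> tuples G i \<and> hd gs \<in> carrier G"
  by (cases gs) (auto simp: tuples_def)

lemma butlast_tuples: "gs \<in> tuples G (Suc i) \<Longrightarrow> butlast gs \<in> tuples G i"
  by (auto simp: tuples_def dest: in_set_butlastD)

lemma cobd_closed:
  assumes "\<theta> \<in> tuples G i \<rightarrow> carrier M" shows "cobd G M act i \<theta> \<in> cochains G M (Suc i)"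
  unfolding cobd_def cochains_def
proof (rule restrict_PiE_iff[THEN iffD2], rule ballI)
  fix gs assume gs: "gs \<in> tuples G (Suc i)"
  show "act (hd gs) (\<theta> (tl gs)) \<oplus>\<^bsub>M\<^esub> (\<Oplus>\<^bsub>M\<^esub>j\<in>{..<i}. [((-1::int) ^ Suc j)] \<cdot>\<^bsub>M\<^esub> \<theta> (merge_at G j gs))
    \<oplus>\<^bsub>M\<^esub> [((-1::int) ^ Suc i)] \<cdot>\<^bsub>M\<^esub> \<theta> (butlast gs) \<in> carrier M"
    using assms merge_tuples[OF gs] tl_tuples[OF gs] butlast_tuples[OF gs]
    by (intro M.a_closed M.finsum_closed M.ipow_closed act_closed) auto
qed

text \<open>The face opposite to the first vertex gives the term with the action, interior faces
  give the merged tuples and the last face gives the shortened tuple. The inhomogeneous coboundary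
  is therefore dual to \<open>bd\<close>.\<close>

lemma homog_cobd:
  assumes \<theta>: "\<theta> \<in> tuples G i \<rightarrow> carrier M" and l: "l \<in> tuples G (Suc (Suc i))"
  shows "homog (cobd G M act i \<theta>) l = fext M (homog \<theta>) (bd l)"
proof -
  obtain x m where lx: "l = x # m" using l by (cases l) (auto simp: tuples_def)
  obtain y m' where my: "m = y # m'" using l lx by (cases m) (auto simp: tuples_def)
  have xy: "x \<in> carrier G" "y \<in> carrier G" "set m \<subseteq> carrier G" "length m = Suc i" "set m' \<subseteq> carrier G"
    using l lx my by (auto simp: tuples_def)
  have qt: "quots G x m \<in> tuples G (Suc i)" using l lx quots_tuples by blast
  have delt: "del j l \<in> tuples G (Suc i)" if "j < Suc (Suc i)" for j
    using l that set_take_subset[of j l] set_drop_subset[of "Suc j" l] by (auto simp: del_def tuples_def)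
  have hc: "homog \<theta> (del j l) \<in> carrier M" if "j < Suc (Suc i)" for j
    using homog_closed[OF \<theta> delt[OF that]] .
  have sgn: "[((-1::int) ^ j)] \<cdot>\<^bsub>M\<^esub> homog \<theta> (del j l) \<in> carrier M" if "j < Suc (Suc i)" for j
    using hc[OF that] by simp
  define c where "c j = [((-1::int) ^ j)] \<cdot>\<^bsub>M\<^esub> homog \<theta> (del j l)" for j
  have hf: "homog \<theta> \<in> tuples G (Suc i) \<rightarrow> carrier M" using homog_closed[OF \<theta>] by blast
  have "fext M (homog \<theta>) (\<Sum>j<k. frag_cmul ((-1) ^ j) (frag_of (del j l))) = (\<Oplus>\<^bsub>M\<^esub>j\<in>{..<k}. c j) \<and>
     Poly_Mapping.keys (\<Sum>j<k. frag_cmul ((-1) ^ j) (frag_of (del j l)) :: 'g list \<Rightarrow>\<^sub>0 int) \<subseteq> tuples G (Suc i)"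
    if "k \<le> Suc (Suc i)" for k
    using that
  proof (induction k)
    case (Suc k)
    have 1: "Poly_Mapping.keys (frag_cmul ((-1) ^ k) (frag_of (del k l)) :: 'g list \<Rightarrow>\<^sub>0 int) \<subseteq> tuples G (Suc i)"
      using delt[of k] Suc.prems by auto
    have 2: "fext M (homog \<theta>) (frag_cmul ((-1) ^ k) (frag_of (del k l))) = c k"
    proof -
      have "Poly_Mapping.keys (frag_cmul ((-1) ^ k) (frag_of (del k l)) :: 'g list \<Rightarrow>\<^sub>0 int) = {del k l}" by auto
      then show ?thesis using hc[of k] Suc.prems sgn[of k] by (simp add: fext_def c_def)
    qed
    have c: "c j \<in> carrier M" if "j < Suc k" for j using sgn[of j] that Suc.prems by (simp add: c_def)
    have "(\<Oplus>\<^bsub>M\<^esub>j\<in>{..<Suc k}. c j) = (\<Oplus>\<^bsub>M\<^esub>j\<in>{..<k}. c j) \<oplus>\<^bsub>M\<^esub> c k"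
    proof -
      have "(\<Oplus>\<^bsub>M\<^esub>j\<in>{..<k}. c j) \<in> carrier M" using c by (intro M.finsum_closed) auto
      then show ?thesis using c by (simp add: lessThan_Suc M.a_comm)
    qed
    then show ?case
      using Suc 1 2 keys_add[of "\<Sum>j<k. frag_cmul ((-1) ^ j) (frag_of (del j l))" "frag_cmul ((-1) ^ k) (frag_of (del k l))"]
      by (auto simp: M.fext_add[OF _ 1 hf])
  qed simp
  from this[of "Suc (Suc i)"] have R: "fext M (homog \<theta>) (bd l) = (\<Oplus>\<^bsub>M\<^esub>j\<in>{..<Suc (Suc i)}. c j)"
    using l by (simp add: bd_sum tuples_def del: sum.lessThan_Suc)
  have cc: "c j \<in> carrier M" if "j < Suc (Suc i)" for j using sgn[OF that] by (simp add: c_def)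
  \<comment> \<open>First, last and interior vertices are separated, as in the three parts of
    \<open>cobd\<close>.\<close>
  have "{..<Suc (Suc i)} = insert 0 (insert (Suc i) (Suc ` {..<i}))"
    unfolding lessThan_Suc_eq_insert_0[of "Suc i"] lessThan_Suc[of i] image_insert ..
  then have "(\<Oplus>\<^bsub>M\<^esub>j\<in>{..<Suc (Suc i)}. c j) = (\<Oplus>\<^bsub>M\<^esub>j\<in>insert 0 (insert (Suc i) (Suc ` {..<i})). c j)" by simp
  also have "\<dots> = c 0 \<oplus>\<^bsub>M\<^esub> (\<Oplus>\<^bsub>M\<^esub>j\<in>insert (Suc i) (Suc ` {..<i}). c j)"
    by (rule M.finsum_insert) (use cc in auto)
  also have "(\<Oplus>\<^bsub>M\<^esub>j\<in>insert (Suc i) (Suc ` {..<i}). c j) = c (Suc i) \<oplus>\<^bsub>M\<^esub> (\<Oplus>\<^bsub>M\<^esub>j\<in>Suc ` {..<i}. c j)"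
    by (rule M.finsum_insert) (use cc in auto)
  also have "(\<Oplus>\<^bsub>M\<^esub>j\<in>Suc ` {..<i}. c j) = (\<Oplus>\<^bsub>M\<^esub>j\<in>{..<i}. c (Suc j))"
    using cc by (subst M.add.finprod_reindex) auto
  finally have R2: "fext M (homog \<theta>) (bd l) = c 0 \<oplus>\<^bsub>M\<^esub> (c (Suc i) \<oplus>\<^bsub>M\<^esub> (\<Oplus>\<^bsub>M\<^esub>j\<in>{..<i}. c (Suc j)))"
    using R by simp
  let ?q = "quots G x m"
  have tq: "\<theta> (tl ?q) \<in> carrier M" "\<theta> (butlast ?q) \<in> carrier M" "hd ?q \<in> carrier G"
    using \<theta> tl_tuples[OF qt] butlast_tuples[OF qt] by auto
  have mq: "\<theta> (merge_at G j ?q) \<in> carrier M" if "j < i" for j using \<theta> merge_tuples[OF qt that] by auto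
  have A: "addhom M M (act x)" using addhom_act xy by blast
  have M: "abelian_group M" ..
  have fs: "(\<Oplus>\<^bsub>M\<^esub>j\<in>{..<i}. [((-1::int) ^ Suc j)] \<cdot>\<^bsub>M\<^esub> \<theta> (merge_at G j ?q)) \<in> carrier M"
    using mq by (intro M.finsum_closed) auto
  have "homog (cobd G M act i \<theta>) l = act x (act (hd ?q) (\<theta> (tl ?q)) \<oplus>\<^bsub>M\<^esub>
     (\<Oplus>\<^bsub>M\<^esub>j\<in>{..<i}. [((-1::int) ^ Suc j)] \<cdot>\<^bsub>M\<^esub> \<theta> (merge_at G j ?q)) \<oplus>\<^bsub>M\<^esub> [((-1::int) ^ Suc i)] \<cdot>\<^bsub>M\<^esub> \<theta> (butlast ?q))"
    using qt by (simp add: homog_def lx cobd_def)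
  also have "\<dots> = act x (act (hd ?q) (\<theta> (tl ?q))) \<oplus>\<^bsub>M\<^esub>
     act x (\<Oplus>\<^bsub>M\<^esub>j\<in>{..<i}. [((-1::int) ^ Suc j)] \<cdot>\<^bsub>M\<^esub> \<theta> (merge_at G j ?q)) \<oplus>\<^bsub>M\<^esub> act x ([((-1::int) ^ Suc i)] \<cdot>\<^bsub>M\<^esub> \<theta> (butlast ?q))"
    using tq fs xy by (simp add: act_add act_closed)
  also have "act x (act (hd ?q) (\<theta> (tl ?q))) = c 0"
  proof -
    have "x \<otimes>\<^bsub>G\<^esub> (inv\<^bsub>G\<^esub> x \<otimes>\<^bsub>G\<^esub> y) = y" using xy by (simp add: G.m_assoc[symmetric])
    then show ?thesis
      using tq xy my hc[of 0] by (simp add: c_def lx del_def homog_def act_mult[symmetric])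
  qed
  also have "act x (\<Oplus>\<^bsub>M\<^esub>j\<in>{..<i}. [((-1::int) ^ Suc j)] \<cdot>\<^bsub>M\<^esub> \<theta> (merge_at G j ?q)) = (\<Oplus>\<^bsub>M\<^esub>j\<in>{..<i}. c (Suc j))"
  proof -
    have "act x (\<Oplus>\<^bsub>M\<^esub>j\<in>{..<i}. [((-1::int) ^ Suc j)] \<cdot>\<^bsub>M\<^esub> \<theta> (merge_at G j ?q)) =
      (\<Oplus>\<^bsub>M\<^esub>j\<in>{..<i}. act x ([((-1::int) ^ Suc j)] \<cdot>\<^bsub>M\<^esub> \<theta> (merge_at G j ?q)))"
      using mq by (intro addhom_finsum[OF M M A]) auto
    also have "\<dots> = (\<Oplus>\<^bsub>M\<^esub>j\<in>{..<i}. c (Suc j))"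
    proof (rule M.finsum_cong')
      fix j assume "j \<in> {..<i}"
      then have j: "j < i" by simp
      have "quots G x (del j m) = merge_at G j ?q" using xy j by (intro G.quots_del) auto
      then have "act x (\<theta> (merge_at G j ?q)) = homog \<theta> (del (Suc j) l)" by (simp add: homog_def lx del_def)
      then show "act x ([((-1::int) ^ Suc j)] \<cdot>\<^bsub>M\<^esub> \<theta> (merge_at G j ?q)) = c (Suc j)"
        using mq[OF j] by (simp add: addhom_ipow[OF M M A] c_def)
    qed (use cc in auto)
    finally show ?thesis .
  qed
  also have "act x ([((-1::int) ^ Suc i)] \<cdot>\<^bsub>M\<^esub> \<theta> (butlast ?q)) = c (Suc i)"
  proof -
    have "del i m = butlast m" using xy by (simp add: del_def butlast_conv_take)
    then have "act x (\<theta> (butlast ?q)) = homog \<theta> (del (Suc i) l)"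
      by (simp add: homog_def lx del_def G.quots_butlast)
    then show ?thesis using tq by (simp add: addhom_ipow[OF M M A] c_def)
  qed
  finally show ?thesis
    using R2 cc by (simp add: M.a_ac M.finsum_closed Pi_iff)
qed

lemma homog_cobd_fext:
  assumes \<theta>: "\<theta> \<in> tuples G i \<rightarrow> carrier M" and u: "Poly_Mapping.keys u \<subseteq> tuples G (Suc (Suc i))"
  shows "fext M (homog (cobd G M act i \<theta>)) u = fext M (homog \<theta>) (frag_extend bd u)"
proof -
  have hf: "homog \<theta> \<in> tuples G (Suc i) \<rightarrow> carrier M" using homog_closed[OF \<theta>] by blast
  have "fext M (homog \<theta>) (frag_extend bd u) = fext M (\<lambda>l. fext M (homog \<theta>) (bd l)) u"
    by (rule M.fext_frag_extend[OF u keys_bd hf])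
  also have "\<dots> = fext M (homog (cobd G M act i \<theta>)) u"
    using u homog_closed cobd_closed[OF \<theta>]
    by (intro M.fext_cong) (auto simp: homog_cobd[OF \<theta>] cochains_def PiE_def subset_iff intro!: homog_closed)
  finally show ?thesis by simp
qed

text \<open>Both coboundaries are moved onto the simplex by \<open>homog_cobd\<close>, where
  \<open>bd_bd\<close> applies.\<close>

lemma cobd_cobd:
  assumes \<theta>: "\<theta> \<in> tuples G i \<rightarrow> carrier M"
  shows "cobd G M act (Suc i) (cobd G M act i \<theta>) = zero_cochain G M (Suc (Suc i))"
proof -
  have c1: "cobd G M act i \<theta> \<in> tuples G (Suc i) \<rightarrow> carrier M" using cobd_closed[OF \<theta>] by (auto simp: cochains_def)
  have c2: "cobd G M act (Suc i) (cobd G M act i \<theta>) \<in> cochains G M (Suc (Suc i))" by (rule cobd_closed[OF c1])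
  have "cobd G M act (Suc i) (cobd G M act i \<theta>) gs = \<zero>\<^bsub>M\<^esub>" if gs: "gs \<in> tuples G (Suc (Suc i))" for gs
  proof -
    obtain l where l: "l \<in> tuples G (Suc (Suc (Suc i)))" "\<And>\<theta>. \<theta> gs \<in> carrier M \<Longrightarrow> homog \<theta> l = \<theta> gs"
      using homog_surj[OF gs] by blast
    have "cobd G M act (Suc i) (cobd G M act i \<theta>) gs \<in> carrier M"
      using c2 gs unfolding cochains_def by (rule PiE_mem)
    then have "cobd G M act (Suc i) (cobd G M act i \<theta>) gs = homog (cobd G M act (Suc i) (cobd G M act i \<theta>)) l"
      by (rule l(2)[symmetric])
    also have "\<dots> = fext M (homog (cobd G M act i \<theta>)) (bd l)" by (rule homog_cobd[OF c1 l(1)])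
    also have "\<dots> = fext M (homog \<theta>) (frag_extend bd (bd l))" by (rule homog_cobd_fext[OF \<theta> keys_bd[OF l(1)]])
    finally show ?thesis by (simp add: bd_bd)
  qed
  then show ?thesis using c2
    by (auto simp: zero_cochain_def fun_eq_iff cochains_def PiE_def extensional_def)
qed

lemma cobd_add:
  assumes f: "f \<in> tuples G i \<rightarrow> carrier M" and g: "g \<in> tuples G i \<rightarrow> carrier M"
  shows "cobd G M act i (\<lambda>gs\<in>tuples G i. f gs \<oplus>\<^bsub>M\<^esub> g gs) = (\<lambda>gs\<in>tuples G (Suc i). cobd G M act i f gs \<oplus>\<^bsub>M\<^esub> cobd G M act i g gs)"
proof (rule ext)
  fix gs
  show "cobd G M act i (\<lambda>gs\<in>tuples G i. f gs \<oplus>\<^bsub>M\<^esub> g gs) gs = (\<lambda>gs\<in>tuples G (Suc i). cobd G M act i f gs \<oplus>\<^bsub>M\<^esub> cobd G M act i g gs) gs"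
  proof (cases "gs \<in> tuples G (Suc i)")
    case gs: True
    note mt = merge_tuples[OF gs] and tt = tl_tuples[OF gs] and bt = butlast_tuples[OF gs]
    have cl: "f (tl gs) \<in> carrier M" "g (tl gs) \<in> carrier M" "f (butlast gs) \<in> carrier M" "g (butlast gs) \<in> carrier M"
      using f g tt bt by auto
    have ml: "f (merge_at G j gs) \<in> carrier M" "g (merge_at G j gs) \<in> carrier M" if "j < i" for j
      using f g mt[OF that] by auto
    let ?s = "\<lambda>f. \<Oplus>\<^bsub>M\<^esub>j\<in>{..<i}. [((-1::int) ^ Suc j)] \<cdot>\<^bsub>M\<^esub> f (merge_at G j gs)"
    have s: "?s f \<in> carrier M" "?s g \<in> carrier M" using ml by (auto intro!: M.finsum_closed)
    have "?s (\<lambda>gs\<in>tuples G i. f gs \<oplus>\<^bsub>M\<^esub> g gs) = (\<Oplus>\<^bsub>M\<^esub>j\<in>{..<i}. [((-1::int) ^ Suc j)] \<cdot>\<^bsub>M\<^esub> f (merge_at G j gs) \<oplus>\<^bsub>M\<^esub> [((-1::int) ^ Suc j)] \<cdot>\<^bsub>M\<^esub> g (merge_at G j gs))"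
      using ml mt by (intro M.finsum_cong') (auto simp: M.ipow_distrib)
    also have "\<dots> = ?s f \<oplus>\<^bsub>M\<^esub> ?s g" using ml by (intro M.finsum_addf) auto
    finally have "?s (\<lambda>gs\<in>tuples G i. f gs \<oplus>\<^bsub>M\<^esub> g gs) = ?s f \<oplus>\<^bsub>M\<^esub> ?s g" .
    then show ?thesis
      using gs tt bt cl s by (simp add: cobd_def act_add act_closed M.ipow_distrib M.a_ac)
  qed (simp add: cobd_def)
qed

lemma comm_group_cocycles: "comm_group (cocycle_group G M act i)"
proof -
  let ?Z = "cocycle_group G M act i"
  have car: "f \<in> carrier ?Z \<longleftrightarrow> f \<in> cochains G M i \<and> cobd G M act i f = zero_cochain G M (Suc i)" for f
    by (simp add: cocycle_group_def)
  have mul: "f \<otimes>\<^bsub>?Z\<^esub> g = (\<lambda>gs\<in>tuples G i. f gs \<oplus>\<^bsub>M\<^esub> g gs)" for f g by (simp add: cocycle_group_def)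
  have one: "\<one>\<^bsub>?Z\<^esub> = zero_cochain G M i" by (simp add: cocycle_group_def)
  have z: "zero_cochain G M i \<in> cochains G M i" by (auto simp: zero_cochain_def cochains_def)
  have coc: "f \<in> tuples G i \<rightarrow> carrier M" if "f \<in> cochains G M i" for f using that by (auto simp: cochains_def)
  have idz: "x = \<zero>\<^bsub>M\<^esub>" if "x \<oplus>\<^bsub>M\<^esub> x = x" "x \<in> carrier M" for x
    using that M.add.r_cancel_one' by metis
  \<comment> \<open>The zero cochain is its own double, so by additivity its coboundary is too, and
    a group element equal to its double is zero.\<close>
  have cz: "cobd G M act i (zero_cochain G M i) = zero_cochain G M (Suc i)"
  proof -
    have "(\<lambda>gs\<in>tuples G i. zero_cochain G M i gs \<oplus>\<^bsub>M\<^esub> zero_cochain G M i gs) = zero_cochain G M i"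
      by (auto simp: zero_cochain_def fun_eq_iff)
    then have eq: "cobd G M act i (zero_cochain G M i) = (\<lambda>gs\<in>tuples G (Suc i). cobd G M act i (zero_cochain G M i) gs \<oplus>\<^bsub>M\<^esub> cobd G M act i (zero_cochain G M i) gs)"
      using cobd_add[OF coc[OF z] coc[OF z]] by simp
    have c: "cobd G M act i (zero_cochain G M i) \<in> cochains G M (Suc i)" by (rule cobd_closed[OF coc[OF z]])
    have "cobd G M act i (zero_cochain G M i) gs = \<zero>\<^bsub>M\<^esub>" if gs: "gs \<in> tuples G (Suc i)" for gs
    proof (rule idz)
      show "cobd G M act i (zero_cochain G M i) gs \<oplus>\<^bsub>M\<^esub> cobd G M act i (zero_cochain G M i) gs = cobd G M act i (zero_cochain G M i) gs"
        using fun_cong[OF eq, of gs] unfolding restrict_apply'[OF gs] by (rule sym)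
      show "cobd G M act i (zero_cochain G M i) gs \<in> carrier M"
        using c gs unfolding cochains_def by (rule PiE_mem)
    qed
    then show ?thesis using c by (auto simp: zero_cochain_def fun_eq_iff cochains_def PiE_def extensional_def)
  qed
  have addc: "(\<lambda>gs\<in>tuples G i. f gs \<oplus>\<^bsub>M\<^esub> g gs) \<in> carrier ?Z" if "f \<in> carrier ?Z" "g \<in> carrier ?Z" for f g
  proof -
    have fg: "f \<in> tuples G i \<rightarrow> carrier M" "g \<in> tuples G i \<rightarrow> carrier M" using that coc by (auto simp: car)
    have "cobd G M act i (\<lambda>gs\<in>tuples G i. f gs \<oplus>\<^bsub>M\<^esub> g gs) = zero_cochain G M (Suc i)"
      using that by (simp add: cobd_add[OF fg] car) (auto simp: zero_cochain_def fun_eq_iff)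
    moreover have "(\<lambda>gs\<in>tuples G i. f gs \<oplus>\<^bsub>M\<^esub> g gs) \<in> cochains G M i"
      using fg by (auto simp: cochains_def)
    ultimately show ?thesis by (simp add: car)
  qed
  show ?thesis
  proof (rule comm_groupI)
    fix x y assume "x \<in> carrier ?Z" "y \<in> carrier ?Z"
    then show "x \<otimes>\<^bsub>?Z\<^esub> y \<in> carrier ?Z" "x \<otimes>\<^bsub>?Z\<^esub> y = y \<otimes>\<^bsub>?Z\<^esub> x"
      using addc by (auto simp: mul fun_eq_iff car cochains_def M.a_comm PiE_def Pi_iff)
  next
    show "\<one>\<^bsub>?Z\<^esub> \<in> carrier ?Z" using z cz by (simp add: car one)
  next
    fix x y w assume "x \<in> carrier ?Z" "y \<in> carrier ?Z" "w \<in> carrier ?Z"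
    then show "x \<otimes>\<^bsub>?Z\<^esub> y \<otimes>\<^bsub>?Z\<^esub> w = x \<otimes>\<^bsub>?Z\<^esub> (y \<otimes>\<^bsub>?Z\<^esub> w)"
      by (auto simp: mul fun_eq_iff car cochains_def M.a_assoc PiE_def Pi_iff)
  next
    fix x assume "x \<in> carrier ?Z"
    then show "\<one>\<^bsub>?Z\<^esub> \<otimes>\<^bsub>?Z\<^esub> x = x"
      by (auto simp: mul one zero_cochain_def fun_eq_iff car cochains_def PiE_def Pi_iff extensional_def)
  next
    fix f assume f: "f \<in> carrier ?Z"
    define g where "g = (\<lambda>gs\<in>tuples G i. \<ominus>\<^bsub>M\<^esub> f gs)"
    have fM: "f gs \<in> carrier M" if "gs \<in> tuples G i" for gs using f that by (auto simp: car cochains_def)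
    have g: "g \<in> cochains G M i" using fM by (auto simp: g_def cochains_def)
    have gf: "(\<lambda>gs\<in>tuples G i. g gs \<oplus>\<^bsub>M\<^esub> f gs) = zero_cochain G M i"
      using fM by (auto simp: g_def zero_cochain_def fun_eq_iff M.l_neg)
    have fc: "f \<in> cochains G M i" using f car by blast
    have cg: "cobd G M act i g \<in> cochains G M (Suc i)" by (rule cobd_closed[OF coc[OF g]])
    have eq: "zero_cochain G M (Suc i) = (\<lambda>gs\<in>tuples G (Suc i). cobd G M act i g gs \<oplus>\<^bsub>M\<^esub> cobd G M act i f gs)"
      using cobd_add[OF coc[OF g] coc[OF fc]] gf cz by simp
    have "cobd G M act i g gs = \<zero>\<^bsub>M\<^esub>" if gs: "gs \<in> tuples G (Suc i)" for gs
    proof -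
      have "cobd G M act i f gs = \<zero>\<^bsub>M\<^esub>" using f gs by (simp add: car zero_cochain_def)
      moreover have "cobd G M act i g gs \<in> carrier M" using cg gs by (auto simp: cochains_def)
      ultimately show ?thesis using fun_cong[OF eq, of gs] gs by (simp add: zero_cochain_def)
    qed
    then have "cobd G M act i g = zero_cochain G M (Suc i)"
      using cg by (auto simp: zero_cochain_def fun_eq_iff cochains_def PiE_def extensional_def)
    then show "\<exists>y\<in>carrier ?Z. y \<otimes>\<^bsub>?Z\<^esub> f = \<one>\<^bsub>?Z\<^esub>"
      using g gf by (intro bexI[of _ g]) (auto simp: car mul one)
  qed
qed

lemma coboundaries_Suc: "coboundaries G M act (Suc i) = cobd G M act i ` cochains G M i"
  by (simp add: coboundaries_def)

lemma subgroup_coboundaries: "subgroup (coboundaries G M act (Suc i)) (cocycle_group G M act (Suc i))"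
proof -
  let ?Z = "cocycle_group G M act (Suc i)"
  interpret Z: comm_group ?Z by (rule comm_group_cocycles)
  interpret Z0: comm_group "cocycle_group G M act i" by (rule comm_group_cocycles)
  have coc: "f \<in> tuples G i \<rightarrow> carrier M" if "f \<in> cochains G M i" for f using that by (auto simp: cochains_def)
  have sub: "cobd G M act i f \<in> carrier ?Z" if "f \<in> cochains G M i" for f
    using cobd_cobd[OF coc[OF that]] cobd_closed[OF coc[OF that]] by (simp add: cocycle_group_def)
  have mul: "f \<otimes>\<^bsub>?Z\<^esub> g = (\<lambda>gs\<in>tuples G (Suc i). f gs \<oplus>\<^bsub>M\<^esub> g gs)" for f g by (simp add: cocycle_group_def)
  have add: "cobd G M act i f \<otimes>\<^bsub>?Z\<^esub> cobd G M act i g = cobd G M act i (\<lambda>gs\<in>tuples G i. f gs \<oplus>\<^bsub>M\<^esub> g gs)"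
    if "f \<in> cochains G M i" "g \<in> cochains G M i" for f g
    by (simp add: mul cobd_add[OF coc[OF that(1)] coc[OF that(2)]])
  have one: "\<one>\<^bsub>?Z\<^esub> = cobd G M act i (zero_cochain G M i)"
    using Z0.one_closed by (auto simp: cocycle_group_def)
  have z: "zero_cochain G M i \<in> cochains G M i" by (auto simp: zero_cochain_def cochains_def)
  show ?thesis
  proof (rule Z.subgroupI)
    show "coboundaries G M act (Suc i) \<subseteq> carrier ?Z" using sub by (auto simp: coboundaries_Suc)
    show "coboundaries G M act (Suc i) \<noteq> {}" using z by (auto simp: coboundaries_Suc)
  next
    fix a assume "a \<in> coboundaries G M act (Suc i)"
    then obtain f where f: "f \<in> cochains G M i" "a = cobd G M act i f" by (auto simp: coboundaries_Suc)
    define g where "g = (\<lambda>gs\<in>tuples G i. \<ominus>\<^bsub>M\<^esub> f gs)"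
    have fM: "f gs \<in> carrier M" if "gs \<in> tuples G i" for gs using f that by (auto simp: cochains_def)
    have g: "g \<in> cochains G M i" using fM by (auto simp: g_def cochains_def)
    have gf: "(\<lambda>gs\<in>tuples G i. g gs \<oplus>\<^bsub>M\<^esub> f gs) = zero_cochain G M i"
      using fM by (auto simp: g_def zero_cochain_def fun_eq_iff M.l_neg)
    have "cobd G M act i g \<otimes>\<^bsub>?Z\<^esub> a = \<one>\<^bsub>?Z\<^esub>" using add[OF g f(1)] f gf one by simp
    then have "inv\<^bsub>?Z\<^esub> a = cobd G M act i g" using sub[OF g] sub[OF f(1)] f Z.inv_equality by blast
    then show "inv\<^bsub>?Z\<^esub> a \<in> coboundaries G M act (Suc i)" using g by (auto simp: coboundaries_Suc)
  next
    fix a b assume "a \<in> coboundaries G M act (Suc i)" "b \<in> coboundaries G M act (Suc i)"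
    then obtain f g where f: "f \<in> cochains G M i" "a = cobd G M act i f" "g \<in> cochains G M i" "b = cobd G M act i g"
      by (auto simp: coboundaries_Suc)
    have "(\<lambda>gs\<in>tuples G i. f gs \<oplus>\<^bsub>M\<^esub> g gs) \<in> cochains G M i" using f by (auto simp: cochains_def)
    then show "a \<otimes>\<^bsub>?Z\<^esub> b \<in> coboundaries G M act (Suc i)" using add f by (auto simp: coboundaries_Suc)
  qed
qed

end

section \<open>Modules over the group ring\<close>

lemma group_ring_carrier: "r \<in> carrier (group_ring G) \<longleftrightarrow> finite {g. r g \<noteq> 0} \<and> {g. r g \<noteq> 0} \<subseteq> carrier G"
  by (simp add: group_ring_def)

lemma group_ring_add [simp]: "r \<oplus>\<^bsub>group_ring G\<^esub> s = (\<lambda>x. r x + s x)"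
  by (simp add: group_ring_def)

lemma group_ring_zero [simp]: "\<zero>\<^bsub>group_ring G\<^esub> = (\<lambda>_. 0)"
  by (simp add: group_ring_def)

lemma group_ring_one: "\<one>\<^bsub>group_ring G\<^esub> = group_elem \<one>\<^bsub>G\<^esub>"
  by (simp add: group_ring_def group_elem_def)

lemma group_ring_mult: "(r \<otimes>\<^bsub>group_ring G\<^esub> s) x =
    (if x \<in> carrier G then \<Sum>g | r g \<noteq> 0. r g * s (inv\<^bsub>G\<^esub> g \<otimes>\<^bsub>G\<^esub> x) else 0)"
  by (simp add: group_ring_def)

lemma group_elem_closed [simp]: "g \<in> carrier G \<Longrightarrow> group_elem g \<in> carrier (group_ring G)"
  by (auto simp: group_ring_carrier group_elem_def)

lemma group_ring_diff_closed:
  assumes "r \<in> carrier (group_ring G)" "s \<in> carrier (group_ring G)"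
  shows "(\<lambda>x. r x - s x) \<in> carrier (group_ring G)"
proof -
  have "{g. r g - s g \<noteq> 0} \<subseteq> {g. r g \<noteq> 0} \<union> {g. s g \<noteq> 0}" by auto
  then show ?thesis using assms unfolding group_ring_carrier
    by (meson finite_UnI finite_subset le_sup_iff order_trans)
qed

text \<open>An element of finite support is an integral combination of group elements. Closure under
  differences covers sums and negatives at once.\<close>

lemma group_ring_induct [consumes 1, case_names zero elem diff]:
  assumes r: "r \<in> carrier (group_ring G)" and 0: "P (\<lambda>_. 0)"
    and 1: "\<And>g. g \<in> carrier G \<Longrightarrow> P (group_elem g)"
    and 2: "\<And>r s. \<lbrakk>r \<in> carrier (group_ring G); s \<in> carrier (group_ring G); P r; P s\<rbrakk> \<Longrightarrow> P (\<lambda>x. r x - s x)"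
  shows "P r"
proof -
  define u where "u = Abs_poly_mapping r"
  have u: "Poly_Mapping.lookup u = r" unfolding u_def using r by (simp add: group_ring_carrier)
  then have "Poly_Mapping.keys u \<subseteq> carrier G" using r by (auto simp: group_ring_carrier in_keys_iff)
  then have "P (Poly_Mapping.lookup u) \<and> Poly_Mapping.lookup u \<in> carrier (group_ring G)"
  proof (rule free_Abelian_group_induct)
    show "P (Poly_Mapping.lookup 0) \<and> Poly_Mapping.lookup 0 \<in> carrier (group_ring G)"
    proof -
      have "Poly_Mapping.lookup (0 :: 'a \<Rightarrow>\<^sub>0 int) = (\<lambda>_. 0)" by (rule ext) simp
      then show ?thesis using 0 by (simp add: group_ring_carrier)
    qed
  next
    fix x y :: "'a \<Rightarrow>\<^sub>0 int"
    assume x: "P (Poly_Mapping.lookup x) \<and> Poly_Mapping.lookup x \<in> carrier (group_ring G)"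
      and y: "P (Poly_Mapping.lookup y) \<and> Poly_Mapping.lookup y \<in> carrier (group_ring G)"
    have eq: "Poly_Mapping.lookup (x - y) = (\<lambda>z. Poly_Mapping.lookup x z - Poly_Mapping.lookup y z)"
      by (rule ext) (simp add: lookup_minus)
    show "P (Poly_Mapping.lookup (x - y)) \<and> Poly_Mapping.lookup (x - y) \<in> carrier (group_ring G)"
      unfolding eq
      by (intro conjI 2 group_ring_diff_closed conjunct1[OF x] conjunct2[OF x] conjunct1[OF y] conjunct2[OF y])
  next
    fix a assume "a \<in> carrier G"
    moreover have "Poly_Mapping.lookup (frag_of a) = group_elem a"
      by (rule ext) (auto simp: group_elem_def)
    ultimately show "P (Poly_Mapping.lookup (frag_of a)) \<and> Poly_Mapping.lookup (frag_of a) \<in> carrier (group_ring G)"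
      using 1 by simp
  qed
  then show ?thesis using u by simp
qed

lemma (in group) group_elem_mult:
  assumes "g \<in> carrier G" "h \<in> carrier G"
  shows "group_elem g \<otimes>\<^bsub>group_ring G\<^esub> group_elem h = group_elem (g \<otimes> h)"
proof
  fix x
  have "{k. group_elem g k \<noteq> 0} = {g}" by (auto simp: group_elem_def)
  moreover have "(inv g \<otimes> x = h) = (x = g \<otimes> h)" if "x \<in> carrier G"
    using assms that by (metis inv_closed inv_solve_left)
  ultimately show "(group_elem g \<otimes>\<^bsub>group_ring G\<^esub> group_elem h) x = group_elem (g \<otimes> h) x"
    using assms by (auto simp: group_ring_mult) (auto simp: group_elem_def)
qed

lemma (in abelian_group) add_right_imp_eq:
  assumes "x \<oplus> z = y \<oplus> z" "x \<in> carrier G" "y \<in> carrier G" "z \<in> carrier G" shows "x = y"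
proof -
  have "x = (x \<oplus> z) \<oplus> \<ominus> z" using assms(2-4) by (simp add: a_assoc r_neg)
  also have "\<dots> = y" using assms by (simp add: a_assoc r_neg)
  finally show ?thesis .
qed

context left_module
begin

lemma is_abelian_group: "abelian_group M" ..

lemma zero_lsmult: "x \<in> carrier M \<Longrightarrow> \<zero>\<^bsub>R\<^esub> \<odot>\<^bsub>M\<^esub> x = \<zero>\<^bsub>M\<^esub>"
  using lsmult_l_distr[of "\<zero>\<^bsub>R\<^esub>" "\<zero>\<^bsub>R\<^esub>" x] lsmult_closed[of "\<zero>\<^bsub>R\<^esub>" x]
  by (metis R.zero_closed R.l_zero M.add.r_cancel_one')

lemma addhom_lsmult: "a \<in> carrier R \<Longrightarrow> addhom M M (\<lambda>x. a \<odot>\<^bsub>M\<^esub> x)"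
  by (auto simp: addhom_def lsmult_closed lsmult_r_distr)

end

lemma lmod_hom_addhom: "f \<in> lmod_hom R M N \<Longrightarrow> addhom M N f"
  by (auto simp: lmod_hom_def addhom_def)

lemma lmod_hom_smult: "f \<in> lmod_hom R M N \<Longrightarrow> a \<in> carrier R \<Longrightarrow> x \<in> carrier M \<Longrightarrow> f (a \<odot>\<^bsub>M\<^esub> x) = a \<odot>\<^bsub>N\<^esub> f x"
  by (auto simp: lmod_hom_def)

lemma lmod_hom_closed: "f \<in> lmod_hom R M N \<Longrightarrow> x \<in> carrier M \<Longrightarrow> f x \<in> carrier N"
  by (auto simp: lmod_hom_def)

lemma lmod_homI: "addhom M N f \<Longrightarrow> (\<And>a x. a \<in> carrier R \<Longrightarrow> x \<in> carrier M \<Longrightarrow> f (a \<odot>\<^bsub>M\<^esub> x) = a \<odot>\<^bsub>N\<^esub> f x) \<Longrightarrow> f \<in> lmod_hom R M N"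
  by (auto simp: lmod_hom_def addhom_def)

lemma lmod_homI_act:
  assumes M: "left_module (group_ring G) M" and N: "left_module (group_ring G) N" and f: "addhom M N f"
    and e: "\<And>g x. g \<in> carrier G \<Longrightarrow> x \<in> carrier M \<Longrightarrow> f (group_elem g \<odot>\<^bsub>M\<^esub> x) = group_elem g \<odot>\<^bsub>N\<^esub> f x"
  shows "f \<in> lmod_hom (group_ring G) M N"
proof (rule lmod_homI[OF f])
  interpret M: left_module "group_ring G" M by (rule M)
  interpret N: left_module "group_ring G" N by (rule N)
  fix r x assume r: "r \<in> carrier (group_ring G)" and x: "x \<in> carrier M"
  note cl = addhom_closed[OF f]
  show "f (r \<odot>\<^bsub>M\<^esub> x) = r \<odot>\<^bsub>N\<^esub> f x" using r
  proof (induction rule: group_ring_induct)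
    case zero
    then show ?case using M.zero_lsmult[OF x] N.zero_lsmult[OF cl[OF x]] addhom_zero[OF M.is_abelian_group N.is_abelian_group f]
      by simp
  next
    case (elem g) then show ?case using e x by blast
  next
    case (diff r s)
    let ?t = "\<lambda>x. r x - s x"
    have t: "?t \<in> carrier (group_ring G)" using diff group_ring_diff_closed by blast
    have rs: "?t \<oplus>\<^bsub>group_ring G\<^esub> s = r" by simp
    have "f (?t \<odot>\<^bsub>M\<^esub> x \<oplus>\<^bsub>M\<^esub> s \<odot>\<^bsub>M\<^esub> x) = f (?t \<odot>\<^bsub>M\<^esub> x) \<oplus>\<^bsub>N\<^esub> f (s \<odot>\<^bsub>M\<^esub> x)"
      by (rule addhom_add[OF f M.lsmult_closed[OF t x] M.lsmult_closed[OF diff(2) x]])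
    moreover have "?t \<odot>\<^bsub>M\<^esub> x \<oplus>\<^bsub>M\<^esub> s \<odot>\<^bsub>M\<^esub> x = r \<odot>\<^bsub>M\<^esub> x" using M.lsmult_l_distr[OF t diff(2) x] rs by simp
    moreover have "?t \<odot>\<^bsub>N\<^esub> f x \<oplus>\<^bsub>N\<^esub> s \<odot>\<^bsub>N\<^esub> f x = r \<odot>\<^bsub>N\<^esub> f x"
      using N.lsmult_l_distr[OF t diff(2) cl[OF x]] rs by simp
    ultimately have "f (?t \<odot>\<^bsub>M\<^esub> x) \<oplus>\<^bsub>N\<^esub> s \<odot>\<^bsub>N\<^esub> f x = ?t \<odot>\<^bsub>N\<^esub> f x \<oplus>\<^bsub>N\<^esub> s \<odot>\<^bsub>N\<^esub> f x"
      using diff by simp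
    then show ?case
      by (rule N.M.add_right_imp_eq[OF _ cl[OF M.lsmult_closed[OF t x]] N.lsmult_closed[OF t cl[OF x]] N.lsmult_closed[OF diff(2) cl[OF x]]])
  qed
qed

section \<open>The regular and the trivial module\<close>

definition reg :: "('g, 'b) monoid_scheme \<Rightarrow> ('g \<Rightarrow> int, 'g \<Rightarrow> int) module"
  where "reg G = \<lparr>carrier = carrier (group_ring G), monoid.mult = undefined, one = undefined,
    ring.zero = ring.zero (group_ring G), ring.add = ring.add (group_ring G), module.smult = monoid.mult (group_ring G)\<rparr>"

lemma reg_simps [simp]: "carrier (reg G) = carrier (group_ring G)" "\<zero>\<^bsub>reg G\<^esub> = (\<lambda>_. 0)" "f \<oplus>\<^bsub>reg G\<^esub> g = (\<lambda>x. f x + g x)"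
  "a \<odot>\<^bsub>reg G\<^esub> f = a \<otimes>\<^bsub>group_ring G\<^esub> f"
  by (simp_all add: reg_def)

lemma left_module_reg: assumes "ring (group_ring G)" shows "left_module (group_ring G) (reg G)"
proof -
  interpret ring "group_ring G" by fact
  have ab: "abelian_group (reg G)"
  proof (rule abelian_groupI)
    fix x assume "x \<in> carrier (reg G)"
    then show "\<exists>y\<in>carrier (reg G). y \<oplus>\<^bsub>reg G\<^esub> x = \<zero>\<^bsub>reg G\<^esub>"
      using group_ring_diff_closed[of "\<lambda>_. 0" G x] zero_closed by (intro bexI[of _ "\<lambda>z. 0 - x z"]) auto
  qed (use a_closed zero_closed in \<open>auto simp: fun_eq_iff\<close>)
  interpret ab: abelian_group "reg G" by fact
  show ?thesis
    by unfold_locales (use l_distr r_distr m_assoc in \<open>auto\<close>)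
qed

lemma gmod_left_module:
  assumes "group G" "left_module (group_ring G) M"
  shows "gmod G M (\<lambda>g x. group_elem g \<odot>\<^bsub>M\<^esub> x)"
proof -
  interpret G: group G by fact
  interpret left_module "group_ring G" M by fact
  show ?thesis
  proof
    fix g h x assume "g \<in> carrier G" "h \<in> carrier G" "x \<in> carrier M"
    then show "group_elem (g \<otimes>\<^bsub>G\<^esub> h) \<odot>\<^bsub>M\<^esub> x = group_elem g \<odot>\<^bsub>M\<^esub> (group_elem h \<odot>\<^bsub>M\<^esub> x)"
      using lsmult_assoc[of "group_elem g" "group_elem h" x] by (simp add: G.group_elem_mult)
  next
    fix x assume "x \<in> carrier M" then show "group_elem \<one>\<^bsub>G\<^esub> \<odot>\<^bsub>M\<^esub> x = x"
      using lsmult_one by (simp add: group_ring_one)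
  qed (auto simp: lsmult_closed lsmult_r_distr)
qed

text \<open>The content is multiplicativity of the augmentation \<open>e\<close>. It is shown first
  for a group element on the left and then extended by \<open>group_ring_induct\<close>.\<close>

lemma left_module_trivial: assumes "ring (group_ring G)" "group G" shows "left_module (group_ring G) trivial_module"
proof -
  interpret ring "group_ring G" by fact
  interpret G: group G by fact
  have ab: "abelian_group (trivial_module :: ('a \<Rightarrow> int, int) module)"
  proof (rule abelian_groupI)
    fix x show "\<exists>y\<in>carrier (trivial_module :: ('a \<Rightarrow> int, int) module). y \<oplus>\<^bsub>(trivial_module :: ('a \<Rightarrow> int, int) module)\<^esub> x = \<zero>\<^bsub>(trivial_module :: ('a \<Rightarrow> int, int) module)\<^esub>"
      by (rule bexI[of _ "- x"]) (auto simp: trivial_module_def)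
  qed (auto simp: trivial_module_def)
  interpret ab: abelian_group "trivial_module :: ('a \<Rightarrow> int, int) module" by fact
  define e where "e r = (\<Sum>g | r g \<noteq> (0::int). r g)" for r :: "'a \<Rightarrow> int"
  have sup: "e r = sum r A" if "finite A" "{g. r g \<noteq> 0} \<subseteq> A" for r A
    unfolding e_def using that by (intro sum.mono_neutral_left) auto
  have add: "e (\<lambda>x. r x + s x) = e r + e s" if "r \<in> carrier (group_ring G)" "s \<in> carrier (group_ring G)" for r s
  proof -
    have f: "finite ({g. r g \<noteq> 0} \<union> {g. s g \<noteq> 0})" using that by (simp add: group_ring_carrier)
    have "e r = sum r ({g. r g \<noteq> 0} \<union> {g. s g \<noteq> 0})" "e s = sum s ({g. r g \<noteq> 0} \<union> {g. s g \<noteq> 0})"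
      "e (\<lambda>x. r x + s x) = sum (\<lambda>x. r x + s x) ({g. r g \<noteq> 0} \<union> {g. s g \<noteq> 0})"
      by (rule sup[OF f]; auto)+
    then show ?thesis by (simp only: sum.distrib)
  qed
  have e_diff: "e (\<lambda>x. r x - s x) = e r - e s" if "r \<in> carrier (group_ring G)" "s \<in> carrier (group_ring G)" for r s
    using add[OF group_ring_diff_closed[OF that] that(2)] by simp
  have el: "e (group_elem g) = 1" for g using sup[of "{g}" "group_elem g"] by (auto simp: group_elem_def)
  have mul1: "e (group_elem g \<otimes>\<^bsub>group_ring G\<^esub> s) = e s" if "g \<in> carrier G" "s \<in> carrier (group_ring G)" for g s
    using that(2)
  proof (induction rule: group_ring_induct)
    case zero
    have "group_elem g \<otimes>\<^bsub>group_ring G\<^esub> \<zero>\<^bsub>group_ring G\<^esub> = \<zero>\<^bsub>group_ring G\<^esub>" using that by (intro r_null) auto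
    then show ?case by simp
  next
    case (elem h) then show ?case using that by (simp add: G.group_elem_mult el)
  next
    case (diff r s)
    have "group_elem g \<otimes>\<^bsub>group_ring G\<^esub> (\<lambda>x. r x - s x) = (\<lambda>x. (group_elem g \<otimes>\<^bsub>group_ring G\<^esub> r) x - (group_elem g \<otimes>\<^bsub>group_ring G\<^esub> s) x)"
      by (auto simp: group_ring_mult fun_eq_iff algebra_simps sum_subtractf)
    then show ?case using diff that by (simp add: e_diff)
  qed
  have mul: "e (r \<otimes>\<^bsub>group_ring G\<^esub> s) = e r * e s" if "r \<in> carrier (group_ring G)" "s \<in> carrier (group_ring G)" for r s
    using that(1)
  proof (induction rule: group_ring_induct)
    case zero
    have "\<zero>\<^bsub>group_ring G\<^esub> \<otimes>\<^bsub>group_ring G\<^esub> s = \<zero>\<^bsub>group_ring G\<^esub>" using that by (intro l_null) auto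
    then show ?case by (simp add: e_def)
  next
    case (elem h) then show ?case using that by (simp add: mul1 el)
  next
    case (diff r r')
    let ?t = "\<lambda>x. r x - r' x"
    have t: "?t \<in> carrier (group_ring G)" using diff group_ring_diff_closed by blast
    have "?t \<otimes>\<^bsub>group_ring G\<^esub> s \<oplus>\<^bsub>group_ring G\<^esub> r' \<otimes>\<^bsub>group_ring G\<^esub> s = r \<otimes>\<^bsub>group_ring G\<^esub> s"
      using l_distr[OF t diff(2) that(2)] by simp
    then have "e (?t \<otimes>\<^bsub>group_ring G\<^esub> s) + e (r' \<otimes>\<^bsub>group_ring G\<^esub> s) = e (r \<otimes>\<^bsub>group_ring G\<^esub> s)"
      using add[of "?t \<otimes>\<^bsub>group_ring G\<^esub> s" "r' \<otimes>\<^bsub>group_ring G\<^esub> s"] t diff that by simp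
    then show ?case unfolding e_diff[OF diff(1,2)] using diff by (simp add: left_diff_distrib)
  qed
  show ?thesis
    by unfold_locales
      (use add mul el in \<open>auto simp: trivial_module_def e_def[symmetric] algebra_simps group_ring_one\<close>)
qed

lemma trivial_simps [simp]: "carrier trivial_module = UNIV" "x \<oplus>\<^bsub>trivial_module\<^esub> y = x + y" "\<zero>\<^bsub>trivial_module\<^esub> = 0"
  "group_elem g \<odot>\<^bsub>trivial_module\<^esub> k = k"
proof -
  have "{h. group_elem g h \<noteq> 0} = {g}" by (auto simp: group_elem_def)
  then show "group_elem g \<odot>\<^bsub>trivial_module\<^esub> k = k" by (simp add: trivial_module_def) (simp add: group_elem_def)
qed (simp_all add: trivial_module_def)

section \<open>Projectivity through dual bases\<close>

definition dual_basis :: "('r, 'c) ring_scheme \<Rightarrow> ('r, 'm, 'd) module_scheme \<Rightarrow> 'm set \<Rightarrow> ('m \<Rightarrow> 'm) \<Rightarrow> ('m \<Rightarrow> 'm \<Rightarrow> 'r) \<Rightarrow> bool"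
  where "dual_basis R P J x \<phi> \<longleftrightarrow> finite J \<and> x \<in> J \<rightarrow> carrier P \<and>
    (\<forall>j\<in>J. \<phi> j \<in> carrier P \<rightarrow> carrier R \<and> (\<forall>y\<in>carrier P. \<forall>z\<in>carrier P. \<phi> j (y \<oplus>\<^bsub>P\<^esub> z) = \<phi> j y \<oplus>\<^bsub>R\<^esub> \<phi> j z) \<and>
      (\<forall>a\<in>carrier R. \<forall>y\<in>carrier P. \<phi> j (a \<odot>\<^bsub>P\<^esub> y) = a \<otimes>\<^bsub>R\<^esub> \<phi> j y)) \<and>
    (\<forall>y\<in>carrier P. y = (\<Oplus>\<^bsub>P\<^esub>j\<in>J. \<phi> j y \<odot>\<^bsub>P\<^esub> x j))"

text \<open>Embed \<open>P\<close> as a summand of a free module. The finitely many generators of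
  \<open>P\<close> involve only finitely many coordinates; these coordinates, together with the
  projections of the corresponding unit vectors, form the dual basis. It turns each later use of
  projectivity into a finite formula.\<close>

lemma ex_dual_basis:
  fixes P :: "('r, 'm, 'd) module_scheme"
  assumes fg: "fin_generated R P" and pr: "projective_module R P"
  shows "\<exists>J x \<phi>. dual_basis R P J x \<phi>"
proof -
  interpret left_module R P using pr by (simp add: projective_module_def)
  obtain S :: "'m set" and i p where i: "i \<in> lmod_hom R P (free_module R S)" and p: "p \<in> lmod_hom R (free_module R S) P"
    and pi: "\<And>x. x \<in> carrier P \<Longrightarrow> p (i x) = x" using pr unfolding projective_module_def by blast
  let ?F = "free_module R S"
  have F: "carrier ?F = {f. finite {s. f s \<noteq> \<zero>\<^bsub>R\<^esub>} \<and> {s. f s \<noteq> \<zero>\<^bsub>R\<^esub>} \<subseteq> S \<and> (\<forall>s\<in>S. f s \<in> carrier R)}"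
    "\<And>f h. f \<oplus>\<^bsub>?F\<^esub> h = (\<lambda>s. if s \<in> S then f s \<oplus>\<^bsub>R\<^esub> h s else \<zero>\<^bsub>R\<^esub>)"
    "\<And>a f. a \<odot>\<^bsub>?F\<^esub> f = (\<lambda>s. if s \<in> S then a \<otimes>\<^bsub>R\<^esub> f s else \<zero>\<^bsub>R\<^esub>)"
    by (simp_all add: free_module_def)
  have iF: "i x \<in> carrier ?F" if "x \<in> carrier P" for x using lmod_hom_closed[OF i that] .
  have iS: "i x s \<in> carrier R" if "x \<in> carrier P" for x s
  proof (cases "s \<in> S")
    case True then show ?thesis using iF[OF that] unfolding F(1) by blast
  next
    case False
    then have "i x s = \<zero>\<^bsub>R\<^esub>" using iF[OF that] unfolding F(1) by blast
    then show ?thesis by simp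
  qed
  have iadd: "i (x \<oplus>\<^bsub>P\<^esub> y) s = i x s \<oplus>\<^bsub>R\<^esub> i y s" if "x \<in> carrier P" "y \<in> carrier P" "s \<in> S" for x y s
    using addhom_add[OF lmod_hom_addhom[OF i] that(1,2)] that(3) by (simp add: F)
  have ismult: "i (a \<odot>\<^bsub>P\<^esub> x) s = a \<otimes>\<^bsub>R\<^esub> i x s" if "a \<in> carrier R" "x \<in> carrier P" "s \<in> S" for a x s
    using lmod_hom_smult[OF i that(1,2)] that(3) by (simp add: F)
  obtain K where K: "finite K" "K \<subseteq> carrier P"
    "\<And>x. x \<in> carrier P \<Longrightarrow> \<exists>c \<in> K \<rightarrow> carrier R. x = (\<Oplus>\<^bsub>P\<^esub>e\<in>K. c e \<odot>\<^bsub>P\<^esub> e)"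
    using fg by (auto simp: fin_generated_def)
  \<comment> \<open>The coordinates that occur in some generator; \<open>supp\<close> shows that all
    others vanish on the whole of \<open>P\<close>.\<close>
  define J where "J = (\<Union>e\<in>K. {s. i e s \<noteq> \<zero>\<^bsub>R\<^esub>})"
  have J: "finite J" "J \<subseteq> S" using K iF unfolding J_def F(1) by blast+
  have izero: "i \<zero>\<^bsub>P\<^esub> s = \<zero>\<^bsub>R\<^esub>" if "s \<in> S" for s
    using ismult[OF R.zero_closed M.zero_closed that] iS[OF M.zero_closed] zero_lsmult[OF M.zero_closed] by simp
  have supp: "i x s = \<zero>\<^bsub>R\<^esub>" if x: "x \<in> carrier P" and s: "s \<notin> J" for x s
  proof (cases "s \<in> S")
    case False then show ?thesis using iF[OF x] unfolding F(1) by auto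
  next
    case sS: True
    obtain c where c: "c \<in> K \<rightarrow> carrier R" "x = (\<Oplus>\<^bsub>P\<^esub>e\<in>K. c e \<odot>\<^bsub>P\<^esub> e)" using K(3)[OF x] by blast
    have "i (\<Oplus>\<^bsub>P\<^esub>e\<in>K'. c e \<odot>\<^bsub>P\<^esub> e) s = \<zero>\<^bsub>R\<^esub>" if "K' \<subseteq> K" for K'
      using finite_subset[OF that K(1)] that
    proof (induction K')
      case empty then show ?case using izero sS by simp
    next
      case (insert e K')
      then have e: "e \<in> carrier P" "c e \<in> carrier R" "e \<in> K" using K c by auto
      have fc: "(\<lambda>e. c e \<odot>\<^bsub>P\<^esub> e) \<in> K' \<rightarrow> carrier P" using insert K c by (auto intro!: lsmult_closed)
      then have sc: "(\<Oplus>\<^bsub>P\<^esub>e\<in>K'. c e \<odot>\<^bsub>P\<^esub> e) \<in> carrier P" by (rule M.finsum_closed)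
      have "i e s = \<zero>\<^bsub>R\<^esub>" using s e unfolding J_def by blast
      then have "i (c e \<odot>\<^bsub>P\<^esub> e) s = \<zero>\<^bsub>R\<^esub>" using ismult[OF e(2,1) sS] e by simp
      moreover have "(\<Oplus>\<^bsub>P\<^esub>e\<in>insert e K'. c e \<odot>\<^bsub>P\<^esub> e) = c e \<odot>\<^bsub>P\<^esub> e \<oplus>\<^bsub>P\<^esub> (\<Oplus>\<^bsub>P\<^esub>e\<in>K'. c e \<odot>\<^bsub>P\<^esub> e)"
        using insert fc e by (intro M.finsum_insert) (auto intro!: lsmult_closed)
      ultimately show ?case using insert iadd[OF lsmult_closed[OF e(2,1)] sc sS] by simp
    qed
    then show ?thesis using c by blast
  qed
  define \<delta> :: "'m \<Rightarrow> 'm \<Rightarrow> 'r" where "\<delta> s = (\<lambda>t. if t = s then \<one>\<^bsub>R\<^esub> else \<zero>\<^bsub>R\<^esub>)" for s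
  have \<delta>: "\<delta> s \<in> carrier ?F" if "s \<in> S" for s
    using that unfolding F(1) by (auto simp: \<delta>_def intro!: finite_subset[of _ "{s}"])
  have p\<delta>: "p (\<delta> s) \<in> carrier P" if "s \<in> S" for s using lmod_hom_closed[OF p \<delta>[OF that]] .
  have zF: "(\<lambda>_. \<zero>\<^bsub>R\<^esub>) \<in> carrier ?F" unfolding F(1) by simp
  have p0: "p (\<lambda>_. \<zero>\<^bsub>R\<^esub>) = \<zero>\<^bsub>P\<^esub>"
  proof -
    have "(\<lambda>_. \<zero>\<^bsub>R\<^esub>) = \<zero>\<^bsub>R\<^esub> \<odot>\<^bsub>?F\<^esub> (\<lambda>_. \<zero>\<^bsub>R\<^esub>)" by (simp add: F fun_eq_iff)
    then have "p (\<lambda>_. \<zero>\<^bsub>R\<^esub>) = \<zero>\<^bsub>R\<^esub> \<odot>\<^bsub>P\<^esub> p (\<lambda>_. \<zero>\<^bsub>R\<^esub>)" using lmod_hom_smult[OF p R.zero_closed zF] by simp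
    then show ?thesis using zero_lsmult[OF lmod_hom_closed[OF p zF]] by simp
  qed
  have exp: "p f = (\<Oplus>\<^bsub>P\<^esub>s\<in>A. f s \<odot>\<^bsub>P\<^esub> p (\<delta> s))" if "finite A" "A \<subseteq> S" "f \<in> carrier ?F" "\<And>s. s \<notin> A \<Longrightarrow> f s = \<zero>\<^bsub>R\<^esub>" for A f
    using that
  proof (induction A arbitrary: f)
    case empty
    then have "f = (\<lambda>_. \<zero>\<^bsub>R\<^esub>)" by auto
    then show ?case using p0 by simp
  next
    case (insert a A)
    define f' where "f' = f(a := \<zero>\<^bsub>R\<^esub>)"
    have fR: "f s \<in> carrier R" if "s \<in> S" for s using insert.prems that unfolding F(1) by auto
    have "{s. f' s \<noteq> \<zero>\<^bsub>R\<^esub>} \<subseteq> {s. f s \<noteq> \<zero>\<^bsub>R\<^esub>}" by (auto simp: f'_def)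
    then have f': "f' \<in> carrier ?F" using insert.prems(2) unfolding F(1)
      by (auto simp: f'_def intro: finite_subset)
    have a: "a \<in> S" using insert.prems by simp
    have sm: "f a \<odot>\<^bsub>?F\<^esub> \<delta> a \<in> carrier ?F" 
      using fR[OF a] a unfolding F(1) F(3) by (auto simp: \<delta>_def intro!: finite_subset[of _ "{a}"])
    have "f = f a \<odot>\<^bsub>?F\<^esub> \<delta> a \<oplus>\<^bsub>?F\<^esub> f'"
    proof
      fix s show "f s = (f a \<odot>\<^bsub>?F\<^esub> \<delta> a \<oplus>\<^bsub>?F\<^esub> f') s"
        using insert.prems(2) fR[of s] fR[OF a] a unfolding F by (auto simp: \<delta>_def f'_def)
    qed
    then have "p f = f a \<odot>\<^bsub>P\<^esub> p (\<delta> a) \<oplus>\<^bsub>P\<^esub> p f'"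
      using addhom_add[OF lmod_hom_addhom[OF p] sm f'] lmod_hom_smult[OF p fR[OF a] \<delta>[OF a]] by simp
    also have "p f' = (\<Oplus>\<^bsub>P\<^esub>s\<in>A. f' s \<odot>\<^bsub>P\<^esub> p (\<delta> s))"
      by (rule insert.IH[OF _ f']) (use insert.prems in \<open>auto simp: f'_def\<close>)
    also have "\<dots> = (\<Oplus>\<^bsub>P\<^esub>s\<in>A. f s \<odot>\<^bsub>P\<^esub> p (\<delta> s))"
      using insert fR p\<delta> by (intro M.finsum_cong') (auto simp: f'_def intro!: lsmult_closed)
    also have "f a \<odot>\<^bsub>P\<^esub> p (\<delta> a) \<oplus>\<^bsub>P\<^esub> \<dots> = (\<Oplus>\<^bsub>P\<^esub>s\<in>insert a A. f s \<odot>\<^bsub>P\<^esub> p (\<delta> s))"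
      using insert fR p\<delta> a by (intro M.finsum_insert[symmetric]) (auto intro!: lsmult_closed)
    finally show ?case .
  qed
  have "dual_basis R P J (\<lambda>s. p (\<delta> s)) (\<lambda>s x. i x s)"
    unfolding dual_basis_def
  proof (intro conjI ballI J)
    fix y assume y: "y \<in> carrier P"
    show "y = (\<Oplus>\<^bsub>P\<^esub>j\<in>J. i y j \<odot>\<^bsub>P\<^esub> p (\<delta> j))"
      using exp[OF J iF[OF y]] supp[OF y] pi[OF y] by simp
  qed (use J p\<delta> iS iadd ismult in auto)
  then show ?thesis by blast
qed

text \<open>Preimages are chosen for the finitely many \<open>\<beta> (x j)\<close> only and
  extended with the coefficients \<open>\<phi> j\<close>. It therefore suffices that these values
  lie in the image of \<open>d\<close>.\<close>

lemma projective_lift: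
  assumes P: "left_module R P" and M: "left_module R M" and N: "left_module R N"
    and db: "dual_basis R P J x \<phi>" and d: "d \<in> lmod_hom R M N" and \<beta>: "\<beta> \<in> lmod_hom R P N"
    and im: "\<And>j. j \<in> J \<Longrightarrow> \<beta> (x j) \<in> d ` carrier M"
  obtains h where "h \<in> lmod_hom R P M" "\<And>y. y \<in> carrier P \<Longrightarrow> d (h y) = \<beta> y"
proof -
  interpret P: left_module R P by fact
  interpret M: left_module R M by fact
  interpret N: left_module R N by fact
  have "\<forall>j\<in>J. \<exists>y\<in>carrier M. d y = \<beta> (x j)" using im by (metis imageE)
  then obtain m where m: "\<And>j. j \<in> J \<Longrightarrow> m j \<in> carrier M" "\<And>j. j \<in> J \<Longrightarrow> d (m j) = \<beta> (x j)" by metis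
  have J: "finite J" and x: "\<And>j. j \<in> J \<Longrightarrow> x j \<in> carrier P"
    and \<phi>: "\<And>j y. j \<in> J \<Longrightarrow> y \<in> carrier P \<Longrightarrow> \<phi> j y \<in> carrier R"
    "\<And>j y z. j \<in> J \<Longrightarrow> y \<in> carrier P \<Longrightarrow> z \<in> carrier P \<Longrightarrow> \<phi> j (y \<oplus>\<^bsub>P\<^esub> z) = \<phi> j y \<oplus>\<^bsub>R\<^esub> \<phi> j z"
    "\<And>j a y. j \<in> J \<Longrightarrow> a \<in> carrier R \<Longrightarrow> y \<in> carrier P \<Longrightarrow> \<phi> j (a \<odot>\<^bsub>P\<^esub> y) = a \<otimes>\<^bsub>R\<^esub> \<phi> j y"
    and exp: "\<And>y. y \<in> carrier P \<Longrightarrow> y = (\<Oplus>\<^bsub>P\<^esub>j\<in>J. \<phi> j y \<odot>\<^bsub>P\<^esub> x j)"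
    using db unfolding dual_basis_def by blast+
  define h where "h y = (\<Oplus>\<^bsub>M\<^esub>j\<in>J. \<phi> j y \<odot>\<^bsub>M\<^esub> m j)" for y
  have t: "\<phi> j y \<odot>\<^bsub>M\<^esub> m j \<in> carrier M" if "j \<in> J" "y \<in> carrier P" for j y
    using that \<phi> m by (intro M.lsmult_closed) auto
  have "h \<in> lmod_hom R P M"
  proof (rule lmod_homI)
    show "addhom P M h"
      unfolding addhom_def
    proof (intro conjI ballI)
      show "h \<in> carrier P \<rightarrow> carrier M" using t by (auto simp: h_def intro!: M.M.finsum_closed)
      fix y z assume yz: "y \<in> carrier P" "z \<in> carrier P"
      have "h (y \<oplus>\<^bsub>P\<^esub> z) = (\<Oplus>\<^bsub>M\<^esub>j\<in>J. \<phi> j y \<odot>\<^bsub>M\<^esub> m j \<oplus>\<^bsub>M\<^esub> \<phi> j z \<odot>\<^bsub>M\<^esub> m j)"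
        unfolding h_def using yz t \<phi> m by (intro M.M.finsum_cong') (auto simp: M.lsmult_l_distr)
      also have "\<dots> = h y \<oplus>\<^bsub>M\<^esub> h z" unfolding h_def using yz t by (intro M.M.finsum_addf) auto
      finally show "h (y \<oplus>\<^bsub>P\<^esub> z) = h y \<oplus>\<^bsub>M\<^esub> h z" .
    qed
    fix a y assume ay: "a \<in> carrier R" "y \<in> carrier P"
    have "h (a \<odot>\<^bsub>P\<^esub> y) = (\<Oplus>\<^bsub>M\<^esub>j\<in>J. a \<odot>\<^bsub>M\<^esub> (\<phi> j y \<odot>\<^bsub>M\<^esub> m j))"
      unfolding h_def using ay t \<phi> m by (intro M.M.finsum_cong') (auto simp: M.lsmult_assoc intro!: M.lsmult_closed)
    also have "\<dots> = a \<odot>\<^bsub>M\<^esub> h y"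
      unfolding h_def using ay t J
      by (intro addhom_finsum[OF M.is_abelian_group M.is_abelian_group M.addhom_lsmult, symmetric]) auto
    finally show "h (a \<odot>\<^bsub>P\<^esub> y) = a \<odot>\<^bsub>M\<^esub> h y" .
  qed
  moreover have "d (h y) = \<beta> y" if y: "y \<in> carrier P" for y
  proof -
    have "d (h y) = (\<Oplus>\<^bsub>N\<^esub>j\<in>J. d (\<phi> j y \<odot>\<^bsub>M\<^esub> m j))"
      unfolding h_def using y t J by (intro addhom_finsum[OF M.is_abelian_group N.is_abelian_group lmod_hom_addhom[OF d]]) auto
    also have "\<dots> = (\<Oplus>\<^bsub>N\<^esub>j\<in>J. \<beta> (\<phi> j y \<odot>\<^bsub>P\<^esub> x j))"
    proof (rule N.M.finsum_cong')
      show "(\<lambda>j. \<beta> (\<phi> j y \<odot>\<^bsub>P\<^esub> x j)) \<in> J \<rightarrow> carrier N"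
        using lmod_hom_closed[OF \<beta> P.lsmult_closed[OF \<phi>(1)[OF _ y] x]] by blast
      show "d (\<phi> j y \<odot>\<^bsub>M\<^esub> m j) = \<beta> (\<phi> j y \<odot>\<^bsub>P\<^esub> x j)" if "j \<in> J" for j
        using lmod_hom_smult[OF d \<phi>(1)[OF that y] m(1)[OF that]] lmod_hom_smult[OF \<beta> \<phi>(1)[OF that y] x[OF that]] m(2)[OF that]
        by simp
    qed simp
    also have "\<dots> = \<beta> (\<Oplus>\<^bsub>P\<^esub>j\<in>J. \<phi> j y \<odot>\<^bsub>P\<^esub> x j)"
    proof (rule addhom_finsum[OF P.is_abelian_group N.is_abelian_group lmod_hom_addhom[OF \<beta>] J, symmetric])
      show "(\<lambda>j. \<phi> j y \<odot>\<^bsub>P\<^esub> x j) \<in> J \<rightarrow> carrier P" using P.lsmult_closed[OF \<phi>(1)[OF _ y] x] by blast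
    qed
    also have "\<dots> = \<beta> y" using exp[OF y] by simp
    finally show ?thesis .
  qed
  ultimately show ?thesis using that by blast
qed

section \<open>Equivariant maps into the bar complex\<close>

definition barhom :: "('g, 'b) monoid_scheme \<Rightarrow> ('g \<Rightarrow> int, 'm) module \<Rightarrow> nat \<Rightarrow> ('m \<Rightarrow> 'g list \<Rightarrow>\<^sub>0 int) \<Rightarrow> bool"
  where "barhom G M i f \<longleftrightarrow> (\<forall>x\<in>carrier M. Poly_Mapping.keys (f x) \<subseteq> tuples G i) \<and>
    (\<forall>x\<in>carrier M. \<forall>y\<in>carrier M. f (x \<oplus>\<^bsub>M\<^esub> y) = f x + f y) \<and>
    (\<forall>g\<in>carrier G. \<forall>x\<in>carrier M. f (group_elem g \<odot>\<^bsub>M\<^esub> x) = gact G g (f x))"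

text \<open>The action of the group ring on bar chains. These are formal combinations rather than a
  module record, so linearity of maps into them is phrased with \<open>gact\<close> and recovered in
  \<open>barhom_rsm\<close>.\<close>

definition rsm :: "('g, 'b) monoid_scheme \<Rightarrow> ('g \<Rightarrow> int) \<Rightarrow> ('g list \<Rightarrow>\<^sub>0 int) \<Rightarrow> ('g list \<Rightarrow>\<^sub>0 int)"
  where "rsm G r u = (\<Sum>g | r g \<noteq> 0. frag_cmul (r g) (gact G g u))"

lemma rsm_superset: "finite A \<Longrightarrow> {g. r g \<noteq> 0} \<subseteq> A \<Longrightarrow> rsm G r u = (\<Sum>g\<in>A. frag_cmul (r g) (gact G g u))"
  unfolding rsm_def by (intro sum.mono_neutral_left) auto

lemma rsm_zero [simp]: "rsm G (\<lambda>_. 0) u = 0"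
  by (simp add: rsm_def)

lemma rsm_elem [simp]: "rsm G (group_elem g) u = gact G g u"
  using rsm_superset[of "{g}" "group_elem g" G u] by (auto simp: group_elem_def)

lemma rsm_add:
  assumes "r \<in> carrier (group_ring G)" "s \<in> carrier (group_ring G)"
  shows "rsm G (\<lambda>x. r x + s x) u = rsm G r u + rsm G s u"
proof -
  have f: "finite ({g. r g \<noteq> 0} \<union> {g. s g \<noteq> 0})" using assms by (simp add: group_ring_carrier)
  show ?thesis
  proof -
    have "rsm G r u = (\<Sum>g\<in>{g. r g \<noteq> 0} \<union> {g. s g \<noteq> 0}. frag_cmul (r g) (gact G g u))"
      "rsm G s u = (\<Sum>g\<in>{g. r g \<noteq> 0} \<union> {g. s g \<noteq> 0}. frag_cmul (s g) (gact G g u))"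
      "rsm G (\<lambda>x. r x + s x) u = (\<Sum>g\<in>{g. r g \<noteq> 0} \<union> {g. s g \<noteq> 0}. frag_cmul (r g + s g) (gact G g u))"
      by (rule rsm_superset[OF f]; auto)+
    then show ?thesis by (simp only: sum.distrib frag_cmul_distrib)
  qed
qed

lemma rsm_diff:
  assumes "r \<in> carrier (group_ring G)" "s \<in> carrier (group_ring G)"
  shows "rsm G (\<lambda>x. r x - s x) u = rsm G r u - rsm G s u"
  using rsm_add[OF group_ring_diff_closed[OF assms] assms(2), of u] by simp

lemma gact_cmul: "gact G g (frag_cmul c u) = frag_cmul c (gact G g u)"
  by (simp add: gact_def frag_extend_cmul)

lemma bd_rsm: "frag_extend bd (rsm G r u) = rsm G r (frag_extend bd u)"
proof (cases "finite {g. r g \<noteq> 0}")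
  case True
  then show ?thesis by (simp add: rsm_def frag_extend_sum comp_def frag_extend_cmul bd_gact)
qed (simp add: rsm_def)

lemma keys_rsm:
  assumes "group G" "Poly_Mapping.keys u \<subseteq> tuples G i" "r \<in> carrier (group_ring G)"
  shows "Poly_Mapping.keys (rsm G r u) \<subseteq> tuples G i"
proof -
  have "frag_cmul (r g) (gact G g u) \<in> carrier (free_Abelian_group (tuples G i))" if "g \<in> {g. r g \<noteq> 0}" for g
  proof -
    have "g \<in> carrier G" using assms(3) that by (auto simp: group_ring_carrier)
    from keys_gact[OF assms(1,2) this] show ?thesis by auto
  qed
  then have "rsm G r u \<in> carrier (free_Abelian_group (tuples G i))" unfolding rsm_def by (rule sum_closed_free_Abelian_group)
  then show ?thesis by simp
qed

lemma (in group) gact_gact: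
  assumes "Poly_Mapping.keys u \<subseteq> tuples G i" "g \<in> carrier G" "h \<in> carrier G"
  shows "gact G g (gact G h u) = gact G (g \<otimes> h) u"
  using assms(1)
proof (rule free_Abelian_group_induct)
  fix l assume "l \<in> tuples G i"
  then have *: "map ((\<otimes>) g) (map ((\<otimes>) h) l) = map ((\<otimes>) (g \<otimes> h)) l"
    using assms by (auto simp: tuples_def m_assoc)
  show "gact G g (gact G h (frag_of l)) = gact G (g \<otimes> h) (frag_of l)" by (simp only: gact_simps *)
qed simp_all

lemma (in group) gact_rsm:
  assumes R: "ring (group_ring G)" and u: "Poly_Mapping.keys u \<subseteq> tuples G i" and g: "g \<in> carrier G" and r: "r \<in> carrier (group_ring G)"
  shows "rsm G (group_elem g \<otimes>\<^bsub>group_ring G\<^esub> r) u = gact G g (rsm G r u)"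
  using r
proof (induction rule: group_ring_induct)
  interpret ring "group_ring G" by fact
  case zero
  have "group_elem g \<otimes>\<^bsub>group_ring G\<^esub> \<zero>\<^bsub>group_ring G\<^esub> = \<zero>\<^bsub>group_ring G\<^esub>" using g by (intro r_null) auto
  then show ?case by simp
next
  case (elem h) then show ?case using g by (simp add: group_elem_mult gact_gact[OF u])
next
  interpret ring "group_ring G" by fact
  case (diff r s)
  have "group_elem g \<otimes>\<^bsub>group_ring G\<^esub> (\<lambda>x. r x - s x) = (\<lambda>x. (group_elem g \<otimes>\<^bsub>group_ring G\<^esub> r) x - (group_elem g \<otimes>\<^bsub>group_ring G\<^esub> s) x)"
    by (auto simp: group_ring_mult fun_eq_iff algebra_simps sum_subtractf)
  then show ?case using diff g by (simp add: rsm_diff)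
qed

lemma barhom_rsm:
  assumes M: "left_module (group_ring G) M" and f: "barhom G M i f" and r: "r \<in> carrier (group_ring G)" and x: "x \<in> carrier M"
  shows "f (r \<odot>\<^bsub>M\<^esub> x) = rsm G r (f x)"
  using r
proof (induction rule: group_ring_induct)
  interpret left_module "group_ring G" M by fact
  case zero
  have "f (\<zero>\<^bsub>M\<^esub> \<oplus>\<^bsub>M\<^esub> \<zero>\<^bsub>M\<^esub>) = f \<zero>\<^bsub>M\<^esub> + f \<zero>\<^bsub>M\<^esub>" using f unfolding barhom_def by blast
  then have "f \<zero>\<^bsub>M\<^esub> = 0" by simp
  then show ?case using zero_lsmult[OF x] by simp
next
  case (elem g) then show ?case using f x by (simp add: barhom_def)
next
  interpret left_module "group_ring G" M by fact
  case (diff r s)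
  let ?t = "\<lambda>x. r x - s x"
  have t: "?t \<in> carrier (group_ring G)" using diff group_ring_diff_closed by blast
  have "f (?t \<odot>\<^bsub>M\<^esub> x) + f (s \<odot>\<^bsub>M\<^esub> x) = f (r \<odot>\<^bsub>M\<^esub> x)"
    using lsmult_l_distr[OF t diff(2) x] f lsmult_closed[OF t x] lsmult_closed[OF diff(2) x] by (simp add: barhom_def)
  then show ?case using diff by (simp add: rsm_diff algebra_simps)
qed

text \<open>Coning with \<open>\<one>\<close> gives a chain bounded by any cycle, but not
  equivariantly. It is applied only to the values at the dual basis, and the equivariant lift is
  assembled from these.\<close>

lemma barhom_lift:
  assumes G: "group G" and P: "left_module (group_ring G) P" and db: "dual_basis (group_ring G) P J x \<phi>"
    and f: "barhom G P i f" and cyc: "\<And>y. y \<in> carrier P \<Longrightarrow> frag_extend bd (f y) = 0"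
  obtains h where "barhom G P (Suc i) h" "\<And>y. y \<in> carrier P \<Longrightarrow> frag_extend bd (h y) = f y"
proof -
  interpret G: group G by fact
  interpret P: left_module "group_ring G" P by fact
  have R: "ring (group_ring G)" ..
  have J: "finite J" and x: "\<And>j. j \<in> J \<Longrightarrow> x j \<in> carrier P"
    and \<phi>: "\<And>j y. j \<in> J \<Longrightarrow> y \<in> carrier P \<Longrightarrow> \<phi> j y \<in> carrier (group_ring G)"
    "\<And>j y z. j \<in> J \<Longrightarrow> y \<in> carrier P \<Longrightarrow> z \<in> carrier P \<Longrightarrow> \<phi> j (y \<oplus>\<^bsub>P\<^esub> z) = \<phi> j y \<oplus>\<^bsub>group_ring G\<^esub> \<phi> j z"
    "\<And>j a y. j \<in> J \<Longrightarrow> a \<in> carrier (group_ring G) \<Longrightarrow> y \<in> carrier P \<Longrightarrow> \<phi> j (a \<odot>\<^bsub>P\<^esub> y) = a \<otimes>\<^bsub>group_ring G\<^esub> \<phi> j y"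
    and exp: "\<And>y. y \<in> carrier P \<Longrightarrow> y = (\<Oplus>\<^bsub>P\<^esub>j\<in>J. \<phi> j y \<odot>\<^bsub>P\<^esub> x j)"
    using db unfolding dual_basis_def by blast+
  have fk: "Poly_Mapping.keys (f y) \<subseteq> tuples G i" if "y \<in> carrier P" for y using f that by (simp add: barhom_def)
  have fadd: "f (y \<oplus>\<^bsub>P\<^esub> z) = f y + f z" if "y \<in> carrier P" "z \<in> carrier P" for y z using f that by (simp add: barhom_def)
  have f0: "f \<zero>\<^bsub>P\<^esub> = 0" using fadd[OF P.M.zero_closed P.M.zero_closed] by simp
  define m where "m j = join \<one>\<^bsub>G\<^esub> (f (x j))" for j
  have mk: "Poly_Mapping.keys (m j) \<subseteq> tuples G (Suc i)" if "j \<in> J" for j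
    unfolding m_def using fk x that by (intro keys_join) auto
  have bm: "frag_extend bd (m j) = f (x j)" if "j \<in> J" for j
    using cyc x that by (simp add: m_def bd_join)
  define h where "h y = (\<Sum>j\<in>J. rsm G (\<phi> j y) (m j))" for y
  have "barhom G P (Suc i) h"
    unfolding barhom_def
  proof (intro conjI ballI)
    fix y assume y: "y \<in> carrier P"
    have "h y \<in> carrier (free_Abelian_group (tuples G (Suc i)))"
      unfolding h_def using keys_rsm[OF G mk \<phi>(1)] y by (intro sum_closed_free_Abelian_group) auto
    then show "Poly_Mapping.keys (h y) \<subseteq> tuples G (Suc i)" by simp
  next
    fix y z assume "y \<in> carrier P" "z \<in> carrier P"
    then show "h (y \<oplus>\<^bsub>P\<^esub> z) = h y + h z"
      unfolding h_def sum.distrib[symmetric] using \<phi> by (intro sum.cong) (auto simp: rsm_add)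
  next
    fix g y assume gy: "g \<in> carrier G" "y \<in> carrier P"
    have "gact G g (h y) = (\<Sum>j\<in>J. gact G g (rsm G (\<phi> j y) (m j)))"
      using J by (simp add: h_def gact_def frag_extend_sum comp_def)
    also have "\<dots> = h (group_elem g \<odot>\<^bsub>P\<^esub> y)"
      unfolding h_def
    proof (rule sum.cong[OF refl])
      fix j assume j: "j \<in> J"
      show "gact G g (rsm G (\<phi> j y) (m j)) = rsm G (\<phi> j (group_elem g \<odot>\<^bsub>P\<^esub> y)) (m j)"
        using G.gact_rsm[OF R mk[OF j] gy(1) \<phi>(1)[OF j gy(2)]] \<phi>(3)[OF j group_elem_closed[OF gy(1)] gy(2)] by simp
    qed
    finally show "h (group_elem g \<odot>\<^bsub>P\<^esub> y) = gact G g (h y)" by simp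
  qed
  moreover have "frag_extend bd (h y) = f y" if y: "y \<in> carrier P" for y
  proof -
    have fs: "f (\<Oplus>\<^bsub>P\<^esub>j\<in>J'. \<phi> j y \<odot>\<^bsub>P\<^esub> x j) = (\<Sum>j\<in>J'. f (\<phi> j y \<odot>\<^bsub>P\<^esub> x j))" if "J' \<subseteq> J" for J'
      using finite_subset[OF that J] that
    proof (induction J')
      case empty then show ?case using f0 by simp
    next
      case (insert j J')
      have c: "\<phi> j y \<odot>\<^bsub>P\<^esub> x j \<in> carrier P" if "j \<in> J" for j using that y \<phi> x by (intro P.lsmult_closed) auto
      then have "(\<Oplus>\<^bsub>P\<^esub>j\<in>J'. \<phi> j y \<odot>\<^bsub>P\<^esub> x j) \<in> carrier P" using insert by (intro P.M.finsum_closed) auto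
      then show ?case using insert c by (simp add: fadd Pi_iff subset_iff)
    qed
    have "frag_extend bd (h y) = (\<Sum>j\<in>J. frag_extend bd (rsm G (\<phi> j y) (m j)))"
      using J by (simp add: h_def frag_extend_sum comp_def)
    also have "\<dots> = (\<Sum>j\<in>J. f (\<phi> j y \<odot>\<^bsub>P\<^esub> x j))"
      using y \<phi> x by (intro sum.cong) (auto simp: bd_rsm bm barhom_rsm[OF P f])
    also have "\<dots> = f y" using fs[of J] exp[OF y] by simp
    finally show ?thesis .
  qed
  ultimately show ?thesis using that by blast
qed

lemma hom_cobd:
  assumes M: "gmod G M act" and N: "gmod G N act'" and f: "addhom M N f"
    and e: "\<And>g x. g \<in> carrier G \<Longrightarrow> x \<in> carrier M \<Longrightarrow> f (act g x) = act' g (f x)"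
    and \<theta>: "\<theta> \<in> tuples G i \<rightarrow> carrier M" and gs: "gs \<in> tuples G (Suc i)"
  shows "f (cobd G M act i \<theta> gs) = cobd G N act' i (\<lambda>gs\<in>tuples G i. f (\<theta> gs)) gs"
proof -
  interpret M: gmod G M act by fact
  interpret N: gmod G N act' by fact
  have ab: "abelian_group M" "abelian_group N" ..
  note mt = M.merge_tuples[OF gs] and tt = M.tl_tuples[OF gs] and bt = M.butlast_tuples[OF gs]
  note cl = addhom_closed[OF f]
  have c: "\<theta> (tl gs) \<in> carrier M" "\<theta> (butlast gs) \<in> carrier M" "\<And>j. j < i \<Longrightarrow> \<theta> (merge_at G j gs) \<in> carrier M"
    using \<theta> mt tt bt by auto
  let ?s = "\<lambda>j. [((-1::int) ^ Suc j)] \<cdot>\<^bsub>M\<^esub> \<theta> (merge_at G j gs)"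
  have s: "(\<Oplus>\<^bsub>M\<^esub>j\<in>{..<i}. ?s j) \<in> carrier M" using c by (intro M.M.finsum_closed) auto
  have "f (\<Oplus>\<^bsub>M\<^esub>j\<in>{..<i}. ?s j) = (\<Oplus>\<^bsub>N\<^esub>j\<in>{..<i}. f (?s j))"
    using c by (intro addhom_finsum[OF ab f]) auto
  also have "\<dots> = (\<Oplus>\<^bsub>N\<^esub>j\<in>{..<i}. [((-1::int) ^ Suc j)] \<cdot>\<^bsub>N\<^esub> (\<lambda>gs\<in>tuples G i. f (\<theta> gs)) (merge_at G j gs))"
    using c cl mt by (intro N.M.finsum_cong') (auto simp: addhom_ipow[OF ab f])
  finally have "f (\<Oplus>\<^bsub>M\<^esub>j\<in>{..<i}. ?s j) = (\<Oplus>\<^bsub>N\<^esub>j\<in>{..<i}. [((-1::int) ^ Suc j)] \<cdot>\<^bsub>N\<^esub> (\<lambda>gs\<in>tuples G i. f (\<theta> gs)) (merge_at G j gs))" .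
  then show ?thesis
    using gs tt bt c s by (simp add: cobd_def addhom_add[OF f] M.act_closed e addhom_ipow[OF ab f])
qed

section \<open>Comparison with the bar resolution\<close>

locale fp_res =
  fixes G :: "('g, 'b) monoid_scheme" and n :: nat and F :: "nat \<Rightarrow> ('g \<Rightarrow> int, 'm) module" and d aug
  assumes group_G: "group G" and FP: "FP_resolution G n F d aug"
begin

abbreviation "R \<equiv> group_ring G"
abbreviation "act i \<equiv> \<lambda>g x. group_elem g \<odot>\<^bsub>F i\<^esub> x"

lemma lm: "i \<le> n \<Longrightarrow> left_module R (F i)"
  using FP by (simp add: FP_resolution_def partial_resolution_def)

lemma dhom: "Suc i \<le> n \<Longrightarrow> d (Suc i) \<in> lmod_hom R (F (Suc i)) (F i)"
  using FP unfolding FP_resolution_def partial_resolution_def by (metis One_nat_def diff_Suc_1 le_add1 plus_1_eq_Suc)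

lemma aug_hom: "aug \<in> lmod_hom R (F 0) trivial_module"
  using FP by (simp add: FP_resolution_def partial_resolution_def)

lemma aug_surj: "aug ` carrier (F 0) = UNIV"
  using FP by (simp add: FP_resolution_def partial_resolution_def)

lemma exact_0: "1 \<le> n \<Longrightarrow> d (Suc 0) ` carrier (F (Suc 0)) = {x \<in> carrier (F 0). aug x = 0}"
  using FP by (simp add: FP_resolution_def partial_resolution_def)

lemma exact: "Suc (Suc i) \<le> n \<Longrightarrow> d (Suc (Suc i)) ` carrier (F (Suc (Suc i))) = {x \<in> carrier (F (Suc i)). d (Suc i) x = \<zero>\<^bsub>F i\<^esub>}"
proof -
  assume "Suc (Suc i) \<le> n"
  then have "1 \<le> Suc i \<and> Suc i < n" by simp
  then have "d (Suc (Suc i)) ` carrier (F (Suc (Suc i))) = {x \<in> carrier (F (Suc i)). d (Suc i) x = \<zero>\<^bsub>F (Suc i - 1)\<^esub>}"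
    using FP unfolding FP_resolution_def partial_resolution_def by blast
  then show ?thesis by simp
qed

lemma inj_top: "0 < n \<Longrightarrow> inj_on (d n) (carrier (F n))"
  using FP by (simp add: FP_resolution_def)

lemma db: "i \<le> n \<Longrightarrow> \<exists>J x \<phi>. dual_basis R (F i) J x \<phi>"
  using FP ex_dual_basis[of R "F i"] by (simp add: FP_resolution_def)

lemma gm: "i \<le> n \<Longrightarrow> gmod G (F i) (act i)"
  by (rule gmod_left_module[OF group_G lm])

lemma ab: "i \<le> n \<Longrightarrow> abelian_group (F i)"
  using left_module.is_abelian_group[OF lm] .

text \<open>The ring axioms are part of the locale of left modules, so any module of the resolution
  provides them.\<close>

lemma ring_R: "ring R"
proof -
  interpret left_module R "F 0" by (rule lm) simp
  show ?thesis ..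
qed

lemma dd: assumes "Suc (Suc i) \<le> n" "x \<in> carrier (F (Suc (Suc i)))" shows "d (Suc i) (d (Suc (Suc i)) x) = \<zero>\<^bsub>F i\<^esub>"
  using exact[OF assms(1)] assms(2) by blast

text \<open>The composite of a map \<open>\<gamma>\<close> to the bar complex with the map back to
  the resolution whose inhomogeneous form is \<open>\<eta>\<close>.\<close>

definition tau :: "nat \<Rightarrow> ('m \<Rightarrow> 'g list \<Rightarrow>\<^sub>0 int) \<Rightarrow> ('g list \<Rightarrow> 'm) \<Rightarrow> 'm \<Rightarrow> 'm"
  where "tau i \<gamma> \<eta> x = fext (F i) (gmod.homog G (act i) \<eta>) (\<gamma> x)"

text \<open>Comparison maps \<open>\<gamma>\<close> to and \<open>\<eta>\<close> from the bar resolution in degrees \<open>k\<close> and \<open>k + 1\<close>,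
  and a homotopy from the identity to their composite.\<close>

definition comparison :: "nat \<Rightarrow> ('m \<Rightarrow> 'g list \<Rightarrow>\<^sub>0 int) \<Rightarrow> ('m \<Rightarrow> 'g list \<Rightarrow>\<^sub>0 int) \<Rightarrow>
    ('g list \<Rightarrow> 'm) \<Rightarrow> ('g list \<Rightarrow> 'm) \<Rightarrow> ('m \<Rightarrow> 'm) \<Rightarrow> bool"
  where "comparison k \<gamma> \<gamma>' \<eta> \<eta>' h \<longleftrightarrow>
    barhom G (F k) (Suc k) \<gamma> \<and> barhom G (F (Suc k)) (Suc (Suc k)) \<gamma>' \<and>
    (\<forall>x\<in>carrier (F (Suc k)). frag_extend bd (\<gamma>' x) = \<gamma> (d (Suc k) x)) \<and>
    \<eta> \<in> cochains G (F k) k \<and> \<eta>' \<in> cochains G (F (Suc k)) (Suc k) \<and>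
    (\<forall>gs\<in>tuples G (Suc k). d (Suc k) (\<eta>' gs) = cobd G (F k) (act k) k \<eta> gs) \<and>
    h \<in> lmod_hom R (F k) (F (Suc k)) \<and>
    (\<forall>x\<in>carrier (F (Suc k)). d (Suc k) (x \<ominus>\<^bsub>F (Suc k)\<^esub> tau (Suc k) \<gamma>' \<eta>' x \<ominus>\<^bsub>F (Suc k)\<^esub> h (d (Suc k) x)) = \<zero>\<^bsub>F k\<^esub>)"

lemma fext_gact:
  assumes "gmod G M a" and f: "f \<in> tuples G i \<rightarrow> carrier M" and g: "g \<in> carrier G"
    and e: "\<And>l. l \<in> tuples G i \<Longrightarrow> f (map ((\<otimes>\<^bsub>G\<^esub>) g) l) = a g (f l)"
    and u: "Poly_Mapping.keys u \<subseteq> tuples G i"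
  shows "fext M f (gact G g u) = a g (fext M f u)"
proof -
  interpret M: gmod G M a by fact
  have A: "abelian_group M" ..
  have k: "Poly_Mapping.keys (frag_of (map ((\<otimes>\<^bsub>G\<^esub>) g) l) :: 'g list \<Rightarrow>\<^sub>0 int) \<subseteq> tuples G i" if "l \<in> tuples G i" for l
    using keys_gact[OF group_G, of "frag_of l" i g] that g by simp
  have "fext M f (gact G g u) = fext M (\<lambda>l. fext M f (frag_of (map ((\<otimes>\<^bsub>G\<^esub>) g) l))) u"
    unfolding gact_def by (rule M.M.fext_frag_extend[OF u k f])
  also have "\<dots> = fext M (\<lambda>l. a g (f l)) u"
  proof (rule M.M.fext_cong)
    show "(\<lambda>l. a g (f l)) \<in> Poly_Mapping.keys u \<rightarrow> carrier M" using u f M.act_closed[OF g] by blast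
    fix l assume "l \<in> Poly_Mapping.keys u"
    then have l: "l \<in> tuples G i" using u by blast
    then have "map ((\<otimes>\<^bsub>G\<^esub>) g) l \<in> tuples G i" using k by simp
    then have "f (map ((\<otimes>\<^bsub>G\<^esub>) g) l) \<in> carrier M" using f by blast
    then show "fext M f (frag_of (map ((\<otimes>\<^bsub>G\<^esub>) g) l)) = a g (f l)" using e[OF l] by simp
  qed
  also have "\<dots> = a g (fext M f u)" by (rule addhom_fext[OF A A M.addhom_act[OF g] u f, symmetric])
  finally show ?thesis .
qed

lemma homogF:
  assumes "i \<le> n" "\<eta> \<in> cochains G (F i) i" shows "gmod.homog G (act i) \<eta> \<in> tuples G (Suc i) \<rightarrow> carrier (F i)"
proof -
  interpret gmod G "F i" "act i" by (rule gm[OF assms(1)])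
  show ?thesis using homog_closed[of \<eta> i] assms(2) by (auto simp: cochains_def)
qed

lemma tau_hom:
  assumes i: "i \<le> n" and \<gamma>: "barhom G (F i) (Suc i) \<gamma>" and \<eta>: "\<eta> \<in> cochains G (F i) i"
  shows "tau i \<gamma> \<eta> \<in> lmod_hom R (F i) (F i)"
proof (rule lmod_homI_act[OF lm[OF i] lm[OF i]])
  interpret M: gmod G "F i" "act i" by (rule gm[OF i])
  note h = homogF[OF i \<eta>]
  have k: "Poly_Mapping.keys (\<gamma> x) \<subseteq> tuples G (Suc i)" if "x \<in> carrier (F i)" for x using \<gamma> that by (simp add: barhom_def)
  show "addhom (F i) (F i) (tau i \<gamma> \<eta>)"
    unfolding addhom_def tau_def
  proof (intro conjI ballI funcsetI)
    fix x assume x: "x \<in> carrier (F i)"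
    show "fext (F i) (M.homog \<eta>) (\<gamma> x) \<in> carrier (F i)"
      by (rule M.M.fext_closed) (use h k[OF x] in blast)
  next
    fix x y assume xy: "x \<in> carrier (F i)" "y \<in> carrier (F i)"
    have "\<gamma> (x \<oplus>\<^bsub>F i\<^esub> y) = \<gamma> x + \<gamma> y" using \<gamma> xy by (simp add: barhom_def)
    then show "fext (F i) (M.homog \<eta>) (\<gamma> (x \<oplus>\<^bsub>F i\<^esub> y)) = fext (F i) (M.homog \<eta>) (\<gamma> x) \<oplus>\<^bsub>F i\<^esub> fext (F i) (M.homog \<eta>) (\<gamma> y)"
      using M.M.fext_add[OF k[OF xy(1)] k[OF xy(2)] h] by simp
  qed
  fix g x assume gx: "g \<in> carrier G" "x \<in> carrier (F i)"
  have "\<gamma> (act i g x) = gact G g (\<gamma> x)" using \<gamma> gx by (simp add: barhom_def)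
  moreover have "M.homog \<eta> (map ((\<otimes>\<^bsub>G\<^esub>) g) l) = act i g (M.homog \<eta> l)" if "l \<in> tuples G (Suc i)" for l
    using M.homog_gact[of \<eta> i l g] \<eta> that gx by (auto simp: cochains_def)
  ultimately show "tau i \<gamma> \<eta> (act i g x) = act i g (tau i \<gamma> \<eta> x)"
    unfolding tau_def using fext_gact[OF gm[OF i] h gx(1) _ k[OF gx(2)]] by simp
qed

lemma homog_hom:
  assumes M: "gmod G M a" and N: "gmod G N a'"
    and e: "\<And>g x. g \<in> carrier G \<Longrightarrow> x \<in> carrier M \<Longrightarrow> f (a g x) = a' g (f x)"
    and \<theta>: "\<theta> \<in> tuples G i \<rightarrow> carrier M" and \<theta>': "\<And>gs. gs \<in> tuples G i \<Longrightarrow> f (\<theta> gs) = \<theta>' gs" and l: "l \<in> tuples G (Suc i)"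
  shows "f (gmod.homog G a \<theta> l) = gmod.homog G a' \<theta>' l"
proof -
  interpret M: gmod G M a by fact
  interpret N: gmod G N a' by fact
  obtain x m where m: "l = x # m" using l by (cases l) (auto simp: tuples_def)
  have q: "quots G x m \<in> tuples G i" using M.quots_tuples l m by blast
  have "x \<in> carrier G" using l m by (simp add: tuples_def)
  then show ?thesis using e[of x "\<theta> (quots G x m)"] q \<theta> \<theta>'[OF q] m by (auto simp: M.homog_def N.homog_def)
qed

text \<open>The differential turns \<open>\<eta>'\<close> into the coboundary of
  \<open>\<eta>\<close>, duality moves this to the bar boundary of \<open>\<gamma>' x\<close>, and
  that boundary is \<open>\<gamma> (d (Suc k) x)\<close>.\<close>

lemma tau_chain:
  assumes k: "Suc k \<le> n" and \<gamma>: "barhom G (F k) (Suc k) \<gamma>" "barhom G (F (Suc k)) (Suc (Suc k)) \<gamma>'"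
    and \<gamma>d: "\<And>x. x \<in> carrier (F (Suc k)) \<Longrightarrow> frag_extend bd (\<gamma>' x) = \<gamma> (d (Suc k) x)"
    and \<eta>: "\<eta> \<in> cochains G (F k) k" "\<eta>' \<in> cochains G (F (Suc k)) (Suc k)"
    and \<eta>d: "\<And>gs. gs \<in> tuples G (Suc k) \<Longrightarrow> d (Suc k) (\<eta>' gs) = cobd G (F k) (act k) k \<eta> gs"
    and x: "x \<in> carrier (F (Suc k))"
  shows "d (Suc k) (tau (Suc k) \<gamma>' \<eta>' x) = tau k \<gamma> \<eta> (d (Suc k) x)"
proof -
  have k': "k \<le> n" using k by simp
  interpret M: gmod G "F (Suc k)" "act (Suc k)" by (rule gm[OF k])
  interpret N: gmod G "F k" "act k" by (rule gm[OF k'])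
  note dh = dhom[OF k]
  have u: "Poly_Mapping.keys (\<gamma>' x) \<subseteq> tuples G (Suc (Suc k))" using \<gamma>(2) x by (simp add: barhom_def)
  have \<eta>f: "\<eta> \<in> tuples G k \<rightarrow> carrier (F k)" "\<eta>' \<in> tuples G (Suc k) \<rightarrow> carrier (F (Suc k))" using \<eta> by (auto simp: cochains_def)
  have "d (Suc k) (tau (Suc k) \<gamma>' \<eta>' x) = fext (F k) (\<lambda>l. d (Suc k) (M.homog \<eta>' l)) (\<gamma>' x)"
    unfolding tau_def by (rule addhom_fext[OF ab[OF k] ab[OF k'] lmod_hom_addhom[OF dh] u homogF[OF k \<eta>(2)]])
  also have "\<dots> = fext (F k) (N.homog (cobd G (F k) (act k) k \<eta>)) (\<gamma>' x)"
  proof (rule N.M.fext_cong)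
    fix l assume "l \<in> Poly_Mapping.keys (\<gamma>' x)"
    then have l: "l \<in> tuples G (Suc (Suc k))" using u by blast
    show "d (Suc k) (M.homog \<eta>' l) = N.homog (cobd G (F k) (act k) k \<eta>) l"
      by (rule homog_hom[where f = "d (Suc k)" and \<theta> = \<eta>' and \<theta>' = "cobd G (F k) (act k) k \<eta>", OF gm[OF k] gm[OF k'] _ \<eta>f(2) \<eta>d l])
        (simp_all add: lmod_hom_smult[OF dh])
  next
    show "N.homog (cobd G (F k) (act k) k \<eta>) \<in> Poly_Mapping.keys (\<gamma>' x) \<rightarrow> carrier (F k)"
      using N.homog_closed[of "cobd G (F k) (act k) k \<eta>" "Suc k"] N.cobd_closed[OF \<eta>f(1)] u by (auto simp: cochains_def)
  qed
  also have "\<dots> = fext (F k) (N.homog \<eta>) (frag_extend bd (\<gamma>' x))"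
    by (rule N.homog_cobd_fext[OF \<eta>f(1) u])
  finally show ?thesis using \<gamma>d[OF x] by (simp add: tau_def)
qed

lemma tau_aug:
  assumes \<gamma>: "barhom G (F 0) (Suc 0) \<gamma>" and \<gamma>a: "\<And>x. x \<in> carrier (F 0) \<Longrightarrow> frag_extend bd (\<gamma> x) = frag_cmul (aug x) (frag_of [])"
    and \<eta>: "\<eta> \<in> cochains G (F 0) 0" "aug (\<eta> []) = 1" and x: "x \<in> carrier (F 0)"
  shows "aug (tau 0 \<gamma> \<eta> x) = aug x"
proof -
  interpret T: left_module R trivial_module by (rule left_module_trivial[OF ring_R group_G])
  interpret M: gmod G "F 0" "act 0" by (rule gm) simp
  have u: "Poly_Mapping.keys (\<gamma> x) \<subseteq> tuples G (Suc 0)" using \<gamma> x by (simp add: barhom_def)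
  have \<eta>c: "\<eta> [] \<in> carrier (F 0)" using \<eta> by (auto simp: cochains_def tuples_def)
  let ?T = "trivial_module :: ('g \<Rightarrow> int, int) module"
  have "aug (tau 0 \<gamma> \<eta> x) = fext ?T (\<lambda>l. aug (M.homog \<eta> l)) (\<gamma> x)"
    unfolding tau_def by (rule addhom_fext[OF ab T.is_abelian_group lmod_hom_addhom[OF aug_hom] u homogF[OF _ \<eta>(1)]]) simp_all
  \<comment> \<open>In degree 0 the boundary of a vertex is the empty simplex. Counting it expresses
    the augmentation through \<open>bd\<close>, so that the condition on \<open>\<gamma>\<close>
    applies.\<close>
  also have "\<dots> = fext ?T (\<lambda>l. fext ?T (\<lambda>_. 1) (bd l)) (\<gamma> x)"
  proof (rule T.M.fext_cong)
    fix l assume "l \<in> Poly_Mapping.keys (\<gamma> x)"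
    then obtain g where g: "g \<in> carrier G" "l = [g]" using u by (auto simp: tuples_Suc_0 subset_iff)
    have "aug (M.homog \<eta> l) = aug (\<eta> [])"
      using lmod_hom_smult[OF aug_hom group_elem_closed[OF g(1)] \<eta>c] g by (simp add: M.homog_def)
    moreover have "fext ?T (\<lambda>_. 1) (bd l) = 1" using g T.M.fext_frag_of[of "\<lambda>_. 1" "[]"] by simp
    ultimately show "aug (M.homog \<eta> l) = fext ?T (\<lambda>_. 1) (bd l)" using \<eta>(2) by simp
  qed simp
  also have "\<dots> = fext ?T (\<lambda>_. 1) (frag_extend bd (\<gamma> x))"
    by (rule T.M.fext_frag_extend[symmetric, where T = UNIV, OF subset_refl]) simp_all
  also have "\<dots> = aug x"
  proof (cases "aug x = 0")
    case True then show ?thesis using \<gamma>a[OF x] T.M.fext_zero[of "\<lambda>_. 1"] by simp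
  next
    case False
    have p: "[k] \<cdot>\<^bsub>?T\<^esub> (1::int) = k" for k :: int
    proof -
      have n: "[int m] \<cdot>\<^bsub>?T\<^esub> (1::int) = int m" for m
      proof (induction m)
        case 0 then show ?case using T.M.ipow_0[of 1] by simp
      next
        case (Suc m) then show ?case using T.M.ipow_add[of 1 1 "int m"] T.M.ipow_1[of 1] by simp
      qed
      show ?thesis
      proof (cases k)
        case (nonneg m) then show ?thesis using n by simp
      next
        case (neg m)
        have "[(k + int (Suc m))] \<cdot>\<^bsub>?T\<^esub> (1::int) = [k] \<cdot>\<^bsub>?T\<^esub> (1::int) + [int (Suc m)] \<cdot>\<^bsub>?T\<^esub> (1::int)"
          using T.M.ipow_add[of 1 k "int (Suc m)"] by simp
        then show ?thesis using neg n[of "Suc m"] T.M.ipow_0[of 1] by simp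
      qed
    qed
    have "Poly_Mapping.keys (frag_cmul (aug x) (frag_of []) :: 'g list \<Rightarrow>\<^sub>0 int) = {[]}" using False by auto
    then show ?thesis using \<gamma>a[OF x] T.M.finsum_insert[of "{}" "[]" "\<lambda>_. [aug x] \<cdot>\<^bsub>?T\<^esub> 1"] p T.M.finsum_empty
      by (simp add: fext_def)
  qed
  finally show ?thesis .
qed

text \<open>The map to the bar complex lifts the augmentation, with the empty simplex as target; the
  map back sends the base vertex to an element of augmentation 1. Both then preserve the
  augmentation, and their composite differs from the identity by boundaries.\<close>

lemma comparison_0:
  assumes n: "1 \<le> n"
  shows "\<exists>\<gamma> \<gamma>' \<eta> \<eta>' h. comparison 0 \<gamma> \<gamma>' \<eta> \<eta>' h"
proof -
  have n': "Suc 0 \<le> n" using n by simp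
  interpret T: left_module R trivial_module by (rule left_module_trivial[OF ring_R group_G])
  interpret L0: left_module R "F 0" by (rule lm) simp
  interpret L1: left_module R "F (Suc 0)" by (rule lm[OF n'])
  interpret M0: gmod G "F 0" "act 0" by (rule gm) simp
  obtain J x \<phi> where db0: "dual_basis R (F 0) J x \<phi>" using db[of 0] by blast
  obtain J1 x1 \<phi>1 where db1: "dual_basis R (F (Suc 0)) J1 x1 \<phi>1" using db[OF n'] by blast
  note d1 = dhom[OF n']
  have aa: "aug (a \<oplus>\<^bsub>F 0\<^esub> b) = aug a + aug b" if "a \<in> carrier (F 0)" "b \<in> carrier (F 0)" for a b
    using addhom_add[OF lmod_hom_addhom[OF aug_hom] that] by simp
  have am: "aug (a \<ominus>\<^bsub>F 0\<^esub> b) = aug a - aug b" if "a \<in> carrier (F 0)" "b \<in> carrier (F 0)" for a b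
  proof -
    have "a = (a \<ominus>\<^bsub>F 0\<^esub> b) \<oplus>\<^bsub>F 0\<^esub> b" using that by (simp add: a_minus_def L0.M.a_assoc L0.M.l_neg)
    then have "aug a = aug (a \<ominus>\<^bsub>F 0\<^esub> b) + aug b" using aa[of "a \<ominus>\<^bsub>F 0\<^esub> b" b] that by simp
    then show ?thesis by simp
  qed
  have ag: "aug (act 0 g a) = aug a" if "g \<in> carrier G" "a \<in> carrier (F 0)" for g a
    using lmod_hom_smult[OF aug_hom group_elem_closed[OF that(1)] that(2)] by simp
  have bh: "barhom G (F 0) 0 (\<lambda>y. frag_cmul (aug y) (frag_of []))"
    by (auto simp: barhom_def tuples_def aa ag frag_cmul_distrib gact_cmul)
  obtain \<gamma> where \<gamma>: "barhom G (F 0) (Suc 0) \<gamma>" "\<And>y. y \<in> carrier (F 0) \<Longrightarrow> frag_extend bd (\<gamma> y) = frag_cmul (aug y) (frag_of [])"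
  proof (rule barhom_lift[OF group_G lm db0 bh])
    show "frag_extend bd (frag_cmul (aug y) (frag_of [])) = 0" if "y \<in> carrier (F 0)" for y
      by (simp add: frag_extend_cmul)
  qed auto
  have dcl: "d (Suc 0) y \<in> carrier (F 0)" "aug (d (Suc 0) y) = 0" if "y \<in> carrier (F (Suc 0))" for y
    using exact_0[OF n] that by blast+
  have bh1: "barhom G (F (Suc 0)) (Suc 0) (\<lambda>y. \<gamma> (d (Suc 0) y))"
    using \<gamma>(1) dcl addhom_add[OF lmod_hom_addhom[OF d1]] lmod_hom_smult[OF d1] by (simp add: barhom_def)
  obtain \<gamma>' where \<gamma>': "barhom G (F (Suc 0)) (Suc (Suc 0)) \<gamma>'" "\<And>y. y \<in> carrier (F (Suc 0)) \<Longrightarrow> frag_extend bd (\<gamma>' y) = \<gamma> (d (Suc 0) y)"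
  proof (rule barhom_lift[OF group_G lm[OF n'] db1 bh1])
    show "frag_extend bd (\<gamma> (d (Suc 0) y)) = 0" if "y \<in> carrier (F (Suc 0))" for y using \<gamma>(2) dcl[OF that] by simp
  qed blast
  obtain e where e: "e \<in> carrier (F 0)" "aug e = 1" using aug_surj by (metis UNIV_I imageE)
  define \<eta> where "\<eta> = (\<lambda>gs\<in>tuples G 0. e)"
  have \<eta>: "\<eta> \<in> cochains G (F 0) 0" "\<eta> [] = e" using e by (auto simp: \<eta>_def cochains_def tuples_def)
  have "\<exists>y\<in>carrier (F (Suc 0)). d (Suc 0) y = cobd G (F 0) (act 0) 0 \<eta> gs" if gs: "gs \<in> tuples G (Suc 0)" for gs
  proof -
    obtain g where g: "g \<in> carrier G" "gs = [g]" using gs by (auto simp: tuples_Suc_0)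
    have "cobd G (F 0) (act 0) 0 \<eta> gs = act 0 g e \<oplus>\<^bsub>F 0\<^esub> \<ominus>\<^bsub>F 0\<^esub> e"
      using g e \<eta>(2) M0.act_closed[OF g(1) e(1)] by (simp add: cobd_def tuples_Suc_0 L0.M.ipow_uminus)
    then have "cobd G (F 0) (act 0) 0 \<eta> gs \<in> {x \<in> carrier (F 0). aug x = 0}"
      using am[of "act 0 g e" e] ag[OF g(1) e(1)] M0.act_closed[OF g(1) e(1)] e by (simp add: a_minus_def)
    then show ?thesis using exact_0[OF n] by (metis (no_types, lifting) imageE)
  qed
  then obtain y where y: "\<And>gs. gs \<in> tuples G (Suc 0) \<Longrightarrow> y gs \<in> carrier (F (Suc 0))"
    "\<And>gs. gs \<in> tuples G (Suc 0) \<Longrightarrow> d (Suc 0) (y gs) = cobd G (F 0) (act 0) 0 \<eta> gs" by metis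
  define \<eta>' where "\<eta>' = restrict y (tuples G (Suc 0))"
  have \<eta>': "\<eta>' \<in> cochains G (F (Suc 0)) (Suc 0)" "\<And>gs. gs \<in> tuples G (Suc 0) \<Longrightarrow> d (Suc 0) (\<eta>' gs) = cobd G (F 0) (act 0) 0 \<eta> gs"
    using y by (auto simp: \<eta>'_def cochains_def)
  note th = tau_hom[OF _ \<gamma>(1) \<eta>(1)] and th' = tau_hom[OF n' \<gamma>'(1) \<eta>'(1)]
  have tcl: "tau 0 \<gamma> \<eta> y \<in> carrier (F 0)" if "y \<in> carrier (F 0)" for y using lmod_hom_closed[OF th that] by simp
  have tcl': "tau (Suc 0) \<gamma>' \<eta>' y \<in> carrier (F (Suc 0))" if "y \<in> carrier (F (Suc 0))" for y using lmod_hom_closed[OF th' that] .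
  \<comment> \<open>By \<open>tau_aug\<close> it maps into the kernel of the augmentation, which is
    the image of \<open>d 1\<close>. Lifting it through \<open>d 1\<close> gives the
    homotopy.\<close>
  define \<beta> where "\<beta> y = y \<ominus>\<^bsub>F 0\<^esub> tau 0 \<gamma> \<eta> y" for y
  have \<beta>: "\<beta> \<in> lmod_hom R (F 0) (F 0)"
  proof (rule lmod_homI)
    show "addhom (F 0) (F 0) \<beta>"
      using tcl addhom_add[OF lmod_hom_addhom[OF th]]
      by (auto simp: addhom_def \<beta>_def a_minus_def L0.M.minus_add L0.M.a_ac)
    fix a y assume ay: "a \<in> carrier R" "y \<in> carrier (F 0)"
    then show "\<beta> (a \<odot>\<^bsub>F 0\<^esub> y) = a \<odot>\<^bsub>F 0\<^esub> \<beta> y"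
      using lmod_hom_smult[OF th ay(1) ay(2)] addhom_minus[OF L0.is_abelian_group L0.is_abelian_group L0.addhom_lsmult[OF ay(1)] ay(2) tcl[OF ay(2)]]
      by (simp add: \<beta>_def)
  qed
  have \<beta>0: "aug (\<beta> y) = 0" if "y \<in> carrier (F 0)" for y
    using tau_aug[OF \<gamma> \<eta>(1) _ that] e \<eta>(2) am[OF that tcl[OF that]] by (simp add: \<beta>_def)
  obtain h where h: "h \<in> lmod_hom R (F 0) (F (Suc 0))" "\<And>y. y \<in> carrier (F 0) \<Longrightarrow> d (Suc 0) (h y) = \<beta> y"
  proof (rule projective_lift[OF lm lm[OF n'] lm db0 d1 \<beta>])
    show "\<beta> (x j) \<in> d (Suc 0) ` carrier (F (Suc 0))" if "j \<in> J" for j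
    proof -
      have "x j \<in> carrier (F 0)" using db0 that by (auto simp: dual_basis_def)
      then show ?thesis unfolding exact_0[OF n] using lmod_hom_closed[OF \<beta>] \<beta>0 by blast
    qed
  qed auto
  have "d (Suc 0) (y \<ominus>\<^bsub>F (Suc 0)\<^esub> tau (Suc 0) \<gamma>' \<eta>' y \<ominus>\<^bsub>F (Suc 0)\<^esub> h (d (Suc 0) y)) = \<zero>\<^bsub>F 0\<^esub>"
    if y: "y \<in> carrier (F (Suc 0))" for y
  proof -
    have t: "d (Suc 0) (tau (Suc 0) \<gamma>' \<eta>' y) = tau 0 \<gamma> \<eta> (d (Suc 0) y)"
      by (rule tau_chain[OF n' \<gamma>(1) \<gamma>' \<eta>(1) \<eta>' y])
    note m = addhom_minus[OF L1.is_abelian_group L0.is_abelian_group lmod_hom_addhom[OF d1]]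
    have hd: "h (d (Suc 0) y) \<in> carrier (F (Suc 0))" using lmod_hom_closed[OF h(1) dcl(1)[OF y]] .
    have "d (Suc 0) (y \<ominus>\<^bsub>F (Suc 0)\<^esub> tau (Suc 0) \<gamma>' \<eta>' y \<ominus>\<^bsub>F (Suc 0)\<^esub> h (d (Suc 0) y)) =
      (d (Suc 0) y \<ominus>\<^bsub>F 0\<^esub> tau 0 \<gamma> \<eta> (d (Suc 0) y)) \<ominus>\<^bsub>F 0\<^esub> \<beta> (d (Suc 0) y)"
      using y hd tcl'[OF y] by (simp add: m t h(2)[OF dcl(1)[OF y]])
    also have "\<dots> = \<zero>\<^bsub>F 0\<^esub>" using dcl(1)[OF y] tcl[OF dcl(1)[OF y]] by (simp add: \<beta>_def a_minus_def L0.M.r_neg)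
    finally show ?thesis .
  qed
  then have "comparison 0 \<gamma> \<gamma>' \<eta> \<eta>' h"
    using \<gamma> \<gamma>' \<eta> \<eta>' h by (simp add: comparison_def)
  then show ?thesis by blast
qed

text \<open>The maps of the upper degree are kept and extended by one degree. The last condition in
  \<open>comparison\<close> says that the previous homotopy corrects the composite up to cycles, and
  exactness turns these into boundaries that can be lifted.\<close>

lemma comparison_Suc:
  assumes n: "Suc (Suc k) \<le> n" and c: "comparison k \<gamma>0 \<gamma> \<eta>0 \<eta> h0"
  shows "\<exists>\<gamma>' \<eta>' h. comparison (Suc k) \<gamma> \<gamma>' \<eta> \<eta>' h"
proof -
  have n1: "Suc k \<le> n" and n0: "k \<le> n" using n by auto
  interpret L0: left_module R "F k" by (rule lm[OF n0])
  interpret L1: left_module R "F (Suc k)" by (rule lm[OF n1])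
  interpret L2: left_module R "F (Suc (Suc k))" by (rule lm[OF n])
  interpret M0: gmod G "F k" "act k" by (rule gm[OF n0])
  interpret M1: gmod G "F (Suc k)" "act (Suc k)" by (rule gm[OF n1])
  obtain J x \<phi> where db1: "dual_basis R (F (Suc k)) J x \<phi>" using db[OF n1] by blast
  obtain J2 x2 \<phi>2 where db2: "dual_basis R (F (Suc (Suc k))) J2 x2 \<phi>2" using db[OF n] by blast
  have \<gamma>0: "barhom G (F k) (Suc k) \<gamma>0" and \<gamma>: "barhom G (F (Suc k)) (Suc (Suc k)) \<gamma>"
    and \<gamma>d: "\<And>x. x \<in> carrier (F (Suc k)) \<Longrightarrow> frag_extend bd (\<gamma> x) = \<gamma>0 (d (Suc k) x)"
    and \<eta>0: "\<eta>0 \<in> cochains G (F k) k" and \<eta>: "\<eta> \<in> cochains G (F (Suc k)) (Suc k)"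
    and \<eta>d: "\<And>gs. gs \<in> tuples G (Suc k) \<Longrightarrow> d (Suc k) (\<eta> gs) = cobd G (F k) (act k) k \<eta>0 gs"
    and h0: "h0 \<in> lmod_hom R (F k) (F (Suc k))"
    and hd0: "\<And>x. x \<in> carrier (F (Suc k)) \<Longrightarrow> d (Suc k) (x \<ominus>\<^bsub>F (Suc k)\<^esub> tau (Suc k) \<gamma> \<eta> x \<ominus>\<^bsub>F (Suc k)\<^esub> h0 (d (Suc k) x)) = \<zero>\<^bsub>F k\<^esub>"
    using c unfolding comparison_def by blast+
  note d1 = dhom[OF n1] and d2 = dhom[OF n]
  have d2cl: "d (Suc (Suc k)) y \<in> carrier (F (Suc k))" if "y \<in> carrier (F (Suc (Suc k)))" for y using lmod_hom_closed[OF d2 that] .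
  have bh: "barhom G (F (Suc (Suc k))) (Suc (Suc k)) (\<lambda>y. \<gamma> (d (Suc (Suc k)) y))"
    using \<gamma> d2cl addhom_add[OF lmod_hom_addhom[OF d2]] lmod_hom_smult[OF d2] by (simp add: barhom_def)
  have \<gamma>00: "\<gamma>0 \<zero>\<^bsub>F k\<^esub> = 0"
  proof -
    have "\<gamma>0 (\<zero>\<^bsub>F k\<^esub> \<oplus>\<^bsub>F k\<^esub> \<zero>\<^bsub>F k\<^esub>) = \<gamma>0 \<zero>\<^bsub>F k\<^esub> + \<gamma>0 \<zero>\<^bsub>F k\<^esub>" using \<gamma>0 L0.M.zero_closed unfolding barhom_def by blast
    then show ?thesis by simp
  qed
  obtain \<gamma>' where \<gamma>': "barhom G (F (Suc (Suc k))) (Suc (Suc (Suc k))) \<gamma>'" "\<And>y. y \<in> carrier (F (Suc (Suc k))) \<Longrightarrow> frag_extend bd (\<gamma>' y) = \<gamma> (d (Suc (Suc k)) y)"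
  proof (rule barhom_lift[OF group_G lm[OF n] db2 bh])
    show "frag_extend bd (\<gamma> (d (Suc (Suc k)) y)) = 0" if "y \<in> carrier (F (Suc (Suc k)))" for y
      using \<gamma>d[OF d2cl[OF that]] dd[OF n that] \<gamma>00 by simp
  qed blast
  have \<eta>f: "\<eta>0 \<in> tuples G k \<rightarrow> carrier (F k)" "\<eta> \<in> tuples G (Suc k) \<rightarrow> carrier (F (Suc k))" using \<eta>0 \<eta> by (auto simp: cochains_def)
  have "\<exists>y\<in>carrier (F (Suc (Suc k))). d (Suc (Suc k)) y = cobd G (F (Suc k)) (act (Suc k)) (Suc k) \<eta> gs"
    if gs: "gs \<in> tuples G (Suc (Suc k))" for gs
  proof -
    have "d (Suc k) (cobd G (F (Suc k)) (act (Suc k)) (Suc k) \<eta> gs) = cobd G (F k) (act k) (Suc k) (\<lambda>gs\<in>tuples G (Suc k). d (Suc k) (\<eta> gs)) gs"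
      by (rule hom_cobd[OF gm[OF n1] gm[OF n0] lmod_hom_addhom[OF d1] _ \<eta>f(2) gs]) (simp add: lmod_hom_smult[OF d1])
    also have "(\<lambda>gs\<in>tuples G (Suc k). d (Suc k) (\<eta> gs)) = cobd G (F k) (act k) k \<eta>0"
      by (auto simp: \<eta>d fun_eq_iff) (simp add: cobd_def)
    also have "cobd G (F k) (act k) (Suc k) \<dots> gs = \<zero>\<^bsub>F k\<^esub>"
      using M0.cobd_cobd[OF \<eta>f(1)] gs by (simp add: zero_cochain_def)
    finally have "cobd G (F (Suc k)) (act (Suc k)) (Suc k) \<eta> gs \<in> {x \<in> carrier (F (Suc k)). d (Suc k) x = \<zero>\<^bsub>F k\<^esub>}"
      using M1.cobd_closed[OF \<eta>f(2)] gs by (auto simp: cochains_def)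
    then show ?thesis using exact[OF n] by (metis (no_types, lifting) imageE)
  qed
  then obtain y where y: "\<And>gs. gs \<in> tuples G (Suc (Suc k)) \<Longrightarrow> y gs \<in> carrier (F (Suc (Suc k)))"
    "\<And>gs. gs \<in> tuples G (Suc (Suc k)) \<Longrightarrow> d (Suc (Suc k)) (y gs) = cobd G (F (Suc k)) (act (Suc k)) (Suc k) \<eta> gs" by metis
  define \<eta>' where "\<eta>' = restrict y (tuples G (Suc (Suc k)))"
  have \<eta>': "\<eta>' \<in> cochains G (F (Suc (Suc k))) (Suc (Suc k))"
    "\<And>gs. gs \<in> tuples G (Suc (Suc k)) \<Longrightarrow> d (Suc (Suc k)) (\<eta>' gs) = cobd G (F (Suc k)) (act (Suc k)) (Suc k) \<eta> gs"
    using y by (auto simp: \<eta>'_def cochains_def)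
  note th = tau_hom[OF n1 \<gamma> \<eta>] and th' = tau_hom[OF n \<gamma>'(1) \<eta>'(1)]
  have tcl: "tau (Suc k) \<gamma> \<eta> y \<in> carrier (F (Suc k))" if "y \<in> carrier (F (Suc k))" for y using lmod_hom_closed[OF th that] .
  have tcl': "tau (Suc (Suc k)) \<gamma>' \<eta>' y \<in> carrier (F (Suc (Suc k)))" if "y \<in> carrier (F (Suc (Suc k)))" for y using lmod_hom_closed[OF th' that] .
  have d1cl: "d (Suc k) y \<in> carrier (F k)" if "y \<in> carrier (F (Suc k))" for y using lmod_hom_closed[OF d1 that] .
  have hcl: "h0 (d (Suc k) y) \<in> carrier (F (Suc k))" if "y \<in> carrier (F (Suc k))" for y using lmod_hom_closed[OF h0 d1cl[OF that]] .
  define \<beta> where "\<beta> y = y \<ominus>\<^bsub>F (Suc k)\<^esub> tau (Suc k) \<gamma> \<eta> y \<ominus>\<^bsub>F (Suc k)\<^esub> h0 (d (Suc k) y)" for y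
  have \<beta>: "\<beta> \<in> lmod_hom R (F (Suc k)) (F (Suc k))"
  proof (rule lmod_homI)
    show "addhom (F (Suc k)) (F (Suc k)) \<beta>"
      unfolding addhom_def
    proof (intro conjI ballI funcsetI)
      fix y assume "y \<in> carrier (F (Suc k))" then show "\<beta> y \<in> carrier (F (Suc k))" using tcl hcl by (simp add: \<beta>_def)
    next
      fix y z assume yz: "y \<in> carrier (F (Suc k))" "z \<in> carrier (F (Suc k))"
      have "h0 (d (Suc k) (y \<oplus>\<^bsub>F (Suc k)\<^esub> z)) = h0 (d (Suc k) y) \<oplus>\<^bsub>F (Suc k)\<^esub> h0 (d (Suc k) z)"
        using yz d1cl by (simp add: addhom_add[OF lmod_hom_addhom[OF d1]] addhom_add[OF lmod_hom_addhom[OF h0]])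
      then show "\<beta> (y \<oplus>\<^bsub>F (Suc k)\<^esub> z) = \<beta> y \<oplus>\<^bsub>F (Suc k)\<^esub> \<beta> z"
        using yz tcl hcl addhom_add[OF lmod_hom_addhom[OF th] yz]
        by (simp add: \<beta>_def a_minus_def L1.M.minus_add L1.M.a_ac)
    qed
    fix a y assume ay: "a \<in> carrier R" "y \<in> carrier (F (Suc k))"
    have 1: "h0 (d (Suc k) (a \<odot>\<^bsub>F (Suc k)\<^esub> y)) = a \<odot>\<^bsub>F (Suc k)\<^esub> h0 (d (Suc k) y)"
      using ay d1cl by (simp add: lmod_hom_smult[OF d1] lmod_hom_smult[OF h0])
    note m = addhom_minus[OF L1.is_abelian_group L1.is_abelian_group L1.addhom_lsmult[OF ay(1)]]
    show "\<beta> (a \<odot>\<^bsub>F (Suc k)\<^esub> y) = a \<odot>\<^bsub>F (Suc k)\<^esub> \<beta> y"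
      using lmod_hom_smult[OF th ay] 1 ay tcl[OF ay(2)] hcl[OF ay(2)] by (simp add: \<beta>_def m)
  qed
  obtain h where h: "h \<in> lmod_hom R (F (Suc k)) (F (Suc (Suc k)))" "\<And>y. y \<in> carrier (F (Suc k)) \<Longrightarrow> d (Suc (Suc k)) (h y) = \<beta> y"
  proof (rule projective_lift[OF lm[OF n1] lm[OF n] lm[OF n1] db1 d2 \<beta>])
    show "\<beta> (x j) \<in> d (Suc (Suc k)) ` carrier (F (Suc (Suc k)))" if "j \<in> J" for j
    proof -
      have xj: "x j \<in> carrier (F (Suc k))" using db1 that by (auto simp: dual_basis_def)
      have "d (Suc k) (\<beta> (x j)) = \<zero>\<^bsub>F k\<^esub>" using hd0[OF xj] by (simp add: \<beta>_def)
      then show ?thesis unfolding exact[OF n] using lmod_hom_closed[OF \<beta> xj] by blast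
    qed
  qed blast
  have "d (Suc (Suc k)) (y \<ominus>\<^bsub>F (Suc (Suc k))\<^esub> tau (Suc (Suc k)) \<gamma>' \<eta>' y \<ominus>\<^bsub>F (Suc (Suc k))\<^esub> h (d (Suc (Suc k)) y)) = \<zero>\<^bsub>F (Suc k)\<^esub>"
    if y: "y \<in> carrier (F (Suc (Suc k)))" for y
  proof -
    let ?dy = "d (Suc (Suc k)) y"
    have t: "d (Suc (Suc k)) (tau (Suc (Suc k)) \<gamma>' \<eta>' y) = tau (Suc k) \<gamma> \<eta> ?dy"
      by (rule tau_chain[OF n \<gamma> \<gamma>' \<eta> \<eta>' y])
    note m = addhom_minus[OF L2.is_abelian_group L1.is_abelian_group lmod_hom_addhom[OF d2]]
    have hd: "h ?dy \<in> carrier (F (Suc (Suc k)))" using lmod_hom_closed[OF h(1) d2cl[OF y]] .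
    have h00: "h0 \<zero>\<^bsub>F k\<^esub> = \<zero>\<^bsub>F (Suc k)\<^esub>" by (rule addhom_zero[OF L0.is_abelian_group L1.is_abelian_group lmod_hom_addhom[OF h0]])
    have "d (Suc (Suc k)) (y \<ominus>\<^bsub>F (Suc (Suc k))\<^esub> tau (Suc (Suc k)) \<gamma>' \<eta>' y \<ominus>\<^bsub>F (Suc (Suc k))\<^esub> h ?dy) =
      (?dy \<ominus>\<^bsub>F (Suc k)\<^esub> tau (Suc k) \<gamma> \<eta> ?dy) \<ominus>\<^bsub>F (Suc k)\<^esub> \<beta> ?dy"
      using y hd tcl'[OF y] by (simp add: m t h(2)[OF d2cl[OF y]])
    \<comment> \<open>On a boundary the term with the previous homotopy disappears, since it
      contains two successive differentials.\<close>
    also have "\<beta> ?dy = ?dy \<ominus>\<^bsub>F (Suc k)\<^esub> tau (Suc k) \<gamma> \<eta> ?dy"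
      using dd[OF n y] h00 d2cl[OF y] tcl[OF d2cl[OF y]] by (simp add: \<beta>_def a_minus_def)
    also have "(?dy \<ominus>\<^bsub>F (Suc k)\<^esub> tau (Suc k) \<gamma> \<eta> ?dy) \<ominus>\<^bsub>F (Suc k)\<^esub> \<dots> = \<zero>\<^bsub>F (Suc k)\<^esub>"
      using d2cl[OF y] tcl[OF d2cl[OF y]] by (simp add: a_minus_def L1.M.r_neg)
    finally show ?thesis .
  qed
  then have "comparison (Suc k) \<gamma> \<gamma>' \<eta> \<eta>' h"
    using \<gamma> \<gamma>' \<eta> \<eta>' h by (simp add: comparison_def)
  then show ?thesis by blast
qed

lemma ex_comparison: "Suc k \<le> n \<Longrightarrow> \<exists>\<gamma> \<gamma>' \<eta> \<eta>' h. comparison k \<gamma> \<gamma>' \<eta> \<eta>' h"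
proof (induction k)
  case 0 then show ?case using comparison_0 by simp
next
  case (Suc k)
  then obtain \<gamma> \<gamma>' \<eta> \<eta>' h where "comparison k \<gamma> \<gamma>' \<eta> \<eta>' h" by fastforce
  then show ?case using comparison_Suc[OF Suc.prems] by blast
qed

section \<open>Cochains with values in the group ring\<close>

abbreviation "ract \<equiv> \<lambda>g x. group_elem g \<otimes>\<^bsub>R\<^esub> x"

lemma gmod_reg: "gmod G R ract"
proof -
  interpret G: group G by (rule group_G)
  interpret ring R by (rule ring_R)
  show ?thesis
  proof
    fix g h x assume "g \<in> carrier G" "h \<in> carrier G" "x \<in> carrier R"
    then show "group_elem (g \<otimes>\<^bsub>G\<^esub> h) \<otimes>\<^bsub>R\<^esub> x = group_elem g \<otimes>\<^bsub>R\<^esub> (group_elem h \<otimes>\<^bsub>R\<^esub> x)"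
      using m_assoc[of "group_elem g" "group_elem h" x] by (simp add: G.group_elem_mult)
  next
    fix x assume "x \<in> carrier R" then show "group_elem \<one>\<^bsub>G\<^esub> \<otimes>\<^bsub>R\<^esub> x = x"
      using l_one[of x] by (simp add: group_ring_one)
  qed (use r_distr in auto)
qed

lemma addhom_reg: "addhom M (reg G) f \<longleftrightarrow> addhom M R f"
  by (simp add: addhom_def)

text \<open>Up to a cycle, \<open>x\<close> is the sum of
  \<open>tau (Suc k) \<gamma>' \<eta>' x\<close> and \<open>h (d (Suc k) x)\<close>, and
  \<open>\<phi>\<close> vanishes on cycles. On the first summand the assumption rewrites
  \<open>\<phi>\<close> as \<open>\<theta>\<close> applied to \<open>\<gamma> (d (Suc k) x)\<close>.
  Hence both summands depend on the boundary of \<open>x\<close> only.\<close>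

lemma comparison_coboundary:
  assumes k: "Suc k \<le> n" and c: "comparison k \<gamma> \<gamma>' \<eta> \<eta>' h" and \<phi>: "\<phi> \<in> lmod_hom R (F (Suc k)) (reg G)"
    and closed: "Suc k < n \<Longrightarrow> \<forall>x\<in>carrier (F (Suc (Suc k))). \<phi> (d (Suc (Suc k)) x) = (\<lambda>_. 0)"
    and \<theta>: "\<theta> \<in> cochains G R k" and cob: "(\<lambda>gs\<in>tuples G (Suc k). \<phi> (\<eta>' gs)) = cobd G R ract k \<theta>"
  shows "\<exists>\<psi>\<in>lmod_hom R (F k) (reg G). \<forall>x\<in>carrier (F (Suc k)). \<phi> x = \<psi> (d (Suc k) x)"
proof -
  have k0: "k \<le> n" using k by simp
  interpret G: group G by (rule group_G)
  interpret R: ring R by (rule ring_R)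
  interpret RM: gmod G R ract by (rule gmod_reg)
  interpret L0: left_module R "F k" by (rule lm[OF k0])
  interpret L1: left_module R "F (Suc k)" by (rule lm[OF k])
  interpret M1: gmod G "F (Suc k)" "act (Suc k)" by (rule gm[OF k])
  have abR: "abelian_group R" ..
  have \<gamma>: "barhom G (F k) (Suc k) \<gamma>" and \<gamma>': "barhom G (F (Suc k)) (Suc (Suc k)) \<gamma>'"
    and \<gamma>d: "\<And>x. x \<in> carrier (F (Suc k)) \<Longrightarrow> frag_extend bd (\<gamma>' x) = \<gamma> (d (Suc k) x)"
    and \<eta>': "\<eta>' \<in> cochains G (F (Suc k)) (Suc k)"
    and h: "h \<in> lmod_hom R (F k) (F (Suc k))"
    and hd: "\<And>x. x \<in> carrier (F (Suc k)) \<Longrightarrow> d (Suc k) (x \<ominus>\<^bsub>F (Suc k)\<^esub> tau (Suc k) \<gamma>' \<eta>' x \<ominus>\<^bsub>F (Suc k)\<^esub> h (d (Suc k) x)) = \<zero>\<^bsub>F k\<^esub>"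
    using c unfolding comparison_def by blast+
  have \<theta>f: "\<theta> \<in> tuples G k \<rightarrow> carrier R" using \<theta> by (auto simp: cochains_def)
  have \<eta>f: "\<eta>' \<in> tuples G (Suc k) \<rightarrow> carrier (F (Suc k))" using \<eta>' by (auto simp: cochains_def)
  have \<phi>a: "addhom (F (Suc k)) R \<phi>" using lmod_hom_addhom[OF \<phi>] by (simp add: addhom_reg)
  have \<phi>g: "\<phi> (act (Suc k) g x) = ract g (\<phi> x)" if "g \<in> carrier G" "x \<in> carrier (F (Suc k))" for g x
    using lmod_hom_smult[OF \<phi> group_elem_closed[OF that(1)] that(2)] by simp
  have hom\<theta>: "RM.homog \<theta> \<in> tuples G (Suc k) \<rightarrow> carrier R" using RM.homog_closed[OF \<theta>f] by blast
  have kx: "Poly_Mapping.keys (\<gamma> x) \<subseteq> tuples G (Suc k)" if "x \<in> carrier (F k)" for x using \<gamma> that by (simp add: barhom_def)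
  define \<psi>1 where "\<psi>1 x = fext R (RM.homog \<theta>) (\<gamma> x)" for x
  have \<psi>1cl: "\<psi>1 x \<in> carrier R" if "x \<in> carrier (F k)" for x
    unfolding \<psi>1_def by (rule R.fext_closed) (use hom\<theta> kx[OF that] in blast)
  have hcl: "h x \<in> carrier (F (Suc k))" if "x \<in> carrier (F k)" for x using lmod_hom_closed[OF h that] .
  \<comment> \<open>The first summand comes from \<open>\<theta>\<close> along the comparison map,
    the second corrects for the homotopy.\<close>
  define \<psi> where "\<psi> x = \<psi>1 x \<oplus>\<^bsub>R\<^esub> \<phi> (h x)" for x
  have \<psi>: "\<psi> \<in> lmod_hom R (F k) (reg G)"
  proof (rule lmod_homI_act[OF lm[OF k0] left_module_reg[OF ring_R]])
    have \<psi>1a: "\<psi>1 (x \<oplus>\<^bsub>F k\<^esub> y) = \<psi>1 x \<oplus>\<^bsub>R\<^esub> \<psi>1 y" if "x \<in> carrier (F k)" "y \<in> carrier (F k)" for x y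
    proof -
      have "\<gamma> (x \<oplus>\<^bsub>F k\<^esub> y) = \<gamma> x + \<gamma> y" using \<gamma> that by (simp add: barhom_def)
      then show ?thesis unfolding \<psi>1_def using R.fext_add[OF kx[OF that(1)] kx[OF that(2)] hom\<theta>] by simp
    qed
    show "addhom (F k) (reg G) \<psi>"
      unfolding addhom_reg unfolding addhom_def
    proof (intro conjI ballI funcsetI)
      fix x assume "x \<in> carrier (F k)" then show "\<psi> x \<in> carrier R"
        unfolding \<psi>_def by (intro R.a_closed \<psi>1cl addhom_closed[OF \<phi>a] hcl)
    next
      fix x y assume xy: "x \<in> carrier (F k)" "y \<in> carrier (F k)"
      have "\<phi> (h (x \<oplus>\<^bsub>F k\<^esub> y)) = \<phi> (h x) \<oplus>\<^bsub>R\<^esub> \<phi> (h y)"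
        using addhom_add[OF lmod_hom_addhom[OF h] xy] addhom_add[OF \<phi>a hcl[OF xy(1)] hcl[OF xy(2)]] by simp
      then show "\<psi> (x \<oplus>\<^bsub>F k\<^esub> y) = \<psi> x \<oplus>\<^bsub>R\<^esub> \<psi> y"
        unfolding \<psi>_def using \<psi>1a[OF xy] by (simp add: fun_eq_iff)
    qed
    fix g x assume gx: "g \<in> carrier G" "x \<in> carrier (F k)"
    have "\<gamma> (act k g x) = gact G g (\<gamma> x)" using \<gamma> gx by (simp add: barhom_def)
    then have "\<psi>1 (act k g x) = ract g (\<psi>1 x)"
      unfolding \<psi>1_def using fext_gact[OF gmod_reg hom\<theta> gx(1) RM.homog_gact[OF \<theta>f _ gx(1)] kx[OF gx(2)]] by simp
    moreover have "\<phi> (h (act k g x)) = ract g (\<phi> (h x))"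
      using lmod_hom_smult[OF h group_elem_closed[OF gx(1)] gx(2)] \<phi>g[OF gx(1) hcl[OF gx(2)]] by simp
    ultimately show "\<psi> (act k g x) = group_elem g \<odot>\<^bsub>reg G\<^esub> \<psi> x"
      unfolding \<psi>_def reg_simps using R.r_distr[OF \<psi>1cl[OF gx(2)] addhom_closed[OF \<phi>a hcl[OF gx(2)]] group_elem_closed[OF gx(1)]] by simp
  qed
  have "\<phi> x = \<psi> (d (Suc k) x)" if x: "x \<in> carrier (F (Suc k))" for x
  proof -
    let ?t = "tau (Suc k) \<gamma>' \<eta>' x" and ?hd = "h (d (Suc k) x)"
    have u: "Poly_Mapping.keys (\<gamma>' x) \<subseteq> tuples G (Suc (Suc k))" using \<gamma>' x by (simp add: barhom_def)
    have tcl: "?t \<in> carrier (F (Suc k))" using lmod_hom_closed[OF tau_hom[OF k \<gamma>' \<eta>'] x] .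
    have dcl: "d (Suc k) x \<in> carrier (F k)" using lmod_hom_closed[OF dhom[OF k] x] .
    have hdcl: "?hd \<in> carrier (F (Suc k))" by (rule hcl[OF dcl])
    have cl: "x \<ominus>\<^bsub>F (Suc k)\<^esub> ?t \<ominus>\<^bsub>F (Suc k)\<^esub> ?hd \<in> carrier (F (Suc k))" using x tcl hdcl by simp
    \<comment> \<open>Below the top degree a cycle is a boundary, on which \<open>\<phi>\<close>
      vanishes by assumption. In the top degree \<open>d n\<close> is injective and the cycle itself
      is 0.\<close>
    have "\<phi> (x \<ominus>\<^bsub>F (Suc k)\<^esub> ?t \<ominus>\<^bsub>F (Suc k)\<^esub> ?hd) = \<zero>\<^bsub>R\<^esub>"
    proof (cases "Suc k < n")
      case True
      then have kk: "Suc (Suc k) \<le> n" by simp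
      have "x \<ominus>\<^bsub>F (Suc k)\<^esub> ?t \<ominus>\<^bsub>F (Suc k)\<^esub> ?hd \<in> d (Suc (Suc k)) ` carrier (F (Suc (Suc k)))"
        unfolding exact[OF kk] using hd[OF x] cl by blast
      then show ?thesis using closed[OF True] by auto
    next
      case False
      then have kn: "n = Suc k" using k by simp
      have "d (Suc k) \<zero>\<^bsub>F (Suc k)\<^esub> = \<zero>\<^bsub>F k\<^esub>"
        by (rule addhom_zero[OF L1.is_abelian_group L0.is_abelian_group lmod_hom_addhom[OF dhom[OF k]]])
      then have "x \<ominus>\<^bsub>F (Suc k)\<^esub> ?t \<ominus>\<^bsub>F (Suc k)\<^esub> ?hd = \<zero>\<^bsub>F (Suc k)\<^esub>"
        using inj_onD[OF inj_top] kn hd[OF x] cl L1.M.zero_closed by simp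
      then show ?thesis using addhom_zero[OF L1.is_abelian_group abR \<phi>a] by simp
    qed
    moreover have "\<phi> (x \<ominus>\<^bsub>F (Suc k)\<^esub> ?t \<ominus>\<^bsub>F (Suc k)\<^esub> ?hd) = \<phi> x \<ominus>\<^bsub>R\<^esub> \<phi> ?t \<ominus>\<^bsub>R\<^esub> \<phi> ?hd"
      using x tcl hdcl by (simp add: addhom_minus[OF L1.is_abelian_group abR \<phi>a])
    moreover have "\<phi> x = (\<phi> x \<ominus>\<^bsub>R\<^esub> \<phi> ?t \<ominus>\<^bsub>R\<^esub> \<phi> ?hd) \<oplus>\<^bsub>R\<^esub> (\<phi> ?t \<oplus>\<^bsub>R\<^esub> \<phi> ?hd)"
    proof -
      have "\<phi> x \<in> carrier R" "\<phi> ?t \<in> carrier R" "\<phi> ?hd \<in> carrier R" using addhom_closed[OF \<phi>a] x tcl hdcl by blast+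
      then show ?thesis
        by (simp only: a_minus_def R.a_ac R.a_closed R.a_inv_closed R.r_neg R.r_neg1 R.r_neg2 R.r_zero R.l_zero)
    qed
    moreover have "\<phi> ?t = \<psi>1 (d (Suc k) x)"
    proof -
      have "\<phi> ?t = fext R (\<lambda>l. \<phi> (M1.homog \<eta>' l)) (\<gamma>' x)"
        unfolding tau_def by (rule addhom_fext[OF L1.is_abelian_group abR \<phi>a u homogF[OF k \<eta>']])
      also have "\<dots> = fext R (RM.homog (cobd G R ract k \<theta>)) (\<gamma>' x)"
      proof (rule R.fext_cong)
        fix l assume "l \<in> Poly_Mapping.keys (\<gamma>' x)"
        then have l: "l \<in> tuples G (Suc (Suc k))" using u by blast
        show "\<phi> (M1.homog \<eta>' l) = RM.homog (cobd G R ract k \<theta>) l"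
        proof (rule homog_hom[where f = \<phi> and \<theta> = \<eta>' and \<theta>' = "cobd G R ract k \<theta>", OF gm[OF k] gmod_reg \<phi>g \<eta>f _ l])
          fix gs assume "gs \<in> tuples G (Suc k)"
          then show "\<phi> (\<eta>' gs) = cobd G R ract k \<theta> gs" using fun_cong[OF cob, of gs] by simp
        qed
      next
        show "RM.homog (cobd G R ract k \<theta>) \<in> Poly_Mapping.keys (\<gamma>' x) \<rightarrow> carrier R"
          using RM.homog_closed[of "cobd G R ract k \<theta>" "Suc k"] RM.cobd_closed[OF \<theta>f] u by (auto simp: cochains_def)
      qed
      also have "\<dots> = fext R (RM.homog \<theta>) (frag_extend bd (\<gamma>' x))" by (rule RM.homog_cobd_fext[OF \<theta>f u])
      finally show ?thesis using \<gamma>d[OF x] by (simp add: \<psi>1_def)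
    qed
    ultimately show ?thesis unfolding \<psi>_def by (simp add: fun_eq_iff)
  qed
  then show ?thesis using \<psi> by blast
qed

text \<open>The coboundary of \<open>\<eta>'\<close> is a cycle of the resolution, because its
  differential is a double coboundary. It is therefore killed by \<open>\<phi>\<close>, again with
  separate reasons in and below the top degree.\<close>

lemma hom_cochain:
  assumes k: "Suc k \<le> n" and c: "comparison k \<gamma> \<gamma>' \<eta> \<eta>' h" and \<phi>: "\<phi> \<in> lmod_hom R (F (Suc k)) (reg G)"
    and closed: "Suc k < n \<Longrightarrow> \<forall>x\<in>carrier (F (Suc (Suc k))). \<phi> (d (Suc (Suc k)) x) = (\<lambda>_. 0)"
  shows "(\<lambda>gs\<in>tuples G (Suc k). \<phi> (\<eta>' gs)) \<in> carrier (cocycle_group G R ract (Suc k))"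
proof -
  have k0: "k \<le> n" using k by simp
  interpret RM: gmod G R ract by (rule gmod_reg)
  interpret L0: left_module R "F k" by (rule lm[OF k0])
  interpret L1: left_module R "F (Suc k)" by (rule lm[OF k])
  interpret M0: gmod G "F k" "act k" by (rule gm[OF k0])
  interpret M1: gmod G "F (Suc k)" "act (Suc k)" by (rule gm[OF k])
  have abR: "abelian_group R" ..
  have \<eta>: "\<eta> \<in> cochains G (F k) k" and \<eta>': "\<eta>' \<in> cochains G (F (Suc k)) (Suc k)"
    and \<eta>d: "\<And>gs. gs \<in> tuples G (Suc k) \<Longrightarrow> d (Suc k) (\<eta>' gs) = cobd G (F k) (act k) k \<eta> gs"
    using c unfolding comparison_def by blast+
  have \<eta>f: "\<eta> \<in> tuples G k \<rightarrow> carrier (F k)" "\<eta>' \<in> tuples G (Suc k) \<rightarrow> carrier (F (Suc k))" using \<eta> \<eta>' by (auto simp: cochains_def)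
  have \<phi>a: "addhom (F (Suc k)) R \<phi>" using lmod_hom_addhom[OF \<phi>] by (simp add: addhom_reg)
  have \<phi>g: "\<phi> (act (Suc k) g x) = ract g (\<phi> x)" if "g \<in> carrier G" "x \<in> carrier (F (Suc k))" for g x
    using lmod_hom_smult[OF \<phi> group_elem_closed[OF that(1)] that(2)] by simp
  let ?f = "\<lambda>gs\<in>tuples G (Suc k). \<phi> (\<eta>' gs)"
  have fc: "?f \<in> cochains G R (Suc k)" using \<eta>f addhom_closed[OF \<phi>a] by (auto simp: cochains_def)
  have "cobd G R ract (Suc k) ?f gs = \<zero>\<^bsub>R\<^esub>" if gs: "gs \<in> tuples G (Suc (Suc k))" for gs
  proof -
    let ?y = "cobd G (F (Suc k)) (act (Suc k)) (Suc k) \<eta>' gs"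
    have ycl: "?y \<in> carrier (F (Suc k))" using M1.cobd_closed[OF \<eta>f(2)] gs by (auto simp: cochains_def)
    have "d (Suc k) ?y = cobd G (F k) (act k) (Suc k) (\<lambda>gs\<in>tuples G (Suc k). d (Suc k) (\<eta>' gs)) gs"
      by (rule hom_cobd[OF gm[OF k] gm[OF k0] lmod_hom_addhom[OF dhom[OF k]] _ \<eta>f(2) gs]) (simp add: lmod_hom_smult[OF dhom[OF k]])
    also have "(\<lambda>gs\<in>tuples G (Suc k). d (Suc k) (\<eta>' gs)) = cobd G (F k) (act k) k \<eta>"
      by (auto simp: \<eta>d fun_eq_iff) (simp add: cobd_def)
    also have "cobd G (F k) (act k) (Suc k) \<dots> gs = \<zero>\<^bsub>F k\<^esub>"
      using M0.cobd_cobd[OF \<eta>f(1)] gs by (simp add: zero_cochain_def)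
    finally have dy: "d (Suc k) ?y = \<zero>\<^bsub>F k\<^esub>" .
    have "\<phi> ?y = \<zero>\<^bsub>R\<^esub>"
    proof (cases "Suc k < n")
      case True
      then have kk: "Suc (Suc k) \<le> n" by simp
      have "?y \<in> d (Suc (Suc k)) ` carrier (F (Suc (Suc k)))" unfolding exact[OF kk] using dy ycl by blast
      then show ?thesis using closed[OF True] by auto
    next
      case False
      then have kn: "n = Suc k" using k by simp
      have "d (Suc k) \<zero>\<^bsub>F (Suc k)\<^esub> = \<zero>\<^bsub>F k\<^esub>"
        by (rule addhom_zero[OF L1.is_abelian_group L0.is_abelian_group lmod_hom_addhom[OF dhom[OF k]]])
      then have "?y = \<zero>\<^bsub>F (Suc k)\<^esub>"
        using inj_onD[OF inj_top] kn dy ycl L1.M.zero_closed by simp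
      then show ?thesis using addhom_zero[OF L1.is_abelian_group abR \<phi>a] by simp
    qed
    then show ?thesis using hom_cobd[OF gm[OF k] gmod_reg \<phi>a \<phi>g \<eta>f(2) gs] by simp
  qed
  moreover have "cobd G R ract (Suc k) ?f \<in> cochains G R (Suc (Suc k))"
  proof (rule RM.cobd_closed)
    show "?f \<in> tuples G (Suc k) \<rightarrow> carrier R" using fc by (simp add: cochains_def PiE_def)
  qed
  ultimately have "cobd G R ract (Suc k) ?f = zero_cochain G R (Suc (Suc k))"
    by (auto simp: zero_cochain_def fun_eq_iff cochains_def PiE_def extensional_def)
  then show ?thesis using fc by (simp add: cocycle_group_def)
qed

text \<open>The form in which vanishing cohomology is used: a homomorphism that is zero on
  boundaries factors through the boundary map.\<close>

theorem hom_exact: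
  assumes k: "Suc (Suc k) \<le> n" and H: "trivial_group (ZG_cohomology G (Suc k))"
    and \<phi>: "\<phi> \<in> lmod_hom R (F (Suc k)) (reg G)"
    and closed: "\<forall>x\<in>carrier (F (Suc (Suc k))). \<phi> (d (Suc (Suc k)) x) = (\<lambda>_. 0)"
  shows "\<exists>\<psi>\<in>lmod_hom R (F k) (reg G). \<forall>x\<in>carrier (F (Suc k)). \<phi> x = \<psi> (d (Suc k) x)"
proof -
  interpret RM: gmod G R ract by (rule gmod_reg)
  have k1: "Suc k \<le> n" using k by simp
  obtain \<gamma> \<gamma>' \<eta> \<eta>' h where c: "comparison k \<gamma> \<gamma>' \<eta> \<eta>' h" using ex_comparison[OF k1] by blast
  interpret Z: comm_group "cocycle_group G R ract (Suc k)" by (rule RM.comm_group_cocycles)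
  have cyc: "(\<lambda>gs\<in>tuples G (Suc k). \<phi> (\<eta>' gs)) \<in> carrier (cocycle_group G R ract (Suc k))"
    using hom_cochain[OF k1 c \<phi>] closed by blast
  have "(\<lambda>gs\<in>tuples G (Suc k). \<phi> (\<eta>' gs)) \<in> coboundaries G R ract (Suc k)"
    by (rule trivial_FactGroup_mem[OF _ cyc subgroup.one_closed[OF RM.subgroup_coboundaries] Z.l_one[OF cyc]])
      (use H in \<open>simp add: ZG_cohomology_def cohomology_group_def\<close>)
  then obtain \<theta> where "\<theta> \<in> cochains G R k" "(\<lambda>gs\<in>tuples G (Suc k). \<phi> (\<eta>' gs)) = cobd G R ract k \<theta>"
    by (auto simp: RM.coboundaries_Suc)
  then show ?thesis using comparison_coboundary[OF k1 c \<phi>] closed by blast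
qed

text \<open>\<open>\<epsilon>\<close> sends a homomorphism to its class in
  \<open>H\<^sup>n(G; \<int>G)\<close>, read as an integer. Its kernel consists of those that factor
  through \<open>d n\<close>; right multiplication by group elements leaves it unchanged because the
  action on cohomology is trivial.\<close>

theorem top_class:
  assumes n: "n = Suc k" and iso: "ZG_cohomology G n \<cong> integer_group"
    and triv: "\<forall>g\<in>carrier G. \<forall>K\<in>carrier (ZG_cohomology G n). ZG_right_translate G n g K = K"
  obtains \<epsilon> :: "('m \<Rightarrow> 'g \<Rightarrow> int) \<Rightarrow> int"
  where "\<And>\<phi> \<phi>'. \<phi> \<in> lmod_hom R (F n) (reg G) \<Longrightarrow> \<phi>' \<in> lmod_hom R (F n) (reg G) \<Longrightarrow> \<epsilon> (\<lambda>x. \<phi> x \<oplus>\<^bsub>R\<^esub> \<phi>' x) = \<epsilon> \<phi> + \<epsilon> \<phi>'"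
    "\<And>\<phi> g. \<phi> \<in> lmod_hom R (F n) (reg G) \<Longrightarrow> g \<in> carrier G \<Longrightarrow> \<epsilon> (\<lambda>x. \<phi> x \<otimes>\<^bsub>R\<^esub> group_elem g) = \<epsilon> \<phi>"
    "\<And>\<phi>. \<phi> \<in> lmod_hom R (F n) (reg G) \<Longrightarrow> \<epsilon> \<phi> = 0 \<longleftrightarrow> (\<exists>\<psi>\<in>lmod_hom R (F k) (reg G). \<forall>x\<in>carrier (F n). \<phi> x = \<psi> (d n x))"
proof -
  interpret G: group G by (rule group_G)
  interpret R: ring R by (rule ring_R)
  interpret RM: gmod G R ract by (rule gmod_reg)
  have k1: "Suc k \<le> n" and k0: "k \<le> n" using n by auto
  obtain \<gamma> \<gamma>' \<eta> \<eta>' h where c: "comparison k \<gamma> \<gamma>' \<eta> \<eta>' h" using ex_comparison[OF k1] by blast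
  define Z where "Z = cocycle_group G R ract n"
  define Bd where "Bd = coboundaries G R ract n"
  interpret Z: comm_group Z unfolding Z_def by (rule RM.comm_group_cocycles)
  have sub: "subgroup Bd Z" unfolding Z_def Bd_def n by (rule RM.subgroup_coboundaries)
  interpret N: normal Bd Z by (rule Z.subgroup_imp_normal[OF sub])
  have HZ: "ZG_cohomology G n = Z Mod Bd" by (simp add: ZG_cohomology_def cohomology_group_def Z_def Bd_def)
  interpret Q: group "Z Mod Bd" by (rule N.factorgroup_is_group)
  obtain \<kappa> where \<kappa>: "\<kappa> \<in> iso (Z Mod Bd) integer_group" using iso unfolding HZ is_iso_def by blast
  have \<kappa>h: "\<kappa> \<in> Group.hom (Z Mod Bd) integer_group" and \<kappa>i: "inj_on \<kappa> (carrier (Z Mod Bd))"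
    using \<kappa> by (auto simp: iso_def bij_betw_def)
  define f where "f \<phi> = (\<lambda>gs\<in>tuples G n. \<phi> (\<eta>' gs))" for \<phi> :: "'m \<Rightarrow> 'g \<Rightarrow> int"
  define \<epsilon> where "\<epsilon> \<phi> = \<kappa> (Bd #>\<^bsub>Z\<^esub> f \<phi>)" for \<phi>
  have fZ: "f \<phi> \<in> carrier Z" if "\<phi> \<in> lmod_hom R (F n) (reg G)" for \<phi>
    using hom_cochain[OF k1 c] that unfolding f_def Z_def n by simp
  have car: "Bd #>\<^bsub>Z\<^esub> z \<in> carrier (Z Mod Bd)" if "z \<in> carrier Z" for z using that by (auto simp: FactGroup_def RCOSETS_def)
  have mul: "a \<otimes>\<^bsub>Z\<^esub> b = (\<lambda>gs\<in>tuples G n. a gs \<oplus>\<^bsub>R\<^esub> b gs)" for a b by (simp add: Z_def cocycle_group_def)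
  have \<eta>': "\<eta>' gs \<in> carrier (F n)" if "gs \<in> tuples G n" for gs
    using c that n unfolding comparison_def cochains_def by blast
  have 1: "\<epsilon> (\<lambda>x. \<phi> x \<oplus>\<^bsub>R\<^esub> \<phi>' x) = \<epsilon> \<phi> + \<epsilon> \<phi>'"
    if "\<phi> \<in> lmod_hom R (F n) (reg G)" "\<phi>' \<in> lmod_hom R (F n) (reg G)" for \<phi> \<phi>'
  proof -
    have "f (\<lambda>x. \<phi> x \<oplus>\<^bsub>R\<^esub> \<phi>' x) = f \<phi> \<otimes>\<^bsub>Z\<^esub> f \<phi>'" by (auto simp: mul f_def fun_eq_iff)
    then have "Bd #>\<^bsub>Z\<^esub> f (\<lambda>x. \<phi> x \<oplus>\<^bsub>R\<^esub> \<phi>' x) = (Bd #>\<^bsub>Z\<^esub> f \<phi>) \<otimes>\<^bsub>Z Mod Bd\<^esub> (Bd #>\<^bsub>Z\<^esub> f \<phi>')"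
      using N.rcos_sum[OF fZ[OF that(1)] fZ[OF that(2)]] by (simp add: FactGroup_def)
    then show ?thesis
      unfolding \<epsilon>_def using hom_mult[OF \<kappa>h car[OF fZ[OF that(1)]] car[OF fZ[OF that(2)]]] by simp
  qed
  \<comment> \<open>The invariant coset contains the translate of its own representative, so both
    cochains represent the same class.\<close>
  have 2: "\<epsilon> (\<lambda>x. \<phi> x \<otimes>\<^bsub>R\<^esub> group_elem g) = \<epsilon> \<phi>" if \<phi>: "\<phi> \<in> lmod_hom R (F n) (reg G)" and g: "g \<in> carrier G" for \<phi> g
  proof -
    let ?K = "Bd #>\<^bsub>Z\<^esub> f \<phi>"
    have "ZG_right_translate G n g ?K = ?K" using triv g car[OF fZ[OF \<phi>]] by (simp add: HZ)
    moreover have "f \<phi> \<in> ?K" using Z.rcos_self[OF fZ[OF \<phi>] sub] .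
    ultimately have "(\<lambda>gs\<in>tuples G n. f \<phi> gs \<otimes>\<^bsub>R\<^esub> group_elem g) \<in> ?K"
      unfolding ZG_right_translate_def by blast
    moreover have "(\<lambda>gs\<in>tuples G n. f \<phi> gs \<otimes>\<^bsub>R\<^esub> group_elem g) = f (\<lambda>x. \<phi> x \<otimes>\<^bsub>R\<^esub> group_elem g)"
      by (auto simp: f_def fun_eq_iff)
    ultimately have "f (\<lambda>x. \<phi> x \<otimes>\<^bsub>R\<^esub> group_elem g) \<in> ?K" by simp
    then have "?K = Bd #>\<^bsub>Z\<^esub> f (\<lambda>x. \<phi> x \<otimes>\<^bsub>R\<^esub> group_elem g)"
      using Z.repr_independence[OF _ fZ[OF \<phi>] sub] by blast
    then show ?thesis by (simp add: \<epsilon>_def)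
  qed
  have 3: "\<epsilon> \<phi> = 0 \<longleftrightarrow> (\<exists>\<psi>\<in>lmod_hom R (F k) (reg G). \<forall>x\<in>carrier (F n). \<phi> x = \<psi> (d n x))"
    if \<phi>: "\<phi> \<in> lmod_hom R (F n) (reg G)" for \<phi>
  proof -
    have one: "\<one>\<^bsub>Z Mod Bd\<^esub> = Bd" by (simp add: FactGroup_def)
    have \<kappa>1: "\<kappa> Bd = 0"
    proof -
      have "Bd \<otimes>\<^bsub>Z Mod Bd\<^esub> Bd = Bd" using Q.l_one[OF Q.one_closed] unfolding one .
      then have "\<kappa> Bd = \<kappa> Bd + \<kappa> Bd" using hom_mult[OF \<kappa>h Q.one_closed Q.one_closed] unfolding one by simp
      then show ?thesis by simp
    qed
    have "\<epsilon> \<phi> = 0 \<longleftrightarrow> Bd #>\<^bsub>Z\<^esub> f \<phi> = Bd"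
      unfolding \<epsilon>_def using \<kappa>1 inj_onD[OF \<kappa>i _ car[OF fZ[OF \<phi>]] Q.one_closed] one by auto
    also have "\<dots> \<longleftrightarrow> f \<phi> \<in> Bd"
      using Z.rcos_self[OF fZ[OF \<phi>] sub] Z.coset_join2[OF fZ[OF \<phi>] sub] by auto
    also have "\<dots> \<longleftrightarrow> (\<exists>\<psi>\<in>lmod_hom R (F k) (reg G). \<forall>x\<in>carrier (F n). \<phi> x = \<psi> (d n x))"
    proof
      assume "f \<phi> \<in> Bd"
      then obtain \<theta> where \<theta>: "\<theta> \<in> cochains G R k" "f \<phi> = cobd G R ract k \<theta>"
        by (auto simp: Bd_def n RM.coboundaries_Suc)
      have "\<exists>\<psi>\<in>lmod_hom R (F k) (reg G). \<forall>x\<in>carrier (F (Suc k)). \<phi> x = \<psi> (d (Suc k) x)"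
        by (rule comparison_coboundary[OF k1 c _ _ \<theta>(1)]) (use \<phi> \<theta>(2) n in \<open>simp_all add: f_def\<close>)
      then show "\<exists>\<psi>\<in>lmod_hom R (F k) (reg G). \<forall>x\<in>carrier (F n). \<phi> x = \<psi> (d n x)" by (simp add: n)
    next
      assume "\<exists>\<psi>\<in>lmod_hom R (F k) (reg G). \<forall>x\<in>carrier (F n). \<phi> x = \<psi> (d n x)"
      then obtain \<psi> where \<psi>: "\<psi> \<in> lmod_hom R (F k) (reg G)" "\<And>x. x \<in> carrier (F n) \<Longrightarrow> \<phi> x = \<psi> (d n x)" by blast
      have \<eta>: "\<eta> \<in> tuples G k \<rightarrow> carrier (F k)" and \<eta>d: "\<And>gs. gs \<in> tuples G n \<Longrightarrow> d n (\<eta>' gs) = cobd G (F k) (act k) k \<eta> gs"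
        using c n unfolding comparison_def by (auto simp: cochains_def)
      have \<psi>a: "addhom (F k) R \<psi>" using lmod_hom_addhom[OF \<psi>(1)] by (simp add: addhom_reg)
      have "f \<phi> gs = cobd G R ract k (\<lambda>gs\<in>tuples G k. \<psi> (\<eta> gs)) gs" if gs: "gs \<in> tuples G (Suc k)" for gs
      proof -
        have "f \<phi> gs = \<psi> (cobd G (F k) (act k) k \<eta> gs)" using gs \<psi>(2) \<eta>' \<eta>d by (simp add: f_def n)
        also have "\<dots> = cobd G R ract k (\<lambda>gs\<in>tuples G k. \<psi> (\<eta> gs)) gs"
        proof (rule hom_cobd[OF gm[OF k0] gmod_reg \<psi>a _ \<eta> gs])
          fix g x assume "g \<in> carrier G" "x \<in> carrier (F k)"
          then show "\<psi> (act k g x) = ract g (\<psi> x)" using lmod_hom_smult[OF \<psi>(1) group_elem_closed] by simp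
        qed
        finally show ?thesis .
      qed
      then have "f \<phi> = cobd G R ract k (\<lambda>gs\<in>tuples G k. \<psi> (\<eta> gs))"
        by (auto simp: f_def n fun_eq_iff) (simp add: cobd_def)
      moreover have "(\<lambda>gs\<in>tuples G k. \<psi> (\<eta> gs)) \<in> cochains G R k"
        using \<eta> addhom_closed[OF \<psi>a] by (auto simp: cochains_def)
      ultimately show "f \<phi> \<in> Bd" by (auto simp: Bd_def n RM.coboundaries_Suc)
    qed
    finally show ?thesis .
  qed
  show ?thesis using that[of \<epsilon>] 1 2 3 by blast
qed

end

section \<open>Chains of a finite index subgroup\<close>

definition fint :: "('x \<Rightarrow> int) \<Rightarrow> ('x \<Rightarrow>\<^sub>0 int) \<Rightarrow> int"
  where "fint f u = (\<Sum>z\<in>Poly_Mapping.keys u. Poly_Mapping.lookup u z * f z)"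

lemma fint_superset: "finite A \<Longrightarrow> Poly_Mapping.keys u \<subseteq> A \<Longrightarrow> fint f u = (\<Sum>z\<in>A. Poly_Mapping.lookup u z * f z)"
  unfolding fint_def by (intro sum.mono_neutral_left) (auto simp: in_keys_iff)

lemma fint_zero [simp]: "fint f 0 = 0"
  by (simp add: fint_def)

lemma fint_frag_of [simp]: "fint f (frag_of x) = f x"
  by (simp add: fint_def)

lemma fint_add: "fint f (u + v) = fint f u + fint f v"
proof -
  let ?A = "Poly_Mapping.keys u \<union> Poly_Mapping.keys v"
  have "fint f (u + v) = (\<Sum>z\<in>?A. Poly_Mapping.lookup (u + v) z * f z)"
    by (rule fint_superset[OF _ keys_add]) simp
  also have "\<dots> = fint f u + fint f v"
    using fint_superset[of ?A u f] fint_superset[of ?A v f] by (simp add: lookup_add algebra_simps sum.distrib)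
  finally show ?thesis .
qed

lemma fint_diff: "fint f (u - v) = fint f u - fint f v"
  using fint_add[of f "u - v" v] by simp

lemma fint_uminus: "fint f (- u) = - fint f u"
  using fint_diff[of f 0 u] by simp

lemma fint_cmul: "fint f (frag_cmul c u) = c * fint f u"
proof -
  have "fint f (frag_cmul c u) = (\<Sum>z\<in>Poly_Mapping.keys u. Poly_Mapping.lookup (frag_cmul c u) z * f z)"
    by (rule fint_superset[OF finite_keys keys_cmul])
  then show ?thesis by (simp add: fint_def sum_distrib_left mult.assoc)
qed

lemma fint_sum: "fint f (sum u A) = (\<Sum>i\<in>A. fint f (u i))"
  by (induction A rule: infinite_finite_induct) (auto simp: fint_add)

lemma fint_frag_extend: "fint f (frag_extend b u) = fint (\<lambda>x. fint f (b x)) u"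
  by (simp add: frag_extend_def fint_sum fint_cmul) (simp add: fint_def)

lemma fint_add_fun: "fint (\<lambda>z. f z + g z) u = fint f u + fint g u"
  by (simp add: fint_def algebra_simps sum.distrib)

lemma fint_cong: "(\<And>z. z \<in> Poly_Mapping.keys u \<Longrightarrow> f z = g z) \<Longrightarrow> fint f u = fint g u"
  by (simp add: fint_def)

lemma fint_scale_fun: "fint (\<lambda>z. c * f z) u = c * fint f u"
  by (simp add: fint_def sum_distrib_left algebra_simps)

lemma fint_sum_fun: "fint (\<lambda>z. \<Sum>i\<in>A. f i z) u = (\<Sum>i\<in>A. fint (f i) u)"
  by (simp add: fint_def sum_distrib_left) (rule sum.swap)

text \<open>The right action of the group ring on functions on the right cosets.\<close>

definition rmul :: "('g, 'b) monoid_scheme \<Rightarrow> ('g set \<Rightarrow> int) \<Rightarrow> ('g \<Rightarrow> int) \<Rightarrow> 'g set \<Rightarrow> int"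
  where "rmul G a r K = (\<Sum>g | r g \<noteq> 0. r g * a (K #>\<^bsub>G\<^esub> inv\<^bsub>G\<^esub> g))"

lemma rmul_superset: "finite A \<Longrightarrow> {g. r g \<noteq> 0} \<subseteq> A \<Longrightarrow> rmul G a r K = (\<Sum>g\<in>A. r g * a (K #>\<^bsub>G\<^esub> inv\<^bsub>G\<^esub> g))"
  unfolding rmul_def by (intro sum.mono_neutral_left) auto

lemma rmul_zero [simp]: "rmul G a (\<lambda>_. 0) K = 0"
  by (simp add: rmul_def)

lemma rmul_elem [simp]: "rmul G a (group_elem g) K = a (K #>\<^bsub>G\<^esub> inv\<^bsub>G\<^esub> g)"
proof -
  have "rmul G a (group_elem g) K = (\<Sum>h\<in>{g}. group_elem g h * a (K #>\<^bsub>G\<^esub> inv\<^bsub>G\<^esub> h))"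
    by (rule rmul_superset) (auto simp: group_elem_def)
  then show ?thesis by (simp add: group_elem_def)
qed

lemma rmul_add:
  assumes "r \<in> carrier (group_ring G)" "s \<in> carrier (group_ring G)"
  shows "rmul G a (\<lambda>x. r x + s x) K = rmul G a r K + rmul G a s K"
proof -
  have f: "finite ({g. r g \<noteq> 0} \<union> {g. s g \<noteq> 0})" using assms by (simp add: group_ring_carrier)
  have "rmul G a r K = (\<Sum>g\<in>{g. r g \<noteq> 0} \<union> {g. s g \<noteq> 0}. r g * a (K #>\<^bsub>G\<^esub> inv\<^bsub>G\<^esub> g))"
    "rmul G a s K = (\<Sum>g\<in>{g. r g \<noteq> 0} \<union> {g. s g \<noteq> 0}. s g * a (K #>\<^bsub>G\<^esub> inv\<^bsub>G\<^esub> g))"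
    "rmul G a (\<lambda>x. r x + s x) K = (\<Sum>g\<in>{g. r g \<noteq> 0} \<union> {g. s g \<noteq> 0}. (r g + s g) * a (K #>\<^bsub>G\<^esub> inv\<^bsub>G\<^esub> g))"
    by (rule rmul_superset[OF f]; auto)+
  then show ?thesis by (simp only: distrib_right sum.distrib)
qed

lemma rmul_diff:
  assumes "r \<in> carrier (group_ring G)" "s \<in> carrier (group_ring G)"
  shows "rmul G a (\<lambda>x. r x - s x) K = rmul G a r K - rmul G a s K"
  using rmul_add[OF group_ring_diff_closed[OF assms] assms(2), of a K] by simp

lemma group_ring_scale_closed:
  assumes "r \<in> carrier (group_ring G)" shows "(\<lambda>x. c * r x) \<in> carrier (group_ring G)"
proof -
  have "{g. c * r g \<noteq> 0} \<subseteq> {g. r g \<noteq> 0}" by auto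
  then show ?thesis using assms unfolding group_ring_carrier by (meson finite_subset order_trans)
qed

lemma rmul_scale:
  assumes "r \<in> carrier (group_ring G)" shows "rmul G a (\<lambda>x. c * r x) K = c * rmul G a r K"
proof -
  have "rmul G a (\<lambda>x. c * r x) K = (\<Sum>g | r g \<noteq> 0. c * r g * a (K #>\<^bsub>G\<^esub> inv\<^bsub>G\<^esub> g))"
    by (rule rmul_superset) (use assms in \<open>auto simp: group_ring_carrier\<close>)
  then show ?thesis by (simp add: rmul_def sum_distrib_left mult.assoc)
qed

lemma group_ring_sum_closed:
  assumes "\<And>i. i \<in> A \<Longrightarrow> r i \<in> carrier (group_ring G)" shows "(\<lambda>x. \<Sum>i\<in>A. r i x) \<in> carrier (group_ring G)"
  using assms
proof (induction A rule: infinite_finite_induct)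
  case (insert i A)
  have "(\<lambda>x. r i x - (0 - (\<Sum>i\<in>A. r i x))) \<in> carrier (group_ring G)"
    using insert by (intro group_ring_diff_closed[of "r i"] group_ring_diff_closed[of "\<lambda>_. 0"]) (auto simp: group_ring_carrier)
  then show ?case using insert by simp
qed (auto simp: group_ring_carrier)

lemma rmul_sum:
  assumes "\<And>i. i \<in> A \<Longrightarrow> r i \<in> carrier (group_ring G)"
  shows "rmul G a (\<lambda>x. \<Sum>i\<in>A. r i x) K = (\<Sum>i\<in>A. rmul G a (r i) K)"
  using assms
proof (induction A rule: infinite_finite_induct)
  case (insert i A)
  have "rmul G a (\<lambda>x. r i x + (\<Sum>i\<in>A. r i x)) K = rmul G a (r i) K + rmul G a (\<lambda>x. \<Sum>i\<in>A. r i x) K"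
    using insert by (intro rmul_add group_ring_sum_closed) auto
  then show ?case using insert by simp
qed auto

lemma rmul_fun_add: "rmul G (\<lambda>K. a K + b K) r K = rmul G a r K + rmul G b r K"
  by (simp add: rmul_def algebra_simps sum.distrib)

lemma rmul_fun_sum: "rmul G (\<lambda>K. \<Sum>i\<in>A. a i K) r K = (\<Sum>i\<in>A. rmul G (a i) r K)"
  by (simp add: rmul_def sum_distrib_left) (rule sum.swap)

lemma group_ring_mult_diff_right: "s \<otimes>\<^bsub>group_ring G\<^esub> (\<lambda>x. r x - r' x) = (\<lambda>x. (s \<otimes>\<^bsub>group_ring G\<^esub> r) x - (s \<otimes>\<^bsub>group_ring G\<^esub> r') x)"
  by (auto simp: group_ring_mult fun_eq_iff algebra_simps sum_subtractf)

lemma group_ring_mult_sum_right: "s \<otimes>\<^bsub>group_ring G\<^esub> (\<lambda>x. \<Sum>i\<in>A. r i x) = (\<lambda>x. \<Sum>i\<in>A. (s \<otimes>\<^bsub>group_ring G\<^esub> r i) x)"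
proof
  fix x show "(s \<otimes>\<^bsub>group_ring G\<^esub> (\<lambda>x. \<Sum>i\<in>A. r i x)) x = (\<Sum>i\<in>A. (s \<otimes>\<^bsub>group_ring G\<^esub> r i) x)"
    by (simp add: group_ring_mult sum_distrib_left) (rule impI, rule sum.swap)
qed

lemma group_ring_mult_scale_right: "s \<otimes>\<^bsub>group_ring G\<^esub> (\<lambda>x. c * r x) = (\<lambda>x. c * (s \<otimes>\<^bsub>group_ring G\<^esub> r) x)"
  by (auto simp: group_ring_mult fun_eq_iff algebra_simps sum_distrib_left)

lemma group_ring_mult_diff_left:
  assumes "ring (group_ring G)" "r \<in> carrier (group_ring G)" "r' \<in> carrier (group_ring G)" "s \<in> carrier (group_ring G)"
  shows "(\<lambda>x. r x - r' x) \<otimes>\<^bsub>group_ring G\<^esub> s = (\<lambda>x. (r \<otimes>\<^bsub>group_ring G\<^esub> s) x - (r' \<otimes>\<^bsub>group_ring G\<^esub> s) x)"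
proof -
  interpret ring "group_ring G" by fact
  have "(\<lambda>x. r x - r' x) \<otimes>\<^bsub>group_ring G\<^esub> s \<oplus>\<^bsub>group_ring G\<^esub> r' \<otimes>\<^bsub>group_ring G\<^esub> s = r \<otimes>\<^bsub>group_ring G\<^esub> s"
    using l_distr[OF group_ring_diff_closed[OF assms(2,3)] assms(3,4)] by simp
  then have "((\<lambda>x. r x - r' x) \<otimes>\<^bsub>group_ring G\<^esub> s) z + (r' \<otimes>\<^bsub>group_ring G\<^esub> s) z = (r \<otimes>\<^bsub>group_ring G\<^esub> s) z" for z
    using fun_cong[of _ _ z] by (simp only: group_ring_add)
  then show ?thesis by (auto simp: fun_eq_iff eq_diff_eq)
qed

context group
begin

lemma rcosets_act:
  assumes H: "subgroup H G" and K: "K \<in> rcosets H"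
  shows "g \<in> carrier G \<Longrightarrow> K #> g \<in> rcosets H" "K #> \<one> = K" "g \<in> carrier G \<Longrightarrow> h \<in> carrier G \<Longrightarrow> (K #> g) #> h = K #> (g \<otimes> h)"
proof -
  obtain x where x: "x \<in> carrier G" "K = H #> x" using K by (auto simp: RCOSETS_def)
  have Hc: "H \<subseteq> carrier G" using H by (rule subgroup.subset)
  have Kc: "K \<subseteq> carrier G" unfolding x(2) by (rule r_coset_subset_G[OF Hc x(1)])
  show "K #> g \<in> rcosets H" if "g \<in> carrier G"
    using x that coset_mult_assoc[OF Hc x(1) that] by (auto simp: RCOSETS_def)
  show "K #> \<one> = K" by (rule coset_mult_one[OF Kc])
  show "(K #> g) #> h = K #> (g \<otimes> h)" if "g \<in> carrier G" "h \<in> carrier G" by (rule coset_mult_assoc[OF Kc that])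
qed

lemma finite_gset_rcosets:
  "subgroup H G \<Longrightarrow> finite (rcosets H) \<Longrightarrow> finite_gset G (rcosets H) (\<lambda>K g. K #> g)"
  by (auto simp: finite_gset_def rcosets_act)

text \<open>Two inductions over the group ring reduce this to group elements, where it says that
  translation by the inverse of \<open>t\<close> followed by that of \<open>g\<close> is translation
  by the inverse of \<open>g t\<close>.\<close>

lemma rmul_mult:
  assumes R: "ring (group_ring G)" and H: "subgroup H G" and K: "K \<in> rcosets H"
    and r: "r \<in> carrier (group_ring G)" and s: "s \<in> carrier (group_ring G)"
  shows "rmul G a (r \<otimes>\<^bsub>group_ring G\<^esub> s) K = rmul G (rmul G a r) s K"
  using s
proof (induction rule: group_ring_induct)
  interpret ring "group_ring G" by (rule R)
  case zero
  have "r \<otimes>\<^bsub>group_ring G\<^esub> \<zero>\<^bsub>group_ring G\<^esub> = \<zero>\<^bsub>group_ring G\<^esub>" by (rule r_null[OF r])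
  then show ?case by simp
next
  interpret ring "group_ring G" by (rule R)
  case (elem t)
  have "rmul G a (r \<otimes>\<^bsub>group_ring G\<^esub> group_elem t) K = rmul G a r (K #> inv t)"
    using r
  proof (induction rule: group_ring_induct)
    case zero
    have "\<zero>\<^bsub>group_ring G\<^esub> \<otimes>\<^bsub>group_ring G\<^esub> group_elem t = \<zero>\<^bsub>group_ring G\<^esub>" by (rule l_null) (use elem in simp)
    then show ?case by simp
  next
    case (elem g)
    then show ?case using \<open>t \<in> carrier G\<close> rcosets_act(3)[OF H K, of "inv t" "inv g"]
      by (simp add: group_elem_mult inv_mult_group)
  next
    case (diff r r')
    have t: "group_elem t \<in> carrier (group_ring G)" using \<open>t \<in> carrier G\<close> by simp
    have "rmul G a ((\<lambda>x. r x - r' x) \<otimes>\<^bsub>group_ring G\<^esub> group_elem t) K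
      = rmul G a (r \<otimes>\<^bsub>group_ring G\<^esub> group_elem t) K - rmul G a (r' \<otimes>\<^bsub>group_ring G\<^esub> group_elem t) K"
      unfolding group_ring_mult_diff_left[OF R diff(1,2) t] by (rule rmul_diff[OF m_closed[OF diff(1) t] m_closed[OF diff(2) t]])
    then show ?case using diff by (simp add: rmul_diff)
  qed
  then show ?case by simp
next
  interpret ring "group_ring G" by (rule R)
  case (diff s s')
  have "rmul G a (r \<otimes>\<^bsub>group_ring G\<^esub> (\<lambda>x. s x - s' x)) K = rmul G a (r \<otimes>\<^bsub>group_ring G\<^esub> s) K - rmul G a (r \<otimes>\<^bsub>group_ring G\<^esub> s') K"
    unfolding group_ring_mult_diff_right by (rule rmul_diff[OF m_closed[OF r diff(1)] m_closed[OF r diff(2)]])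
  then show ?case using diff by (simp add: rmul_diff)
qed

text \<open>Each group element permutes the cosets and preserves the norm, so an element of the
  group ring costs at most the sum of the absolute values of its coefficients. This factor does not
  depend on \<open>H\<close>.\<close>

lemma l1_rmul:
  assumes H: "subgroup H G" "finite (rcosets H)" and r: "r \<in> carrier (group_ring G)"
  shows "l1 (rcosets H) (rmul G a r) \<le> (\<Sum>g | r g \<noteq> 0. real_of_int \<bar>r g\<bar>) * l1 (rcosets H) a"
proof -
  have "l1 (rcosets H) (rmul G a r) \<le> real_of_int (\<Sum>K\<in>rcosets H. \<Sum>g | r g \<noteq> 0. \<bar>r g\<bar> * \<bar>a (K #> inv g)\<bar>)"
    unfolding l1_def rmul_def of_int_le_iff by (intro sum_mono order_trans[OF sum_abs]) (simp add: abs_mult)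
  also have "(\<Sum>K\<in>rcosets H. \<Sum>g | r g \<noteq> 0. \<bar>r g\<bar> * \<bar>a (K #> inv g)\<bar>) = (\<Sum>g | r g \<noteq> 0. \<bar>r g\<bar> * (\<Sum>K\<in>rcosets H. \<bar>a (K #> inv g)\<bar>))"
    by (subst sum.swap) (simp add: sum_distrib_left)
  also have "real_of_int \<dots> = (\<Sum>g | r g \<noteq> 0. real_of_int \<bar>r g\<bar> * l1 (rcosets H) (\<lambda>K. a (K #> inv g)))"
    by (simp add: l1_def)
  also have "\<dots> = (\<Sum>g | r g \<noteq> 0. real_of_int \<bar>r g\<bar> * l1 (rcosets H) a)"
  proof (intro sum.cong refl arg_cong2[of _ _ _ _ "(*)"])
    fix g assume "g \<in> {g. r g \<noteq> 0}"
    then have "inv g \<in> carrier G" using r by (auto simp: group_ring_carrier)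
    from l1_act[OF is_group finite_gset_rcosets[OF H] this, of a]
    show "l1 (rcosets H) (\<lambda>K. a (K #> inv g)) = l1 (rcosets H) a" .
  qed
  finally show ?thesis by (simp add: sum_distrib_right)
qed

end

lemma finite_basis_coords:
  assumes M: "left_module (group_ring G) M" and G: "group G" and E: "finite_basis (group_ring G) M E"
  obtains crd where "\<And>e. e \<in> E \<Longrightarrow> crd e \<in> lmod_hom (group_ring G) M (reg G)"
    "\<And>x. x \<in> carrier M \<Longrightarrow> x = (\<Oplus>\<^bsub>M\<^esub>e\<in>E. crd e x \<odot>\<^bsub>M\<^esub> e)"
    "\<And>e e'. e \<in> E \<Longrightarrow> e' \<in> E \<Longrightarrow> crd e e' = (if e = e' then \<one>\<^bsub>group_ring G\<^esub> else (\<lambda>_. 0))"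
proof -
  interpret left_module "group_ring G" M by fact
  let ?R = "group_ring G"
  have fin: "finite E" "E \<subseteq> carrier M" and
    ex: "\<And>x. x \<in> carrier M \<Longrightarrow> \<exists>!c. c \<in> E \<rightarrow>\<^sub>E carrier ?R \<and> x = (\<Oplus>\<^bsub>M\<^esub>e\<in>E. c e \<odot>\<^bsub>M\<^esub> e)"
    using E unfolding finite_basis_def by blast+
  define C where "C x = (THE c. c \<in> E \<rightarrow>\<^sub>E carrier ?R \<and> x = (\<Oplus>\<^bsub>M\<^esub>e\<in>E. c e \<odot>\<^bsub>M\<^esub> e))" for x
  have C: "C x \<in> E \<rightarrow>\<^sub>E carrier ?R" "x = (\<Oplus>\<^bsub>M\<^esub>e\<in>E. C x e \<odot>\<^bsub>M\<^esub> e)" if "x \<in> carrier M" for x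
    using theI'[OF ex[OF that]] unfolding C_def by blast+
  \<comment> \<open>Uniqueness of coefficients in a form that ignores values outside
    \<open>E\<close>. Linearity of the coordinates and their values on the basis all follow by
    exhibiting one expansion.\<close>
  have Ceq: "C x e = c e" if "x \<in> carrier M" "\<And>e. e \<in> E \<Longrightarrow> c e \<in> carrier ?R" "x = (\<Oplus>\<^bsub>M\<^esub>e\<in>E. c e \<odot>\<^bsub>M\<^esub> e)" "e \<in> E" for x c e
  proof -
    have "(\<Oplus>\<^bsub>M\<^esub>e\<in>E. c e \<odot>\<^bsub>M\<^esub> e) = (\<Oplus>\<^bsub>M\<^esub>e\<in>E. restrict c E e \<odot>\<^bsub>M\<^esub> e)"
      using that(2) fin by (intro M.finsum_cong') (auto intro!: lsmult_closed)
    then have "restrict c E \<in> E \<rightarrow>\<^sub>E carrier ?R \<and> x = (\<Oplus>\<^bsub>M\<^esub>e\<in>E. restrict c E e \<odot>\<^bsub>M\<^esub> e)" using that by auto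
    then have "C x = restrict c E" using ex[OF that(1)] C[OF that(1)] by blast
    then show ?thesis using that by simp
  qed
  have Cc: "C x e \<in> carrier ?R" if "x \<in> carrier M" "e \<in> E" for x e using C(1)[OF that(1)] that(2) by (rule PiE_mem)
  have Cm: "(\<lambda>e. C x e \<odot>\<^bsub>M\<^esub> e) \<in> E \<rightarrow> carrier M" if "x \<in> carrier M" for x
    using Cc[OF that] fin by (auto intro!: lsmult_closed)
  define crd where "crd e x = C x e" for e x
  show ?thesis
  proof (rule that[of crd])
    fix e assume e: "e \<in> E"
    show "crd e \<in> lmod_hom ?R M (reg G)"
    proof (rule lmod_homI)
      show "addhom M (reg G) (crd e)"
        unfolding addhom_def crd_def reg_simps
      proof (intro conjI ballI funcsetI Cc e)
        fix x y assume xy: "x \<in> carrier M" "y \<in> carrier M"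
        have "C (x \<oplus>\<^bsub>M\<^esub> y) e = (\<lambda>e. C x e \<oplus>\<^bsub>?R\<^esub> C y e) e"
        proof (rule Ceq[OF _ _ _ e])
          have "x \<oplus>\<^bsub>M\<^esub> y = (\<Oplus>\<^bsub>M\<^esub>e\<in>E. C x e \<odot>\<^bsub>M\<^esub> e) \<oplus>\<^bsub>M\<^esub> (\<Oplus>\<^bsub>M\<^esub>e\<in>E. C y e \<odot>\<^bsub>M\<^esub> e)"
            using C(2)[OF xy(1)] C(2)[OF xy(2)] by simp
          also have "\<dots> = (\<Oplus>\<^bsub>M\<^esub>e\<in>E. C x e \<odot>\<^bsub>M\<^esub> e \<oplus>\<^bsub>M\<^esub> C y e \<odot>\<^bsub>M\<^esub> e)"
            by (rule M.finsum_addf[symmetric]) (use Cm xy in auto)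
          also have "\<dots> = (\<Oplus>\<^bsub>M\<^esub>e\<in>E. (C x e \<oplus>\<^bsub>?R\<^esub> C y e) \<odot>\<^bsub>M\<^esub> e)"
          proof (rule M.finsum_cong')
            fix e assume e: "e \<in> E"
            then have ec: "e \<in> carrier M" using fin by blast
            show "C x e \<odot>\<^bsub>M\<^esub> e \<oplus>\<^bsub>M\<^esub> C y e \<odot>\<^bsub>M\<^esub> e = (C x e \<oplus>\<^bsub>?R\<^esub> C y e) \<odot>\<^bsub>M\<^esub> e"
              by (rule lsmult_l_distr[OF Cc[OF xy(1) e] Cc[OF xy(2) e] ec, symmetric])
          next
            show "(\<lambda>e. (C x e \<oplus>\<^bsub>?R\<^esub> C y e) \<odot>\<^bsub>M\<^esub> e) \<in> E \<rightarrow> carrier M"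
              using R.a_closed[OF Cc[OF xy(1)] Cc[OF xy(2)]] fin by (intro funcsetI lsmult_closed) auto
          qed simp
          finally show "x \<oplus>\<^bsub>M\<^esub> y = (\<Oplus>\<^bsub>M\<^esub>e\<in>E. (C x e \<oplus>\<^bsub>?R\<^esub> C y e) \<odot>\<^bsub>M\<^esub> e)" .
          show "x \<oplus>\<^bsub>M\<^esub> y \<in> carrier M" using xy by simp
          show "C x e \<oplus>\<^bsub>?R\<^esub> C y e \<in> carrier ?R" if "e \<in> E" for e by (rule R.a_closed[OF Cc[OF xy(1) that] Cc[OF xy(2) that]])
        qed
        then show "C (x \<oplus>\<^bsub>M\<^esub> y) e = (\<lambda>z. C x e z + C y e z)" by simp
      qed
    next
      fix a x assume ax: "a \<in> carrier ?R" "x \<in> carrier M"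
      have "C (a \<odot>\<^bsub>M\<^esub> x) e = (\<lambda>e. a \<otimes>\<^bsub>?R\<^esub> C x e) e"
      proof (rule Ceq[OF _ _ _ e])
        have "a \<odot>\<^bsub>M\<^esub> x = a \<odot>\<^bsub>M\<^esub> (\<Oplus>\<^bsub>M\<^esub>e\<in>E. C x e \<odot>\<^bsub>M\<^esub> e)" using C(2)[OF ax(2)] by simp
        also have "\<dots> = (\<Oplus>\<^bsub>M\<^esub>e\<in>E. a \<odot>\<^bsub>M\<^esub> (C x e \<odot>\<^bsub>M\<^esub> e))"
          by (rule addhom_finsum[OF is_abelian_group is_abelian_group addhom_lsmult[OF ax(1)] fin(1) Cm[OF ax(2)]])
        also have "\<dots> = (\<Oplus>\<^bsub>M\<^esub>e\<in>E. (a \<otimes>\<^bsub>?R\<^esub> C x e) \<odot>\<^bsub>M\<^esub> e)"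
        proof (rule M.finsum_cong')
          fix e assume e: "e \<in> E"
          then have ec: "e \<in> carrier M" using fin by blast
          show "a \<odot>\<^bsub>M\<^esub> (C x e \<odot>\<^bsub>M\<^esub> e) = (a \<otimes>\<^bsub>?R\<^esub> C x e) \<odot>\<^bsub>M\<^esub> e"
            by (rule lsmult_assoc[OF ax(1) Cc[OF ax(2) e] ec, symmetric])
        next
          show "(\<lambda>e. (a \<otimes>\<^bsub>?R\<^esub> C x e) \<odot>\<^bsub>M\<^esub> e) \<in> E \<rightarrow> carrier M"
            using R.m_closed[OF ax(1) Cc[OF ax(2)]] fin by (intro funcsetI lsmult_closed) auto
        qed simp
        finally show "a \<odot>\<^bsub>M\<^esub> x = (\<Oplus>\<^bsub>M\<^esub>e\<in>E. (a \<otimes>\<^bsub>?R\<^esub> C x e) \<odot>\<^bsub>M\<^esub> e)" .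
        show "a \<odot>\<^bsub>M\<^esub> x \<in> carrier M" by (rule lsmult_closed[OF ax])
        show "a \<otimes>\<^bsub>?R\<^esub> C x e \<in> carrier ?R" if "e \<in> E" for e by (rule R.m_closed[OF ax(1) Cc[OF ax(2) that]])
      qed
      then show "crd e (a \<odot>\<^bsub>M\<^esub> x) = a \<odot>\<^bsub>reg G\<^esub> crd e x" by (simp add: crd_def)
    qed
  next
    fix x assume "x \<in> carrier M" then show "x = (\<Oplus>\<^bsub>M\<^esub>e\<in>E. crd e x \<odot>\<^bsub>M\<^esub> e)" using C(2) by (simp add: crd_def)
  next
    fix e e' assume e: "e \<in> E" "e' \<in> E"
    have ec: "e' \<in> carrier M" using e fin by blast
    have "C e' e = (\<lambda>e. if e = e' then \<one>\<^bsub>?R\<^esub> else \<zero>\<^bsub>?R\<^esub>) e"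
    proof (rule Ceq[OF ec _ _ e(1)])
      have zs: "(if e = e' then \<one>\<^bsub>?R\<^esub> else \<zero>\<^bsub>?R\<^esub>) \<odot>\<^bsub>M\<^esub> e = (if e' = e then e else \<zero>\<^bsub>M\<^esub>)" if "e \<in> E" for e
        using that fin zero_lsmult lsmult_one by (auto simp: subset_iff simp del: group_ring_zero)
      have "(\<Oplus>\<^bsub>M\<^esub>e\<in>E. (if e = e' then \<one>\<^bsub>?R\<^esub> else \<zero>\<^bsub>?R\<^esub>) \<odot>\<^bsub>M\<^esub> e) = (\<Oplus>\<^bsub>M\<^esub>e\<in>E. (if e' = e then e else \<zero>\<^bsub>M\<^esub>))"
        by (rule M.finsum_cong') (use zs fin in auto)
      also have "\<dots> = e'" using M.add.finprod_singleton[OF e(2) fin(1), of "\<lambda>e. e"] fin by auto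
      finally show "e' = (\<Oplus>\<^bsub>M\<^esub>e\<in>E. (if e = e' then \<one>\<^bsub>?R\<^esub> else \<zero>\<^bsub>?R\<^esub>) \<odot>\<^bsub>M\<^esub> e)" by simp
    qed (auto simp del: group_ring_zero)
    then show "crd e e' = (if e = e' then \<one>\<^bsub>?R\<^esub> else (\<lambda>_. 0))" by (simp add: crd_def)
  qed
qed

lemma ring_inversion_closed:
  assumes "group G" "r \<in> carrier (group_ring (G\<lparr>carrier := H\<rparr>))" "H \<subseteq> carrier G"
  shows "ring_inversion G r \<in> carrier (group_ring G)"
proof -
  interpret group G by fact
  have r: "finite {g. r g \<noteq> 0}" "{g. r g \<noteq> 0} \<subseteq> carrier G" using assms by (auto simp: group_ring_carrier)
  have "{g. ring_inversion G r g \<noteq> 0} \<subseteq> m_inv G ` {g. r g \<noteq> 0}"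
  proof
    fix g assume "g \<in> {g. ring_inversion G r g \<noteq> 0}"
    then have "g \<in> carrier G" "r (inv\<^bsub>G\<^esub> g) \<noteq> 0" by (auto simp: ring_inversion_def split: if_splits)
    then show "g \<in> m_inv G ` {g. r g \<noteq> 0}" by (intro image_eqI[of _ _ "inv\<^bsub>G\<^esub> g"]) auto
  qed
  moreover have "{g. ring_inversion G r g \<noteq> 0} \<subseteq> carrier G" by (auto simp: ring_inversion_def)
  ultimately show ?thesis using r(1) unfolding group_ring_carrier by (blast intro: finite_subset)
qed

section \<open>The tensor product as a quotient of formal combinations\<close>

locale chain_module = G: group G + L: left_module "group_ring G" M
  for G :: "('g, 'b) monoid_scheme" and M :: "('g \<Rightarrow> int, 'm) module" +
  fixes H :: "'g set"
  assumes H: "subgroup H G" and fin: "finite (rcosets\<^bsub>G\<^esub> H)"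
begin

abbreviation "R \<equiv> group_ring G"
abbreviation "TG \<equiv> tensor_gens M (trivial_module :: ('g \<Rightarrow> int, int) module)"
abbreviation "N \<equiv> tensor_relations (subgroup_ring G H) M (right_action G M) trivial_module"
abbreviation "S \<equiv> carrier M \<times> (UNIV :: int set)"

lemma TG: "TG = free_Abelian_group S"
  by (simp add: tensor_gens_def)

definition gens :: "('m \<times> int \<Rightarrow>\<^sub>0 int) set"
  where "gens = {frag_of (x \<oplus>\<^bsub>M\<^esub> x', y) - frag_of (x, y) - frag_of (x', y) | x x' y. x \<in> carrier M \<and> x' \<in> carrier M} \<union>
     {frag_of (x, y + y') - frag_of (x, y) - frag_of (x, y') | x y y'. x \<in> carrier M} \<union>
     {frag_of (ring_inversion G r \<odot>\<^bsub>M\<^esub> x, y) - frag_of (x, (\<Sum>g | r g \<noteq> 0. r g) * y) | x r y.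
        x \<in> carrier M \<and> r \<in> carrier (subgroup_ring G H)}"

lemma N_eq: "N = generate TG gens"
proof -
  have "r \<odot>\<^bsub>(trivial_module :: ('g \<Rightarrow> int, int) module)\<^esub> y = (\<Sum>g | r g \<noteq> 0. r g) * y" for r and y :: int
    by (simp add: trivial_module_def)
  then show ?thesis unfolding tensor_relations_def gens_def right_action_def by simp
qed

lemma gens_sub: "gens \<subseteq> carrier TG"
proof -
  have c: "ring_inversion G r \<odot>\<^bsub>M\<^esub> x \<in> carrier M" if "x \<in> carrier M" "r \<in> carrier (subgroup_ring G H)" for x r
    by (rule L.lsmult_closed[OF ring_inversion_closed[OF G.is_group that(2) subgroup.subset[OF H]] that(1)])
  have k: "Poly_Mapping.keys (a - b) \<subseteq> S" if "Poly_Mapping.keys a \<subseteq> S" "Poly_Mapping.keys b \<subseteq> S" for a b :: "'m \<times> int \<Rightarrow>\<^sub>0 int"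
    using keys_diff[of a b] that by blast
  show ?thesis unfolding TG gens_def
    by (intro subsetI, elim UnE CollectE exE conjE; simp only:, simp only: carrier_free_Abelian_group_iff, intro k; simp add: c)
qed

lemma group_TG: "comm_group TG"
  unfolding TG by (rule abelian_free_Abelian_group)

lemma subN: "subgroup N TG"
  unfolding N_eq by (rule group.generate_is_subgroup[OF comm_group.axioms(2)[OF group_TG] gens_sub])

lemma N_keys: "u \<in> N \<Longrightarrow> Poly_Mapping.keys u \<subseteq> S"
  using subsetD[OF subgroup.subset[OF subN], of u] by (simp add: TG)

lemma N_zero: "0 \<in> N"
  using subgroup.one_closed[OF subN] by (simp add: TG)

lemma N_add: "u \<in> N \<Longrightarrow> v \<in> N \<Longrightarrow> u + v \<in> N"
  using subgroup.m_closed[OF subN, of u v] by (simp add: TG)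

lemma N_uminus: "u \<in> N \<Longrightarrow> - u \<in> N"
  using subgroup.m_inv_closed[OF subN, of u] N_keys[of u] by (simp add: TG)

lemma N_diff: "u \<in> N \<Longrightarrow> v \<in> N \<Longrightarrow> u - v \<in> N"
  using N_add[OF _ N_uminus] by (metis add_uminus_conv_diff)

lemma N_sum: "(\<And>i. i \<in> A \<Longrightarrow> f i \<in> N) \<Longrightarrow> sum f A \<in> N"
  by (induction A rule: infinite_finite_induct) (auto intro: N_add N_zero)

lemma N_cmul: "u \<in> N \<Longrightarrow> frag_cmul c u \<in> N"
  by (rule frag_closure_minus_cmul[of "\<lambda>u. u \<in> N"]) (auto intro: N_zero N_diff)

lemma N_gen: "u \<in> gens \<Longrightarrow> u \<in> N"
  unfolding N_eq by (rule generate.incl)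

lemma rel_add: "x \<in> carrier M \<Longrightarrow> x' \<in> carrier M \<Longrightarrow> frag_of (x \<oplus>\<^bsub>M\<^esub> x', y) - (frag_of (x, y) + frag_of (x', y)) \<in> N"
  unfolding diff_diff_eq[symmetric] by (rule N_gen) (unfold gens_def, blast)

lemma rel_int: "x \<in> carrier M \<Longrightarrow> frag_of (x, y + y') - (frag_of (x, y) + frag_of (x, y')) \<in> N"
  unfolding diff_diff_eq[symmetric] by (rule N_gen) (unfold gens_def, blast)

lemma rel_smult: "x \<in> carrier M \<Longrightarrow> r \<in> carrier (subgroup_ring G H) \<Longrightarrow>
    frag_of (ring_inversion G r \<odot>\<^bsub>M\<^esub> x, y) - frag_of (x, (\<Sum>g | r g \<noteq> 0. r g) * y) \<in> N"
  by (rule N_gen) (unfold gens_def, blast)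

text \<open>A homomorphism \<open>c\<close> to the group ring induces a map from chains to \<open>\<int>[G/H]\<close>. For the coordinate
  functions of a basis of \<open>M\<close> these are the coordinates of a chain.\<close>

definition ev :: "('m \<Rightarrow> 'g \<Rightarrow> int) \<Rightarrow> ('m \<times> int \<Rightarrow>\<^sub>0 int) \<Rightarrow> 'g set \<Rightarrow> int"
  where "ev c u K = fint (\<lambda>(x, k). k * rmul G (\<lambda>K. of_bool (K = H)) (c x) K) u"

lemma ev_diff: "ev c (u - v) K = ev c u K - ev c v K" and ev_add: "ev c (u + v) K = ev c u K + ev c v K"
  and ev_frag_of: "ev c (frag_of (x, k)) K = k * rmul G (\<lambda>K. of_bool (K = H)) (c x) K"
  and ev_uminus: "ev c (- u) K = - ev c u K" and ev_zero: "ev c 0 K = 0"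
  and ev_cmul: "ev c (frag_cmul a u) K = a * ev c u K" and ev_sum: "ev c (sum w A) K = (\<Sum>i\<in>A. ev c (w i) K)"
  by (simp_all add: ev_def fint_diff fint_add fint_uminus fint_cmul fint_sum)

text \<open>Translation by elements of \<open>H\<close> fixes the coset \<open>H\<close> and carries
  no other coset to it. The indicator of \<open>H\<close> therefore sees an element of
  \<open>\<int>H\<close> only through its augmentation.\<close>

lemma rmul_inversion:
  assumes r: "r \<in> carrier (subgroup_ring G H)" and K: "K \<in> rcosets\<^bsub>G\<^esub> H"
  shows "rmul G (\<lambda>K. of_bool (K = H)) (ring_inversion G r) K = (\<Sum>g | r g \<noteq> 0. r g) * of_bool (K = H)"
proof -
  have rf: "finite {g. r g \<noteq> 0}" "{g. r g \<noteq> 0} \<subseteq> H" using r by (auto simp: group_ring_carrier)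
  then have rG: "{g. r g \<noteq> 0} \<subseteq> carrier G" using subgroup.subset[OF H] by blast
  have inj: "inj_on (m_inv G) {g. r g \<noteq> 0}" using rG by (intro inj_onI) (metis G.inv_inv subsetD)
  have "{g. ring_inversion G r g \<noteq> 0} \<subseteq> m_inv G ` {g. r g \<noteq> 0}"
  proof
    fix g assume "g \<in> {g. ring_inversion G r g \<noteq> 0}"
    then have "g \<in> carrier G" "r (inv\<^bsub>G\<^esub> g) \<noteq> 0" by (auto simp: ring_inversion_def split: if_splits)
    then show "g \<in> m_inv G ` {g. r g \<noteq> 0}" by (intro image_eqI[of _ _ "inv\<^bsub>G\<^esub> g"]) auto
  qed
  then have "rmul G (\<lambda>K. of_bool (K = H)) (ring_inversion G r) K =
    (\<Sum>g\<in>m_inv G ` {g. r g \<noteq> 0}. ring_inversion G r g * of_bool (K #>\<^bsub>G\<^esub> inv\<^bsub>G\<^esub> g = H))"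
    using rf by (intro rmul_superset) auto
  also have "\<dots> = (\<Sum>h | r h \<noteq> 0. ring_inversion G r (inv\<^bsub>G\<^esub> h) * of_bool (K #>\<^bsub>G\<^esub> inv\<^bsub>G\<^esub> (inv\<^bsub>G\<^esub> h) = H))"
    by (simp add: sum.reindex[OF inj])
  also have "\<dots> = (\<Sum>h | r h \<noteq> 0. r h * of_bool (K = H))"
  proof (rule sum.cong[OF refl])
    fix h assume "h \<in> {h. r h \<noteq> 0}"
    then have h: "h \<in> H" "h \<in> carrier G" using rf rG by auto
    have "K #>\<^bsub>G\<^esub> h = H \<longleftrightarrow> K = H"
    proof
      assume "K = H" then show "K #>\<^bsub>G\<^esub> h = H" using G.coset_join2[OF h(2) H h(1)] by simp
    next
      assume "K #>\<^bsub>G\<^esub> h = H"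
      then have "K #>\<^bsub>G\<^esub> h #>\<^bsub>G\<^esub> inv\<^bsub>G\<^esub> h = H #>\<^bsub>G\<^esub> inv\<^bsub>G\<^esub> h" by simp
      then show "K = H" using G.rcosets_act(2,3)[OF H K] h G.coset_join2[OF _ H, of "inv\<^bsub>G\<^esub> h"] subgroup.m_inv_closed[OF H h(1)] by simp
    qed
    then show "ring_inversion G r (inv\<^bsub>G\<^esub> h) * of_bool (K #>\<^bsub>G\<^esub> inv\<^bsub>G\<^esub> (inv\<^bsub>G\<^esub> h) = H) = r h * of_bool (K = H)"
      using h by (simp add: ring_inversion_def)
  qed
  finally show ?thesis by (simp only: sum_distrib_right)
qed

lemma ring_R: "ring R" ..

text \<open>Evaluation descends to chains. The balancing relation is respected because
  \<open>c\<close> is linear over the group ring and the indicator of \<open>H\<close> absorbs the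
  factor from \<open>\<int>H\<close> by \<open>rmul_inversion\<close>.\<close>

lemma ev_N:
  assumes c: "c \<in> lmod_hom R M (reg G)" and u: "u \<in> N" and K: "K \<in> rcosets\<^bsub>G\<^esub> H"
  shows "ev c u K = 0"
proof -
  let ?a = "\<lambda>K. of_bool (K = H) :: int"
  note ccl = lmod_hom_closed[OF c, unfolded reg_simps]
  have g: "ev c w K = 0" if w: "w \<in> gens" for w
  proof -
    consider (1) x x' y where "w = frag_of (x \<oplus>\<^bsub>M\<^esub> x', y) - frag_of (x, y) - frag_of (x', y)" "x \<in> carrier M" "x' \<in> carrier M"
      | (2) x y y' where "w = frag_of (x, y + y') - frag_of (x, y) - frag_of (x, y')" "x \<in> carrier M"
      | (3) x r y where "w = frag_of (ring_inversion G r \<odot>\<^bsub>M\<^esub> x, y) - frag_of (x, (\<Sum>g | r g \<noteq> 0. r g) * y)" "x \<in> carrier M" "r \<in> carrier (subgroup_ring G H)"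
      using w unfolding gens_def by blast
    then show ?thesis
    proof cases
      case 1
      have "c (x \<oplus>\<^bsub>M\<^esub> x') = (\<lambda>z. c x z + c x' z)" using addhom_add[OF lmod_hom_addhom[OF c] 1(2,3)] by simp
      then show ?thesis using rmul_add[OF ccl[OF 1(2)] ccl[OF 1(3)], of ?a K] unfolding 1(1)
        by (simp add: ev_diff ev_frag_of distrib_left)
    next
      case 2 then show ?thesis unfolding 2(1) by (simp add: ev_diff ev_frag_of distrib_right)
    next
      case 3
      have ri: "ring_inversion G r \<in> carrier R" by (rule ring_inversion_closed[OF G.is_group 3(3) subgroup.subset[OF H]])
      have "c (ring_inversion G r \<odot>\<^bsub>M\<^esub> x) = ring_inversion G r \<otimes>\<^bsub>R\<^esub> c x" using lmod_hom_smult[OF c ri 3(2)] by simp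
      then have "rmul G ?a (c (ring_inversion G r \<odot>\<^bsub>M\<^esub> x)) K = rmul G (rmul G ?a (ring_inversion G r)) (c x) K"
        using G.rmul_mult[OF ring_R H K ri ccl[OF 3(2)]] by simp
      also have "\<dots> = (\<Sum>g | c x g \<noteq> 0. c x g * ((\<Sum>g | r g \<noteq> 0. r g) * ?a (K #>\<^bsub>G\<^esub> inv\<^bsub>G\<^esub> g)))"
        unfolding rmul_def[of G "rmul G ?a (ring_inversion G r)"]
      proof (rule sum.cong[OF refl])
        fix g assume "g \<in> {g. c x g \<noteq> 0}"
        then have "inv\<^bsub>G\<^esub> g \<in> carrier G" using ccl[OF 3(2)] by (auto simp: group_ring_carrier)
        then have "K #>\<^bsub>G\<^esub> inv\<^bsub>G\<^esub> g \<in> rcosets\<^bsub>G\<^esub> H" by (rule G.rcosets_act(1)[OF H K])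
        then show "c x g * rmul G ?a (ring_inversion G r) (K #>\<^bsub>G\<^esub> inv\<^bsub>G\<^esub> g) = c x g * ((\<Sum>g | r g \<noteq> 0. r g) * ?a (K #>\<^bsub>G\<^esub> inv\<^bsub>G\<^esub> g))"
          by (simp only: rmul_inversion[OF 3(3)])
      qed
      also have "\<dots> = (\<Sum>g | r g \<noteq> 0. r g) * rmul G ?a (c x) K"
        unfolding rmul_def sum_distrib_left by (intro sum.cong refl) (simp only: ac_simps)
      finally show ?thesis unfolding 3(1) by (simp add: ev_diff ev_frag_of)
    qed
  qed
  show ?thesis using u unfolding N_eq
  proof (induction rule: generate.induct)
    case (inv h)
    then have "Poly_Mapping.keys h \<subseteq> S" using subsetD[OF gens_sub] by (simp add: TG)
    then show ?case using g[OF inv] by (simp add: TG ev_uminus)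
  qed (simp_all add: TG ev_zero ev_add g)
qed

lemma reps_bij:
  assumes T: "coset_representatives G H T" shows "bij_betw (\<lambda>t. H #>\<^bsub>G\<^esub> t) T (rcosets\<^bsub>G\<^esub> H)"
proof -
  have TG: "T \<subseteq> carrier G" and ex: "\<And>K. K \<in> rcosets\<^bsub>G\<^esub> H \<Longrightarrow> \<exists>!t. t \<in> T \<and> t \<in> K"
    using T by (auto simp: coset_representatives_def)
  have mem: "H #>\<^bsub>G\<^esub> t \<in> rcosets\<^bsub>G\<^esub> H" "t \<in> H #>\<^bsub>G\<^esub> t" if "t \<in> T" for t
    using that TG G.rcosetsI[OF subgroup.subset[OF H], of t] G.rcos_self[OF _ H, of t] by auto
  show ?thesis
    unfolding bij_betw_def
  proof
    show "inj_on (\<lambda>t. H #>\<^bsub>G\<^esub> t) T"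
    proof (rule inj_onI)
      fix s t assume st: "s \<in> T" "t \<in> T" "H #>\<^bsub>G\<^esub> s = H #>\<^bsub>G\<^esub> t"
      then have "s \<in> H #>\<^bsub>G\<^esub> t" "t \<in> H #>\<^bsub>G\<^esub> t" using mem by auto
      then show "s = t" using ex[OF mem(1)[OF st(2)]] st by blast
    qed
    show "(\<lambda>t. H #>\<^bsub>G\<^esub> t) ` T = rcosets\<^bsub>G\<^esub> H"
    proof
      show "(\<lambda>t. H #>\<^bsub>G\<^esub> t) ` T \<subseteq> rcosets\<^bsub>G\<^esub> H" using mem by auto
      show "rcosets\<^bsub>G\<^esub> H \<subseteq> (\<lambda>t. H #>\<^bsub>G\<^esub> t) ` T"
      proof
        fix K assume K: "K \<in> rcosets\<^bsub>G\<^esub> H"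
        then obtain x where x: "x \<in> carrier G" "K = H #>\<^bsub>G\<^esub> x" by (auto simp: RCOSETS_def)
        obtain t where t: "t \<in> T" "t \<in> K" using ex[OF K] by blast
        then have "K = H #>\<^bsub>G\<^esub> t" using G.repr_independence[of t H x] x H by simp
        then show "K \<in> (\<lambda>t. H #>\<^bsub>G\<^esub> t) ` T" using t by blast
      qed
    qed
  qed
qed

text \<open>A group element is some \<open>h\<close> in \<open>H\<close> times a unique
  representative, and \<open>h\<close> is absorbed by the trivial factor of the tensor product. The
  coefficients are the evaluations used in \<open>ev\<close>, so linearity gives the general
  case.\<close>

lemma span_smult:
  assumes T: "coset_representatives G H T" and x: "x \<in> carrier M" and r: "r \<in> carrier R"
  shows "frag_of (r \<odot>\<^bsub>M\<^esub> x, 1) - (\<Sum>t\<in>T. frag_cmul (rmul G (\<lambda>K. of_bool (K = H)) r (H #>\<^bsub>G\<^esub> t)) (frag_of (group_elem t \<odot>\<^bsub>M\<^esub> x, 1))) \<in> N"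
  using r
proof (induction rule: group_ring_induct)
  case zero
  have "frag_of (\<zero>\<^bsub>M\<^esub> \<oplus>\<^bsub>M\<^esub> \<zero>\<^bsub>M\<^esub>, 1) - (frag_of (\<zero>\<^bsub>M\<^esub>, 1) + frag_of (\<zero>\<^bsub>M\<^esub>, 1)) \<in> N" by (rule rel_add) simp_all
  then have "- (frag_of (\<zero>\<^bsub>M\<^esub>, 1 :: int)) \<in> N" by simp
  then have "frag_of (\<zero>\<^bsub>M\<^esub>, 1 :: int) \<in> N" using N_uminus by fastforce
  then show ?case using L.zero_lsmult[OF x] by simp
next
  case (elem g)
  have TG: "T \<subseteq> carrier G" using T by (simp add: coset_representatives_def)
  have finT: "finite T" using bij_betw_finite[OF reps_bij[OF T]] fin by simp
  have "H #>\<^bsub>G\<^esub> g \<in> rcosets\<^bsub>G\<^esub> H" by (rule G.rcosetsI[OF subgroup.subset[OF H] elem])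
  then obtain t0 where t0: "t0 \<in> T" "H #>\<^bsub>G\<^esub> g = H #>\<^bsub>G\<^esub> t0" using reps_bij[OF T] by (auto simp: bij_betw_def)
  then have t0G: "t0 \<in> carrier G" using TG by blast
  have iff: "(H #>\<^bsub>G\<^esub> t #>\<^bsub>G\<^esub> inv\<^bsub>G\<^esub> g = H) = (t = t0)" if t: "t \<in> T" for t
  proof
    have tG: "t \<in> carrier G" using t TG by blast
    have Kt: "H #>\<^bsub>G\<^esub> t \<in> rcosets\<^bsub>G\<^esub> H" by (rule G.rcosetsI[OF subgroup.subset[OF H] tG])
    assume "H #>\<^bsub>G\<^esub> t #>\<^bsub>G\<^esub> inv\<^bsub>G\<^esub> g = H"
    then have "H #>\<^bsub>G\<^esub> t #>\<^bsub>G\<^esub> inv\<^bsub>G\<^esub> g #>\<^bsub>G\<^esub> g = H #>\<^bsub>G\<^esub> t0" using t0 by simp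
    then have "H #>\<^bsub>G\<^esub> t = H #>\<^bsub>G\<^esub> t0" using G.rcosets_act(2,3)[OF H Kt] elem by simp
    then show "t = t0" using reps_bij[OF T] t t0 by (auto simp: bij_betw_def inj_on_def)
  next
    assume "t = t0"
    then have "H #>\<^bsub>G\<^esub> t #>\<^bsub>G\<^esub> inv\<^bsub>G\<^esub> g = H #>\<^bsub>G\<^esub> g #>\<^bsub>G\<^esub> inv\<^bsub>G\<^esub> g" using t0 by simp
    also have "\<dots> = H" using G.coset_mult_assoc[OF subgroup.subset[OF H] elem, of "inv\<^bsub>G\<^esub> g"] elem subgroup.subset[OF H] by simp
    finally show "H #>\<^bsub>G\<^esub> t #>\<^bsub>G\<^esub> inv\<^bsub>G\<^esub> g = H" .
  qed
  have "(\<Sum>t\<in>T. frag_cmul (rmul G (\<lambda>K. of_bool (K = H)) (group_elem g) (H #>\<^bsub>G\<^esub> t)) (frag_of (group_elem t \<odot>\<^bsub>M\<^esub> x, 1)))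
    = (\<Sum>t\<in>T. if t = t0 then frag_of (group_elem t \<odot>\<^bsub>M\<^esub> x, 1 :: int) else 0)"
    by (intro sum.cong refl) (simp add: iff)
  also have "\<dots> = frag_of (group_elem t0 \<odot>\<^bsub>M\<^esub> x, 1)" using t0 finT by simp
  finally have eq: "(\<Sum>t\<in>T. frag_cmul (rmul G (\<lambda>K. of_bool (K = H)) (group_elem g) (H #>\<^bsub>G\<^esub> t)) (frag_of (group_elem t \<odot>\<^bsub>M\<^esub> x, 1)))
    = frag_of (group_elem t0 \<odot>\<^bsub>M\<^esub> x, 1 :: int)" .
  have "g \<in> H #>\<^bsub>G\<^esub> t0" using G.rcos_self[OF elem H] t0 by simp
  then obtain h where h: "h \<in> H" "g = h \<otimes>\<^bsub>G\<^esub> t0" by (auto simp: r_coset_def)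
  have hG: "h \<in> carrier G" using h subgroup.subset[OF H] by blast
  \<comment> \<open>The right module structure uses inversion, so the relation for the inverse of
    \<open>h\<close> removes left multiplication by \<open>h\<close>.\<close>
  let ?r = "group_elem (inv\<^bsub>G\<^esub> h)"
  have r: "?r \<in> carrier (subgroup_ring G H)"
    using subgroup.m_inv_closed[OF H h(1)] by (auto simp: group_ring_carrier group_elem_def)
  have ri: "ring_inversion G ?r = group_elem h"
    using hG by (auto simp: ring_inversion_def group_elem_def fun_eq_iff dest: G.inv_eq_imp_eq)
  have "{g. ?r g \<noteq> 0} = {inv\<^bsub>G\<^esub> h}" by (auto simp: group_elem_def)
  then have s1: "(\<Sum>g | ?r g \<noteq> 0. ?r g) = 1" by (simp add: group_elem_def)
  have tx: "group_elem t0 \<odot>\<^bsub>M\<^esub> x \<in> carrier M" using t0G x by (intro L.lsmult_closed) auto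
  have "group_elem h \<odot>\<^bsub>M\<^esub> (group_elem t0 \<odot>\<^bsub>M\<^esub> x) = group_elem g \<odot>\<^bsub>M\<^esub> x"
    using L.lsmult_assoc[of "group_elem h" "group_elem t0" x] hG t0G x h by (simp add: G.group_elem_mult)
  then show ?case using rel_smult[OF tx r, of 1] unfolding eq by (simp add: ri s1)
next
  case (diff r s)
  let ?f = "\<lambda>r. \<Sum>t\<in>T. frag_cmul (rmul G (\<lambda>K. of_bool (K = H)) r (H #>\<^bsub>G\<^esub> t)) (frag_of (group_elem t \<odot>\<^bsub>M\<^esub> x, 1 :: int))"
  let ?t = "\<lambda>x. r x - s x"
  have t: "?t \<in> carrier R" using diff group_ring_diff_closed by blast
  have "?t \<odot>\<^bsub>M\<^esub> x \<oplus>\<^bsub>M\<^esub> s \<odot>\<^bsub>M\<^esub> x = r \<odot>\<^bsub>M\<^esub> x" using L.lsmult_l_distr[OF t diff(2) x] by simp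
  then have 1: "frag_of (r \<odot>\<^bsub>M\<^esub> x, 1) - (frag_of (?t \<odot>\<^bsub>M\<^esub> x, 1) + frag_of (s \<odot>\<^bsub>M\<^esub> x, 1)) \<in> N"
    using rel_add[OF L.lsmult_closed[OF t x] L.lsmult_closed[OF diff(2) x], of 1] by simp
  have "?f ?t = ?f r - ?f s"
    by (simp add: rmul_diff[OF diff(1,2)] frag_cmul_diff_distrib sum_subtractf)
  then have eq: "frag_of (?t \<odot>\<^bsub>M\<^esub> x, 1) - ?f ?t = (frag_of (r \<odot>\<^bsub>M\<^esub> x, 1) - ?f r) - (frag_of (s \<odot>\<^bsub>M\<^esub> x, 1) - ?f s)
    - (frag_of (r \<odot>\<^bsub>M\<^esub> x, 1) - (frag_of (?t \<odot>\<^bsub>M\<^esub> x, 1) + frag_of (s \<odot>\<^bsub>M\<^esub> x, 1)))"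
    by (simp add: algebra_simps)
  show ?case unfolding eq by (rule N_diff[OF N_diff[OF diff(3,4)] 1])
qed

lemma frag_int: "x \<in> carrier M \<Longrightarrow> frag_of (x, k) - frag_cmul k (frag_of (x, 1)) \<in> N"
proof -
  assume x: "x \<in> carrier M"
  have z: "frag_of (x, 0 :: int) \<in> N"
  proof -
    have "- frag_of (x, 0 :: int) \<in> N" using rel_int[OF x, of 0 0] by simp
    then show ?thesis using N_uminus by fastforce
  qed
  have n: "frag_of (x, int n) - frag_cmul (int n) (frag_of (x, 1)) \<in> N" for n
  proof (induction n)
    case (Suc n)
    have eq: "frag_of (x, int (Suc n)) - frag_cmul (int (Suc n)) (frag_of (x, 1)) =
      (frag_of (x, 1 + int n) - (frag_of (x, 1) + frag_of (x, int n))) + (frag_of (x, int n) - frag_cmul (int n) (frag_of (x, 1)))"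
      by (simp add: frag_cmul_distrib algebra_simps)
    show ?case unfolding eq by (rule N_add[OF rel_int[OF x] Suc])
  qed (use z in simp)
  show "frag_of (x, k) - frag_cmul k (frag_of (x, 1)) \<in> N"
  proof (cases k)
    case (nonneg m) then show ?thesis using n by simp
  next
    case (neg m)
    let ?m = "int (Suc m)"
    \<comment> \<open>Additivity in the second factor is applied to
      \<open>?m + - ?m = 0\<close>.\<close>
    have eq: "frag_of (x, k) - frag_cmul k (frag_of (x, 1)) =
      frag_of (x, 0) - (frag_of (x, ?m) - frag_cmul ?m (frag_of (x, 1))) - (frag_of (x, ?m + - ?m) - (frag_of (x, ?m) + frag_of (x, - ?m)))"
      unfolding neg by (simp add: algebra_simps del: of_nat_Suc flip: minus_frag_cmul)
    show ?thesis unfolding eq by (rule N_diff[OF N_diff[OF z n[of "Suc m"]] rel_int[OF x, of ?m "- ?m"]])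
  qed
qed

end

section \<open>Bases of chain groups and the chain norm\<close>

locale based_chain_module = chain_module +
  fixes T :: "'a set" and E :: "'c set" and crd :: "'c \<Rightarrow> 'c \<Rightarrow> 'a \<Rightarrow> int"
  assumes T: "coset_representatives G H T" and E: "finite E" "E \<subseteq> carrier M"
    and crd: "\<And>e. e \<in> E \<Longrightarrow> crd e \<in> lmod_hom (group_ring G) M (reg G)"
    and crd_exp: "\<And>x. x \<in> carrier M \<Longrightarrow> x = (\<Oplus>\<^bsub>M\<^esub>e\<in>E. crd e x \<odot>\<^bsub>M\<^esub> e)"
    and crd_E: "\<And>e e'. e \<in> E \<Longrightarrow> e' \<in> E \<Longrightarrow> crd e e' = (if e = e' then \<one>\<^bsub>group_ring G\<^esub> else (\<lambda>_. 0))"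
begin

definition b :: "'a \<times> 'c \<Rightarrow> ('c \<times> int \<Rightarrow>\<^sub>0 int)"
  where "b = (\<lambda>(t, e). frag_of (group_elem t \<odot>\<^bsub>M\<^esub> e, 1))"

lemma TG': "T \<subseteq> carrier G" using T by (simp add: coset_representatives_def)

lemma finT: "finite T" using bij_betw_finite[OF reps_bij[OF T]] fin by simp

lemma b_keys: "i \<in> T \<times> E \<Longrightarrow> Poly_Mapping.keys (b i) \<subseteq> S"
  using TG' E by (auto simp: b_def intro!: L.lsmult_closed group_elem_closed)

text \<open>Modulo relations a generator has second entry 1; it is expanded in the basis of the
  module, and then every coefficient in the representatives by \<open>span_smult\<close>.\<close>

lemma span:
  assumes u: "Poly_Mapping.keys u \<subseteq> S"
  shows "u - (\<Sum>(t, e)\<in>T \<times> E. frag_cmul (ev (crd e) u (H #>\<^bsub>G\<^esub> t)) (b (t, e))) \<in> N"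
  using u
proof (rule free_Abelian_group_induct)
  show "0 - (\<Sum>(t, e)\<in>T \<times> E. frag_cmul (ev (crd e) 0 (H #>\<^bsub>G\<^esub> t)) (b (t, e))) \<in> N" by (simp add: ev_zero case_prod_unfold N_zero)
next
  fix u v
  assume "u - (\<Sum>(t, e)\<in>T \<times> E. frag_cmul (ev (crd e) u (H #>\<^bsub>G\<^esub> t)) (b (t, e))) \<in> N"
    "v - (\<Sum>(t, e)\<in>T \<times> E. frag_cmul (ev (crd e) v (H #>\<^bsub>G\<^esub> t)) (b (t, e))) \<in> N"
  from N_diff[OF this]
  show "u - v - (\<Sum>(t, e)\<in>T \<times> E. frag_cmul (ev (crd e) (u - v) (H #>\<^bsub>G\<^esub> t)) (b (t, e))) \<in> N"
    by (simp add: ev_diff frag_cmul_diff_distrib sum_subtractf case_prod_unfold algebra_simps)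
next
  fix z assume "z \<in> S"
  then obtain x k where z: "z = (x, k)" and x: "x \<in> carrier M" by auto
  let ?p = "\<lambda>r t. rmul G (\<lambda>K. of_bool (K = H)) r (H #>\<^bsub>G\<^esub> t)"
  have ccl: "crd e x \<in> carrier R" if "e \<in> E" for e using lmod_hom_closed[OF crd[OF that] x] by simp
  have Ec: "e \<in> carrier M" if "e \<in> E" for e using that E by blast
  have m: "crd e x \<odot>\<^bsub>M\<^esub> e \<in> carrier M" if "e \<in> E" for e by (rule L.lsmult_closed[OF ccl[OF that] Ec[OF that]])
  have fs: "frag_of (\<Oplus>\<^bsub>M\<^esub>e\<in>E'. crd e x \<odot>\<^bsub>M\<^esub> e, 1) - (\<Sum>e\<in>E'. frag_of (crd e x \<odot>\<^bsub>M\<^esub> e, 1)) \<in> N" if "E' \<subseteq> E" for E'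
    using finite_subset[OF that E(1)] that
  proof (induction E')
    case empty
    have "- frag_of (\<zero>\<^bsub>M\<^esub>, 1 :: int) \<in> N" using rel_add[of "\<zero>\<^bsub>M\<^esub>" "\<zero>\<^bsub>M\<^esub>" 1] by simp
    then show ?case using N_uminus by fastforce
  next
    case (insert e E')
    have fm: "(\<lambda>e. crd e x \<odot>\<^bsub>M\<^esub> e) \<in> E' \<rightarrow> carrier M" using m insert by auto
    have eq: "(\<Oplus>\<^bsub>M\<^esub>e\<in>insert e E'. crd e x \<odot>\<^bsub>M\<^esub> e) = crd e x \<odot>\<^bsub>M\<^esub> e \<oplus>\<^bsub>M\<^esub> (\<Oplus>\<^bsub>M\<^esub>e\<in>E'. crd e x \<odot>\<^bsub>M\<^esub> e)"
      using insert fm m by (intro L.M.finsum_insert) auto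
    have "frag_of (\<Oplus>\<^bsub>M\<^esub>e\<in>insert e E'. crd e x \<odot>\<^bsub>M\<^esub> e, 1) - (frag_of (crd e x \<odot>\<^bsub>M\<^esub> e, 1) + frag_of (\<Oplus>\<^bsub>M\<^esub>e\<in>E'. crd e x \<odot>\<^bsub>M\<^esub> e, 1)) \<in> N"
      unfolding eq using insert m L.M.finsum_closed[OF fm] by (intro rel_add) auto
    moreover have "frag_of (\<Oplus>\<^bsub>M\<^esub>e\<in>E'. crd e x \<odot>\<^bsub>M\<^esub> e, 1) - (\<Sum>e\<in>E'. frag_of (crd e x \<odot>\<^bsub>M\<^esub> e, 1)) \<in> N" using insert by auto
    ultimately show ?case using N_add insert by (fastforce simp: algebra_simps)
  qed
  have 1: "frag_of (x, 1) - (\<Sum>e\<in>E. frag_of (crd e x \<odot>\<^bsub>M\<^esub> e, 1)) \<in> N" using fs[of E] crd_exp[OF x] by simp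
  have 2: "(\<Sum>e\<in>E. frag_of (crd e x \<odot>\<^bsub>M\<^esub> e, 1) - (\<Sum>t\<in>T. frag_cmul (?p (crd e x) t) (b (t, e)))) \<in> N"
    unfolding b_def prod.case by (rule N_sum[OF span_smult[OF T Ec ccl]])
  have "frag_of (x, 1) - (\<Sum>e\<in>E. \<Sum>t\<in>T. frag_cmul (?p (crd e x) t) (b (t, e))) \<in> N"
    using N_add[OF 1 2] by (simp add: sum_subtractf)
  then have "frag_cmul k (frag_of (x, 1) - (\<Sum>e\<in>E. \<Sum>t\<in>T. frag_cmul (?p (crd e x) t) (b (t, e)))) \<in> N" by (rule N_cmul)
  from N_add[OF frag_int[OF x, of k] this]
  have "frag_of (x, k) - frag_cmul k (\<Sum>e\<in>E. \<Sum>t\<in>T. frag_cmul (?p (crd e x) t) (b (t, e))) \<in> N"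
    using frag_cmul_distrib2[of k "frag_of (x, 1) - (\<Sum>e\<in>E. \<Sum>t\<in>T. frag_cmul (?p (crd e x) t) (b (t, e)))" "\<Sum>e\<in>E. \<Sum>t\<in>T. frag_cmul (?p (crd e x) t) (b (t, e))"]
    by simp
  moreover have "frag_cmul k (\<Sum>e\<in>E. \<Sum>t\<in>T. frag_cmul (?p (crd e x) t) (b (t, e))) = (\<Sum>(t, e)\<in>T \<times> E. frag_cmul (ev (crd e) (frag_of (x, k)) (H #>\<^bsub>G\<^esub> t)) (b (t, e)))"
    by (subst sum.swap) (simp add: ev_frag_of frag_cmul_sum sum.cartesian_product case_prod_unfold)
  ultimately show "frag_of z - (\<Sum>(t, e)\<in>T \<times> E. frag_cmul (ev (crd e) (frag_of z) (H #>\<^bsub>G\<^esub> t)) (b (t, e))) \<in> N"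
    by (simp add: z)
qed

text \<open>The evaluations are dual to the spanning set, which therefore is a basis.\<close>

lemma ev_basis:
  assumes t: "t \<in> T" "t' \<in> T" and e: "e \<in> E" "e' \<in> E"
  shows "ev (crd e) (b (t', e')) (H #>\<^bsub>G\<^esub> t) = of_bool (t = t' \<and> e = e')"
proof -
  have tG: "t \<in> carrier G" "t' \<in> carrier G" using t TG' by auto
  have ec: "e' \<in> carrier M" using e E by blast
  have "crd e (group_elem t' \<odot>\<^bsub>M\<^esub> e') = group_elem t' \<otimes>\<^bsub>R\<^esub> crd e e'"
    using lmod_hom_smult[OF crd[OF e(1)] group_elem_closed[OF tG(2)] ec] by simp
  also have "\<dots> = (if e = e' then group_elem t' else (\<lambda>_. 0))"
    using crd_E[OF e] tG L.R.r_one[of "group_elem t'"] L.R.r_null[of "group_elem t'"] by simp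
  finally have "ev (crd e) (b (t', e')) (H #>\<^bsub>G\<^esub> t) = (if e = e' then of_bool (H #>\<^bsub>G\<^esub> t #>\<^bsub>G\<^esub> inv\<^bsub>G\<^esub> t' = H) else 0)"
    by (simp add: b_def ev_frag_of)
  moreover have "H #>\<^bsub>G\<^esub> t #>\<^bsub>G\<^esub> inv\<^bsub>G\<^esub> t' = H \<longleftrightarrow> t = t'"
  proof
    have Kt: "H #>\<^bsub>G\<^esub> t \<in> rcosets\<^bsub>G\<^esub> H" by (rule G.rcosetsI[OF subgroup.subset[OF H] tG(1)])
    assume "H #>\<^bsub>G\<^esub> t #>\<^bsub>G\<^esub> inv\<^bsub>G\<^esub> t' = H"
    then have "H #>\<^bsub>G\<^esub> t #>\<^bsub>G\<^esub> inv\<^bsub>G\<^esub> t' #>\<^bsub>G\<^esub> t' = H #>\<^bsub>G\<^esub> t'" by simp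
    then have "H #>\<^bsub>G\<^esub> t = H #>\<^bsub>G\<^esub> t'" using G.rcosets_act(2,3)[OF H Kt] tG by simp
    then show "t = t'" using reps_bij[OF T] t by (auto simp: bij_betw_def inj_on_def)
  next
    assume "t = t'" then show "H #>\<^bsub>G\<^esub> t #>\<^bsub>G\<^esub> inv\<^bsub>G\<^esub> t' = H"
      using G.coset_mult_assoc[OF subgroup.subset[OF H], of t "inv\<^bsub>G\<^esub> t"] tG subgroup.subset[OF H] by simp
  qed
  ultimately show ?thesis by simp
qed

lemma ev_comb:
  assumes "t \<in> T" "e \<in> E"
  shows "ev (crd e) (\<Sum>i\<in>T \<times> E. frag_cmul (c i) (b i)) (H #>\<^bsub>G\<^esub> t) = c (t, e)"
proof -
  have "ev (crd e) (\<Sum>i\<in>T \<times> E. frag_cmul (c i) (b i)) (H #>\<^bsub>G\<^esub> t) = (\<Sum>i\<in>T \<times> E. if i = (t, e) then c i else 0)"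
    unfolding ev_sum ev_cmul using ev_basis assms by (intro sum.cong) auto
  also have "\<dots> = c (t, e)" using assms finT E by simp
  finally show ?thesis .
qed

lemma coset_eq_iff:
  assumes "Poly_Mapping.keys u \<subseteq> S" "Poly_Mapping.keys v \<subseteq> S"
  shows "N #>\<^bsub>TG\<^esub> u = N #>\<^bsub>TG\<^esub> v \<longleftrightarrow> u - v \<in> N"
proof -
  interpret TGr: comm_group TG by (rule group_TG)
  have c: "u \<in> carrier TG" "v \<in> carrier TG" using assms by (auto simp: TG)
  show ?thesis
  proof
    assume "N #>\<^bsub>TG\<^esub> u = N #>\<^bsub>TG\<^esub> v"
    then have "u \<in> N #>\<^bsub>TG\<^esub> v" using TGr.rcos_self[OF c(1) subN] by simp
    then show "u - v \<in> N" by (auto simp: r_coset_def TG)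
  next
    assume "u - v \<in> N"
    then have "u \<in> N #>\<^bsub>TG\<^esub> v" by (auto simp: r_coset_def TG intro!: bexI[of _ "u - v"])
    then show "N #>\<^bsub>TG\<^esub> u = N #>\<^bsub>TG\<^esub> v" using TGr.repr_independence[OF _ c(2) subN] by simp
  qed
qed

lemma chain_group_eq: "chain_group G H M = TG Mod N"
  by (simp add: chain_group_def tensor_product_def)

text \<open>The norm is defined with products and powers in the multiplicative chain group. The
  coset map is a homomorphism, so they become ordinary integral combinations.\<close>

lemma finprod_cosets:
  assumes "finite I" "I \<subseteq> T \<times> E"
  shows "(\<Otimes>\<^bsub>chain_group G H M\<^esub>i\<in>I. (N #>\<^bsub>TG\<^esub> b i) [^]\<^bsub>chain_group G H M\<^esub> (c i :: int)) = N #>\<^bsub>TG\<^esub> (\<Sum>i\<in>I. frag_cmul (c i) (b i))"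
proof -
  interpret TGr: comm_group TG by (rule group_TG)
  interpret N: normal N TG by (rule TGr.subgroup_imp_normal[OF subN])
  interpret A: comm_group "TG Mod N" by (rule TGr.abelian_FactGroup[OF subN])
  interpret h: group_hom TG "TG Mod N" "\<lambda>a. N #>\<^bsub>TG\<^esub> a"
    by unfold_locales (rule N.r_coset_hom_Mod)
  have bc: "b i \<in> carrier TG" if "i \<in> T \<times> E" for i using b_keys[OF that] by (simp add: TG)
  have pw: "(N #>\<^bsub>TG\<^esub> b i) [^]\<^bsub>TG Mod N\<^esub> (c i) = N #>\<^bsub>TG\<^esub> frag_cmul (c i) (b i)" if "i \<in> T \<times> E" for i
    using h.hom_int_pow[OF bc[OF that], of "c i"] b_keys[OF that] by (simp add: TG)
  have cb: "frag_cmul (c i) (b i) \<in> carrier TG" if "i \<in> T \<times> E" for i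
    using b_keys[OF that] by (auto simp: TG)
  show ?thesis unfolding chain_group_eq using assms
  proof (induction I)
    case empty
    have "N #>\<^bsub>TG\<^esub> 0 = N" using TGr.coset_mult_one[OF subgroup.subset[OF subN]] by (simp add: TG)
    then show ?case by simp
  next
    case (insert i I)
    have s: "(\<Sum>i\<in>I. frag_cmul (c i) (b i)) \<in> carrier TG"
      unfolding TG using cb insert by (intro sum_closed_free_Abelian_group) (auto simp: TG)
    have "(\<Otimes>\<^bsub>TG Mod N\<^esub>i\<in>insert i I. (N #>\<^bsub>TG\<^esub> b i) [^]\<^bsub>TG Mod N\<^esub> (c i)) = (N #>\<^bsub>TG\<^esub> b i) [^]\<^bsub>TG Mod N\<^esub> (c i) \<otimes>\<^bsub>TG Mod N\<^esub> (\<Otimes>\<^bsub>TG Mod N\<^esub>i\<in>I. (N #>\<^bsub>TG\<^esub> b i) [^]\<^bsub>TG Mod N\<^esub> (c i))"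
    proof (rule A.finprod_insert)
      show "(\<lambda>i. (N #>\<^bsub>TG\<^esub> b i) [^]\<^bsub>TG Mod N\<^esub> (c i)) \<in> I \<rightarrow> carrier (TG Mod N)"
        using insert bc h.hom_closed by (auto intro!: A.int_pow_closed)
      show "(N #>\<^bsub>TG\<^esub> b i) [^]\<^bsub>TG Mod N\<^esub> (c i) \<in> carrier (TG Mod N)"
        using insert bc h.hom_closed by (auto intro!: A.int_pow_closed)
    qed (use insert in auto)
    also have "\<dots> = (N #>\<^bsub>TG\<^esub> frag_cmul (c i) (b i)) \<otimes>\<^bsub>TG Mod N\<^esub> (N #>\<^bsub>TG\<^esub> (\<Sum>i\<in>I. frag_cmul (c i) (b i)))"
      using insert pw[of i] by simp
    also have "\<dots> = N #>\<^bsub>TG\<^esub> (frag_cmul (c i) (b i) + (\<Sum>i\<in>I. frag_cmul (c i) (b i)))"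
      using h.hom_mult[OF cb s, of i] insert by (simp add: TG)
    finally show ?case using insert by simp
  qed
qed

text \<open>\<open>span\<close> shows that the evaluations are coefficients, and \<open>ev_N\<close>
  with \<open>ev_comb\<close> that there are no others. As they are functions on cosets, summing
  over representatives is summing over cosets and the choice of \<open>T\<close> disappears.\<close>

lemma chain_norm_eq:
  assumes u: "Poly_Mapping.keys u \<subseteq> S"
  shows "real_of_int (chain_norm G H T M E (N #>\<^bsub>TG\<^esub> u)) = (\<Sum>e\<in>E. l1 (rcosets\<^bsub>G\<^esub> H) (ev (crd e) u))"
proof -
  have p: "(\<lambda>(t, e). pure_tensor (subgroup_ring G H) M (right_action G M) trivial_module (group_elem t \<odot>\<^bsub>M\<^esub> e) 1) = (\<lambda>i. N #>\<^bsub>TG\<^esub> b i)"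
    by (auto simp: pure_tensor_def b_def fun_eq_iff)
  have finI: "finite (T \<times> E)" using finT E by simp
  have keysc: "Poly_Mapping.keys (\<Sum>i\<in>T \<times> E. frag_cmul (c i) (b i)) \<subseteq> S" for c :: "'a \<times> 'c \<Rightarrow> int"
  proof -
    have "(\<Sum>i\<in>T \<times> E. frag_cmul (c i) (b i)) \<in> carrier (free_Abelian_group S)"
      using b_keys by (intro sum_closed_free_Abelian_group) fastforce
    then show ?thesis by simp
  qed
  define c0 where "c0 = (\<lambda>(t, e)\<in>T \<times> E. ev (crd e) u (H #>\<^bsub>G\<^esub> t))"
  have "(THE c. c \<in> T \<times> E \<rightarrow>\<^sub>E (UNIV :: int set) \<and> N #>\<^bsub>TG\<^esub> u = (\<Otimes>\<^bsub>chain_group G H M\<^esub>i\<in>T \<times> E. (N #>\<^bsub>TG\<^esub> b i) [^]\<^bsub>chain_group G H M\<^esub> c i)) = c0"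
  proof (rule the_equality)
    have "(\<Sum>i\<in>T \<times> E. frag_cmul (c0 i) (b i)) = (\<Sum>(t, e)\<in>T \<times> E. frag_cmul (ev (crd e) u (H #>\<^bsub>G\<^esub> t)) (b (t, e)))"
      by (rule sum.cong) (auto simp: c0_def)
    then have "u - (\<Sum>i\<in>T \<times> E. frag_cmul (c0 i) (b i)) \<in> N" using span[OF u] by simp
    then have "N #>\<^bsub>TG\<^esub> u = N #>\<^bsub>TG\<^esub> (\<Sum>i\<in>T \<times> E. frag_cmul (c0 i) (b i))" using coset_eq_iff[OF u keysc] by blast
    then show "c0 \<in> T \<times> E \<rightarrow>\<^sub>E (UNIV :: int set) \<and> N #>\<^bsub>TG\<^esub> u = (\<Otimes>\<^bsub>chain_group G H M\<^esub>i\<in>T \<times> E. (N #>\<^bsub>TG\<^esub> b i) [^]\<^bsub>chain_group G H M\<^esub> c0 i)"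
      using finprod_cosets[OF finI subset_refl, of c0] by (simp add: c0_def)
  next
    fix c assume c: "c \<in> T \<times> E \<rightarrow>\<^sub>E (UNIV :: int set) \<and> N #>\<^bsub>TG\<^esub> u = (\<Otimes>\<^bsub>chain_group G H M\<^esub>i\<in>T \<times> E. (N #>\<^bsub>TG\<^esub> b i) [^]\<^bsub>chain_group G H M\<^esub> c i)"
    then have "N #>\<^bsub>TG\<^esub> u = N #>\<^bsub>TG\<^esub> (\<Sum>i\<in>T \<times> E. frag_cmul (c i) (b i))" using finprod_cosets[OF finI subset_refl, of c] by simp
    then have n: "u - (\<Sum>i\<in>T \<times> E. frag_cmul (c i) (b i)) \<in> N" using coset_eq_iff[OF u keysc] by blast
    have "c (t, e) = ev (crd e) u (H #>\<^bsub>G\<^esub> t)" if te: "t \<in> T" "e \<in> E" for t e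
    proof -
      have "H #>\<^bsub>G\<^esub> t \<in> rcosets\<^bsub>G\<^esub> H" using te TG' by (intro G.rcosetsI[OF subgroup.subset[OF H]]) auto
      then have "ev (crd e) (u - (\<Sum>i\<in>T \<times> E. frag_cmul (c i) (b i))) (H #>\<^bsub>G\<^esub> t) = 0" using ev_N[OF crd[OF te(2)] n] by blast
      then show ?thesis using ev_comb[OF te, of c] by (simp add: ev_diff)
    qed
    then show "c = c0" using c by (auto simp: c0_def fun_eq_iff PiE_def extensional_def)
  qed
  then have "chain_norm G H T M E (N #>\<^bsub>TG\<^esub> u) = (\<Sum>i\<in>T \<times> E. \<bar>c0 i\<bar>)"
    unfolding chain_norm_def l1_norm_def p by simp
  also have "\<dots> = (\<Sum>(t, e)\<in>T \<times> E. \<bar>ev (crd e) u (H #>\<^bsub>G\<^esub> t)\<bar>)" by (rule sum.cong) (auto simp: c0_def)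
  also have "\<dots> = (\<Sum>e\<in>E. \<Sum>t\<in>T. \<bar>ev (crd e) u (H #>\<^bsub>G\<^esub> t)\<bar>)"
    by (subst sum.swap) (simp add: sum.cartesian_product)
  also have "\<dots> = (\<Sum>e\<in>E. \<Sum>K\<in>rcosets\<^bsub>G\<^esub> H. \<bar>ev (crd e) u K\<bar>)"
    by (intro sum.cong refl sum.reindex_bij_betw[OF reps_bij[OF T], of "\<lambda>K. \<bar>ev (crd _) u K\<bar>"])
  finally show ?thesis by (simp add: l1_def)
qed

end

section \<open>Consequences of duality\<close>

definition augm :: "('g \<Rightarrow> int) \<Rightarrow> int"
  where "augm r = (\<Sum>g | r g \<noteq> 0. r g)"

text \<open>With the constant function 1 and an arbitrary coset, linearity of the augmentation is
  inherited from \<open>rmul\<close>.\<close>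

lemma augm_rmul: "augm r = rmul G (\<lambda>_. 1) r K"
  by (simp add: augm_def rmul_def)

lemma augm_zero [simp]: "augm (\<lambda>_. 0) = 0"
  by (simp add: augm_def)

lemma finsum_reg:
  assumes R: "ring (group_ring G)" and "finite A" "\<And>i. i \<in> A \<Longrightarrow> f i \<in> carrier (group_ring G)"
  shows "(\<Oplus>\<^bsub>reg G\<^esub>i\<in>A. f i) = (\<lambda>g. \<Sum>i\<in>A. f i g)"
  using assms(2,3)
proof (induction A)
  interpret left_module "group_ring G" "reg G" by (rule left_module_reg[OF R])
  case (insert i A)
  then show ?case by (subst M.finsum_insert) auto
next
  interpret left_module "group_ring G" "reg G" by (rule left_module_reg[OF R])
  case empty
  then show ?case by simp
qed

lemma finsum_trivial:
  fixes G :: "('g, 'b) monoid_scheme"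
  assumes R: "ring (group_ring G)" "group G" and "finite A"
  shows "(\<Oplus>\<^bsub>(trivial_module :: ('g \<Rightarrow> int, int) module)\<^esub>i\<in>A. f i) = (\<Sum>i\<in>A. f i)"
  using assms(3)
proof (induction A)
  interpret left_module "group_ring G" "trivial_module :: ('g \<Rightarrow> int, int) module" by (rule left_module_trivial[OF R])
  case (insert i A)
  then show ?case by (subst M.finsum_insert) auto
next
  interpret left_module "group_ring G" "trivial_module :: ('g \<Rightarrow> int, int) module" by (rule left_module_trivial[OF R])
  case empty
  then show ?case by simp
qed

section \<open>Homomorphisms to the group ring\<close>

lemma hom_reg_iff:
  "\<phi> \<in> lmod_hom (group_ring G) M (reg G) \<longleftrightarrow> (\<forall>x\<in>carrier M. \<phi> x \<in> carrier (group_ring G)) \<and>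
    (\<forall>x\<in>carrier M. \<forall>y\<in>carrier M. \<phi> (x \<oplus>\<^bsub>M\<^esub> y) = (\<lambda>g. \<phi> x g + \<phi> y g)) \<and>
    (\<forall>a\<in>carrier (group_ring G). \<forall>x\<in>carrier M. \<phi> (a \<odot>\<^bsub>M\<^esub> x) = a \<otimes>\<^bsub>group_ring G\<^esub> \<phi> x)"
  by (auto simp: lmod_hom_def)

lemma hom_reg_closed: "\<phi> \<in> lmod_hom (group_ring G) M (reg G) \<Longrightarrow> x \<in> carrier M \<Longrightarrow> \<phi> x \<in> carrier (group_ring G)"
  by (simp add: hom_reg_iff)

lemma hom_reg_comp:
  "\<phi> \<in> lmod_hom (group_ring G) N (reg G) \<Longrightarrow> f \<in> lmod_hom (group_ring G) M N \<Longrightarrow> (\<lambda>x. \<phi> (f x)) \<in> lmod_hom (group_ring G) M (reg G)"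
  by (simp add: lmod_hom_def Pi_iff)

lemma hom_reg_diff:
  assumes "\<phi> \<in> lmod_hom (group_ring G) M (reg G)" "\<psi> \<in> lmod_hom (group_ring G) M (reg G)"
  shows "(\<lambda>x g. \<phi> x g - \<psi> x g) \<in> lmod_hom (group_ring G) M (reg G)"
  using assms by (auto simp: hom_reg_iff group_ring_diff_closed group_ring_mult_diff_right)

lemma hom_reg_scale:
  assumes "\<phi> \<in> lmod_hom (group_ring G) M (reg G)"
  shows "(\<lambda>x g. c * \<phi> x g) \<in> lmod_hom (group_ring G) M (reg G)"
  using assms by (auto simp: hom_reg_iff group_ring_scale_closed group_ring_mult_scale_right distrib_left)

lemma hom_reg_sum:
  assumes "\<And>i. i \<in> A \<Longrightarrow> \<phi> i \<in> lmod_hom (group_ring G) M (reg G)"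
  shows "(\<lambda>x g. \<Sum>i\<in>A. \<phi> i x g) \<in> lmod_hom (group_ring G) M (reg G)"
  using assms by (auto simp: hom_reg_iff group_ring_mult_sum_right sum.distrib intro!: group_ring_sum_closed)

lemma hom_reg_mult:
  assumes R: "ring (group_ring G)" and \<phi>: "\<phi> \<in> lmod_hom (group_ring G) M (reg G)" and r: "r \<in> carrier (group_ring G)"
  shows "(\<lambda>x. \<phi> x \<otimes>\<^bsub>group_ring G\<^esub> r) \<in> lmod_hom (group_ring G) M (reg G)"
proof -
  interpret ring "group_ring G" by fact
  have cl: "\<phi> x \<in> carrier (group_ring G)" if "x \<in> carrier M" for x using \<phi> that by (rule hom_reg_closed)
  show ?thesis unfolding hom_reg_iff
  proof (intro conjI ballI)
    fix x y assume xy: "x \<in> carrier M" "y \<in> carrier M"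
    show "\<phi> (x \<oplus>\<^bsub>M\<^esub> y) \<otimes>\<^bsub>group_ring G\<^esub> r = (\<lambda>g. (\<phi> x \<otimes>\<^bsub>group_ring G\<^esub> r) g + (\<phi> y \<otimes>\<^bsub>group_ring G\<^esub> r) g)"
      using l_distr[OF cl[OF xy(1)] cl[OF xy(2)] r] \<phi> xy by (simp add: hom_reg_iff)
  next
    fix a x assume ax: "a \<in> carrier (group_ring G)" "x \<in> carrier M"
    show "\<phi> (a \<odot>\<^bsub>M\<^esub> x) \<otimes>\<^bsub>group_ring G\<^esub> r = a \<otimes>\<^bsub>group_ring G\<^esub> (\<phi> x \<otimes>\<^bsub>group_ring G\<^esub> r)"
      using m_assoc[OF ax(1) cl[OF ax(2)] r] \<phi> ax by (simp add: hom_reg_iff)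
  qed (use cl r in auto)
qed

lemma group_ring_expand:
  assumes "r \<in> carrier (group_ring G)"
  shows "r = (\<lambda>x. \<Sum>s | r s \<noteq> 0. r s * group_elem s x)"
proof
  fix x
  have "(\<Sum>s | r s \<noteq> 0. r s * group_elem s x) = (\<Sum>s | r s \<noteq> 0. if s = x then r x else 0)"
    by (rule sum.cong) (auto simp: group_elem_def)
  also have "\<dots> = r x" using assms by (simp add: group_ring_carrier)
  finally show "r x = (\<Sum>s | r s \<noteq> 0. r s * group_elem s x)" by simp
qed

lemma group_ring_mult_expand:
  assumes "r \<in> carrier (group_ring G)"
  shows "a \<otimes>\<^bsub>group_ring G\<^esub> r = (\<lambda>x. \<Sum>s | r s \<noteq> 0. r s * (a \<otimes>\<^bsub>group_ring G\<^esub> group_elem s) x)"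
proof -
  have "a \<otimes>\<^bsub>group_ring G\<^esub> (\<lambda>x. \<Sum>s | r s \<noteq> 0. r s * group_elem s x) = (\<lambda>x. \<Sum>s | r s \<noteq> 0. r s * (a \<otimes>\<^bsub>group_ring G\<^esub> group_elem s) x)"
    unfolding group_ring_mult_sum_right group_ring_mult_scale_right ..
  then show ?thesis using group_ring_expand[OF assms] by simp
qed

lemma dual_basis_hom: "dual_basis (group_ring G) M J x \<phi> \<Longrightarrow> j \<in> J \<Longrightarrow> \<phi> j \<in> lmod_hom (group_ring G) M (reg G)"
  by (auto simp: dual_basis_def hom_reg_iff)

lemma dual_basis_mem: "dual_basis R M J x \<phi> \<Longrightarrow> j \<in> J \<Longrightarrow> x j \<in> carrier M"
  by (auto simp: dual_basis_def)

lemma dual_basis_finite: "dual_basis R M J x \<phi> \<Longrightarrow> finite J"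
  by (simp add: dual_basis_def)

lemma dual_basis_expand:
  assumes M: "left_module R M" and N: "left_module R N" and db: "dual_basis R M J x \<phi>"
    and \<psi>: "\<psi> \<in> lmod_hom R M N" and y: "y \<in> carrier M"
  shows "\<psi> y = (\<Oplus>\<^bsub>N\<^esub>j\<in>J. \<phi> j y \<odot>\<^bsub>N\<^esub> \<psi> (x j))"
proof -
  interpret M: left_module R M by fact
  interpret N: left_module R N by fact
  have f: "finite J" and xc: "\<And>j. j \<in> J \<Longrightarrow> x j \<in> carrier M" and \<phi>c: "\<And>j. j \<in> J \<Longrightarrow> \<phi> j y \<in> carrier R"
    and ex: "y = (\<Oplus>\<^bsub>M\<^esub>j\<in>J. \<phi> j y \<odot>\<^bsub>M\<^esub> x j)"
    using db y unfolding dual_basis_def by blast+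
  have mc: "(\<lambda>j. \<phi> j y \<odot>\<^bsub>M\<^esub> x j) \<in> J \<rightarrow> carrier M" using xc \<phi>c by (auto intro: M.lsmult_closed)
  have "\<psi> y = \<psi> (\<Oplus>\<^bsub>M\<^esub>j\<in>J. \<phi> j y \<odot>\<^bsub>M\<^esub> x j)" using ex by simp
  also have "\<dots> = (\<Oplus>\<^bsub>N\<^esub>j\<in>J. \<psi> (\<phi> j y \<odot>\<^bsub>M\<^esub> x j))"
    by (rule addhom_finsum[OF M.is_abelian_group N.is_abelian_group lmod_hom_addhom[OF \<psi>] f mc])
  also have "\<dots> = (\<Oplus>\<^bsub>N\<^esub>j\<in>J. \<phi> j y \<odot>\<^bsub>N\<^esub> \<psi> (x j))"
  proof (rule N.M.finsum_cong')
    show "(\<lambda>j. \<phi> j y \<odot>\<^bsub>N\<^esub> \<psi> (x j)) \<in> J \<rightarrow> carrier N"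
      using \<phi>c lmod_hom_closed[OF \<psi> xc] by (auto intro: N.lsmult_closed)
    show "\<psi> (\<phi> j y \<odot>\<^bsub>M\<^esub> x j) = \<phi> j y \<odot>\<^bsub>N\<^esub> \<psi> (x j)" if "j \<in> J" for j by (rule lmod_hom_smult[OF \<psi> \<phi>c[OF that] xc[OF that]])
  qed simp
  finally show ?thesis .
qed

lemma dual_basis_expand_reg:
  assumes M: "left_module (group_ring G) M" and db: "dual_basis (group_ring G) M J x \<phi>"
    and \<psi>: "\<psi> \<in> lmod_hom (group_ring G) M (reg G)" and y: "y \<in> carrier M"
  shows "\<psi> y = (\<lambda>g. \<Sum>j\<in>J. (\<phi> j y \<otimes>\<^bsub>group_ring G\<^esub> \<psi> (x j)) g)"
proof -
  interpret left_module "group_ring G" M by fact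
  have R: "ring (group_ring G)" ..
  have c: "\<phi> j y \<otimes>\<^bsub>group_ring G\<^esub> \<psi> (x j) \<in> carrier (group_ring G)" if "j \<in> J" for j
    by (rule R.m_closed[OF hom_reg_closed[OF dual_basis_hom[OF db that] y] hom_reg_closed[OF \<psi> dual_basis_mem[OF db that]]])
  have "\<psi> y = (\<Oplus>\<^bsub>reg G\<^esub>j\<in>J. \<phi> j y \<otimes>\<^bsub>group_ring G\<^esub> \<psi> (x j))"
    using dual_basis_expand[OF M left_module_reg[OF R] db \<psi> y] by simp
  then show ?thesis using finsum_reg[OF R dual_basis_finite[OF db] c] by simp
qed

lemma dual_basis_expand_trivial:
  fixes G :: "('g, 'b) monoid_scheme"
  assumes G: "group G" and M: "left_module (group_ring G) M" and db: "dual_basis (group_ring G) M J x \<phi>"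
    and \<psi>: "\<psi> \<in> lmod_hom (group_ring G) M trivial_module" and y: "y \<in> carrier M"
  shows "\<psi> y = (\<Sum>j\<in>J. augm (\<phi> j y) * \<psi> (x j))"
proof -
  interpret left_module "group_ring G" M by fact
  have R: "ring (group_ring G)" ..
  have "\<psi> y = (\<Oplus>\<^bsub>(trivial_module :: ('g \<Rightarrow> int, int) module)\<^esub>j\<in>J. \<phi> j y \<odot>\<^bsub>(trivial_module :: ('g \<Rightarrow> int, int) module)\<^esub> \<psi> (x j))"
    by (rule dual_basis_expand[OF M left_module_trivial[OF R G] db \<psi> y])
  then show ?thesis unfolding finsum_trivial[OF R G dual_basis_finite[OF db]] by (simp add: trivial_module_def augm_def)
qed

text \<open>Elements of \<open>H\<close> do not move the coset \<open>H\<close>, so the value of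
  \<open>a\<close> there factors out.\<close>

lemma (in group) rmul_supported:
  assumes H: "subgroup H G" and s: "{g. s g \<noteq> 0} \<subseteq> H"
  shows "rmul G a s H = augm s * a H"
proof -
  have "rmul G a s H = (\<Sum>g | s g \<noteq> 0. s g * a H)"
    unfolding rmul_def
  proof (rule sum.cong[OF refl])
    fix g assume "g \<in> {g. s g \<noteq> 0}"
    then have "inv g \<in> H" using s subgroup.m_inv_closed[OF H] by blast
    then have "H #> inv g = H" using coset_join2[OF _ H] subgroup.mem_carrier[OF H] by blast
    then show "s g * a (H #> inv g) = s g * a H" by simp
  qed
  then show ?thesis by (simp add: augm_def sum_distrib_right)
qed

context fp_res
begin

text \<open>The subgroup \<open>\<Gamma>\<close> generated by the supports of \<open>x\<^sub>0\<close> and of the boundaries of generators of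
  \<open>F 1\<close> is everything: the map \<open>\<mu>\<close>, which counts coefficients in \<open>\<Gamma>\<close>, vanishes on boundaries but
  equals 1 on \<open>x\<^sub>0\<close> and 0 on \<open>g x\<^sub>0\<close> for \<open>g \<notin> \<Gamma>\<close>.\<close>

lemma finitely_generated:
  assumes n: "1 \<le> n"
  shows "\<exists>S. finite S \<and> S \<subseteq> carrier G \<and> generate G S = carrier G"
proof -
  interpret G: group G by (rule group_G)
  interpret R: ring R by (rule ring_R)
  have L0: "left_module R (F 0)" and L1: "left_module R (F (Suc 0))" using lm n by auto
  interpret L0: left_module R "F 0" by fact
  interpret L1: left_module R "F (Suc 0)" by fact
  obtain J x \<phi> where db0: "dual_basis R (F 0) J x \<phi>" using db[of 0] by auto
  obtain I w \<psi> where db1: "dual_basis R (F (Suc 0)) I w \<psi>" using db[of "Suc 0"] n by auto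
  note J = dual_basis_finite[OF db0] and xc = dual_basis_mem[OF db0] and \<phi>h = dual_basis_hom[OF db0]
  note I = dual_basis_finite[OF db1] and wc = dual_basis_mem[OF db1] and \<psi>h = dual_basis_hom[OF db1]
  note \<phi>c = hom_reg_closed[OF \<phi>h] and \<psi>c = hom_reg_closed[OF \<psi>h]
  have dh: "d (Suc 0) \<in> lmod_hom R (F (Suc 0)) (F 0)" using dhom[of 0] n by simp
  note dc = lmod_hom_closed[OF dh]
  obtain x0 where x0: "x0 \<in> carrier (F 0)" "aug x0 = 1" using aug_surj by (metis UNIV_I imageE)
  \<comment> \<open>These elements are chosen so that \<open>x0\<close> and all boundaries of
    generators of \<open>F 1\<close> have coordinates supported in the subgroup that they
    generate.\<close>
  define S where "S = (\<Union>j\<in>J. {g. \<phi> j x0 g \<noteq> 0} \<union> (\<Union>i\<in>I. {g. \<phi> j (d (Suc 0) (w i)) g \<noteq> 0}))"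
  have supp: "finite {g. \<phi> j v g \<noteq> 0}" "{g. \<phi> j v g \<noteq> 0} \<subseteq> carrier G" if "j \<in> J" "v \<in> carrier (F 0)" for j v
    using \<phi>c[OF that] by (auto simp: group_ring_carrier)
  have S: "finite S" "S \<subseteq> carrier G"
    unfolding S_def using J I supp(1) supp(2)[OF _ x0(1)] supp(2)[OF _ dc[OF wc]] x0(1) dc wc by (auto, blast+)
  define \<Gamma> where "\<Gamma> = generate G S"
  have \<Gamma>: "subgroup \<Gamma> G" unfolding \<Gamma>_def by (rule G.generate_is_subgroup[OF S(2)])
  have S\<Gamma>: "S \<subseteq> \<Gamma>" by (auto simp: \<Gamma>_def intro: generate.incl)
  have K: "\<Gamma> \<in> rcosets\<^bsub>G\<^esub> \<Gamma>" using subgroup.subgroup_in_rcosets[OF \<Gamma> group_G] .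
  define \<nu> where "\<nu> r = rmul G (\<lambda>K. of_bool (K = \<Gamma>)) r \<Gamma>" for r
  define \<mu> where "\<mu> v = (\<Sum>j\<in>J. \<nu> (\<phi> j v) * aug (x j))" for v
  have \<mu>_add: "\<mu> (v \<oplus>\<^bsub>F 0\<^esub> v') = \<mu> v + \<mu> v'" if "v \<in> carrier (F 0)" "v' \<in> carrier (F 0)" for v v'
    unfolding \<mu>_def sum.distrib[symmetric]
  proof (rule sum.cong[OF refl])
    fix j assume j: "j \<in> J"
    have "\<phi> j (v \<oplus>\<^bsub>F 0\<^esub> v') = (\<lambda>g. \<phi> j v g + \<phi> j v' g)" using \<phi>h[OF j] that by (simp add: hom_reg_iff)
    then show "\<nu> (\<phi> j (v \<oplus>\<^bsub>F 0\<^esub> v')) * aug (x j) = \<nu> (\<phi> j v) * aug (x j) + \<nu> (\<phi> j v') * aug (x j)"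
      using rmul_add[OF \<phi>c[OF j that(1)] \<phi>c[OF j that(2)]] by (simp add: \<nu>_def distrib_right)
  qed
  \<comment> \<open>If the coordinates of \<open>v\<close> lie over \<open>\<Gamma>\<close>, they
    cannot move coefficients into or out of \<open>\<Gamma>\<close>; hence the count of
    \<open>r\<close> splits off and the augmentation of \<open>v\<close> remains.\<close>
  have \<mu>_smult: "\<mu> (r \<odot>\<^bsub>F 0\<^esub> v) = \<nu> r * aug v"
    if r: "r \<in> carrier R" and v: "v \<in> carrier (F 0)" and sv: "\<And>j. j \<in> J \<Longrightarrow> {g. \<phi> j v g \<noteq> 0} \<subseteq> \<Gamma>" for r v
  proof -
    have "\<nu> (\<phi> j (r \<odot>\<^bsub>F 0\<^esub> v)) = \<nu> r * augm (\<phi> j v)" if j: "j \<in> J" for j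
    proof -
      have "\<phi> j (r \<odot>\<^bsub>F 0\<^esub> v) = r \<otimes>\<^bsub>R\<^esub> \<phi> j v" using \<phi>h[OF j] r v by (simp add: hom_reg_iff)
      then show ?thesis using G.rmul_mult[OF ring_R \<Gamma> K r \<phi>c[OF j v]] G.rmul_supported[OF \<Gamma> sv[OF j]] by (simp add: \<nu>_def)
    qed
    then show ?thesis using dual_basis_expand_trivial[OF group_G L0 db0 aug_hom v]
      by (simp add: \<mu>_def sum_distrib_left mult.assoc)
  qed
  have \<mu>_addhom: "addhom (F 0) (trivial_module :: ('g \<Rightarrow> int, int) module) \<mu>" using \<mu>_add by (auto simp: addhom_def)
  have "abelian_group (trivial_module :: ('g \<Rightarrow> int, int) module)"
    by (rule left_module.is_abelian_group[OF left_module_trivial[OF ring_R group_G]])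
  note abs = L0.is_abelian_group this
  have \<mu>_d: "\<mu> (d (Suc 0) y) = 0" if y: "y \<in> carrier (F (Suc 0))" for y
  proof -
    have m: "(\<lambda>i. \<psi> i y \<odot>\<^bsub>F 0\<^esub> d (Suc 0) (w i)) \<in> I \<rightarrow> carrier (F 0)"
      using \<psi>c[OF _ y] dc[OF wc] by (auto intro: L0.lsmult_closed)
    have "\<mu> (d (Suc 0) y) = \<mu> (\<Oplus>\<^bsub>F 0\<^esub>i\<in>I. \<psi> i y \<odot>\<^bsub>F 0\<^esub> d (Suc 0) (w i))"
      using dual_basis_expand[OF L1 L0 db1 dh y] by simp
    also have "\<dots> = (\<Oplus>\<^bsub>(trivial_module :: ('g \<Rightarrow> int, int) module)\<^esub>i\<in>I. \<mu> (\<psi> i y \<odot>\<^bsub>F 0\<^esub> d (Suc 0) (w i)))"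
      by (rule addhom_finsum[OF abs \<mu>_addhom I m])
    also have "\<dots> = (\<Sum>i\<in>I. \<mu> (\<psi> i y \<odot>\<^bsub>F 0\<^esub> d (Suc 0) (w i)))" by (rule finsum_trivial[OF ring_R group_G I])
    also have "\<dots> = 0"
    proof (rule sum.neutral, rule ballI)
      fix i assume i: "i \<in> I"
      have "{g. \<phi> j (d (Suc 0) (w i)) g \<noteq> 0} \<subseteq> \<Gamma>" if "j \<in> J" for j using S\<Gamma> i that unfolding S_def by blast
      moreover have "aug (d (Suc 0) (w i)) = 0" using exact_0[OF n] wc[OF i] by blast
      ultimately show "\<mu> (\<psi> i y \<odot>\<^bsub>F 0\<^esub> d (Suc 0) (w i)) = 0"
        using \<mu>_smult[OF \<psi>c[OF i y] dc[OF wc[OF i]]] by simp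
    qed
    finally show ?thesis .
  qed
  have s0: "{g. \<phi> j x0 g \<noteq> 0} \<subseteq> \<Gamma>" if "j \<in> J" for j using S\<Gamma> that unfolding S_def by blast
  have \<mu>g: "\<mu> (group_elem g \<odot>\<^bsub>F 0\<^esub> x0) = of_bool (\<Gamma> #>\<^bsub>G\<^esub> inv\<^bsub>G\<^esub> g = \<Gamma>)" if "g \<in> carrier G" for g
    using \<mu>_smult[OF group_elem_closed[OF that] x0(1) s0] x0(2) by (simp add: \<nu>_def)
  have "carrier G \<subseteq> \<Gamma>"
  proof
    fix g assume g: "g \<in> carrier G"
    let ?g = "group_elem g \<odot>\<^bsub>F 0\<^esub> x0" and ?e = "group_elem \<one>\<^bsub>G\<^esub> \<odot>\<^bsub>F 0\<^esub> x0"
    have gc: "?g \<in> carrier (F 0)" "?e \<in> carrier (F 0)" using g x0 by (auto intro: L0.lsmult_closed)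
    have aug_act: "aug (group_elem h \<odot>\<^bsub>F 0\<^esub> x0) = 1" if "h \<in> carrier G" for h
      using lmod_hom_smult[OF aug_hom group_elem_closed[OF that] x0(1)] x0(2) by simp
    have mc: "?g \<ominus>\<^bsub>F 0\<^esub> ?e \<in> carrier (F 0)" using gc by simp
    have ge: "?g = (?g \<ominus>\<^bsub>F 0\<^esub> ?e) \<oplus>\<^bsub>F 0\<^esub> ?e" using gc by (simp add: a_minus_def L0.M.a_assoc L0.M.l_neg)
    have "aug ?g = aug (?g \<ominus>\<^bsub>F 0\<^esub> ?e) + aug ?e"
      using addhom_add[OF lmod_hom_addhom[OF aug_hom] mc gc(2)] ge by simp
    then have "aug (?g \<ominus>\<^bsub>F 0\<^esub> ?e) = 0" using aug_act[OF g] aug_act[of "\<one>\<^bsub>G\<^esub>"] by simp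
    then obtain y where y: "y \<in> carrier (F (Suc 0))" "?g \<ominus>\<^bsub>F 0\<^esub> ?e = d (Suc 0) y" using exact_0[OF n] mc by blast
    have "\<mu> ?g = \<mu> (?g \<ominus>\<^bsub>F 0\<^esub> ?e) + \<mu> ?e" using \<mu>_add[OF mc gc(2)] ge by simp
    then have "\<mu> ?g = \<mu> ?e" using \<mu>_d[OF y(1)] y(2) by simp
    moreover have "\<Gamma> #>\<^bsub>G\<^esub> inv\<^bsub>G\<^esub> \<one>\<^bsub>G\<^esub> = \<Gamma>" using G.coset_mult_one[OF subgroup.subset[OF \<Gamma>]] by simp
    ultimately have "\<Gamma> #>\<^bsub>G\<^esub> inv\<^bsub>G\<^esub> g = \<Gamma>" using \<mu>g[OF g] \<mu>g[of "\<one>\<^bsub>G\<^esub>"] by (simp split: if_splits)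
    then have "inv\<^bsub>G\<^esub> g \<in> \<Gamma>" using G.rcos_self[OF G.inv_closed[OF g] \<Gamma>] by simp
    then show "g \<in> \<Gamma>" using subgroup.m_inv_closed[OF \<Gamma>] g by fastforce
  qed
  then have "generate G S = carrier G" using subgroup.subset[OF \<Gamma>] by (simp add: \<Gamma>_def subset_antisym)
  then show ?thesis using S by blast
qed

text \<open>Let \<open>p\<close> in the dual of \<open>F n\<close> map to a generator of the image of \<open>\<epsilon>\<close>. On boundaries, \<open>\<beta> s\<close> is
  \<open>p s - p\<close> and \<open>\<eta> j\<close> is \<open>\<phi>\<^sub>j - c j p\<close>, where \<open>x\<^sub>j\<close>, \<open>\<phi>\<^sub>j\<close> is a dual basis of \<open>F n\<close>, and \<open>y j\<close> is the
  boundary of \<open>x\<^sub>j\<close>. The formulas for \<open>\<beta>\<close> and \<open>crd\<close> hold on boundaries without \<open>\<zeta>\<close> and \<open>h\<close>; since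
  \<open>H\<^sup>k\<^sup>+\<^sup>1\<close> vanishes, the errors factor through the boundary map.\<close>

lemma duality:
  assumes n: "n = Suc (Suc k)" and iso: "ZG_cohomology G n \<cong> integer_group"
    and triv: "\<forall>g\<in>carrier G. \<forall>K\<in>carrier (ZG_cohomology G n). ZG_right_translate G n g K = K"
    and H: "trivial_group (ZG_cohomology G (Suc k))"
    and crd: "\<And>e. e \<in> E \<Longrightarrow> crd e \<in> lmod_hom R (F (Suc k)) (reg G)"
  obtains \<xi> \<beta> \<zeta> and J :: "'m set" and \<eta> y h c
  where "finite J" "\<And>e. e \<in> E \<Longrightarrow> \<xi> e \<in> carrier R"
    "\<And>s. s \<in> carrier G \<Longrightarrow> \<beta> s \<in> lmod_hom R (F (Suc k)) (reg G)"
    "\<And>s t. s \<in> carrier G \<Longrightarrow> t \<in> carrier G \<Longrightarrow> \<zeta> s t \<in> lmod_hom R (F k) (reg G)"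
    "\<And>s t x. s \<in> carrier G \<Longrightarrow> t \<in> carrier G \<Longrightarrow> x \<in> carrier (F (Suc k)) \<Longrightarrow>
      \<beta> (s \<otimes>\<^bsub>G\<^esub> t) x = (\<lambda>g. (\<beta> s x \<otimes>\<^bsub>R\<^esub> group_elem t) g + \<beta> t x g + \<zeta> s t (d (Suc k) x) g)"
    "\<And>j. j \<in> J \<Longrightarrow> \<eta> j \<in> lmod_hom R (F (Suc k)) (reg G)"
    "\<And>j. j \<in> J \<Longrightarrow> y j \<in> carrier (F (Suc k))" "\<And>j. j \<in> J \<Longrightarrow> d (Suc k) (y j) = \<zero>\<^bsub>F k\<^esub>"
    "\<And>e. e \<in> E \<Longrightarrow> h e \<in> lmod_hom R (F k) (reg G)"
    "\<And>e x. e \<in> E \<Longrightarrow> x \<in> carrier (F (Suc k)) \<Longrightarrow> crd e x =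
      (\<lambda>g. (\<Sum>s | \<xi> e s \<noteq> 0. \<xi> e s * \<beta> s x g) + (\<Sum>j\<in>J. (\<eta> j x \<otimes>\<^bsub>R\<^esub> crd e (y j)) g) + h e (d (Suc k) x) g)"
    "\<And>e. e \<in> E \<Longrightarrow> \<xi> e = (\<lambda>g. \<Sum>j\<in>J. c j * crd e (y j) g)" "\<And>e. e \<in> E \<Longrightarrow> augm (\<xi> e) = 0"
proof -
  interpret G: group G by (rule group_G)
  interpret R: ring R by (rule ring_R)
  let ?H = "\<lambda>i. lmod_hom R (F i) (reg G)"
  have Ln: "left_module R (F n)" using lm by simp
  have dn: "d n \<in> lmod_hom R (F n) (F (Suc k))" using dhom[of "Suc k"] n by simp
  note dnc = lmod_hom_closed[OF dn]
  have ex: "\<exists>\<psi>\<in>?H k. \<forall>x\<in>carrier (F (Suc k)). \<phi> x = \<psi> (d (Suc k) x)"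
    if "\<phi> \<in> ?H (Suc k)" "\<And>x. x \<in> carrier (F n) \<Longrightarrow> \<phi> (d n x) = (\<lambda>_. 0)" for \<phi>
    using hom_exact[OF _ H that(1)] that(2) n by simp
  obtain \<epsilon> :: "('m \<Rightarrow> 'g \<Rightarrow> int) \<Rightarrow> int" where
    \<epsilon>_add': "\<And>\<phi> \<phi>'. \<phi> \<in> ?H n \<Longrightarrow> \<phi>' \<in> ?H n \<Longrightarrow> \<epsilon> (\<lambda>x. \<phi> x \<oplus>\<^bsub>R\<^esub> \<phi>' x) = \<epsilon> \<phi> + \<epsilon> \<phi>'"
    and \<epsilon>_elem: "\<And>\<phi> g. \<phi> \<in> ?H n \<Longrightarrow> g \<in> carrier G \<Longrightarrow> \<epsilon> (\<lambda>x. \<phi> x \<otimes>\<^bsub>R\<^esub> group_elem g) = \<epsilon> \<phi>"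
    and \<epsilon>_zero: "\<And>\<phi>. \<phi> \<in> ?H n \<Longrightarrow> \<epsilon> \<phi> = 0 \<longleftrightarrow> (\<exists>\<psi>\<in>?H (Suc k). \<forall>x\<in>carrier (F n). \<phi> x = \<psi> (d n x))"
    by (rule top_class[OF n iso triv]) (rule that; assumption)
  have \<epsilon>_diff: "\<epsilon> (\<lambda>x g. \<phi> x g - \<psi> x g) = \<epsilon> \<phi> - \<epsilon> \<psi>" if "\<phi> \<in> ?H n" "\<psi> \<in> ?H n" for \<phi> \<psi>
    using \<epsilon>_add'[OF hom_reg_diff[OF that] that(2)] by simp
  have H0: "(\<lambda>x. \<lambda>_. 0) \<in> ?H i" for i :: nat using hom_reg_sum[of "{}" "\<lambda>i x g. 0" G "F i"] by simp
  have \<epsilon>_0: "\<epsilon> (\<lambda>x. \<lambda>_. 0) = 0" using \<epsilon>_diff[OF H0 H0] by simp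
  have \<epsilon>_add: "\<epsilon> (\<lambda>x g. \<phi> x g + \<psi> x g) = \<epsilon> \<phi> + \<epsilon> \<psi>" if "\<phi> \<in> ?H n" "\<psi> \<in> ?H n" for \<phi> \<psi>
    using \<epsilon>_add'[OF that] by simp
  have \<epsilon>_mult: "\<epsilon> (\<lambda>x. \<phi> x \<otimes>\<^bsub>R\<^esub> r) = augm r * \<epsilon> \<phi>" if \<phi>: "\<phi> \<in> ?H n" and r: "r \<in> carrier R" for \<phi> r
    using r
  proof (induction rule: group_ring_induct)
    case zero
    have "a \<otimes>\<^bsub>R\<^esub> (\<lambda>_. 0) = (\<lambda>_. 0)" for a by (simp add: group_ring_mult fun_eq_iff)
    then show ?case using \<epsilon>_0 by simp
  next
    case (elem g)
    have "augm (group_elem g) = 1" unfolding augm_rmul[of _ G "{}"] by simp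
    then show ?case using \<epsilon>_elem[OF \<phi> elem] by simp
  next
    case (diff r s)
    have "augm (\<lambda>x. r x - s x) = augm r - augm s"
      unfolding augm_rmul[of _ G "{}"] by (rule rmul_diff[OF diff(1,2)])
    then show ?case
      using \<epsilon>_diff[OF hom_reg_mult[OF ring_R \<phi> diff(1)] hom_reg_mult[OF ring_R \<phi> diff(2)]] diff(3,4)
      by (simp add: group_ring_mult_diff_right left_diff_distrib)
  qed
  have \<epsilon>_sum: "\<epsilon> (\<lambda>x g. \<Sum>i\<in>A. \<phi> i x g) = (\<Sum>i\<in>A. \<epsilon> (\<phi> i))" if "finite A" "\<And>i. i \<in> A \<Longrightarrow> \<phi> i \<in> ?H n" for A :: "'m set" and \<phi>
    using that
  proof (induction A)
    case (insert i A)
    have "(\<lambda>x g. \<Sum>i\<in>A. \<phi> i x g) \<in> ?H n" by (rule hom_reg_sum) (use insert in simp)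
    from \<epsilon>_add[OF insert.prems[OF insertI1] this] show ?case using insert by simp
  qed (use \<epsilon>_0 in simp)
  \<comment> \<open>Homomorphisms are constrained on the carrier only, while
    \<open>\<epsilon>\<close> takes functions on the whole type. Two that agree on the carrier
    differ by one that factors through the zero map.\<close>
  have \<epsilon>_cong: "\<epsilon> \<psi> = \<epsilon> \<psi>'" if "\<psi> \<in> ?H n" "\<psi>' \<in> ?H n" "\<And>x. x \<in> carrier (F n) \<Longrightarrow> \<psi> x = \<psi>' x" for \<psi> \<psi>'
  proof -
    have "\<epsilon> (\<lambda>x g. \<psi> x g - \<psi>' x g) = 0"
      using that H0[of "Suc k"] by (subst \<epsilon>_zero[OF hom_reg_diff[OF that(1,2)]]) (auto intro!: bexI[of _ "\<lambda>x. \<lambda>_. 0"])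
    then show ?thesis using \<epsilon>_diff[OF that(1,2)] by simp
  qed
  have \<epsilon>_scale: "\<epsilon> (\<lambda>x g. c * \<phi> x g) = c * \<epsilon> \<phi>" if \<phi>: "\<phi> \<in> ?H n" for c \<phi>
  proof -
    let ?c = "\<lambda>x. c * group_elem \<one>\<^bsub>G\<^esub> x"
    have one: "group_elem \<one>\<^bsub>G\<^esub> \<in> carrier R" by simp
    have "augm ?c = c" unfolding augm_rmul[of _ G "{}"] rmul_scale[OF one] by simp
    then have "\<epsilon> (\<lambda>x. \<phi> x \<otimes>\<^bsub>R\<^esub> ?c) = c * \<epsilon> \<phi>" using \<epsilon>_mult[OF \<phi> group_ring_scale_closed[OF one, of c]] by simp
    moreover have "\<epsilon> (\<lambda>x. \<phi> x \<otimes>\<^bsub>R\<^esub> ?c) = \<epsilon> (\<lambda>x g. c * (\<phi> x \<otimes>\<^bsub>R\<^esub> group_elem \<one>\<^bsub>G\<^esub>) g)"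
      by (simp add: group_ring_mult_scale_right)
    moreover from \<epsilon>_cong[OF hom_reg_scale[OF hom_reg_mult[OF ring_R \<phi> one]] hom_reg_scale[OF \<phi>], of c c]
    have "\<epsilon> (\<lambda>x g. c * (\<phi> x \<otimes>\<^bsub>R\<^esub> group_elem \<one>\<^bsub>G\<^esub>) g) = \<epsilon> (\<lambda>x g. c * \<phi> x g)"
      using R.r_one[OF hom_reg_closed[OF \<phi>]] by (simp add: group_ring_one)
    ultimately show ?thesis by simp
  qed
  obtain J x \<phi> where db: "dual_basis R (F n) J x \<phi>" using db[of n] by auto
  note J = dual_basis_finite[OF db] and xc = dual_basis_mem[OF db] and \<phi>h = dual_basis_hom[OF db]
  \<comment> \<open>The integer \<open>\<epsilon> p\<close> is to be a common divisor of all
    \<open>\<epsilon> (\<phi> j)\<close>. Bezout coefficients produce it one index at a time; the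
    zero homomorphism starts the induction.\<close>
  have "\<exists>p\<in>?H n. \<forall>j\<in>J'. \<epsilon> p dvd \<epsilon> (\<phi> j)" if "J' \<subseteq> J" for J'
    using finite_subset[OF that J] that
  proof (induction J')
    case empty then show ?case using H0 by blast
  next
    case (insert j J')
    then obtain p where p: "p \<in> ?H n" "\<And>i. i \<in> J' \<Longrightarrow> \<epsilon> p dvd \<epsilon> (\<phi> i)" by auto
    have j: "\<phi> j \<in> ?H n" using \<phi>h insert by simp
    obtain u v where uv: "u * \<epsilon> p + v * \<epsilon> (\<phi> j) = gcd (\<epsilon> p) (\<epsilon> (\<phi> j))" using bezout_int by blast
    let ?p = "\<lambda>x g. u * p x g - - v * \<phi> j x g"
    have "\<epsilon> ?p = gcd (\<epsilon> p) (\<epsilon> (\<phi> j))"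
      using \<epsilon>_diff[OF hom_reg_scale[OF p(1), of u] hom_reg_scale[OF j, of "- v"]] \<epsilon>_scale[OF p(1), of u] \<epsilon>_scale[OF j, of "- v"] uv by simp
    moreover have "?p \<in> ?H n" by (rule hom_reg_diff[OF hom_reg_scale[OF p(1)] hom_reg_scale[OF j]])
    ultimately show ?case using p(2) by (intro bexI[of _ ?p]) (auto intro: dvd_trans[OF gcd_dvd1])
  qed
  then obtain p where p: "p \<in> ?H n" "\<And>j. j \<in> J \<Longrightarrow> \<epsilon> p dvd \<epsilon> (\<phi> j)" by blast
  \<comment> \<open>If \<open>\<epsilon> p = 0\<close>, divisibility forces all
    \<open>\<epsilon> (\<phi> j)\<close> to be 0, and \<open>c j = 0\<close> is consistent.\<close>
  define c where "c j = (if \<epsilon> p = 0 then 0 else \<epsilon> (\<phi> j) div \<epsilon> p)" for j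
  have c: "\<epsilon> (\<phi> j) = c j * \<epsilon> p" if "j \<in> J" for j using p(2)[OF that] by (auto simp: c_def)
  define y where "y j = d n (x j)" for j
  have yc: "y j \<in> carrier (F (Suc k))" if "j \<in> J" for j unfolding y_def by (rule dnc[OF xc[OF that]])
  have dy: "d (Suc k) (y j) = \<zero>\<^bsub>F k\<^esub>" if "j \<in> J" for j
    using dd[of k "x j"] xc[OF that] n by (simp add: y_def)
  have crdc: "crd e (y j) \<in> carrier R" if "e \<in> E" "j \<in> J" for e j by (rule hom_reg_closed[OF crd[OF that(1)] yc[OF that(2)]])
  define \<xi> where "\<xi> e = (\<lambda>g. \<Sum>j\<in>J. c j * crd e (y j) g)" for e
  have \<xi>c: "\<xi> e \<in> carrier R" if "e \<in> E" for e
    unfolding \<xi>_def by (intro group_ring_sum_closed group_ring_scale_closed crdc that)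
  have crd_d: "crd e (d n z) = (\<lambda>g. \<Sum>j\<in>J. (\<phi> j z \<otimes>\<^bsub>R\<^esub> crd e (y j)) g)" if "e \<in> E" "z \<in> carrier (F n)" for e z
    unfolding y_def by (rule dual_basis_expand_reg[OF Ln db hom_reg_comp[OF crd[OF that(1)] dn] that(2)])
  \<comment> \<open>The coordinate function composed with \<open>d n\<close> has class 0, since it
    visibly factors through \<open>d n\<close>. Expanding it in the dual basis shows that this class
    is also \<open>augm (\<xi> e) * \<epsilon> p\<close>.\<close>
  have aug_\<xi>: "augm (\<xi> e) = 0" if e: "e \<in> E" for e
  proof (cases "\<epsilon> p = 0")
    case True then show ?thesis by (simp add: \<xi>_def c_def)
  next
    case False
    have "\<epsilon> (\<lambda>z. crd e (d n z)) = 0"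
      using crd[OF e] by (subst \<epsilon>_zero[OF hom_reg_comp[OF crd[OF e] dn]]) blast
    moreover have "\<epsilon> (\<lambda>z. crd e (d n z)) = \<epsilon> (\<lambda>z g. \<Sum>j\<in>J. (\<phi> j z \<otimes>\<^bsub>R\<^esub> crd e (y j)) g)"
      by (intro \<epsilon>_cong crd_d e hom_reg_comp[OF crd[OF e] dn] hom_reg_sum hom_reg_mult[OF ring_R] \<phi>h crdc)
    moreover have "\<dots> = (\<Sum>j\<in>J. \<epsilon> (\<lambda>z. \<phi> j z \<otimes>\<^bsub>R\<^esub> crd e (y j)))"
      by (rule \<epsilon>_sum[OF J]) (intro hom_reg_mult[OF ring_R] \<phi>h crdc e)
    moreover have "\<dots> = (\<Sum>j\<in>J. augm (crd e (y j)) * (c j * \<epsilon> p))"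
      by (rule sum.cong) (simp_all add: \<epsilon>_mult[OF \<phi>h crdc[OF e]] c)
    moreover have "augm (\<xi> e) = (\<Sum>j\<in>J. c j * augm (crd e (y j)))"
      unfolding \<xi>_def augm_rmul[of _ G "{}"]
      by (subst rmul_sum) (auto simp: rmul_scale[OF crdc[OF e]] intro: group_ring_scale_closed crdc e)
    moreover have "(\<Sum>j\<in>J. augm (crd e (y j)) * (c j * \<epsilon> p)) = (\<Sum>j\<in>J. c j * augm (crd e (y j))) * \<epsilon> p"
      unfolding sum_distrib_right by (rule sum.cong) simp_all
    ultimately have "augm (\<xi> e) * \<epsilon> p = 0" by simp
    then show ?thesis using False by simp
  qed
  \<comment> \<open>Translation by \<open>s\<close> does not change the class of \<open>p\<close>,
    so the difference has class 0 and factors through \<open>d n\<close>.\<close>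
  have "\<exists>\<beta>. \<beta> \<in> ?H (Suc k) \<and> (\<forall>z\<in>carrier (F n). (\<lambda>g. (p z \<otimes>\<^bsub>R\<^esub> group_elem s) g - p z g) = \<beta> (d n z))" if "s \<in> carrier G" for s
  proof -
    note ps = hom_reg_mult[OF ring_R p(1) group_elem_closed[OF that]]
    have "\<epsilon> (\<lambda>z g. (p z \<otimes>\<^bsub>R\<^esub> group_elem s) g - p z g) = 0" using \<epsilon>_diff[OF ps p(1)] \<epsilon>_elem[OF p(1) that] by simp
    then show ?thesis using \<epsilon>_zero[OF hom_reg_diff[OF ps p(1)]] by blast
  qed
  then obtain \<beta> where \<beta>: "\<And>s. s \<in> carrier G \<Longrightarrow> \<beta> s \<in> ?H (Suc k)"
    "\<And>s z. s \<in> carrier G \<Longrightarrow> z \<in> carrier (F n) \<Longrightarrow> \<beta> s (d n z) = (\<lambda>g. (p z \<otimes>\<^bsub>R\<^esub> group_elem s) g - p z g)" by metis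
  have "\<exists>\<eta>. \<eta> \<in> ?H (Suc k) \<and> (\<forall>z\<in>carrier (F n). (\<lambda>g. \<phi> j z g - c j * p z g) = \<eta> (d n z))" if "j \<in> J" for j
  proof -
    have "\<epsilon> (\<lambda>z g. \<phi> j z g - c j * p z g) = 0"
      using \<epsilon>_diff[OF \<phi>h[OF that] hom_reg_scale[OF p(1)], of "c j"] \<epsilon>_scale[OF p(1)] c[OF that] by simp
    then show ?thesis using \<epsilon>_zero[OF hom_reg_diff[OF \<phi>h[OF that] hom_reg_scale[OF p(1)]]] by blast
  qed
  then obtain \<eta> where \<eta>: "\<And>j. j \<in> J \<Longrightarrow> \<eta> j \<in> ?H (Suc k)"
    "\<And>j z. j \<in> J \<Longrightarrow> z \<in> carrier (F n) \<Longrightarrow> \<eta> j (d n z) = (\<lambda>g. \<phi> j z g - c j * p z g)" by metis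
  \<comment> \<open>On boundaries the cocycle identity is exact, because there
    \<open>\<beta> s\<close> is the difference of a translate of \<open>p\<close> and
    \<open>p\<close>. The error is thus zero on boundaries and factors through
    \<open>d (Suc k)\<close> by \<open>hom_exact\<close>.\<close>
  have "\<exists>\<zeta>. \<zeta> \<in> ?H k \<and> (\<forall>x\<in>carrier (F (Suc k)). \<beta> (s \<otimes>\<^bsub>G\<^esub> t) x = (\<lambda>g. (\<beta> s x \<otimes>\<^bsub>R\<^esub> group_elem t) g + \<beta> t x g + \<zeta> (d (Suc k) x) g))"
    if st: "s \<in> carrier G" "t \<in> carrier G" for s t
  proof -
    let ?f = "\<lambda>x g. \<beta> (s \<otimes>\<^bsub>G\<^esub> t) x g - (\<beta> s x \<otimes>\<^bsub>R\<^esub> group_elem t) g - \<beta> t x g"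
    have f: "?f \<in> ?H (Suc k)"
      by (intro hom_reg_diff \<beta>(1) hom_reg_mult[OF ring_R] group_elem_closed G.m_closed st)
    have "?f (d n z) = (\<lambda>_. 0)" if z: "z \<in> carrier (F n)" for z
    proof -
      have pz: "p z \<in> carrier R" by (rule hom_reg_closed[OF p(1) z])
      have "(\<lambda>g. (p z \<otimes>\<^bsub>R\<^esub> group_elem s) g - p z g) \<otimes>\<^bsub>R\<^esub> group_elem t =
        (\<lambda>g. (p z \<otimes>\<^bsub>R\<^esub> group_elem s \<otimes>\<^bsub>R\<^esub> group_elem t) g - (p z \<otimes>\<^bsub>R\<^esub> group_elem t) g)"
        using st pz by (intro group_ring_mult_diff_left[OF ring_R]) auto
      moreover have "p z \<otimes>\<^bsub>R\<^esub> group_elem s \<otimes>\<^bsub>R\<^esub> group_elem t = p z \<otimes>\<^bsub>R\<^esub> group_elem (s \<otimes>\<^bsub>G\<^esub> t)"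
        using st pz by (simp add: R.m_assoc G.group_elem_mult)
      ultimately show ?thesis using st z by (simp add: \<beta>(2))
    qed
    then obtain \<zeta> where z: "\<zeta> \<in> ?H k" "\<And>x. x \<in> carrier (F (Suc k)) \<Longrightarrow> ?f x = \<zeta> (d (Suc k) x)" using ex[OF f] by blast
    have "\<beta> (s \<otimes>\<^bsub>G\<^esub> t) x = (\<lambda>g. (\<beta> s x \<otimes>\<^bsub>R\<^esub> group_elem t) g + \<beta> t x g + \<zeta> (d (Suc k) x) g)" if "x \<in> carrier (F (Suc k))" for x
      unfolding z(2)[OF that, symmetric] by simp
    then show ?thesis using z(1) by blast
  qed
  note ex_\<zeta> = this
  define \<zeta> where "\<zeta> s t = (SOME \<zeta>. \<zeta> \<in> ?H k \<and> (\<forall>x\<in>carrier (F (Suc k)). \<beta> (s \<otimes>\<^bsub>G\<^esub> t) x =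
    (\<lambda>g. (\<beta> s x \<otimes>\<^bsub>R\<^esub> group_elem t) g + \<beta> t x g + \<zeta> (d (Suc k) x) g)))" for s t
  have \<zeta>: "\<zeta> s t \<in> ?H k" "\<And>x. x \<in> carrier (F (Suc k)) \<Longrightarrow>
      \<beta> (s \<otimes>\<^bsub>G\<^esub> t) x = (\<lambda>g. (\<beta> s x \<otimes>\<^bsub>R\<^esub> group_elem t) g + \<beta> t x g + \<zeta> s t (d (Suc k) x) g)"
    if "s \<in> carrier G" "t \<in> carrier G" for s t
    using someI_ex[OF ex_\<zeta>[OF that], folded \<zeta>_def] by blast+
  have "\<exists>h. h \<in> ?H k \<and> (\<forall>x\<in>carrier (F (Suc k)). crd e x =
      (\<lambda>g. (\<Sum>s | \<xi> e s \<noteq> 0. \<xi> e s * \<beta> s x g) + (\<Sum>j\<in>J. (\<eta> j x \<otimes>\<^bsub>R\<^esub> crd e (y j)) g) + h (d (Suc k) x) g))"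
    if e: "e \<in> E" for e
  proof -
    have sG: "s \<in> carrier G" if "s \<in> {s. \<xi> e s \<noteq> 0}" for s using \<xi>c[OF e] that by (auto simp: group_ring_carrier)
    let ?a = "\<lambda>x g. \<Sum>s | \<xi> e s \<noteq> 0. \<xi> e s * \<beta> s x g" and ?b = "\<lambda>x g. \<Sum>j\<in>J. (\<eta> j x \<otimes>\<^bsub>R\<^esub> crd e (y j)) g"
    let ?f = "\<lambda>x g. crd e x g - ?a x g - ?b x g"
    have f: "?f \<in> ?H (Suc k)"
      by (intro hom_reg_diff hom_reg_sum hom_reg_scale hom_reg_mult[OF ring_R] crd[OF e] \<beta>(1) sG \<eta>(1) crdc e)
    \<comment> \<open>On the boundary of \<open>z\<close> the sum over \<open>\<beta>\<close> gives
      \<open>p z\<close> times \<open>\<xi> e\<close>, by augmentation 0, and the sum over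
      \<open>\<eta>\<close> gives the coordinate minus this same product.\<close>
    have "?f (d n z) = (\<lambda>_. 0)" if z: "z \<in> carrier (F n)" for z
    proof
      fix g
      have pz: "p z \<in> carrier R" and \<phi>z: "\<And>j. j \<in> J \<Longrightarrow> \<phi> j z \<in> carrier R"
        using hom_reg_closed[OF p(1) z] hom_reg_closed[OF \<phi>h z] by auto
      have "?b (d n z) g = (\<Sum>j\<in>J. (\<phi> j z \<otimes>\<^bsub>R\<^esub> crd e (y j)) g - c j * (p z \<otimes>\<^bsub>R\<^esub> crd e (y j)) g)"
      proof (rule sum.cong[OF refl])
        fix j assume j: "j \<in> J"
        let ?c = "crd e (y j)"
        have s: "(\<lambda>g. c j * p z g) \<otimes>\<^bsub>R\<^esub> ?c = (\<lambda>g. c j * (p z \<otimes>\<^bsub>R\<^esub> ?c) g)"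
        proof -
          have c1: "(\<lambda>g. c j * p z g) = p z \<otimes>\<^bsub>R\<^esub> (\<lambda>g. c j * group_elem \<one>\<^bsub>G\<^esub> g)"
            using R.r_one[OF pz] by (simp add: group_ring_mult_scale_right group_ring_one)
          have "(\<lambda>g. c j * p z g) \<otimes>\<^bsub>R\<^esub> ?c = p z \<otimes>\<^bsub>R\<^esub> (\<lambda>g. c j * group_elem \<one>\<^bsub>G\<^esub> g) \<otimes>\<^bsub>R\<^esub> ?c"
            by (simp only: c1)
          also have "\<dots> = p z \<otimes>\<^bsub>R\<^esub> ((\<lambda>g. c j * group_elem \<one>\<^bsub>G\<^esub> g) \<otimes>\<^bsub>R\<^esub> ?c)"
            by (rule R.m_assoc[OF pz group_ring_scale_closed crdc[OF e j]]) simp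
          also have "(\<lambda>g. c j * group_elem \<one>\<^bsub>G\<^esub> g) \<otimes>\<^bsub>R\<^esub> ?c = (\<lambda>g. c j * ?c g)"
          proof (cases "c j = 0")
            case True
            then show ?thesis using R.l_null[OF crdc[OF e j]] by simp
          next
            case False
            then have "{h. c j * group_elem \<one>\<^bsub>G\<^esub> h \<noteq> 0} = {\<one>\<^bsub>G\<^esub>}" by (auto simp: group_elem_def)
            moreover have "?c x = 0" if "x \<notin> carrier G" for x using crdc[OF e j] that by (auto simp: group_ring_carrier)
            ultimately show ?thesis by (simp add: group_ring_mult fun_eq_iff) (simp add: group_elem_def)
          qed
          finally show ?thesis by (simp add: group_ring_mult_scale_right)
        qed
        have "\<eta> j (d n z) \<otimes>\<^bsub>R\<^esub> ?c = (\<lambda>g. (\<phi> j z \<otimes>\<^bsub>R\<^esub> ?c) g - ((\<lambda>g. c j * p z g) \<otimes>\<^bsub>R\<^esub> ?c) g)"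
          unfolding \<eta>(2)[OF j z] by (rule group_ring_mult_diff_left[OF ring_R \<phi>z[OF j] group_ring_scale_closed[OF pz] crdc[OF e j]])
        then show "(\<eta> j (d n z) \<otimes>\<^bsub>R\<^esub> ?c) g = (\<phi> j z \<otimes>\<^bsub>R\<^esub> ?c) g - c j * (p z \<otimes>\<^bsub>R\<^esub> ?c) g" unfolding s by simp
      qed
      also have "\<dots> = crd e (d n z) g - (p z \<otimes>\<^bsub>R\<^esub> \<xi> e) g"
        unfolding \<xi>_def group_ring_mult_sum_right group_ring_mult_scale_right crd_d[OF e z] by (simp add: sum_subtractf)
      finally have b: "?b (d n z) g = crd e (d n z) g - (p z \<otimes>\<^bsub>R\<^esub> \<xi> e) g" .
      have "?a (d n z) g = (\<Sum>s | \<xi> e s \<noteq> 0. \<xi> e s * (p z \<otimes>\<^bsub>R\<^esub> group_elem s) g - \<xi> e s * p z g)"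
        using \<beta>(2)[OF sG z] by (intro sum.cong) (auto simp: right_diff_distrib)
      also have "\<dots> = (p z \<otimes>\<^bsub>R\<^esub> \<xi> e) g - augm (\<xi> e) * p z g"
        by (simp add: sum_subtractf group_ring_mult_expand[OF \<xi>c[OF e], of "p z"] augm_def sum_distrib_right)
      finally show "?f (d n z) g = 0" using b aug_\<xi>[OF e] by simp
    qed
    then obtain h where h: "h \<in> ?H k" "\<And>x. x \<in> carrier (F (Suc k)) \<Longrightarrow> ?f x = h (d (Suc k) x)" using ex[OF f] by blast
    have "crd e x = (\<lambda>g. ?a x g + ?b x g + h (d (Suc k) x) g)" if "x \<in> carrier (F (Suc k))" for x
      unfolding h(2)[OF that, symmetric] by simp
    then show ?thesis using h(1) by blast
  qed
  note ex_h = this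
  define h where "h e = (SOME h. h \<in> ?H k \<and> (\<forall>x\<in>carrier (F (Suc k)). crd e x =
      (\<lambda>g. (\<Sum>s | \<xi> e s \<noteq> 0. \<xi> e s * \<beta> s x g) + (\<Sum>j\<in>J. (\<eta> j x \<otimes>\<^bsub>R\<^esub> crd e (y j)) g) + h (d (Suc k) x) g)))" for e
  have h: "h e \<in> ?H k" "\<And>x. x \<in> carrier (F (Suc k)) \<Longrightarrow> crd e x =
      (\<lambda>g. (\<Sum>s | \<xi> e s \<noteq> 0. \<xi> e s * \<beta> s x g) + (\<Sum>j\<in>J. (\<eta> j x \<otimes>\<^bsub>R\<^esub> crd e (y j)) g) + h e (d (Suc k) x) g)"
    if "e \<in> E" for e
    using someI_ex[OF ex_h[OF that], folded h_def] by blast+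
  show thesis by (rule that[OF J \<xi>c \<beta>(1) \<zeta> \<eta>(1) yc dy h \<xi>_def aug_\<xi>])
qed

end

section \<open>Filling exact cycles\<close>

lemma l1_sum: "l1 Q (\<lambda>q. \<Sum>i\<in>A. f i q) \<le> (\<Sum>i\<in>A. l1 Q (f i))"
proof -
  have "l1 Q (\<lambda>q. \<Sum>i\<in>A. f i q) \<le> real_of_int (\<Sum>q\<in>Q. \<Sum>i\<in>A. \<bar>f i q\<bar>)"
    unfolding l1_def of_int_le_iff by (intro sum_mono sum_abs)
  also have "\<dots> = (\<Sum>i\<in>A. l1 Q (f i))" by (subst sum.swap) (simp add: l1_def)
  finally show ?thesis .
qed

lemma l1_scale: "l1 Q (\<lambda>q. c * f q) = real_of_int \<bar>c\<bar> * l1 Q f"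
  by (simp add: l1_def abs_mult sum_distrib_left)

lemma rmul_fun_scale: "rmul G (\<lambda>K. c * a K) r K = c * rmul G a r K"
  by (simp add: rmul_def sum_distrib_left ac_simps)

lemma rmul_fun_diff: "rmul G (\<lambda>K. a K - b K) r K = rmul G a r K - rmul G b r K"
  by (simp add: rmul_def algebra_simps sum_subtractf)

lemma (in group) rmul_cong:
  assumes H: "subgroup H G" and K: "K \<in> rcosets H" and r: "r \<in> carrier (group_ring G)"
    and eq: "\<And>K. K \<in> rcosets H \<Longrightarrow> a K = b K"
  shows "rmul G a r K = rmul G b r K"
  unfolding rmul_def
proof (rule sum.cong[OF refl])
  fix g assume "g \<in> {g. r g \<noteq> 0}"
  then have "g \<in> carrier G" using r by (auto simp: group_ring_carrier)
  then have "K #> inv g \<in> rcosets H" by (intro rcosets_act(1)[OF H K]) simp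
  then show "r g * a (K #> inv g) = r g * b (K #> inv g)" using eq by simp
qed

definition ring_l1 :: "('g \<Rightarrow> int) \<Rightarrow> real"
  where "ring_l1 r = (\<Sum>g | r g \<noteq> 0. real_of_int \<bar>r g\<bar>)"

lemma ring_l1_nonneg: "0 \<le> ring_l1 r"
  by (simp add: ring_l1_def sum_nonneg)

context chain_module
begin

lemma ev_cong:
  assumes "Poly_Mapping.keys u \<subseteq> S" "\<And>x. x \<in> carrier M \<Longrightarrow> c x = c' x"
  shows "ev c u K = ev c' u K"
  unfolding ev_def using assms by (intro fint_cong) auto

lemma ev_fun_add:
  assumes u: "Poly_Mapping.keys u \<subseteq> S" and c: "\<And>x. x \<in> carrier M \<Longrightarrow> c x \<in> carrier R" "\<And>x. x \<in> carrier M \<Longrightarrow> c' x \<in> carrier R"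
  shows "ev (\<lambda>x g. c x g + c' x g) u K = ev c u K + ev c' u K"
  unfolding ev_def fint_add_fun[symmetric]
  using u by (intro fint_cong) (auto simp: rmul_add[OF c] distrib_left subset_iff)

lemma ev_fun_sum:
  assumes u: "Poly_Mapping.keys u \<subseteq> S" and c: "\<And>i x. i \<in> A \<Longrightarrow> x \<in> carrier M \<Longrightarrow> c i x \<in> carrier R"
  shows "ev (\<lambda>x g. \<Sum>i\<in>A. c i x g) u K = (\<Sum>i\<in>A. ev (c i) u K)"
  unfolding ev_def fint_sum_fun[symmetric]
proof (rule fint_cong)
  fix z assume "z \<in> Poly_Mapping.keys u"
  then obtain x k where z: "z = (x, k)" "x \<in> carrier M" using u by auto
  show "(case z of (x, k) \<Rightarrow> k * rmul G (\<lambda>K. of_bool (K = H)) (\<lambda>g. \<Sum>i\<in>A. c i x g) K) =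
    (\<Sum>i\<in>A. case z of (x, k) \<Rightarrow> k * rmul G (\<lambda>K. of_bool (K = H)) (c i x) K)"
    using rmul_sum[of A "\<lambda>i. c i x", OF c[OF _ z(2)]] by (simp add: z(1) sum_distrib_left)
qed

lemma ev_fun_scale:
  assumes u: "Poly_Mapping.keys u \<subseteq> S" and c: "\<And>x. x \<in> carrier M \<Longrightarrow> c x \<in> carrier R"
  shows "ev (\<lambda>x g. a * c x g) u K = a * ev c u K"
  unfolding ev_def fint_scale_fun[symmetric]
  using u by (intro fint_cong) (auto simp: rmul_scale[OF c] subset_iff)

text \<open>Right multiplication of values becomes the right action on functions on cosets, by
  \<open>rmul_mult\<close> applied to each term of the chain.\<close>

lemma ev_mult:
  assumes u: "Poly_Mapping.keys u \<subseteq> S" and c: "\<And>x. x \<in> carrier M \<Longrightarrow> c x \<in> carrier R"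
    and r: "r \<in> carrier R" and K: "K \<in> rcosets\<^bsub>G\<^esub> H"
  shows "ev (\<lambda>x. c x \<otimes>\<^bsub>R\<^esub> r) u K = rmul G (ev c u) r K"
proof -
  have "rmul G (ev c u) r K = fint (\<lambda>z. \<Sum>g | r g \<noteq> 0. r g * (case z of (x, k) \<Rightarrow> k * rmul G (\<lambda>K. of_bool (K = H)) (c x) (K #>\<^bsub>G\<^esub> inv\<^bsub>G\<^esub> g))) u"
    by (simp add: rmul_def[of G "ev c u"] ev_def fint_sum_fun fint_scale_fun)
  also have "\<dots> = ev (\<lambda>x. c x \<otimes>\<^bsub>R\<^esub> r) u K"
    unfolding ev_def
  proof (rule fint_cong)
    fix z assume "z \<in> Poly_Mapping.keys u"
    then obtain x k where z: "z = (x, k)" "x \<in> carrier M" using u by auto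
    have "rmul G (\<lambda>K. of_bool (K = H)) (c x \<otimes>\<^bsub>R\<^esub> r) K = rmul G (rmul G (\<lambda>K. of_bool (K = H)) (c x)) r K"
      by (rule G.rmul_mult[OF ring_R H K c[OF z(2)] r])
    then show "(\<Sum>g | r g \<noteq> 0. r g * (case z of (x, k) \<Rightarrow> k * rmul G (\<lambda>K. of_bool (K = H)) (c x) (K #>\<^bsub>G\<^esub> inv\<^bsub>G\<^esub> g))) =
      (case z of (x, k) \<Rightarrow> k * rmul G (\<lambda>K. of_bool (K = H)) (c x \<otimes>\<^bsub>R\<^esub> r) K)"
      by (simp add: z(1) rmul_def[of G "rmul G _ _"] sum_distrib_left ac_simps)
  qed
  finally show ?thesis by simp
qed

end

section \<open>The boundary map on chains\<close>

definition frag_map :: "('l \<Rightarrow> 'm) \<Rightarrow> ('l \<times> int \<Rightarrow>\<^sub>0 int) \<Rightarrow> ('m \<times> int \<Rightarrow>\<^sub>0 int)"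
  where "frag_map \<phi> u = frag_extend (\<lambda>(x, k). frag_of (\<phi> x, k)) u"

lemma frag_map_add: "frag_map \<phi> (u + v) = frag_map \<phi> u + frag_map \<phi> v" and frag_map_diff: "frag_map \<phi> (u - v) = frag_map \<phi> u - frag_map \<phi> v"
  and frag_map_uminus: "frag_map \<phi> (- u) = - frag_map \<phi> u" and frag_map_frag_of: "frag_map \<phi> (frag_of (x, k)) = frag_of (\<phi> x, k)"
  and frag_map_zero: "frag_map \<phi> 0 = 0"
  by (simp_all add: frag_map_def frag_extend_add frag_extend_diff frag_extend_minus)

lemma keys_frag_map: "Poly_Mapping.keys u \<subseteq> carrier M \<times> UNIV \<Longrightarrow> \<phi> \<in> carrier M \<rightarrow> carrier M' \<Longrightarrow> Poly_Mapping.keys (frag_map \<phi> u) \<subseteq> carrier M' \<times> UNIV"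
  unfolding frag_map_def using keys_frag_extend[of "\<lambda>(x, k). frag_of (\<phi> x, k)" u] by fastforce

locale chain_modules = C1: chain_module G M1 H + C2: chain_module G M2 H
  for G :: "('g, 'b) monoid_scheme" and M1 M2 :: "('g \<Rightarrow> int, 'm) module" and H +
  fixes \<phi> assumes \<phi>: "\<phi> \<in> lmod_hom (group_ring G) M1 M2"
begin

lemma ev_frag_map: "C1.ev c (frag_map \<phi> u) K = C1.ev (\<lambda>x. c (\<phi> x)) u K"
proof -
  have "fint f (frag_map \<phi> u) = fint (\<lambda>(x, k). f (\<phi> x, k)) u" for f
    unfolding frag_map_def fint_frag_extend by (rule arg_cong[of _ _ "\<lambda>f. fint f u"]) auto
  then show ?thesis unfolding C1.ev_def by simp
qed

lemma frag_map_N: assumes "u \<in> C1.N" shows "frag_map \<phi> u \<in> C2.N"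
proof -
  note cl = lmod_hom_closed[OF \<phi>] and add = addhom_add[OF lmod_hom_addhom[OF \<phi>]]
  have g: "frag_map \<phi> w \<in> C2.N" if w: "w \<in> C1.gens" for w
  proof -
    consider (1) x x' y where "w = frag_of (x \<oplus>\<^bsub>M1\<^esub> x', y) - frag_of (x, y) - frag_of (x', y)" "x \<in> carrier M1" "x' \<in> carrier M1"
      | (2) x y y' where "w = frag_of (x, y + y') - frag_of (x, y) - frag_of (x, y')" "x \<in> carrier M1"
      | (3) x r y where "w = frag_of (ring_inversion G r \<odot>\<^bsub>M1\<^esub> x, y) - frag_of (x, (\<Sum>g | r g \<noteq> 0. r g) * y)" "x \<in> carrier M1" "r \<in> carrier (subgroup_ring G H)"
      using w unfolding C1.gens_def by blast
    then show ?thesis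
    proof cases
      case 1
      then show ?thesis using C2.rel_add[OF cl cl, of x x' y] by (simp add: frag_map_diff frag_map_add frag_map_frag_of add diff_diff_eq)
    next
      case 2
      then show ?thesis using C2.rel_int[OF cl, of x y y'] by (simp add: frag_map_diff frag_map_add frag_map_frag_of diff_diff_eq)
    next
      case 3
      have "ring_inversion G r \<in> carrier (group_ring G)"
        by (rule ring_inversion_closed[OF C1.G.is_group 3(3) subgroup.subset[OF C1.H]])
      from lmod_hom_smult[OF \<phi> this 3(2)] show ?thesis using C2.rel_smult[OF cl[OF 3(2)] 3(3), of y]
        unfolding 3(1) by (simp add: frag_map_diff frag_map_frag_of)
    qed
  qed
  show ?thesis using assms unfolding C1.N_eq
  proof (induction rule: generate.induct)
    case one then show ?case by (simp add: C1.TG frag_map_zero C2.N_zero)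
  next
    case (incl w) then show ?case by (rule g)
  next
    case (inv w)
    then have "Poly_Mapping.keys w \<subseteq> C1.S" using subsetD[OF C1.gens_sub] by (simp add: C1.TG)
    then show ?case using C2.N_uminus[OF g[OF inv]] by (simp add: C1.TG frag_map_uminus)
  next
    case (eng v w) then show ?case using C2.N_add by (simp add: C1.TG frag_map_add)
  qed
qed

text \<open>The image of the relations of the source consists of relations of the target, so
  enlarging the image of a coset to a full coset changes only the representative.\<close>

lemma chain_map_coset:
  "chain_map G H M2 \<phi> (C1.N #>\<^bsub>C1.TG\<^esub> u) = C2.N #>\<^bsub>C2.TG\<^esub> frag_map \<phi> u"
proof -
  have eq: "chain_map G H M2 \<phi> (C1.N #>\<^bsub>C1.TG\<^esub> u) = {v + frag_map \<phi> (w + u) | v w. v \<in> C2.N \<and> w \<in> C1.N}"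
    unfolding chain_map_def tensor_map_def frag_map_def[symmetric] set_mult_def r_coset_def by (auto simp: C1.TG C2.TG)
  have "{v + frag_map \<phi> (w + u) | v w. v \<in> C2.N \<and> w \<in> C1.N} = {v + frag_map \<phi> u | v. v \<in> C2.N}"
  proof
    show "{v + frag_map \<phi> (w + u) | v w. v \<in> C2.N \<and> w \<in> C1.N} \<subseteq> {v + frag_map \<phi> u | v. v \<in> C2.N}"
    proof
      fix a assume "a \<in> {v + frag_map \<phi> (w + u) | v w. v \<in> C2.N \<and> w \<in> C1.N}"
      then obtain v w where vw: "a = v + frag_map \<phi> (w + u)" "v \<in> C2.N" "w \<in> C1.N" by blast
      then have "a = (v + frag_map \<phi> w) + frag_map \<phi> u" by (simp add: frag_map_add add.assoc)
      moreover have "v + frag_map \<phi> w \<in> C2.N" using vw frag_map_N C2.N_add by blast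
      ultimately show "a \<in> {v + frag_map \<phi> u | v. v \<in> C2.N}" by blast
    qed
    show "{v + frag_map \<phi> u | v. v \<in> C2.N} \<subseteq> {v + frag_map \<phi> (w + u) | v w. v \<in> C2.N \<and> w \<in> C1.N}"
    proof
      fix a assume "a \<in> {v + frag_map \<phi> u | v. v \<in> C2.N}"
      then obtain v where "a = v + frag_map \<phi> u" "v \<in> C2.N" by blast
      then show "a \<in> {v + frag_map \<phi> (w + u) | v w. v \<in> C2.N \<and> w \<in> C1.N}"
        using C1.N_zero by (intro CollectI exI[of _ v] exI[of _ 0]) simp
    qed
  qed
  then show ?thesis unfolding eq by (auto simp: r_coset_def C2.TG)
qed

end

lemma (in chain_module) carrier_chain_group:
  "carrier (chain_group G H M) = {N #>\<^bsub>TG\<^esub> u | u. Poly_Mapping.keys u \<subseteq> S}"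
  by (auto simp: chain_group_def tensor_product_def FactGroup_def RCOSETS_def TG)

context based_chain_module
begin

lemma dual_basis_crd: "dual_basis (group_ring G) M E (\<lambda>e. e) crd"
  unfolding dual_basis_def using E crd crd_exp by (auto simp: hom_reg_iff)

text \<open>Any homomorphism to the group ring acts on chains through the coordinates and its values
  on the basis, as a matrix over the group ring acting from the right.\<close>

lemma ev_coords:
  assumes c: "c \<in> lmod_hom (group_ring G) M (reg G)" and u: "Poly_Mapping.keys u \<subseteq> S" and K: "K \<in> rcosets\<^bsub>G\<^esub> H"
  shows "ev c u K = (\<Sum>e\<in>E. rmul G (ev (crd e) u) (c e) K)"
proof -
  have Lm: "left_module (group_ring G) M" ..
  note cc = hom_reg_closed[OF crd] and ce = hom_reg_closed[OF c subsetD[OF E(2)]]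
  have "ev c u K = ev (\<lambda>x g. \<Sum>e\<in>E. (crd e x \<otimes>\<^bsub>group_ring G\<^esub> c e) g) u K"
    by (rule ev_cong[OF u dual_basis_expand_reg[OF Lm dual_basis_crd c]])
  also have "\<dots> = (\<Sum>e\<in>E. ev (\<lambda>x. crd e x \<otimes>\<^bsub>group_ring G\<^esub> c e) u K)"
    by (rule ev_fun_sum[OF u]) (rule L.R.m_closed[OF cc ce])
  also have "\<dots> = (\<Sum>e\<in>E. rmul G (ev (crd e) u) (c e) K)"
    by (rule sum.cong[OF refl]) (rule ev_mult[OF u cc ce K])
  finally show ?thesis .
qed

text \<open>By \<open>ev_coords\<close> and \<open>l1_rmul\<close>. The factor involves the values
  of \<open>c\<close> on the basis and no data of \<open>H\<close>, which is what makes the final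
  constant uniform.\<close>

lemma l1_ev_le:
  assumes c: "c \<in> lmod_hom (group_ring G) M (reg G)" and u: "Poly_Mapping.keys u \<subseteq> S"
  shows "l1 (rcosets\<^bsub>G\<^esub> H) (ev c u) \<le> (\<Sum>e\<in>E. ring_l1 (c e)) * (\<Sum>e\<in>E. l1 (rcosets\<^bsub>G\<^esub> H) (ev (crd e) u))"
proof -
  have "l1 (rcosets\<^bsub>G\<^esub> H) (ev c u) = l1 (rcosets\<^bsub>G\<^esub> H) (\<lambda>K. \<Sum>e\<in>E. rmul G (ev (crd e) u) (c e) K)"
    by (rule l1_cong[OF ev_coords[OF c u]])
  also have "\<dots> \<le> (\<Sum>e\<in>E. l1 (rcosets\<^bsub>G\<^esub> H) (rmul G (ev (crd e) u) (c e)))" by (rule l1_sum)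
  also have "\<dots> \<le> (\<Sum>e\<in>E. ring_l1 (c e) * l1 (rcosets\<^bsub>G\<^esub> H) (ev (crd e) u))"
    unfolding ring_l1_def
    by (rule sum_mono, rule G.l1_rmul[OF H fin]) (rule hom_reg_closed[OF c subsetD[OF E(2)]])
  also have "\<dots> \<le> (\<Sum>e\<in>E. ring_l1 (c e) * (\<Sum>e\<in>E. l1 (rcosets\<^bsub>G\<^esub> H) (ev (crd e) u)))"
    by (intro sum_mono mult_left_mono ring_l1_nonneg member_le_sum l1_nonneg E)
  finally show ?thesis by (simp add: sum_distrib_right)
qed

lemma mem_N_if_ev_zero:
  assumes u: "Poly_Mapping.keys u \<subseteq> S" and z: "\<And>e K. e \<in> E \<Longrightarrow> K \<in> rcosets\<^bsub>G\<^esub> H \<Longrightarrow> ev (crd e) u K = 0"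
  shows "u \<in> N"
proof -
  have "(\<Sum>(t, e)\<in>T \<times> E. frag_cmul (ev (crd e) u (H #>\<^bsub>G\<^esub> t)) (b (t, e))) = 0"
    by (rule sum.neutral) (use TG' G.rcosetsI[OF subgroup.subset[OF H]] in \<open>auto simp: z subset_iff\<close>)
  then show ?thesis using span[OF u] by simp
qed

lemma ex_ev_eq:
  obtains u where "Poly_Mapping.keys u \<subseteq> S" "\<And>e K. e \<in> E \<Longrightarrow> K \<in> rcosets\<^bsub>G\<^esub> H \<Longrightarrow> ev (crd e) u K = a e K"
proof -
  define u where "u = (\<Sum>i\<in>T \<times> E. frag_cmul (case i of (t, e) \<Rightarrow> a e (H #>\<^bsub>G\<^esub> t)) (b i))"
  have "u \<in> carrier (free_Abelian_group S)"
    unfolding u_def using b_keys by (intro sum_closed_free_Abelian_group) fastforce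
  moreover have "ev (crd e) u K = a e K" if e: "e \<in> E" and K: "K \<in> rcosets\<^bsub>G\<^esub> H" for e K
  proof -
    obtain t where t: "t \<in> T" "K = H #>\<^bsub>G\<^esub> t" using reps_bij[OF T] K by (auto simp: bij_betw_def)
    show ?thesis unfolding t(2) u_def ev_comb[OF t(1) e] by simp
  qed
  ultimately show thesis using that by simp
qed

end

context fp_res
begin

text \<open>A filling \<open>u0\<close> of unknown size is evaluated on the homomorphisms from
  \<open>duality\<close>. Its large part is an almost cocycle, which property (T) reduces to size
  comparable with the boundary; the chain with the reduced coordinates differs from
  \<open>u0\<close> by cycles.\<close>

theorem linear_filling:
  assumes n: "n = Suc (Suc k)" and T: "property_T G" and iso: "ZG_cohomology G n \<cong> integer_group"
    and triv: "\<forall>g\<in>carrier G. \<forall>K\<in>carrier (ZG_cohomology G n). ZG_right_translate G n g K = K"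
    and coh: "trivial_group (ZG_cohomology G (Suc k))"
    and E1: "finite_basis R (F (Suc k)) E1" and E2: "finite_basis R (F k) E2"
  shows "\<exists>C::real. \<forall>H T z. subgroup H G \<and> finite (rcosets\<^bsub>G\<^esub> H) \<and> coset_representatives G H T \<and>
    z \<in> chain_map G H (F k) (d (Suc k)) ` carrier (chain_group G H (F (Suc k))) \<longrightarrow>
    (\<exists>A\<in>carrier (chain_group G H (F (Suc k))). chain_map G H (F k) (d (Suc k)) A = z \<and>
       real_of_int (chain_norm G H T (F (Suc k)) E1 A) \<le> C * real_of_int (chain_norm G H T (F k) E2 z))"
proof -
  interpret G: group G by (rule group_G)
  interpret R: ring R by (rule ring_R)
  have L1: "left_module R (F (Suc k))" and L2: "left_module R (F k)" using lm n by auto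
  have dk: "d (Suc k) \<in> lmod_hom R (F (Suc k)) (F k)" using dhom n by simp
  have fin: "finite E1" "E1 \<subseteq> carrier (F (Suc k))" "finite E2" "E2 \<subseteq> carrier (F k)"
    using E1 E2 by (auto simp: finite_basis_def)
  obtain crd1 where crd1: "\<And>e. e \<in> E1 \<Longrightarrow> crd1 e \<in> lmod_hom R (F (Suc k)) (reg G)"
    "\<And>x. x \<in> carrier (F (Suc k)) \<Longrightarrow> x = (\<Oplus>\<^bsub>F (Suc k)\<^esub>e\<in>E1. crd1 e x \<odot>\<^bsub>F (Suc k)\<^esub> e)"
    "\<And>e e'. e \<in> E1 \<Longrightarrow> e' \<in> E1 \<Longrightarrow> crd1 e e' = (if e = e' then \<one>\<^bsub>R\<^esub> else (\<lambda>_. 0))"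
    using finite_basis_coords[OF L1 group_G E1] by blast
  obtain crd2 where crd2: "\<And>e. e \<in> E2 \<Longrightarrow> crd2 e \<in> lmod_hom R (F k) (reg G)"
    "\<And>x. x \<in> carrier (F k) \<Longrightarrow> x = (\<Oplus>\<^bsub>F k\<^esub>e\<in>E2. crd2 e x \<odot>\<^bsub>F k\<^esub> e)"
    "\<And>e e'. e \<in> E2 \<Longrightarrow> e' \<in> E2 \<Longrightarrow> crd2 e e' = (if e = e' then \<one>\<^bsub>R\<^esub> else (\<lambda>_. 0))"
    using finite_basis_coords[OF L2 group_G E2] by blast
  obtain \<xi> \<beta> \<zeta> and J :: "'m set" and \<eta> y h c where J: "finite J"
    and \<xi>c: "\<And>e. e \<in> E1 \<Longrightarrow> \<xi> e \<in> carrier R"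
    and \<beta>h: "\<And>s. s \<in> carrier G \<Longrightarrow> \<beta> s \<in> lmod_hom R (F (Suc k)) (reg G)"
    and \<zeta>h: "\<And>s t. s \<in> carrier G \<Longrightarrow> t \<in> carrier G \<Longrightarrow> \<zeta> s t \<in> lmod_hom R (F k) (reg G)"
    and \<beta>_mult: "\<And>s t x. s \<in> carrier G \<Longrightarrow> t \<in> carrier G \<Longrightarrow> x \<in> carrier (F (Suc k)) \<Longrightarrow>
      \<beta> (s \<otimes>\<^bsub>G\<^esub> t) x = (\<lambda>g. (\<beta> s x \<otimes>\<^bsub>R\<^esub> group_elem t) g + \<beta> t x g + \<zeta> s t (d (Suc k) x) g)"
    and \<eta>h: "\<And>j. j \<in> J \<Longrightarrow> \<eta> j \<in> lmod_hom R (F (Suc k)) (reg G)"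
    and yc: "\<And>j. j \<in> J \<Longrightarrow> y j \<in> carrier (F (Suc k))" and dy: "\<And>j. j \<in> J \<Longrightarrow> d (Suc k) (y j) = \<zero>\<^bsub>F k\<^esub>"
    and hh: "\<And>e. e \<in> E1 \<Longrightarrow> h e \<in> lmod_hom R (F k) (reg G)"
    and crd_eq: "\<And>e x. e \<in> E1 \<Longrightarrow> x \<in> carrier (F (Suc k)) \<Longrightarrow> crd1 e x =
      (\<lambda>g. (\<Sum>s | \<xi> e s \<noteq> 0. \<xi> e s * \<beta> s x g) + (\<Sum>j\<in>J. (\<eta> j x \<otimes>\<^bsub>R\<^esub> crd1 e (y j)) g) + h e (d (Suc k) x) g)"
    and \<xi>_eq: "\<And>e. e \<in> E1 \<Longrightarrow> \<xi> e = (\<lambda>g. \<Sum>j\<in>J. c j * crd1 e (y j) g)"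
    and aug_\<xi>: "\<And>e. e \<in> E1 \<Longrightarrow> augm (\<xi> e) = 0"
  proof (rule duality[where E = E1 and crd = crd1, OF n iso triv coh])
    show "crd1 e \<in> lmod_hom R (F (Suc k)) (reg G)" if "e \<in> E1" for e using that by (rule crd1(1))
  qed (rule that; assumption)
  have \<xi>s: "finite {s. \<xi> e s \<noteq> 0}" "{s. \<xi> e s \<noteq> 0} \<subseteq> carrier G" if "e \<in> E1" for e
    using \<xi>c[OF that] by (auto simp: group_ring_carrier)
  obtain S0 where S0: "finite S0" "S0 \<subseteq> carrier G" "generate G S0 = carrier G" using finitely_generated n by auto
  \<comment> \<open>The estimate is used on the supports of the \<open>\<xi> e\<close>, whereas
    \<open>S0\<close> ensures that the group is generated.\<close>
  define S where "S = S0 \<union> (\<Union>e\<in>E1. {s. \<xi> e s \<noteq> 0})"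
  have S: "finite S" "S \<subseteq> carrier G" unfolding S_def using S0 \<xi>s fin(1) by (auto, blast+)
  have "carrier G \<subseteq> generate G S" unfolding S0(3)[symmetric] by (rule G.mono_generate) (simp add: S_def)
  then have Sgen: "generate G S = carrier G" using G.generate_incl[OF S(2)] by blast
  obtain C0 and P :: "('g \<times> 'g) set" where P: "finite P" "P \<subseteq> carrier G \<times> carrier G" and C0: "0 \<le> C0"
    and coc: "\<And>(Q :: 'g set set) act b. finite_gset G Q act \<Longrightarrow>
      \<exists>f. \<forall>s\<in>S. l1 Q (\<lambda>q. b s q - (f (act q (inv\<^bsub>G\<^esub> s)) - f q)) \<le> C0 * (\<Sum>(x, y)\<in>P. l1 Q (defect G act b x y))"
    using property_T_almost_cocycle[OF T S Sgen] by blast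
  define D where "D = (\<Sum>(s, t)\<in>P. \<Sum>e\<in>E2. ring_l1 (\<zeta> s t e))"
  \<comment> \<open>All ingredients are fixed before \<open>H\<close>. The first summand estimates
    the reduced cocycle weighted by \<open>\<xi> e\<close>, the second the error term
    \<open>h e\<close> evaluated on the boundary.\<close>
  define C where "C = (\<Sum>e\<in>E1. ring_l1 (\<xi> e) * (C0 * D) + (\<Sum>e'\<in>E2. ring_l1 (h e e')))"
  have "\<exists>A\<in>carrier (chain_group G H (F (Suc k))). chain_map G H (F k) (d (Suc k)) A = z \<and>
       real_of_int (chain_norm G H T (F (Suc k)) E1 A) \<le> C * real_of_int (chain_norm G H T (F k) E2 z)"
    if H: "subgroup H G" and fQ: "finite (rcosets\<^bsub>G\<^esub> H)" and rep: "coset_representatives G H T"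
      and z: "z \<in> chain_map G H (F k) (d (Suc k)) ` carrier (chain_group G H (F (Suc k)))" for H T z
  proof -
    interpret C1: based_chain_module G "F (Suc k)" H T E1 crd1
      by (intro based_chain_module.intro chain_module.intro chain_module_axioms.intro based_chain_module_axioms.intro group_G L1 H fQ rep fin crd1)
    interpret C2: based_chain_module G "F k" H T E2 crd2
      by (intro based_chain_module.intro chain_module.intro chain_module_axioms.intro based_chain_module_axioms.intro group_G L2 H fQ rep fin crd2)
    interpret CM: chain_modules G "F (Suc k)" "F k" H "d (Suc k)"
      by (intro chain_modules.intro chain_modules_axioms.intro C1.chain_module_axioms C2.chain_module_axioms dk)
    let ?Q = "rcosets\<^bsub>G\<^esub> H"
    obtain u0 where u0: "Poly_Mapping.keys u0 \<subseteq> C1.S" and zu0: "z = chain_map G H (F k) (d (Suc k)) (C1.N #>\<^bsub>C1.TG\<^esub> u0)"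
      using z unfolding C1.carrier_chain_group by blast
    define v where "v = frag_map (d (Suc k)) u0"
    have zv: "z = C2.N #>\<^bsub>C2.TG\<^esub> v" unfolding zu0 v_def by (rule CM.chain_map_coset)
    have dF: "d (Suc k) \<in> carrier (F (Suc k)) \<rightarrow> carrier (F k)" using lmod_hom_closed[OF dk] by blast
    have vk: "Poly_Mapping.keys v \<subseteq> C2.S" unfolding v_def by (rule keys_frag_map[OF u0 dF])
    define V where "V = (\<Sum>e\<in>E2. l1 ?Q (C2.ev (crd2 e) v))"
    have V: "real_of_int (chain_norm G H T (F k) E2 z) = V" unfolding zv V_def by (rule C2.chain_norm_eq[OF vk])
    have bound: "l1 ?Q (C2.ev \<psi> v) \<le> (\<Sum>e\<in>E2. ring_l1 (\<psi> e)) * V" if "\<psi> \<in> lmod_hom R (F k) (reg G)" for \<psi>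
      unfolding V_def by (rule C2.l1_ev_le[OF that vk])
    define b where "b s = C1.ev (\<beta> s) u0" for s
    have gset: "finite_gset G ?Q (\<lambda>K g. K #>\<^bsub>G\<^esub> g)" by (rule G.finite_gset_rcosets[OF H fQ])
    \<comment> \<open>The error \<open>\<zeta> s t\<close> sees only the boundary of a chain, so its
      value on \<open>u0\<close> is its value on \<open>v\<close>. This bounds the defects by the
      norm of the cycle.\<close>
    have def: "defect G (\<lambda>K g. K #>\<^bsub>G\<^esub> g) b s t K = C2.ev (\<zeta> s t) v K" if st: "s \<in> carrier G" "t \<in> carrier G" and K: "K \<in> ?Q" for s t K
    proof -
      note sc = hom_reg_closed[OF \<beta>h[OF st(1)]] and tc = hom_reg_closed[OF \<beta>h[OF st(2)]] and zc = hom_reg_closed[OF hom_reg_comp[OF \<zeta>h[OF st] dk]]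
      have stc: "\<beta> s x \<otimes>\<^bsub>R\<^esub> group_elem t \<in> carrier R" if "x \<in> carrier (F (Suc k))" for x using sc[OF that] st by simp
      have "C1.ev (\<beta> (s \<otimes>\<^bsub>G\<^esub> t)) u0 K = C1.ev (\<lambda>x g. (\<beta> s x \<otimes>\<^bsub>R\<^esub> group_elem t) g + \<beta> t x g + \<zeta> s t (d (Suc k) x) g) u0 K"
        by (rule C1.ev_cong[OF u0 \<beta>_mult[OF st]])
      also have "\<dots> = C1.ev (\<lambda>x g. (\<beta> s x \<otimes>\<^bsub>R\<^esub> group_elem t) g + \<beta> t x g) u0 K + C1.ev (\<lambda>x. \<zeta> s t (d (Suc k) x)) u0 K"
        using R.a_closed[OF stc tc] by (intro C1.ev_fun_add[OF u0 _ zc]) simp_all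
      also have "C1.ev (\<lambda>x g. (\<beta> s x \<otimes>\<^bsub>R\<^esub> group_elem t) g + \<beta> t x g) u0 K = C1.ev (\<lambda>x. \<beta> s x \<otimes>\<^bsub>R\<^esub> group_elem t) u0 K + C1.ev (\<beta> t) u0 K"
        by (rule C1.ev_fun_add[OF u0 stc tc])
      also have "C1.ev (\<lambda>x. \<beta> s x \<otimes>\<^bsub>R\<^esub> group_elem t) u0 K = C1.ev (\<beta> s) u0 (K #>\<^bsub>G\<^esub> inv\<^bsub>G\<^esub> t)"
        using C1.ev_mult[OF u0 sc group_elem_closed[OF st(2)] K] by simp
      finally show ?thesis by (simp add: defect_def b_def v_def CM.ev_frag_map)
    qed
    have "(\<Sum>(s, t)\<in>P. l1 ?Q (defect G (\<lambda>K g. K #>\<^bsub>G\<^esub> g) b s t)) \<le> (\<Sum>(s, t)\<in>P. (\<Sum>e\<in>E2. ring_l1 (\<zeta> s t e)) * V)"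
    proof (rule sum_mono)
      fix i assume "i \<in> P"
      then obtain s t where i: "i = (s, t)" "s \<in> carrier G" "t \<in> carrier G" using P by blast
      have "l1 ?Q (defect G (\<lambda>K g. K #>\<^bsub>G\<^esub> g) b s t) = l1 ?Q (C2.ev (\<zeta> s t) v)" by (rule l1_cong[OF def[OF i(2,3)]])
      then show "(case i of (s, t) \<Rightarrow> l1 ?Q (defect G (\<lambda>K g. K #>\<^bsub>G\<^esub> g) b s t)) \<le> (case i of (s, t) \<Rightarrow> (\<Sum>e\<in>E2. ring_l1 (\<zeta> s t e)) * V)"
        using bound[OF \<zeta>h[OF i(2,3)]] i(1) by simp
    qed
    also have "\<dots> = D * V" by (simp add: D_def sum_distrib_right case_prod_unfold)
    finally have defs: "C0 * (\<Sum>(s, t)\<in>P. l1 ?Q (defect G (\<lambda>K g. K #>\<^bsub>G\<^esub> g) b s t)) \<le> C0 * (D * V)"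
      by (rule mult_left_mono[OF _ C0])
    obtain f where f: "\<And>s. s \<in> S \<Longrightarrow> l1 ?Q (\<lambda>K. b s K - (f (K #>\<^bsub>G\<^esub> inv\<^bsub>G\<^esub> s) - f K)) \<le> C0 * (D * V)"
      using coc[OF gset, of b] order_trans[OF _ defs] by blast
    \<comment> \<open>The coordinate formula for \<open>u0\<close> with the reduced cocycle in place
      of \<open>b\<close> and without the terms with \<open>\<eta>\<close>. Every remaining term is
      bounded by the norm of the cycle.\<close>
    define a where "a e K = (\<Sum>s | \<xi> e s \<noteq> 0. \<xi> e s * (b s K - (f (K #>\<^bsub>G\<^esub> inv\<^bsub>G\<^esub> s) - f K))) + C2.ev (h e) v K" for e K
    have a_le: "l1 ?Q (a e) \<le> (ring_l1 (\<xi> e) * (C0 * D) + (\<Sum>e'\<in>E2. ring_l1 (h e e'))) * V" if e: "e \<in> E1" for e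
    proof -
      have "l1 ?Q (a e) \<le> l1 ?Q (\<lambda>K. \<Sum>s | \<xi> e s \<noteq> 0. \<xi> e s * (b s K - (f (K #>\<^bsub>G\<^esub> inv\<^bsub>G\<^esub> s) - f K))) + l1 ?Q (C2.ev (h e) v)"
        unfolding a_def by (rule l1_add)
      also have "l1 ?Q (\<lambda>K. \<Sum>s | \<xi> e s \<noteq> 0. \<xi> e s * (b s K - (f (K #>\<^bsub>G\<^esub> inv\<^bsub>G\<^esub> s) - f K))) \<le>
        (\<Sum>s | \<xi> e s \<noteq> 0. l1 ?Q (\<lambda>K. \<xi> e s * (b s K - (f (K #>\<^bsub>G\<^esub> inv\<^bsub>G\<^esub> s) - f K))))" by (rule l1_sum)
      also have "\<dots> \<le> (\<Sum>s | \<xi> e s \<noteq> 0. real_of_int \<bar>\<xi> e s\<bar> * (C0 * (D * V)))"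
        unfolding l1_scale using e by (intro sum_mono mult_left_mono f) (auto simp: S_def)
      also have "\<dots> = ring_l1 (\<xi> e) * (C0 * D) * V" by (simp add: ring_l1_def sum_distrib_right mult.assoc)
      also have "l1 ?Q (C2.ev (h e) v) \<le> (\<Sum>e'\<in>E2. ring_l1 (h e e')) * V" by (rule bound[OF hh[OF e]])
      finally show ?thesis by (simp add: distrib_right)
    qed
    obtain u where u: "Poly_Mapping.keys u \<subseteq> C1.S" and ua: "\<And>e K. e \<in> E1 \<Longrightarrow> K \<in> ?Q \<Longrightarrow> C1.ev (crd1 e) u K = a e K"
      using C1.ex_ev_eq by blast
    \<comment> \<open>The coefficient of \<open>y j\<close> in what was removed:
      \<open>c j * f\<close> from the coboundary, by the expansion of \<open>\<xi> e\<close>, and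
      the evaluation of \<open>\<eta> j\<close> from the omitted term.\<close>
    define \<theta> where "\<theta> j K = c j * f K + C1.ev (\<eta> j) u0 K" for j K
    have y1: "crd1 e (y j) \<in> carrier R" if "e \<in> E1" "j \<in> J" for e j by (rule hom_reg_closed[OF crd1(1)[OF that(1)] yc[OF that(2)]])
    \<comment> \<open>Summing the coboundary of \<open>f\<close> against \<open>\<xi> e\<close>
      gives \<open>rmul G f (\<xi> e)\<close> minus \<open>augm (\<xi> e)\<close> times
      \<open>f\<close>, and the second part is 0.\<close>
    have diff: "a e K - C1.ev (crd1 e) u0 K = - (\<Sum>j\<in>J. rmul G (\<theta> j) (crd1 e (y j)) K)" if e: "e \<in> E1" and K: "K \<in> ?Q" for e K
    proof -
      have sG: "s \<in> carrier G" if "s \<in> {s. \<xi> e s \<noteq> 0}" for s using \<xi>s[OF e] that by blast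
      note \<beta>c = hom_reg_closed[OF \<beta>h[OF sG]] and \<eta>c = hom_reg_closed[OF \<eta>h] and hc = hom_reg_closed[OF hom_reg_comp[OF hh[OF e] dk]]
      let ?A = "\<lambda>x g. \<Sum>s | \<xi> e s \<noteq> 0. \<xi> e s * \<beta> s x g" and ?B = "\<lambda>x g. \<Sum>j\<in>J. (\<eta> j x \<otimes>\<^bsub>R\<^esub> crd1 e (y j)) g"
      have Ac: "?A x \<in> carrier R" if "x \<in> carrier (F (Suc k))" for x
        by (rule group_ring_sum_closed, rule group_ring_scale_closed, rule \<beta>c[OF _ that])
      have Bc: "?B x \<in> carrier R" if "x \<in> carrier (F (Suc k))" for x
        by (rule group_ring_sum_closed, rule R.m_closed[OF \<eta>c[OF _ that] y1[OF e]])
      have ABc: "(\<lambda>g. ?A x g + ?B x g) \<in> carrier R" if "x \<in> carrier (F (Suc k))" for x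
        using R.a_closed[OF Ac[OF that] Bc[OF that]] by simp
      have "C1.ev (crd1 e) u0 K = C1.ev (\<lambda>x g. ?A x g + ?B x g + h e (d (Suc k) x) g) u0 K"
        by (rule C1.ev_cong[OF u0 crd_eq[OF e]])
      also have "\<dots> = C1.ev (\<lambda>x g. ?A x g + ?B x g) u0 K + C1.ev (\<lambda>x. h e (d (Suc k) x)) u0 K"
        by (rule C1.ev_fun_add[OF u0 ABc hc])
      also have "C1.ev (\<lambda>x g. ?A x g + ?B x g) u0 K = C1.ev ?A u0 K + C1.ev ?B u0 K" by (rule C1.ev_fun_add[OF u0 Ac Bc])
      also have "C1.ev ?A u0 K = (\<Sum>s | \<xi> e s \<noteq> 0. \<xi> e s * b s K)"
        unfolding b_def by (subst C1.ev_fun_sum[OF u0]) (auto simp: C1.ev_fun_scale[OF u0 \<beta>c] intro: group_ring_scale_closed \<beta>c)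
      also have "C1.ev ?B u0 K = (\<Sum>j\<in>J. C1.ev (\<lambda>x. \<eta> j x \<otimes>\<^bsub>R\<^esub> crd1 e (y j)) u0 K)"
        by (rule C1.ev_fun_sum[OF u0]) (rule R.m_closed[OF \<eta>c y1[OF e]])
      also have "\<dots> = (\<Sum>j\<in>J. rmul G (C1.ev (\<eta> j) u0) (crd1 e (y j)) K)"
        by (rule sum.cong[OF refl]) (rule C1.ev_mult[OF u0 \<eta>c y1[OF e] K])
      also have "C1.ev (\<lambda>x. h e (d (Suc k) x)) u0 K = C2.ev (h e) v K" unfolding v_def by (simp add: CM.ev_frag_map)
      finally have ev0: "C1.ev (crd1 e) u0 K = (\<Sum>s | \<xi> e s \<noteq> 0. \<xi> e s * b s K) + (\<Sum>j\<in>J. rmul G (C1.ev (\<eta> j) u0) (crd1 e (y j)) K) + C2.ev (h e) v K" .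
      have "(\<Sum>s | \<xi> e s \<noteq> 0. \<xi> e s * (b s K - (f (K #>\<^bsub>G\<^esub> inv\<^bsub>G\<^esub> s) - f K))) = (\<Sum>s | \<xi> e s \<noteq> 0. \<xi> e s * b s K) - rmul G f (\<xi> e) K + augm (\<xi> e) * f K"
        by (simp add: rmul_def augm_def algebra_simps sum.distrib sum_subtractf sum_distrib_left)
      moreover have "rmul G f (\<xi> e) K = (\<Sum>j\<in>J. c j * rmul G f (crd1 e (y j)) K)"
        unfolding \<xi>_eq[OF e] by (subst rmul_sum) (auto simp: rmul_scale[OF y1[OF e]] intro: group_ring_scale_closed y1 e)
      moreover have "(\<Sum>j\<in>J. rmul G (\<theta> j) (crd1 e (y j)) K) = (\<Sum>j\<in>J. c j * rmul G f (crd1 e (y j)) K) + (\<Sum>j\<in>J. rmul G (C1.ev (\<eta> j) u0) (crd1 e (y j)) K)"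
        unfolding sum.distrib[symmetric] \<theta>_def rmul_fun_add rmul_fun_scale ..
      ultimately show ?thesis using aug_\<xi>[OF e] by (simp add: a_def ev0)
    qed
    \<comment> \<open>By \<open>diff\<close> the two chains differ by the \<open>y j\<close> with
      coefficients \<open>- \<theta> j\<close>. Applying a coordinate of the boundary and regrouping
      over \<open>E1\<close> produces that coordinate of \<open>d (Suc k) (y j)\<close>, which is
      0.\<close>
    have zero: "C2.ev (crd2 e') (frag_map (d (Suc k)) u - v) K = 0" if e': "e' \<in> E2" and K: "K \<in> ?Q" for e' K
    proof -
      let ?c = "\<lambda>x. crd2 e' (d (Suc k) x)"
      note ch = hom_reg_comp[OF crd2(1)[OF e'] dk]
      have ec: "?c e \<in> carrier R" if "e \<in> E1" for e using hom_reg_closed[OF ch] fin(2) that by blast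
      have "C2.ev (crd2 e') (frag_map (d (Suc k)) u - v) K = C1.ev ?c u K - C1.ev ?c u0 K"
        unfolding v_def C2.ev_diff CM.ev_frag_map ..
      also have "\<dots> = (\<Sum>e\<in>E1. rmul G (\<lambda>K. C1.ev (crd1 e) u K - C1.ev (crd1 e) u0 K) (?c e) K)"
        by (simp add: C1.ev_coords[OF ch u K] C1.ev_coords[OF ch u0 K] rmul_fun_diff sum_subtractf)
      also have "\<dots> = (\<Sum>e\<in>E1. rmul G (\<lambda>K. \<Sum>j\<in>J. rmul G (\<lambda>K. - 1 * \<theta> j K) (crd1 e (y j)) K) (?c e) K)"
      proof (rule sum.cong[OF refl])
        fix e assume e: "e \<in> E1"
        show "rmul G (\<lambda>K. C1.ev (crd1 e) u K - C1.ev (crd1 e) u0 K) (?c e) K = rmul G (\<lambda>K. \<Sum>j\<in>J. rmul G (\<lambda>K. - 1 * \<theta> j K) (crd1 e (y j)) K) (?c e) K"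
        proof (rule G.rmul_cong[OF H K ec[OF e]])
          fix K assume K: "K \<in> ?Q"
          show "C1.ev (crd1 e) u K - C1.ev (crd1 e) u0 K = (\<Sum>j\<in>J. rmul G (\<lambda>K. - 1 * \<theta> j K) (crd1 e (y j)) K)"
            unfolding ua[OF e K] diff[OF e K] rmul_fun_scale by (simp add: sum_negf)
        qed
      qed
      also have "\<dots> = (\<Sum>e\<in>E1. \<Sum>j\<in>J. rmul G (\<lambda>K. - 1 * \<theta> j K) (crd1 e (y j) \<otimes>\<^bsub>R\<^esub> ?c e) K)"
        unfolding rmul_fun_sum by (intro sum.cong refl G.rmul_mult[OF ring_R H K y1 ec, symmetric])
      also have "\<dots> = (\<Sum>j\<in>J. \<Sum>e\<in>E1. rmul G (\<lambda>K. - 1 * \<theta> j K) (crd1 e (y j) \<otimes>\<^bsub>R\<^esub> ?c e) K)" by (rule sum.swap)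
      also have "\<dots> = (\<Sum>j\<in>J. 0)"
      proof (rule sum.cong[OF refl])
        fix j assume j: "j \<in> J"
        have "(\<Sum>e\<in>E1. rmul G (\<lambda>K. - 1 * \<theta> j K) (crd1 e (y j) \<otimes>\<^bsub>R\<^esub> ?c e) K) = rmul G (\<lambda>K. - 1 * \<theta> j K) (\<lambda>g. \<Sum>e\<in>E1. (crd1 e (y j) \<otimes>\<^bsub>R\<^esub> ?c e) g) K"
          by (rule rmul_sum[symmetric]) (rule R.m_closed[OF y1[OF _ j] ec])
        also have "(\<lambda>g. \<Sum>e\<in>E1. (crd1 e (y j) \<otimes>\<^bsub>R\<^esub> ?c e) g) = ?c (y j)"
          by (rule dual_basis_expand_reg[OF L1 C1.dual_basis_crd ch yc[OF j], symmetric])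
        also have "?c (y j) = (\<lambda>_. 0)"
          unfolding dy[OF j] using addhom_zero[OF left_module.is_abelian_group[OF L2] left_module.is_abelian_group[OF left_module_reg[OF ring_R]] lmod_hom_addhom[OF crd2(1)[OF e']]] by simp
        finally show "(\<Sum>e\<in>E1. rmul G (\<lambda>K. - 1 * \<theta> j K) (crd1 e (y j) \<otimes>\<^bsub>R\<^esub> ?c e) K) = 0" by simp
      qed
      finally show ?thesis by simp
    qed
    have pk: "Poly_Mapping.keys (frag_map (d (Suc k)) u) \<subseteq> C2.S" by (rule keys_frag_map[OF u dF])
    have "Poly_Mapping.keys (frag_map (d (Suc k)) u - v) \<subseteq> C2.S" using keys_diff[of "frag_map (d (Suc k)) u" v] pk vk by blast
    then have "frag_map (d (Suc k)) u - v \<in> C2.N" using zero by (rule C2.mem_N_if_ev_zero)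
    then have A: "chain_map G H (F k) (d (Suc k)) (C1.N #>\<^bsub>C1.TG\<^esub> u) = z"
      unfolding zv CM.chain_map_coset C2.coset_eq_iff[OF pk vk] .
    have "real_of_int (chain_norm G H T (F (Suc k)) E1 (C1.N #>\<^bsub>C1.TG\<^esub> u)) = (\<Sum>e\<in>E1. l1 ?Q (C1.ev (crd1 e) u))"
      by (rule C1.chain_norm_eq[OF u])
    also have "\<dots> = (\<Sum>e\<in>E1. l1 ?Q (a e))" by (rule sum.cong[OF refl]) (rule l1_cong[OF ua])
    also have "\<dots> \<le> (\<Sum>e\<in>E1. (ring_l1 (\<xi> e) * (C0 * D) + (\<Sum>e'\<in>E2. ring_l1 (h e e'))) * V)" by (rule sum_mono[OF a_le])
    also have "\<dots> = C * real_of_int (chain_norm G H T (F k) E2 z)" by (simp add: C_def V sum_distrib_right)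
    finally show ?thesis using A u unfolding C1.carrier_chain_group by blast
  qed
  then show ?thesis by blast
qed

end

theorem proposition1p11:
  fixes G :: "('g, 'b) monoid_scheme"
    and n :: nat
    and F :: "nat \<Rightarrow> ('g \<Rightarrow> int, 'm) module"
    and d :: "nat \<Rightarrow> 'm \<Rightarrow> 'm"
    and aug :: "'m \<Rightarrow> int"
    and E :: "nat \<Rightarrow> 'm set"
  assumes "PD_plus_group n G"
    and "property_T G"
    and "n > 2"
    and "FP_resolution G n F d aug"
    and "based_FL_resolution G (n - 1) F d aug E"
  shows "\<exists>C::real. \<forall>H T z.
    H \<lhd> G \<and> finite (rcosets\<^bsub>G\<^esub> H) \<and> coset_representatives G H T \<and>
    z \<in> chain_map G H (F (n - 2)) (d (n - 1)) ` carrier (chain_group G H (F (n - 1))) \<longrightarrow>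
    (\<exists>A \<in> carrier (chain_group G H (F (n - 1))).
       chain_map G H (F (n - 2)) (d (n - 1)) A = z \<and>
       real_of_int (chain_norm G H T (F (n - 1)) (E (n - 1)) A)
         \<le> C * real_of_int (chain_norm G H T (F (n - 2)) (E (n - 2)) z))"
proof -
  have PD: "group G" "\<And>i. i \<noteq> n \<Longrightarrow> trivial_group (ZG_cohomology G i)" "ZG_cohomology G n \<cong> integer_group"
    "\<forall>g\<in>carrier G. \<forall>K\<in>carrier (ZG_cohomology G n). ZG_right_translate G n g K = K"
    using assms(1) unfolding PD_plus_group_def by auto
  interpret fp_res G n F d aug by (rule fp_res.intro[OF PD(1) assms(4)])
  define k where "k = n - 2"
  have k: "n = Suc (Suc k)" "n - 1 = Suc k" "n - 2 = k" using assms(3) by (auto simp: k_def)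
  have E: "finite_basis (group_ring G) (F (Suc k)) (E (Suc k))" "finite_basis (group_ring G) (F k) (E k)"
    using assms(5) k(2) by (auto simp: based_FL_resolution_def)
  have "trivial_group (ZG_cohomology G (Suc k))" using PD(2) k(1) by simp
  from linear_filling[OF k(1) assms(2) PD(3,4) this E] show ?thesis
    unfolding k(2,3) by (meson normal_imp_subgroup)
qed

end
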